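(* Let $p=p_N\le N$ and $r=r_N$ be sequences of positive integers such that, as $N\to\infty$, $N/p\to 1+\lambda\ge 1$ and $N/r\to\mu>0$, and let $\beta=\lim p/r=\mu/(1+\lambda)$. Let $U$ be an $N\times r$ matrix with i.i.d. standard real Gaussian entries and let $X$ be an $N\times p$ full-rank matrix independent of $U$. Let $\widehat{A} = (X^{\ast}X)^{-1}X^{\ast}U$ and $\widehat{Y} = X\widehat{A}$. (i) As $N\to\infty$, the empirical eigenvalue distribution of the $r\times r$ matrix $\frac1r\widehat{Y}^{\ast}\widehat{Y}$ converges weakly to the Marchenko–Pastur probability measure $\mathbb{P}_{MP}^{(\beta)}$ defined in the context. (ii) In addition, suppose that the entries of $X$ are i.i.d. standard real Gaussian variables. Then, as $N\to\infty$, the empirical eigenvalue distribution of $\widehat{A}^{\ast}\widehat{A}$ converges weakly to the probability measure $\mathbb{P}^{(\lambda,\beta)}$ defined in the context.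
   Context: $M^{\ast}$ denotes the transpose of a real matrix. The empirical eigenvalue distribution of a Hermitian $r\times r$ matrix with eigenvalues $\lambda_1,\dots,\lambda_r$ is the measure $\frac1r\sum_{i=1}^r\delta_{\lambda_i}$, where $\delta_x$ is the Dirac measure at $x$. The Marchenko–Pastur measure $\mathbb{P}_{MP}^{(\beta)}$ ($\beta>0$) has continuous part supported on $[(\sqrt\beta-1)^2,(\sqrt\beta+1)^2]$ with density $$p_{MP}^{\beta}(x) = \frac1{2\pi x}\sqrt{4\beta-(\beta+1-x)^2},$$ and, if $0<\beta<1$, an additional atom at $0$ of mass $1-\beta$. The measure $\mathbb{P}^{(\lambda,\beta)}$ ($\lambda\ge0$, $\beta>0$) has continuous part supported on $[x_1,x_2]$, where for $\lambda>0$ $$x_{1,2} = \frac1{\lambda^2\beta}\left[(1+\beta)\lambda+2\mp2\sqrt{\lambda^2\beta+\lambda(\beta+1)+1}\right]$$ ($x_1$ with the minus sign, $x_2$ with the plus sign), and for $\lambda=0$, $x_1=(\beta-1)^2/(4\beta)$ and $x_2=\infty$. In both cases the density of the continuous part is $$p^{(\lambda,\beta)}(x) = \frac{1}{2\pi}\frac{1}{x(x+1)}\sqrt{-(\beta-1)^2+2\beta\left[(1+\beta)\lambda+2\right]x-\beta^2\lambda^2x^2}.$$ If $0<\beta<1$, there is an additional atom at $0$ of mass $1-\beta$. *)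

theory Defs
  imports
    "HOL-Probability.Probability"
    "HOL-Computational_Algebra.Polynomial"
    "Jordan_Normal_Form.Char_Poly"
    "Jordan_Normal_Form.DL_Rank"
    "Jordan_Normal_Form.Gauss_Jordan_Elimination"
begin

text \<open>Empirical eigenvalue distribution. The eigenvalues of a square matrix, listed with
  multiplicity, are the roots of its characteristic polynomial listed with multiplicity
  (for a real symmetric matrix these are \<open>dim_row A\<close> real numbers).\<close>

definition dirac_sum :: "real multiset \<Rightarrow> real measure" where
  "dirac_sum S = measure_of UNIV (sets borel) (\<lambda>E. \<Sum>x\<in>#S. emeasure (return borel x) E)"

definition empirical_eigenvalue_distribution :: "real mat \<Rightarrow> real measure" where
  "empirical_eigenvalue_distribution A =
     scale_measure (1 / of_nat (dim_row A)) (dirac_sum (proots (char_poly A)))"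

definition add_measure :: "real measure \<Rightarrow> real measure \<Rightarrow> real measure" where
  "add_measure \<nu> \<rho> = measure_of UNIV (sets borel) (\<lambda>E. emeasure \<nu> E + emeasure \<rho> E)"

text \<open>\<open>measure_of\<close> is the null measure when the given set function is not a measure; the two
  \<open>emeasure\<close> facts below show that this does not happen here.\<close>

lemma sets_dirac_sum [simp]: "sets (dirac_sum S) = sets borel"
  unfolding dirac_sum_def by (metis sets.sets_measure_of_eq space_borel)

lemma suminf_sum_mset_ennreal:
  fixes f :: "'a \<Rightarrow> nat \<Rightarrow> ennreal"
  shows "(\<Sum>n. \<Sum>x\<in>#S. f x n) = (\<Sum>x\<in>#S. \<Sum>n. f x n)"
  by (induction S) (simp_all add: suminf_add [symmetric])

lemma emeasure_dirac_sum:
  assumes "E \<in> sets borel"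
  shows "emeasure (dirac_sum S) E = (\<Sum>x\<in>#S. indicator E x)"
proof -
  have "emeasure (dirac_sum S) E = (\<Sum>x\<in>#S. emeasure (return borel x) E)"
  proof (rule emeasure_measure_of [OF dirac_sum_def])
    show "positive (sets (dirac_sum S)) (\<lambda>E. \<Sum>x\<in>#S. emeasure (return borel x) E)"
      by (simp add: positive_def)
    show "countably_additive (sets (dirac_sum S)) (\<lambda>E. \<Sum>x\<in>#S. emeasure (return borel x) E)"
    proof (rule countably_additiveI)
      fix B :: "nat \<Rightarrow> real set"
      assume B: "range B \<subseteq> sets (dirac_sum S)" "disjoint_family B"
      have "(\<Sum>n. emeasure (return borel x) (B n)) = emeasure (return borel x) (\<Union>n. B n)" for x
        using B by (intro suminf_emeasure) auto
      then show "(\<Sum>n. \<Sum>x\<in>#S. emeasure (return borel x) (B n)) =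
          (\<Sum>x\<in>#S. emeasure (return borel x) (\<Union>n. B n))"
        by (simp add: suminf_sum_mset_ennreal)
    qed
  qed (use assms in auto)
  also have "\<dots> = (\<Sum>x\<in>#S. indicator E x)"
    using assms by simp
  finally show ?thesis .
qed

lemma sets_add_measure [simp]: "sets (add_measure \<nu> \<rho>) = sets borel"
  unfolding add_measure_def by (metis sets.sets_measure_of_eq space_borel)

lemma emeasure_add_measure:
  assumes "sets \<nu> = sets borel" "sets \<rho> = sets borel" "E \<in> sets borel"
  shows "emeasure (add_measure \<nu> \<rho>) E = emeasure \<nu> E + emeasure \<rho> E"
proof (rule emeasure_measure_of [OF add_measure_def])
  show "positive (sets (add_measure \<nu> \<rho>)) (\<lambda>E. emeasure \<nu> E + emeasure \<rho> E)"
    by (simp add: positive_def)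
  show "countably_additive (sets (add_measure \<nu> \<rho>)) (\<lambda>E. emeasure \<nu> E + emeasure \<rho> E)"
  proof (rule countably_additiveI)
    fix B :: "nat \<Rightarrow> real set"
    assume B: "range B \<subseteq> sets (add_measure \<nu> \<rho>)" "disjoint_family B"
    have "(\<Sum>n. emeasure \<nu> (B n)) = emeasure \<nu> (\<Union>n. B n)"
      "(\<Sum>n. emeasure \<rho> (B n)) = emeasure \<rho> (\<Union>n. B n)"
      using B assms by (auto intro!: suminf_emeasure)
    then show "(\<Sum>n. emeasure \<nu> (B n) + emeasure \<rho> (B n)) =
        emeasure \<nu> (\<Union>n. B n) + emeasure \<rho> (\<Union>n. B n)"
      by (simp add: suminf_add [symmetric])
  qed
qed (use assms in auto)

definition atom_at_zero :: "real \<Rightarrow> real measure" where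
  "atom_at_zero \<beta> = scale_measure (ennreal (if \<beta> < 1 then 1 - \<beta> else 0)) (return borel 0)"

definition marchenko_pastur :: "real \<Rightarrow> real measure" where
  "marchenko_pastur \<beta> = add_measure
     (density lborel (\<lambda>x. ennreal
        (indicator {(sqrt \<beta> - 1)\<^sup>2 .. (sqrt \<beta> + 1)\<^sup>2} x *
         (1 / (2 * pi * x) * sqrt (4 * \<beta> - (\<beta> + 1 - x)\<^sup>2)))))
     (atom_at_zero \<beta>)"

text \<open>The measure with parameters \<open>l\<close> and \<open>\<beta>\<close>, where \<open>l\<close> plays the role of the
  parameter lambda.\<close>

definition coeff_law_support :: "real \<Rightarrow> real \<Rightarrow> real set" where
  "coeff_law_support l \<beta> =
     (if l = 0 then {(\<beta> - 1)\<^sup>2 / (4 * \<beta>) ..}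
      else {1 / (l\<^sup>2 * \<beta>) * ((1 + \<beta>) * l + 2 - 2 * sqrt (l\<^sup>2 * \<beta> + l * (\<beta> + 1) + 1)) ..
            1 / (l\<^sup>2 * \<beta>) * ((1 + \<beta>) * l + 2 + 2 * sqrt (l\<^sup>2 * \<beta> + l * (\<beta> + 1) + 1))})"

definition coeff_law :: "real \<Rightarrow> real \<Rightarrow> real measure" where
  "coeff_law l \<beta> = add_measure
     (density lborel (\<lambda>x. ennreal
        (indicator (coeff_law_support l \<beta>) x *
         (1 / (2 * pi) * (1 / (x * (x + 1))) *
          sqrt (- (\<beta> - 1)\<^sup>2 + 2 * \<beta> * ((1 + \<beta>) * l + 2) * x - \<beta>\<^sup>2 * l\<^sup>2 * x\<^sup>2)))))
     (atom_at_zero \<beta>)"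

definition mat_entries :: "nat \<Rightarrow> nat \<Rightarrow> real mat \<Rightarrow> nat \<times> nat \<Rightarrow> real" where
  "mat_entries n m A = (\<lambda>ij\<in>{..<n} \<times> {..<m}. A $$ ij)"

definition entry_space :: "nat \<Rightarrow> nat \<Rightarrow> (nat \<times> nat \<Rightarrow> real) measure" where
  "entry_space n m = (\<Pi>\<^sub>M ij\<in>{..<n} \<times> {..<m}. borel)"

definition random_matrix :: "'a measure \<Rightarrow> nat \<Rightarrow> nat \<Rightarrow> ('a \<Rightarrow> real mat) \<Rightarrow> bool" where
  "random_matrix M n m A \<longleftrightarrow>
     (\<forall>\<omega>\<in>space M. A \<omega> \<in> carrier_mat n m) \<and>
     (\<lambda>\<omega>. mat_entries n m (A \<omega>)) \<in> measurable M (entry_space n m)"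

definition indep_random_matrices ::
    "'a measure \<Rightarrow> nat \<Rightarrow> nat \<Rightarrow> ('a \<Rightarrow> real mat) \<Rightarrow> nat \<Rightarrow> nat \<Rightarrow> ('a \<Rightarrow> real mat) \<Rightarrow> bool" where
  "indep_random_matrices M n m A k l B \<longleftrightarrow>
     prob_space.indep_var M (entry_space n m) (\<lambda>\<omega>. mat_entries n m (A \<omega>))
                            (entry_space k l) (\<lambda>\<omega>. mat_entries k l (B \<omega>))"

definition iid_std_gaussian_entries ::
    "'a measure \<Rightarrow> nat \<Rightarrow> nat \<Rightarrow> ('a \<Rightarrow> real mat) \<Rightarrow> bool" where
  "iid_std_gaussian_entries M n m A \<longleftrightarrow>
     prob_space.indep_vars M (\<lambda>_. borel) (\<lambda>ij \<omega>. A \<omega> $$ ij) ({..<n} \<times> {..<m}) \<and>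
     (\<forall>ij\<in>{..<n} \<times> {..<m}.
        distributed M lborel (\<lambda>\<omega>. A \<omega> $$ ij) (\<lambda>x. ennreal (std_normal_density x)))"

text \<open>For \<open>X\<close> of full column rank the Gram matrix is invertible and \<open>mat_inverse\<close> is not
  \<open>None\<close>; otherwise the value of \<open>A_hat\<close> is unspecified.\<close>

definition A_hat :: "real mat \<Rightarrow> real mat \<Rightarrow> real mat" where
  "A_hat X U = the (mat_inverse (X\<^sup>T * X)) * X\<^sup>T * U"

definition Y_hat :: "real mat \<Rightarrow> real mat \<Rightarrow> real mat" where
  "Y_hat X U = X * A_hat X U"

end

theory Submission
  imports Defs
begin

text \<open>Weak convergence of laws on \<open>[0, \<infinity>)\<close> follows from convergence of the Stieltjes transforms
  \<open>\<integral> 1 / (x + t) d\<nu>(x)\<close> for a sequence of \<open>t > 1\<close> tending to \<open>1\<close>, so only resolvents at negative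
  reals occur. Given \<open>X\<close>, both matrices have the form \<open>U\<^sup>T B U\<close> with \<open>B\<close> symmetric; by rotation
  invariance of the Gaussian law \<open>B\<close> may be taken diagonal, with entries \<open>b\<^sub>i\<close>. Removing one row of
  \<open>U\<close> at a time (Sherman--Morrison) and bounding fourth moments of quadratic forms shows that
  \<open>\<theta> = tr (U\<^sup>T B U + t I)\<^sup>-\<^sup>1\<close> satisfies \<open>t \<theta> + (\<Sum>i. b\<^sub>i \<theta> / (1 + b\<^sub>i \<theta>)) \<approx> r\<close> outside an event of
  probability \<open>O(N\<^sup>-\<^sup>2)\<close>, and Borel--Cantelli applies. For the fitted values the \<open>b\<^sub>i\<close> are \<open>0\<close> and \<open>1\<close>
  up to scaling. For the coefficients they are \<open>0\<close> and the inverse eigenvalues of \<open>X\<^sup>T X\<close>, so the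
  sum is itself a resolvent trace of a Gaussian Gram matrix, to which the same estimate applies.
  The left-hand side has slope at least \<open>t\<close> in \<open>\<theta>\<close>, so \<open>\<theta> / r\<close> converges to the root of the limiting
  equation, and explicit integration identifies this root as the transform of the limit law.\<close>

text \<open>Two obstacles shape the proof. The weights for the coefficients are inverse eigenvalues
  of \<open>X\<^sup>T * X\<close>, which have no uniform bound when \<open>l = 0\<close>. No
  estimate of the smallest eigenvalue is attempted: weights above a threshold are only counted, and
  the count is controlled by the resolvent trace of \<open>X\<^sup>T * X\<close> itself. Second,
  variances of quadratic forms would give exceptional probabilities of order \<open>1 / N\<close>,
  which are not summable; this is why fourth moments are used. Real parameters suffice because
  \<open>y = 1 / (x + 1)\<close> maps the half-line onto \<open>(0, 1]\<close>. A product of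
  resolvents at distinct points is a combination of single resolvents, so letting the points tend to
  \<open>1\<close> gives all powers of \<open>y\<close>, and polynomials in \<open>y\<close> are
  uniformly dense. The points stay different from \<open>1\<close> because the density of the
  coefficient law already has the factor \<open>1 / (x + 1)\<close>, so the pole at
  \<open>-1\<close> would become double. Monotonicity of the limiting equations gives existence of
  the limit and its value at once, without compactness.\<close>

no_notation vec_nth (infixl "$" 90)
no_notation inner (infix "\<bullet>" 70)

section \<open>Symmetric real matrices\<close>

lemma symmetric_scalar_prod_mult_mat_vec:
  fixes A :: "real mat"
  assumes "A \<in> carrier_mat n n" "A\<^sup>T = A" "x \<in> carrier_vec n" "y \<in> carrier_vec n"
  shows "y \<bullet> (A *\<^sub>v x) = x \<bullet> (A *\<^sub>v y)"
proof -
  have "y \<bullet> (A *\<^sub>v x) = (A\<^sup>T *\<^sub>v y) \<bullet> x"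
    using transpose_vec_mult_scalar[of A n n x y] assms by simp
  also have "\<dots> = x \<bullet> (A *\<^sub>v y)"
    using assms by (metis comm_scalar_prod mult_mat_vec_carrier)
  finally show ?thesis .
qed

lemma scalar_prod_self:
  "(v :: real vec) \<bullet> v = (\<Sum>i<dim_vec v. (v $ i)\<^sup>2)"
  by (simp add: scalar_prod_def power2_eq_square atLeast0LessThan)

lemma scalar_prod_self_nonneg: "(v :: real vec) \<bullet> v \<ge> 0"
  unfolding scalar_prod_self by (intro sum_nonneg) auto

lemma scalar_prod_self_eq_0:
  assumes "(v :: real vec) \<in> carrier_vec n"
  shows "v \<bullet> v = 0 \<longleftrightarrow> v = 0\<^sub>v n"
proof
  assume "v \<bullet> v = 0"
  then have "\<forall>i<dim_vec v. (v $ i)\<^sup>2 = 0"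
    unfolding scalar_prod_self by (subst (asm) sum_nonneg_eq_0_iff) auto
  then show "v = 0\<^sub>v n" using assms by (intro eq_vecI) auto
qed (use assms in auto)

text \<open>The fundamental theorem of algebra gives a complex eigenvector \<open>x + i y\<close>.
  Comparing \<open>y \<bullet> (A x)\<close> with \<open>x \<bullet> (A y)\<close> forces the
  imaginary part of the eigenvalue to vanish, after which \<open>x\<close> and \<open>y\<close> both
  satisfy the eigenvector equation and at least one of them is nonzero.\<close>

lemma symmetric_real_eigenvector:
  fixes A :: "real mat"
  assumes A: "A \<in> carrier_mat n n" and sym: "A\<^sup>T = A" and n: "n > 0"
  obtains v e where "v \<in> carrier_vec n" "v \<noteq> 0\<^sub>v n" "A *\<^sub>v v = e \<cdot>\<^sub>v v"
proof -
  let ?C = "map_mat complex_of_real A"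
  have C: "?C \<in> carrier_mat n n" using A by auto
  have dA [simp]: "dim_row A = n" "dim_col A = n" using A by auto
  have "degree (char_poly ?C) = n" using degree_monic_char_poly[OF C] by auto
  then have "\<not> constant (poly (char_poly ?C))" using n by (simp add: constant_degree)
  then obtain z where "poly (char_poly ?C) z = 0" using fundamental_theorem_of_algebra by blast
  then obtain w where w: "w \<in> carrier_vec n" "w \<noteq> 0\<^sub>v n" "?C *\<^sub>v w = z \<cdot>\<^sub>v w"
    using eigenvalue_root_char_poly[OF C] C unfolding eigenvalue_def eigenvector_def by auto
  have [simp]: "dim_vec w = n" using w by auto
  define x y where "x = map_vec Re w" and "y = map_vec Im w"
  have xy: "x \<in> carrier_vec n" "y \<in> carrier_vec n" using w by (auto simp: x_def y_def)
  have comp: "(\<Sum>j = 0..<n. complex_of_real (A $$ (i,j)) * w $ j) = z * w $ i" if i: "i < n" for i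
  proof -
    have "(?C *\<^sub>v w) $ i = (z \<cdot>\<^sub>v w) $ i" using w(3) by simp
    moreover have "(?C *\<^sub>v w) $ i = (\<Sum>j = 0..<n. complex_of_real (A $$ (i,j)) * w $ j)"
      using i by (auto simp: scalar_prod_def intro!: sum.cong)
    ultimately show ?thesis using i by simp
  qed
  have Ax: "A *\<^sub>v x = Re z \<cdot>\<^sub>v x - Im z \<cdot>\<^sub>v y"
  proof (rule eq_vecI)
    fix i assume "i < dim_vec (Re z \<cdot>\<^sub>v x - Im z \<cdot>\<^sub>v y)"
    then have i: "i < n" using xy by auto
    have "Re (\<Sum>j = 0..<n. complex_of_real (A $$ (i,j)) * w $ j) = Re (z * w $ i)"
      using comp[OF i] by simp
    moreover have "(A *\<^sub>v x) $ i = (\<Sum>j = 0..<n. A $$ (i,j) * Re (w $ j))"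
      using i xy by (auto simp: scalar_prod_def x_def intro!: sum.cong)
    ultimately show "(A *\<^sub>v x) $ i = (Re z \<cdot>\<^sub>v x - Im z \<cdot>\<^sub>v y) $ i"
      using i xy by (simp add: x_def y_def algebra_simps)
  qed (use A xy in auto)
  have Ay: "A *\<^sub>v y = Im z \<cdot>\<^sub>v x + Re z \<cdot>\<^sub>v y"
  proof (rule eq_vecI)
    fix i assume "i < dim_vec (Im z \<cdot>\<^sub>v x + Re z \<cdot>\<^sub>v y)"
    then have i: "i < n" using xy by auto
    have "Im (\<Sum>j = 0..<n. complex_of_real (A $$ (i,j)) * w $ j) = Im (z * w $ i)"
      using comp[OF i] by simp
    moreover have "(A *\<^sub>v y) $ i = (\<Sum>j = 0..<n. A $$ (i,j) * Im (w $ j))"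
      using i xy by (auto simp: scalar_prod_def y_def intro!: sum.cong)
    ultimately show "(A *\<^sub>v y) $ i = (Im z \<cdot>\<^sub>v x + Re z \<cdot>\<^sub>v y) $ i"
      using i xy by (simp add: x_def y_def algebra_simps)
  qed (use A xy in auto)
  have "y \<bullet> (A *\<^sub>v x) = x \<bullet> (A *\<^sub>v y)"
    by (rule symmetric_scalar_prod_mult_mat_vec[OF A sym xy])
  then have z0: "Im z * (x \<bullet> x + y \<bullet> y) = 0"
    using xy comm_scalar_prod[of x n y] unfolding Ax Ay
    by (simp add: scalar_prod_minus_distrib[of _ n] scalar_prod_add_distrib[of _ n] algebra_simps)
  have ne: "x \<noteq> 0\<^sub>v n \<or> y \<noteq> 0\<^sub>v n"
  proof (rule ccontr)
    assume "\<not> ?thesis"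
    then have "map_vec Re w = 0\<^sub>v n" "map_vec Im w = 0\<^sub>v n" by (auto simp: x_def y_def)
    then have "Re (w $ i) = 0 \<and> Im (w $ i) = 0" if "i < n" for i
      using that w(1) by (metis carrier_vecD index_map_vec(1) index_zero_vec(1))
    then have "w = 0\<^sub>v n" using w(1) by (intro eq_vecI) (auto simp: complex_eq_iff)
    then show False using w by simp
  qed
  then have "x \<bullet> x + y \<bullet> y \<noteq> 0"
    using xy scalar_prod_self_eq_0[of x n] scalar_prod_self_eq_0[of y n] scalar_prod_self_nonneg[of x]
      scalar_prod_self_nonneg[of y] by (auto simp: add_nonneg_eq_0_iff)
  with z0 have "Im z = 0" by (metis mult_eq_0_iff)
  then have "A *\<^sub>v x = Re z \<cdot>\<^sub>v x" "A *\<^sub>v y = Re z \<cdot>\<^sub>v y"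
    using Ax Ay xy by (auto intro!: eq_vecI)
  with ne xy that show ?thesis by blast
qed

text \<open>The reflection along \<open>w = v - e\<close> exchanges the first unit vector
  \<open>e\<close> with \<open>v\<close>, as both have length one. If \<open>v = e\<close> then
  \<open>q = 0\<close> and \<open>c = 2 / 0 = 0\<close>, so \<open>H\<close> is the identity and the
  claim still holds.\<close>

lemma householder:
  fixes v :: "real vec"
  assumes v: "v \<in> carrier_vec (Suc n)" "v \<bullet> v = 1"
  obtains H where "H \<in> carrier_mat (Suc n) (Suc n)" "H\<^sup>T = H" "H * H = 1\<^sub>m (Suc n)"
    "\<And>i. i < Suc n \<Longrightarrow> H $$ (i, 0) = v $ i"
proof -
  define d :: "nat \<Rightarrow> nat \<Rightarrow> real" where "d i j = (if i = j then 1 else 0)" for i j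
  define w where "w i = v $ i - d i 0" for i
  define q where "q = (\<Sum>i<Suc n. (w i)\<^sup>2)"
  define c where "c = 2 / q"
  define H where "H = mat (Suc n) (Suc n) (\<lambda>(i,j). d i j - c * w i * w j)"
  have vv: "(\<Sum>i<Suc n. (v $ i)\<^sup>2) = 1" using v scalar_prod_self[of v] by auto
  have q: "q = 2 - 2 * v $ 0"
  proof -
    have "q = (\<Sum>i<Suc n. (v $ i)\<^sup>2 - 2 * (v $ i * d i 0) + d i 0)"
      unfolding q_def w_def by (intro sum.cong) (auto simp: power2_eq_square d_def algebra_simps)
    also have "\<dots> = 1 - 2 * (\<Sum>i<Suc n. v $ i * d i 0) + (\<Sum>i<Suc n. d i 0)"
      by (simp only: sum.distrib sum_subtractf sum_distrib_left[symmetric] vv)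
    also have "(\<Sum>i<Suc n. v $ i * d i 0) = v $ 0"
      by (simp add: d_def if_distrib cong: if_cong del: sum.lessThan_Suc)
    also have "(\<Sum>i<Suc n. d i 0) = 1" by (simp add: d_def del: sum.lessThan_Suc)
    finally show ?thesis by simp
  qed
  \<comment> \<open>True in the degenerate case as well, where both sides are
    \<open>0\<close>.\<close>
  have cq: "c * c * q = 2 * c" by (auto simp: c_def)
  have "H * H = 1\<^sub>m (Suc n)"
  proof (rule eq_matI)
    fix i j assume "i < dim_row (1\<^sub>m (Suc n))" "j < dim_col (1\<^sub>m (Suc n))"
    then have ij: "i < Suc n" "j < Suc n" by auto
    have "(H * H) $$ (i, j) = (\<Sum>k<Suc n. (d i k - c * w i * w k) * (d k j - c * w k * w j))"
      using ij by (simp add: H_def scalar_prod_def atLeast0LessThan del: sum.lessThan_Suc)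
    also have "\<dots> = (\<Sum>k<Suc n. d i k * d k j - c * w i * (w k * d k j) - c * w j * (d i k * w k)
        + c * c * w i * w j * (w k)\<^sup>2)"
      by (intro sum.cong) (auto simp: algebra_simps power2_eq_square)
    also have "\<dots> = (\<Sum>k<Suc n. d i k * d k j) - c * w i * (\<Sum>k<Suc n. w k * d k j)
        - c * w j * (\<Sum>k<Suc n. d i k * w k) + c * c * w i * w j * q"
      by (simp only: sum.distrib sum_subtractf sum_distrib_left q_def)
    also have "(\<Sum>k<Suc n. d i k * d k j) = d i j"
      using ij by (simp add: d_def if_distrib cong: if_cong del: sum.lessThan_Suc)
    also have "(\<Sum>k<Suc n. w k * d k j) = w j"
      using ij by (simp add: d_def if_distrib cong: if_cong del: sum.lessThan_Suc)
    also have "(\<Sum>k<Suc n. d i k * w k) = w i"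
      using ij by (simp add: d_def if_distrib if_distribR cong: if_cong del: sum.lessThan_Suc)
    also have "c * c * w i * w j * q = w i * w j * (c * c * q)" by simp
    also have "\<dots> = w i * w j * (2 * c)" unfolding cq ..
    finally have "(H * H) $$ (i, j) = d i j" by (simp add: algebra_simps)
    then show "(H * H) $$ (i, j) = 1\<^sub>m (Suc n) $$ (i, j)" using ij by (simp add: d_def)
  qed (auto simp: H_def)
  moreover have "H $$ (i, 0) = v $ i" if i: "i < Suc n" for i
  proof (cases "q = 0")
    case True
    then have "\<forall>i<Suc n. (w i)\<^sup>2 = 0"
      unfolding q_def by (subst (asm) sum_nonneg_eq_0_iff) auto
    then have "w i = 0" using i by auto
    then show ?thesis using i by (simp add: H_def w_def)
  next
    case False
    \<comment> \<open>Since \<open>q = 2 - 2 * v $ 0 = - 2 * w 0\<close>, the factor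
      \<open>c * w 0\<close> equals \<open>-1\<close>, and subtracting it times \<open>w i\<close>
      restores \<open>v $ i\<close>.\<close>
    then have "v $ 0 \<noteq> 1" using q by auto
    then have "c * w 0 = - 1" unfolding c_def q w_def d_def by (simp add: field_simps)
    then have "d i 0 - c * w i * w 0 = d i 0 + w i"
      by (metis add_uminus_conv_diff minus_mult_right mult.commute mult.left_commute mult_1 diff_minus_eq_add mult_minus_left)
    then show ?thesis using i by (simp add: H_def w_def)
  qed
  moreover have "H\<^sup>T = H" by (rule eq_matI) (auto simp: H_def d_def)
  moreover have "H \<in> carrier_mat (Suc n) (Suc n)" by (simp add: H_def)
  ultimately show ?thesis using that by blast
qed

text \<open>Deflation: conjugating by the reflection that carries the first unit vector to a unit
  eigenvector leaves only the eigenvalue in the first column. Symmetry clears the first row too, and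
  the induction hypothesis diagonalises the remaining block.\<close>

theorem real_symmetric_spectral:
  fixes A :: "real mat"
  assumes "A \<in> carrier_mat n n" "A\<^sup>T = A"
  shows "\<exists>Q d. Q \<in> carrier_mat n n \<and> Q\<^sup>T * Q = 1\<^sub>m n \<and> Q * Q\<^sup>T = 1\<^sub>m n \<and> A = Q * mat_diag n d * Q\<^sup>T"
  using assms
proof (induction n arbitrary: A)
  case 0
  then show ?case by (intro exI[of _ "1\<^sub>m 0"]) (auto intro!: eq_matI)
next
  case (Suc n A)
  note A = Suc.prems(1) and sym = Suc.prems(2)
  obtain u e where u: "u \<in> carrier_vec (Suc n)" "u \<noteq> 0\<^sub>v (Suc n)" "A *\<^sub>v u = e \<cdot>\<^sub>v u"
    using symmetric_real_eigenvector[OF A sym] by auto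
  define v where "v = (1 / sqrt (u \<bullet> u)) \<cdot>\<^sub>v u"
  have uu: "u \<bullet> u > 0"
    using u scalar_prod_self_eq_0[OF u(1)] scalar_prod_self_nonneg[of u] by auto
  have v: "v \<in> carrier_vec (Suc n)" "v \<bullet> v = 1" "A *\<^sub>v v = e \<cdot>\<^sub>v v"
    using u uu A by (auto simp: v_def mult_mat_vec[OF A u(1)] smult_smult_assoc mult.commute)
  obtain H where H: "H \<in> carrier_mat (Suc n) (Suc n)" "H\<^sup>T = H" "H * H = 1\<^sub>m (Suc n)"
    "\<And>i. i < Suc n \<Longrightarrow> H $$ (i, 0) = v $ i"
    using householder[OF v(1,2)] by blast
  have col: "col H 0 = v" using H v by (intro eq_vecI) auto
  define A' where "A' = H * A * H"
  have A': "A' \<in> carrier_mat (Suc n) (Suc n)" using H A by (auto simp: A'_def)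
  have symA': "A'\<^sup>T = A'"
    using H A sym by (simp add: A'_def transpose_mult[of _ "Suc n" "Suc n" _ "Suc n"] assoc_mult_mat[of _ "Suc n" "Suc n" _ "Suc n" _ "Suc n"])
  have A'0: "A' $$ (i, 0) = (if i = 0 then e else 0)" if i: "i < Suc n" for i
  proof -
    have "col A' 0 = H *\<^sub>v (A *\<^sub>v v)"
      using H A by (simp add: A'_def assoc_mult_mat[of _ "Suc n" "Suc n" _ "Suc n" _ "Suc n"]
        col_mult2[of _ "Suc n" "Suc n" _ "Suc n"] col) (simp add: mult_mat_vec_def)
    also have "\<dots> = e \<cdot>\<^sub>v (H *\<^sub>v v)" using H(1) v by (simp add: mult_mat_vec)
    also have "H *\<^sub>v v = col (H * H) 0" using H(1) by (simp add: col_mult2[of _ "Suc n" "Suc n" _ "Suc n"] col mult_mat_vec_def)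
    finally have "col A' 0 = e \<cdot>\<^sub>v unit_vec (Suc n) 0" by (simp add: H(3))
    then have "col A' 0 $ i = (e \<cdot>\<^sub>v unit_vec (Suc n) 0) $ i" by simp
    then show ?thesis using i A' by (auto split: if_splits)
  qed
  have A'0': "A' $$ (0, i) = (if i = 0 then e else 0)" if i: "i < Suc n" for i
  proof -
    have "A' $$ (0, i) = A'\<^sup>T $$ (i, 0)" using i A' by simp
    then show ?thesis using A'0[OF i] symA' by simp
  qed
  define A3 where "A3 = mat n n (\<lambda>(i,j). A' $$ (Suc i, Suc j))"
  have A3: "A3 \<in> carrier_mat n n" by (simp add: A3_def)
  have "A' $$ (i, j) = A' $$ (j, i)" if "i < Suc n" "j < Suc n" for i j
    using that A' symA' by (metis carrier_matD index_transpose_mat(1))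
  then have "A3\<^sup>T = A3" by (intro eq_matI) (auto simp: A3_def)
  from Suc.IH[OF A3 this] obtain Q3 d3 where Q3: "Q3 \<in> carrier_mat n n" "Q3\<^sup>T * Q3 = 1\<^sub>m n"
    "Q3 * Q3\<^sup>T = 1\<^sub>m n" "A3 = Q3 * mat_diag n d3 * Q3\<^sup>T" by blast
  define d where "d i = (case i of 0 \<Rightarrow> e | Suc k \<Rightarrow> d3 k)" for i
  define F where "F = four_block_mat (1\<^sub>m 1) (0\<^sub>m 1 n) (0\<^sub>m n 1) Q3"
  have F: "F \<in> carrier_mat (Suc n) (Suc n)" using Q3 by (auto simp: F_def)
  have FT: "F\<^sup>T = four_block_mat (1\<^sub>m 1) (0\<^sub>m 1 n) (0\<^sub>m n 1) Q3\<^sup>T"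
    unfolding F_def using Q3 by (subst transpose_four_block_mat[of _ 1 1 _ n _ n]) auto
  have D: "mat_diag (Suc n) d = four_block_mat (mat_diag 1 d) (0\<^sub>m 1 n) (0\<^sub>m n 1) (mat_diag n d3)"
    by (rule eq_matI) (auto simp: mat_diag_def d_def split: nat.splits)
  have A'F: "A' = four_block_mat (mat_diag 1 d) (0\<^sub>m 1 n) (0\<^sub>m n 1) A3"
  proof (rule eq_matI)
    fix i j assume "i < dim_row (four_block_mat (mat_diag 1 d) (0\<^sub>m 1 n) (0\<^sub>m n 1) A3)"
      "j < dim_col (four_block_mat (mat_diag 1 d) (0\<^sub>m 1 n) (0\<^sub>m n 1) A3)"
    then have ij: "i < Suc n" "j < Suc n" using A3 by (auto simp: mat_diag_def)
    then show "A' $$ (i, j) = four_block_mat (mat_diag 1 d) (0\<^sub>m 1 n) (0\<^sub>m n 1) A3 $$ (i, j)"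
      using A'0[OF ij(1)] A'0'[OF ij(2)]
      by (cases i; cases j) (auto simp: A3_def mat_diag_def d_def)
  qed (use A' A3 in \<open>auto simp: mat_diag_def\<close>)
  have one: "four_block_mat (1\<^sub>m 1) (0\<^sub>m 1 n) (0\<^sub>m n 1) (1\<^sub>m n) = 1\<^sub>m (Suc n)"
    by (rule eq_matI) auto
  have d1: "mat_diag 1 d \<in> carrier_mat 1 1" "mat_diag n d3 \<in> carrier_mat n n" by (auto simp: mat_diag_def)
  have FF: "F\<^sup>T * F = 1\<^sub>m (Suc n)" "F * F\<^sup>T = 1\<^sub>m (Suc n)"
    unfolding FT unfolding F_def using Q3
    by (subst mult_four_block_mat[of _ 1 1 _ n _ n _ _ 1 _ n]; simp add: one)+
  have Q3T: "Q3\<^sup>T \<in> carrier_mat n n" and Q3D: "Q3 * mat_diag n d3 \<in> carrier_mat n n"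
    using Q3(1) d1 by auto
  have z: "0\<^sub>m 1 n * mat_diag n d3 = 0\<^sub>m 1 n" "0\<^sub>m n 1 * mat_diag 1 d = 0\<^sub>m n 1"
    "0\<^sub>m 1 n * Q3\<^sup>T = 0\<^sub>m 1 n" "Q3 * 0\<^sub>m n 1 = 0\<^sub>m n 1" "Q3 * mat_diag n d3 * 0\<^sub>m n 1 = 0\<^sub>m n 1"
    "1\<^sub>m 1 * mat_diag 1 d + 0\<^sub>m 1 1 = mat_diag 1 d" "mat_diag 1 d * 1\<^sub>m 1 + 0\<^sub>m 1 1 = mat_diag 1 d"
    "mat_diag 1 d * 0\<^sub>m 1 n + 0\<^sub>m 1 n = 0\<^sub>m 1 n"
    "0\<^sub>m n n + Q3 * mat_diag n d3 * Q3\<^sup>T = Q3 * mat_diag n d3 * Q3\<^sup>T"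
    using left_add_zero_mat[OF mult_carrier_mat[OF Q3D Q3T]] right_mult_one_mat[OF d1(1)] right_mult_zero_mat[OF d1(1)]
      right_add_zero_mat[OF zero_carrier_mat] right_add_zero_mat[OF d1(1)] left_mult_one_mat[OF d1(1)] left_mult_zero_mat[OF d1(2)] left_mult_zero_mat[OF d1(1)] left_mult_zero_mat[OF Q3T]
      right_mult_zero_mat[OF Q3(1)] right_mult_zero_mat[OF Q3D] by metis+
  have FD1: "F * mat_diag (Suc n) d = four_block_mat (mat_diag 1 d) (0\<^sub>m 1 n) (0\<^sub>m n 1) (Q3 * mat_diag n d3)"
    unfolding F_def D using Q3(1) d1 Q3D
    by (subst mult_four_block_mat[of _ 1 1 _ n _ n _ _ 1 _ n]) (auto simp del: One_nat_def simp: z)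
  have FD: "F * mat_diag (Suc n) d * F\<^sup>T = A'"
    unfolding FD1 unfolding FT A'F unfolding Q3(4) using Q3(1) d1 Q3D Q3T
    by (subst mult_four_block_mat[of _ 1 1 _ n _ n _ _ 1 _ n]) (auto simp del: One_nat_def simp: z)
  define Q where "Q = H * F"
  have DC: "mat_diag (Suc n) d \<in> carrier_mat (Suc n) (Suc n)" by (auto simp: mat_diag_def)
  note ass = assoc_mult_mat[of _ "Suc n" "Suc n" _ "Suc n" _ "Suc n"]
  have QT: "Q\<^sup>T = F\<^sup>T * H" unfolding Q_def using H F by (simp add: transpose_mult[of _ "Suc n" "Suc n" _ "Suc n"])
  have FTc: "F\<^sup>T \<in> carrier_mat (Suc n) (Suc n)" using F by auto
  have "Q\<^sup>T * Q = F\<^sup>T * (H * H) * F" unfolding QT unfolding Q_def using H(1) F FTc by (simp add: ass)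
  also have "\<dots> = 1\<^sub>m (Suc n)" using H(3) FF FTc by simp
  finally have Q1: "Q\<^sup>T * Q = 1\<^sub>m (Suc n)" .
  have "Q * Q\<^sup>T = H * (F * F\<^sup>T) * H" unfolding QT unfolding Q_def using H(1) F FTc by (simp add: ass)
  also have "\<dots> = 1\<^sub>m (Suc n)" using H(1,3) FF by simp
  finally have Q2: "Q * Q\<^sup>T = 1\<^sub>m (Suc n)" .
  have "Q * mat_diag (Suc n) d * Q\<^sup>T = H * (F * mat_diag (Suc n) d * F\<^sup>T) * H"
    unfolding QT unfolding Q_def using H(1) F FTc DC by (simp add: ass mult_carrier_mat[of _ "Suc n" "Suc n" _ "Suc n"])
  also have "\<dots> = H * H * A * (H * H)" unfolding FD A'_def using H(1) A by (simp add: ass)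
  also have "\<dots> = A" unfolding H(3) using A by simp
  finally have "A = Q * mat_diag (Suc n) d * Q\<^sup>T" ..
  moreover have "Q \<in> carrier_mat (Suc n) (Suc n)" unfolding Q_def using H F by auto
  ultimately show ?case using Q1 Q2 by blast
qed

text \<open>Connects the spectral theorem with \<open>empirical_eigenvalue_distribution\<close>,
  which sees the matrix only through the roots of its characteristic polynomial.\<close>

lemma char_poly_orthogonal_diag:
  fixes Q :: "real mat"
  assumes Q: "Q \<in> carrier_mat n n" "Q\<^sup>T * Q = 1\<^sub>m n" "Q * Q\<^sup>T = 1\<^sub>m n"
  shows "char_poly (Q * mat_diag n d * Q\<^sup>T) = (\<Prod>i\<leftarrow>[0..<n]. [:- d i, 1:])"
    and "proots (char_poly (Q * mat_diag n d * Q\<^sup>T)) = mset (map d [0..<n])"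
proof -
  have D: "mat_diag n d \<in> carrier_mat n n" by (simp add: mat_diag_def)
  have "similar_mat (Q * mat_diag n d * Q\<^sup>T) (mat_diag n d)"
    unfolding similar_mat_def similar_mat_wit_def using Q D
    by (intro exI[of _ Q] exI[of _ "Q\<^sup>T"]) (auto simp: Let_def)
  then have "char_poly (Q * mat_diag n d * Q\<^sup>T) = char_poly (mat_diag n d)"
    by (rule char_poly_similar)
  also have "\<dots> = (\<Prod>a\<leftarrow>diag_mat (mat_diag n d). [:- a, 1:])"
    by (rule char_poly_upper_triangular[OF D]) (auto simp: upper_triangular_def mat_diag_def)
  also have "diag_mat (mat_diag n d) = map d [0..<n]" by (auto simp: diag_mat_def mat_diag_def)
  finally show *: "char_poly (Q * mat_diag n d * Q\<^sup>T) = (\<Prod>i\<leftarrow>[0..<n]. [:- d i, 1:])"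
    by (simp add: o_def)
  have "proots (\<Prod>p\<leftarrow>map (\<lambda>i. [:- d i, 1:]) xs. p) = mset (map d xs)" for xs
    by (subst proots_prod_list) (auto, induction xs, auto)
  from this[of "[0..<n]"] show "proots (char_poly (Q * mat_diag n d * Q\<^sup>T)) = mset (map d [0..<n])"
    unfolding * by simp
qed

section \<open>Weighted Gram matrices and their resolvent\<close>

lemma scalar_prod_Cauchy_Schwarz:
  assumes "(x :: real vec) \<in> carrier_vec n" "y \<in> carrier_vec n"
  shows "(x \<bullet> y)\<^sup>2 \<le> (x \<bullet> x) * (y \<bullet> y)"
proof -
  have "(\<Sum>i<n. x $ i * y $ i)\<^sup>2 \<le> (\<Sum>i<n. (x $ i)\<^sup>2) * (\<Sum>i<n. (y $ i)\<^sup>2)"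
    by (rule Cauchy_Schwarz_ineq_sum)
  then show ?thesis using assms by (simp add: scalar_prod_self) (simp add: scalar_prod_def atLeast0LessThan)
qed

section \<open>Inverses and resolvent bounds for coercive matrices\<close>

definition mtrace :: "real mat \<Rightarrow> real" where "mtrace A = (\<Sum>i<dim_row A. A $$ (i, i))"

text \<open>The adjugate formula is total and rational in the entries, which makes measurability of
  resolvents immediate. On singular matrices it is the zero matrix, because
  \<open>1 / 0 = 0\<close>.\<close>

definition minv :: "real mat \<Rightarrow> real mat" where "minv A = (1 / det A) \<cdot>\<^sub>m adj_mat A"

lemma minv:
  assumes "A \<in> carrier_mat n n" "det A \<noteq> 0"
  shows "minv A \<in> carrier_mat n n" "A * minv A = 1\<^sub>m n" "minv A * A = 1\<^sub>m n"
proof -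
  note adj = adj_mat[OF assms(1)]
  show "minv A \<in> carrier_mat n n" using adj by (simp add: minv_def)
  have one: "(1 / det A) \<cdot>\<^sub>m (det A \<cdot>\<^sub>m 1\<^sub>m n) = 1\<^sub>m n"
    using assms(2) by (intro eq_matI) auto
  show "A * minv A = 1\<^sub>m n"
    unfolding minv_def mult_smult_distrib[OF assms(1) adj(1)] adj(2) by (rule one)
  show "minv A * A = 1\<^sub>m n"
    unfolding minv_def mult_smult_assoc_mat[OF adj(1) assms(1)] adj(3) by (rule one)
qed

lemma minv_unique:
  assumes "A \<in> carrier_mat n n" "B \<in> carrier_mat n n" "A * B = 1\<^sub>m n"
  shows "minv A = B" "det A \<noteq> 0"
proof -
  have "det A * det B = 1" using det_mult[OF assms(1,2)] assms(3) by simp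
  then show d: "det A \<noteq> 0" by auto
  note m = minv[OF assms(1) d]
  have "minv A = minv A * (A * B)" using m(1) assms(3) by simp
  also have "\<dots> = minv A * A * B" by (rule assoc_mult_mat[OF m(1) assms(1,2), symmetric])
  also have "\<dots> = B" unfolding m(3) using assms by simp
  finally show "minv A = B" .
qed

lemma minv_symmetric:
  assumes A: "A \<in> carrier_mat n n" and "det A \<noteq> 0" "A\<^sup>T = A"
  shows "(minv A)\<^sup>T = minv A"
proof -
  note m = minv[OF assms(1,2)]
  have "A * (minv A)\<^sup>T = (minv A * A)\<^sup>T" using transpose_mult[OF m(1) A] assms(3) by simp
  then have "A * (minv A)\<^sup>T = 1\<^sub>m n" using m(3) by simp
  from minv_unique(1)[OF A _ this] m(1) show ?thesis by auto
qed

lemma minv_mult_vec: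
  assumes A: "A \<in> carrier_mat n n" and "det A \<noteq> 0" and "x \<in> carrier_vec n"
  shows "A *\<^sub>v (minv A *\<^sub>v x) = x" "minv A *\<^sub>v (A *\<^sub>v x) = x"
  using minv[OF assms(1,2)] assms by (simp_all add: assoc_mult_mat_vec[of _ n n _ n, symmetric])

text \<open>Models a resolvent at the point \<open>-t\<close> of a positive semidefinite matrix. All
  bounds below come from coercivity and the Cauchy--Schwarz inequality, with no reference to
  eigenvalues.\<close>

locale coercive_mat =
  fixes A :: "real mat" and n :: nat and t :: real
  assumes carrier [simp]: "A \<in> carrier_mat n n" and sym: "A\<^sup>T = A" and t: "t > 0"
    and coercive: "\<And>x. x \<in> carrier_vec n \<Longrightarrow> t * (x \<bullet> x) \<le> x \<bullet> (A *\<^sub>v x)"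
begin

lemma det_nz: "det A \<noteq> 0"
proof
  assume "det A = 0"
  then obtain v where v: "v \<in> carrier_vec n" "v \<noteq> 0\<^sub>v n" "A *\<^sub>v v = 0\<^sub>v n"
    using det_0_iff_vec_prod_zero[OF carrier] by auto
  then have "t * (v \<bullet> v) \<le> 0" using coercive[OF v(1)] by simp
  then show False using t v scalar_prod_self_eq_0[OF v(1)] scalar_prod_self_nonneg[of v]
    by (simp add: mult_le_0_iff)
qed

lemma inv_carrier [simp]: "minv A \<in> carrier_mat n n"
  by (rule minv(1)[OF carrier det_nz])

lemma inv_mult_carrier [simp]: "x \<in> carrier_vec n \<Longrightarrow> minv A *\<^sub>v x \<in> carrier_vec n"
  using mult_mat_vec_carrier[OF inv_carrier] .

lemmas inv_cancel = minv_mult_vec[OF carrier det_nz]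

lemma inv_self_adjoint:
  "x \<in> carrier_vec n \<Longrightarrow> y \<in> carrier_vec n \<Longrightarrow> y \<bullet> (minv A *\<^sub>v x) = x \<bullet> (minv A *\<^sub>v y)"
  by (rule symmetric_scalar_prod_mult_mat_vec[OF inv_carrier minv_symmetric[OF carrier det_nz sym]])

lemma inv_quadratic:
  assumes x: "x \<in> carrier_vec n"
  shows "t * ((minv A *\<^sub>v x) \<bullet> (minv A *\<^sub>v x)) \<le> x \<bullet> (minv A *\<^sub>v x)"
  using coercive[OF inv_mult_carrier[OF x]] inv_cancel(1)[OF x] comm_scalar_prod[OF x inv_mult_carrier[OF x]] by simp

lemma inv_quadratic_nonneg: "x \<in> carrier_vec n \<Longrightarrow> 0 \<le> x \<bullet> (minv A *\<^sub>v x)"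
  using inv_quadratic[of x] scalar_prod_self_nonneg[of "minv A *\<^sub>v x"] t
  by (meson mult_nonneg_nonneg less_imp_le order_trans)

text \<open>Write \<open>R\<close> for the inverse and \<open>q\<close> for the squared length of
  \<open>R x\<close>. Coercivity at \<open>R x\<close> and Cauchy--Schwarz give
  \<open>(t * q)\<^sup>2 \<le> (x \<bullet> x) * q\<close>; dividing by \<open>q\<close> is harmless
  once \<open>q = 0\<close> is treated separately.\<close>

lemma inv_norm:
  assumes x: "x \<in> carrier_vec n"
  shows "(minv A *\<^sub>v x) \<bullet> (minv A *\<^sub>v x) \<le> (x \<bullet> x) / t\<^sup>2"
proof (cases "(minv A *\<^sub>v x) \<bullet> (minv A *\<^sub>v x) = 0")
  case True
  then show ?thesis using scalar_prod_self_nonneg[of x] t by simp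
next
  case False
  define q where "q = (minv A *\<^sub>v x) \<bullet> (minv A *\<^sub>v x)"
  have q: "q > 0" using False scalar_prod_self_nonneg[of "minv A *\<^sub>v x"] by (simp add: q_def)
  have "(t * q)\<^sup>2 \<le> (x \<bullet> (minv A *\<^sub>v x))\<^sup>2"
    using inv_quadratic[OF x] t q by (intro power_mono) (auto simp: q_def)
  also have "\<dots> \<le> (x \<bullet> x) * q" unfolding q_def by (rule scalar_prod_Cauchy_Schwarz[OF x inv_mult_carrier[OF x]])
  finally have "q * (t\<^sup>2 * q) \<le> q * (x \<bullet> x)" by (simp add: power2_eq_square algebra_simps)
  then have "t\<^sup>2 * q \<le> x \<bullet> x" using q by simp
  then show ?thesis using t unfolding q_def[symmetric] by (simp add: field_simps)
qed

lemma inv_unit_entry: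
  assumes "k < n" "l < n"
  shows "(minv A *\<^sub>v unit_vec n l) $ k = minv A $$ (k, l)"
  using assms carrier_matD[OF inv_carrier] by (simp add: scalar_prod_right_unit[of _ n])

lemma inv_diag:
  assumes k: "k < n"
  shows "0 \<le> minv A $$ (k, k)" "minv A $$ (k, k) \<le> 1 / t"
proof -
  let ?e = "unit_vec n k :: real vec"
  have e: "?e \<in> carrier_vec n" "?e \<bullet> ?e = 1" using k by auto
  have d: "?e \<bullet> (minv A *\<^sub>v ?e) = minv A $$ (k, k)"
    using k inv_unit_entry[OF k k] inv_mult_carrier[OF e(1)] by (simp add: scalar_prod_left_unit)
  show nn: "0 \<le> minv A $$ (k, k)" using inv_quadratic_nonneg[OF e(1)] d by simp
  have "(minv A $$ (k, k))\<^sup>2 \<le> 1 * ((minv A *\<^sub>v ?e) \<bullet> (minv A *\<^sub>v ?e))"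
    using scalar_prod_Cauchy_Schwarz[OF e(1) inv_mult_carrier[OF e(1)]] d e(2) by simp
  also have "\<dots> \<le> (1 / t)\<^sup>2" using inv_norm[OF e(1)] e(2) by (simp add: power_divide)
  finally show "minv A $$ (k, k) \<le> 1 / t" using t by (meson power2_le_imp_le zero_le_divide_1_iff less_imp_le)
qed

lemma inv_trace: "0 \<le> mtrace (minv A)" "mtrace (minv A) \<le> n / t"
proof -
  have dim: "dim_row (minv A) = n" using inv_carrier by blast
  show "0 \<le> mtrace (minv A)" unfolding mtrace_def dim by (intro sum_nonneg inv_diag) simp
  have "(\<Sum>i<n. minv A $$ (i, i)) \<le> (\<Sum>i<n. 1 / t)" by (intro sum_mono inv_diag) simp
  then show "mtrace (minv A) \<le> n / t" unfolding mtrace_def dim by simp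
qed

lemma inv_trace_pos: "n > 0 \<Longrightarrow> 0 < mtrace (minv A)"
proof -
  assume n: "n > 0"
  have "0 < minv A $$ (k, k)" if k: "k < n" for k
  proof -
    let ?e = "unit_vec n k :: real vec"
    have e: "?e \<in> carrier_vec n" "?e \<noteq> 0\<^sub>v n"
      using k by (auto simp: vec_eq_iff unit_vec_def)
    have ne: "minv A *\<^sub>v ?e \<noteq> 0\<^sub>v n"
    proof
      assume "minv A *\<^sub>v ?e = 0\<^sub>v n"
      then have "A *\<^sub>v (0\<^sub>v n) = ?e" using inv_cancel(1)[OF e(1)] by simp
      moreover have "A *\<^sub>v (0\<^sub>v n) = 0\<^sub>v n"
        using carrier_matD[OF carrier] by (intro eq_vecI) (simp_all add: scalar_prod_def)
      ultimately show False using e(2) by simp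
    qed
    then have "0 < t * ((minv A *\<^sub>v ?e) \<bullet> (minv A *\<^sub>v ?e))"
      using scalar_prod_self_eq_0[OF inv_mult_carrier[OF e(1)]] scalar_prod_self_nonneg[of "minv A *\<^sub>v ?e"] t by auto
    also have "\<dots> \<le> ?e \<bullet> (minv A *\<^sub>v ?e)" by (rule inv_quadratic[OF e(1)])
    also have "\<dots> = minv A $$ (k, k)"
      using k inv_unit_entry[OF k k] inv_mult_carrier[OF e(1)] by (simp add: scalar_prod_left_unit)
    finally show ?thesis .
  qed
  moreover have dim: "dim_row (minv A) = n" using inv_carrier by blast
  ultimately show ?thesis unfolding mtrace_def dim using n by (intro sum_pos) auto
qed

text \<open>Each column is the image of a unit vector, so \<open>inv_norm\<close> bounds it. The
  Frobenius norm governs the fluctuation of Gaussian quadratic forms: its square is of order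
  \<open>n\<close>, so deviations are of order \<open>sqrt n\<close>, against a trace bound of order
  \<open>n\<close>.\<close>

lemma inv_frobenius: "(\<Sum>k<n. \<Sum>l<n. (minv A $$ (k, l))\<^sup>2) \<le> n / t\<^sup>2"
proof -
  have "(\<Sum>k<n. (minv A $$ (k, l))\<^sup>2) \<le> 1 / t\<^sup>2" if l: "l < n" for l
  proof -
    have e: "(unit_vec n l :: real vec) \<in> carrier_vec n" by simp
    have "(minv A *\<^sub>v unit_vec n l) \<bullet> (minv A *\<^sub>v unit_vec n l) = (\<Sum>k<n. (minv A $$ (k, l))\<^sup>2)"
      unfolding scalar_prod_self carrier_vecD[OF inv_mult_carrier[OF e]]
      by (intro sum.cong refl) (simp only: inv_unit_entry[OF _ l] lessThan_iff)
    then show ?thesis using inv_norm[OF e] l by simp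
  qed
  then have "(\<Sum>l<n. \<Sum>k<n. (minv A $$ (k, l))\<^sup>2) \<le> (\<Sum>l<n. 1 / t\<^sup>2)" by (intro sum_mono) simp
  then show ?thesis by (subst sum.swap) simp
qed

end

text \<open>This is \<open>U\<^sup>T * B * U + t * 1\<close> for a diagonal \<open>B\<close>, with
  the rows of \<open>U\<close> indexed by an arbitrary set \<open>I\<close>, so that deleting a row
  is simply passing to \<open>I - {i}\<close>.\<close>

definition weighted_gram :: "real \<Rightarrow> nat \<Rightarrow> 'i set \<Rightarrow> ('i \<Rightarrow> real) \<Rightarrow> ('i \<times> nat \<Rightarrow> real) \<Rightarrow> real mat" where
  "weighted_gram t d I b u = mat d d (\<lambda>(k, l). (if k = l then t else 0) + (\<Sum>i\<in>I. b i * u (i, k) * u (i, l)))"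

definition row_of :: "nat \<Rightarrow> ('i \<times> nat \<Rightarrow> real) \<Rightarrow> 'i \<Rightarrow> real vec" where
  "row_of d u i = vec d (\<lambda>k. u (i, k))"

lemma row_of_carrier [simp]: "row_of d u i \<in> carrier_vec d" by (simp add: row_of_def)

lemma weighted_gram_carrier [simp]: "weighted_gram t d I b u \<in> carrier_mat d d"
  by (simp add: weighted_gram_def)

lemma weighted_gram_symmetric: "(weighted_gram t d I b u)\<^sup>T = weighted_gram t d I b u"
  by (rule eq_matI) (auto simp: weighted_gram_def mult_ac)

lemma weighted_gram_mult_vec:
  assumes x: "x \<in> carrier_vec d" and k: "k < d" and I: "finite I"
  shows "(weighted_gram t d I b u *\<^sub>v x) $ k = t * x $ k + (\<Sum>i\<in>I. b i * (row_of d u i \<bullet> x) * u (i, k))"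
proof -
  have "(weighted_gram t d I b u *\<^sub>v x) $ k
      = (\<Sum>l<d. ((if k = l then t else 0) + (\<Sum>i\<in>I. b i * u (i, k) * u (i, l))) * x $ l)"
    using x k by (auto simp: weighted_gram_def scalar_prod_def atLeast0LessThan)
  also have "\<dots> = (\<Sum>l<d. (if k = l then t * x $ l else 0)) + (\<Sum>l<d. \<Sum>i\<in>I. b i * u (i, k) * u (i, l) * x $ l)"
    by (simp add: distrib_right sum.distrib sum_distrib_right if_distrib[of "\<lambda>z. z * _"] cong: if_cong)
  also have "(\<Sum>l<d. (if k = l then t * x $ l else 0)) = t * x $ k" using k by simp
  also have "(\<Sum>l<d. \<Sum>i\<in>I. b i * u (i, k) * u (i, l) * x $ l) = (\<Sum>i\<in>I. \<Sum>l<d. b i * u (i, k) * u (i, l) * x $ l)"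
    by (rule sum.swap)
  also have "\<dots> = (\<Sum>i\<in>I. b i * (row_of d u i \<bullet> x) * u (i, k))"
    using x by (intro sum.cong refl)
      (auto simp: scalar_prod_def row_of_def atLeast0LessThan sum_distrib_left sum_distrib_right mult_ac intro!: sum.cong)
  finally show ?thesis .
qed

lemma weighted_gram_quadratic:
  assumes x: "x \<in> carrier_vec d" and I: "finite I"
  shows "x \<bullet> (weighted_gram t d I b u *\<^sub>v x) = t * (x \<bullet> x) + (\<Sum>i\<in>I. b i * (row_of d u i \<bullet> x)\<^sup>2)"
proof -
  have dim: "dim_vec (weighted_gram t d I b u *\<^sub>v x) = d" by (simp add: weighted_gram_def)
  have "x \<bullet> (weighted_gram t d I b u *\<^sub>v x) = (\<Sum>k<d. x $ k * (t * x $ k + (\<Sum>i\<in>I. b i * (row_of d u i \<bullet> x) * u (i, k))))"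
    unfolding scalar_prod_def[of x] dim atLeast0LessThan
    by (intro sum.cong refl) (simp add: weighted_gram_mult_vec[OF x _ I])
  also have "\<dots> = t * (x \<bullet> x) + (\<Sum>k<d. \<Sum>i\<in>I. x $ k * (b i * (row_of d u i \<bullet> x) * u (i, k)))"
    using x by (simp add: distrib_left sum.distrib scalar_prod_self sum_distrib_left power2_eq_square mult_ac)
  also have "(\<Sum>k<d. \<Sum>i\<in>I. x $ k * (b i * (row_of d u i \<bullet> x) * u (i, k))) = (\<Sum>i\<in>I. \<Sum>k<d. x $ k * (b i * (row_of d u i \<bullet> x) * u (i, k)))"
    by (rule sum.swap)
  also have "\<dots> = (\<Sum>i\<in>I. b i * (row_of d u i \<bullet> x)\<^sup>2)"
  proof (rule sum.cong[OF refl])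
    fix i
    have "row_of d u i \<bullet> x = (\<Sum>k<d. u (i, k) * x $ k)"
      using x by (simp add: scalar_prod_def row_of_def atLeast0LessThan)
    then have "b i * (row_of d u i \<bullet> x) * (row_of d u i \<bullet> x) = b i * (row_of d u i \<bullet> x) * (\<Sum>k<d. u (i, k) * x $ k)" by simp
    then show "(\<Sum>k<d. x $ k * (b i * (row_of d u i \<bullet> x) * u (i, k))) = b i * (row_of d u i \<bullet> x)\<^sup>2"
      by (simp add: power2_eq_square sum_distrib_left mult_ac)
  qed
  finally show ?thesis .
qed

lemma coercive_weighted_gram:
  assumes "finite I" "t > 0" "\<And>i. i \<in> I \<Longrightarrow> b i \<ge> 0"
  shows "coercive_mat (weighted_gram t d I b u) d t"
  using assms by unfold_locales
    (auto simp: weighted_gram_symmetric weighted_gram_quadratic intro!: sum_nonneg)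

text \<open>Leave one out: the removed vector enters through its quadratic form only (Sherman--Morrison),
  and the trace of the resolvent moves by at most the rank one bound \<open>1 / t\<close>.\<close>

lemma weighted_gram_leave_one_out:
  fixes u :: "'i \<times> nat \<Rightarrow> real" and d :: nat
  assumes I: "finite I" "i \<in> I" and t: "t > 0" and b: "\<And>i. i \<in> I \<Longrightarrow> b i \<ge> 0"
  defines "R \<equiv> minv (weighted_gram t d I b u)" and "R' \<equiv> minv (weighted_gram t d (I - {i}) b u)"
    and "h \<equiv> row_of d u i"
  shows "h \<bullet> (R *\<^sub>v h) = (h \<bullet> (R' *\<^sub>v h)) / (1 + b i * (h \<bullet> (R' *\<^sub>v h)))"
    and "0 \<le> mtrace R' - mtrace R" "mtrace R' - mtrace R \<le> 1 / t"
proof -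
  let ?K = "weighted_gram t d I b u" and ?K' = "weighted_gram t d (I - {i}) b u"
  interpret K: coercive_mat ?K d t by (rule coercive_weighted_gram) (use assms in auto)
  interpret K': coercive_mat ?K' d t by (rule coercive_weighted_gram) (use assms in auto)
  define a where "a = h \<bullet> (R' *\<^sub>v h)"
  have h: "h \<in> carrier_vec d" by (simp add: h_def)
  have Rc: "R \<in> carrier_mat d d" "R' \<in> carrier_mat d d" by (auto simp: R_def R'_def)
  have a0: "a \<ge> 0" unfolding a_def R'_def by (rule K'.inv_quadratic_nonneg[OF h])
  have ba: "1 + b i * a > 0" using a0 b[OF I(2)] by (simp add: add_pos_nonneg)
  \<comment> \<open>The two matrices differ by the rank one term \<open>b i\<close> times
    \<open>h\<close> times its transpose. Applying the larger one to \<open>R' x\<close> and then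
    \<open>R\<close> gives the resolvent identity in vector form.\<close>
  have R'x: "R' *\<^sub>v x = R *\<^sub>v x + (b i * (h \<bullet> (R' *\<^sub>v x))) \<cdot>\<^sub>v (R *\<^sub>v h)" if x: "x \<in> carrier_vec d" for x
  proof -
    have y: "R' *\<^sub>v x \<in> carrier_vec d" using Rc x by simp
    have "?K *\<^sub>v (R' *\<^sub>v x) = ?K' *\<^sub>v (R' *\<^sub>v x) + (b i * (h \<bullet> (R' *\<^sub>v x))) \<cdot>\<^sub>v h"
    proof (rule eq_vecI)
      fix k assume "k < dim_vec (?K' *\<^sub>v (R' *\<^sub>v x) + (b i * (h \<bullet> (R' *\<^sub>v x))) \<cdot>\<^sub>v h)"
      then have k: "k < d" using h by simp
      show "(?K *\<^sub>v (R' *\<^sub>v x)) $ k = (?K' *\<^sub>v (R' *\<^sub>v x) + (b i * (h \<bullet> (R' *\<^sub>v x))) \<cdot>\<^sub>v h) $ k"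
        using k h I weighted_gram_mult_vec[OF y k I(1)] weighted_gram_mult_vec[OF y k finite_Diff[OF I(1)]]
        by (simp add: sum.remove[OF I] h_def[symmetric]) (simp add: h_def row_of_def)
    qed (use h in \<open>simp add: weighted_gram_def\<close>)
    also have "?K' *\<^sub>v (R' *\<^sub>v x) = x" unfolding R'_def by (rule K'.inv_cancel(1)[OF x])
    finally have e: "?K *\<^sub>v (R' *\<^sub>v x) = x + (b i * (h \<bullet> (R' *\<^sub>v x))) \<cdot>\<^sub>v h" .
    have "R' *\<^sub>v x = R *\<^sub>v (?K *\<^sub>v (R' *\<^sub>v x))" unfolding R_def using K.inv_cancel(2)[OF y] by simp
    also have "\<dots> = R *\<^sub>v x + (b i * (h \<bullet> (R' *\<^sub>v x))) \<cdot>\<^sub>v (R *\<^sub>v h)"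
      unfolding e using Rc x h by (simp add: mult_add_distrib_mat_vec[of _ d d] mult_mat_vec[of _ d d])
    finally show ?thesis .
  qed
  have Rhc: "R *\<^sub>v h \<in> carrier_vec d" using Rc h by simp
  have "R *\<^sub>v h + (b i * a) \<cdot>\<^sub>v (R *\<^sub>v h) = (1 + b i * a) \<cdot>\<^sub>v (R *\<^sub>v h)"
    using add_smult_distrib_vec[of 1 "b i * a" "R *\<^sub>v h"] by simp
  then have Rh: "R' *\<^sub>v h = (1 + b i * a) \<cdot>\<^sub>v (R *\<^sub>v h)"
    using R'x[OF h] unfolding a_def[symmetric] by simp
  have "a = h \<bullet> ((1 + b i * a) \<cdot>\<^sub>v (R *\<^sub>v h))" unfolding Rh[symmetric] by (rule a_def)
  also have "\<dots> = (1 + b i * a) * (h \<bullet> (R *\<^sub>v h))" by (rule scalar_prod_smult_distrib[OF h Rhc])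
  finally have "a = (1 + b i * a) * (h \<bullet> (R *\<^sub>v h))" .
  then show "h \<bullet> (R *\<^sub>v h) = (h \<bullet> (R' *\<^sub>v h)) / (1 + b i * (h \<bullet> (R' *\<^sub>v h)))"
    unfolding a_def[symmetric] using ba by (simp add: field_simps)
  define q where "q = (R' *\<^sub>v h) \<bullet> (R' *\<^sub>v h)"
  have diff: "mtrace R' - mtrace R = b i * q / (1 + b i * a)"
  proof -
    have "R' $$ (k, k) - R $$ (k, k) = b i * ((R' *\<^sub>v h) $ k)\<^sup>2 / (1 + b i * a)" if k: "k < d" for k
    proof -
      have e: "(unit_vec d k :: real vec) \<in> carrier_vec d" by simp
      have hk: "h \<bullet> (R' *\<^sub>v unit_vec d k) = (R' *\<^sub>v h) $ k"
        using K'.inv_self_adjoint[OF e h] k Rc h unfolding R'_def[symmetric] by (simp add: scalar_prod_left_unit)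
      have "(R' *\<^sub>v unit_vec d k) $ k = (R *\<^sub>v unit_vec d k) $ k + b i * (R' *\<^sub>v h) $ k * (R *\<^sub>v h) $ k"
        using arg_cong[OF R'x[OF e], of "\<lambda>v. v $ k"] Rc h k unfolding hk by simp
      moreover have "(R' *\<^sub>v h) $ k = (1 + b i * a) * (R *\<^sub>v h) $ k"
        using arg_cong[OF Rh, of "\<lambda>v. v $ k"] Rc h k by simp
      ultimately show ?thesis
        using K.inv_unit_entry[OF k k] K'.inv_unit_entry[OF k k] ba unfolding R_def[symmetric] R'_def[symmetric]
        by (simp add: power2_eq_square)
    qed
    then have "mtrace R' - mtrace R = (\<Sum>k<d. b i * ((R' *\<^sub>v h) $ k)\<^sup>2 / (1 + b i * a))"
      unfolding mtrace_def using Rc by (simp add: sum_subtractf[symmetric])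
    also have "\<dots> = b i * q / (1 + b i * a)"
      unfolding q_def scalar_prod_self using Rc by (simp add: sum_divide_distrib sum_distrib_left)
    finally show ?thesis .
  qed
  have q0: "q \<ge> 0" unfolding q_def by (rule scalar_prod_self_nonneg)
  show "0 \<le> mtrace R' - mtrace R" unfolding diff using q0 ba b[OF I(2)] by simp
  \<comment> \<open>Coercivity of the reduced matrix at \<open>R' h\<close> bounds the numerator
    \<open>b i * q\<close> of the trace difference by its denominator divided by \<open>t\<close>;
    hence the rank one bound does not depend on \<open>h\<close> or on the size of
    \<open>b i\<close>.\<close>
  have "t * q \<le> a" unfolding q_def a_def R'_def by (rule K'.inv_quadratic[OF h])
  then have "b i * (t * q) \<le> b i * a" using b[OF I(2)] by (rule mult_left_mono)
  then have "t * (b i * q) \<le> 1 + b i * a" by (simp add: mult_ac)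
  then show "mtrace R' - mtrace R \<le> 1 / t" unfolding diff using ba t by (simp add: field_simps)
qed

text \<open>Take the trace of the product of the matrix and its inverse \<open>R\<close>; the rank
  one summands contribute quadratic forms of \<open>R\<close> at the rows. With the leave-one-out
  formula this becomes an equation for the trace.\<close>

lemma weighted_gram_trace_identity:
  fixes u :: "'i \<times> nat \<Rightarrow> real" and d :: nat
  assumes I: "finite I" and t: "t > 0" and b: "\<And>i. i \<in> I \<Longrightarrow> b i \<ge> 0"
  defines "R \<equiv> minv (weighted_gram t d I b u)"
  shows "real d = t * mtrace R + (\<Sum>i\<in>I. b i * (row_of d u i \<bullet> (R *\<^sub>v row_of d u i)))"
proof -
  let ?K = "weighted_gram t d I b u"
  interpret K: coercive_mat ?K d t by (rule coercive_weighted_gram) (use assms in auto)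
  have Rc: "R \<in> carrier_mat d d" by (simp add: R_def)
  have one: "1 = t * R $$ (k, k) + (\<Sum>i\<in>I. b i * (row_of d u i $ k * (R *\<^sub>v row_of d u i) $ k))" if k: "k < d" for k
  proof -
    let ?e = "unit_vec d k :: real vec"
    have e: "?e \<in> carrier_vec d" by simp
    have "1 = ?e \<bullet> (?K *\<^sub>v (R *\<^sub>v ?e))" using K.inv_cancel(1)[OF e] k unfolding R_def by simp
    also have "\<dots> = (?K *\<^sub>v (R *\<^sub>v ?e)) $ k"
      using Rc by (intro scalar_prod_left_unit[OF _ k] mult_mat_vec_carrier[OF weighted_gram_carrier] mult_mat_vec_carrier[of R d d]) auto
    also have "\<dots> = t * (R *\<^sub>v ?e) $ k + (\<Sum>i\<in>I. b i * (row_of d u i \<bullet> (R *\<^sub>v ?e)) * u (i, k))"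
      using Rc e by (intro weighted_gram_mult_vec[OF _ k I]) simp
    also have "(R *\<^sub>v ?e) $ k = R $$ (k, k)" using K.inv_unit_entry[OF k k] by (simp add: R_def)
    also have "(\<Sum>i\<in>I. b i * (row_of d u i \<bullet> (R *\<^sub>v ?e)) * u (i, k)) = (\<Sum>i\<in>I. b i * (row_of d u i $ k * (R *\<^sub>v row_of d u i) $ k))"
    proof (rule sum.cong[OF refl])
      fix i
      have "row_of d u i \<bullet> (R *\<^sub>v ?e) = ?e \<bullet> (R *\<^sub>v row_of d u i)"
        unfolding R_def by (rule K.inv_self_adjoint) auto
      also have "\<dots> = (R *\<^sub>v row_of d u i) $ k" using k Rc by (simp add: scalar_prod_left_unit)
      finally show "b i * (row_of d u i \<bullet> (R *\<^sub>v ?e)) * u (i, k) = b i * (row_of d u i $ k * (R *\<^sub>v row_of d u i) $ k)"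
        using k by (simp add: row_of_def)
    qed
    finally show ?thesis .
  qed
  have "real d = (\<Sum>k<d. 1)" by simp
  also have "\<dots> = (\<Sum>k<d. t * R $$ (k, k) + (\<Sum>i\<in>I. b i * (row_of d u i $ k * (R *\<^sub>v row_of d u i) $ k)))"
    by (intro sum.cong refl one) simp
  also have "\<dots> = t * mtrace R + (\<Sum>i\<in>I. \<Sum>k<d. b i * (row_of d u i $ k * (R *\<^sub>v row_of d u i) $ k))"
    unfolding sum.distrib using Rc by (subst sum.swap) (simp add: mtrace_def sum_distrib_left)
  also have "(\<Sum>i\<in>I. \<Sum>k<d. b i * (row_of d u i $ k * (R *\<^sub>v row_of d u i) $ k)) = (\<Sum>i\<in>I. b i * (row_of d u i \<bullet> (R *\<^sub>v row_of d u i)))"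
    using Rc by (simp add: scalar_prod_def atLeast0LessThan sum_distrib_left)
  finally show ?thesis .
qed

text \<open>The weights above the threshold \<open>C\<close> are only counted,
  because \<open>x \<mapsto> b x / (1 + b x)\<close> has Lipschitz constant \<open>b\<close>.\<close>

lemma weighted_gram_self_consistent:
  fixes u :: "'i \<times> nat \<Rightarrow> real" and d :: nat
  assumes I: "finite I" and t: "t > 0" and b: "\<And>i. i \<in> I \<Longrightarrow> b i \<ge> 0" and C: "C \<ge> 0"
  defines "\<theta> \<equiv> mtrace (minv (weighted_gram t d I b u))"
    and "\<epsilon> \<equiv> (\<lambda>i. \<bar>row_of d u i \<bullet> (minv (weighted_gram t d (I - {i}) b u) *\<^sub>v row_of d u i)
        - mtrace (minv (weighted_gram t d (I - {i}) b u))\<bar>)"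
  shows "\<bar>t * \<theta> + (\<Sum>i\<in>I. b i * \<theta> / (1 + b i * \<theta>)) - d\<bar>
    \<le> C * (\<Sum>i\<in>I. \<epsilon> i + 1 / t) + card {i\<in>I. b i > C}"
proof -
  define a where "a i = row_of d u i \<bullet> (minv (weighted_gram t d (I - {i}) b u) *\<^sub>v row_of d u i)" for i
  interpret K: coercive_mat "weighted_gram t d I b u" d t by (rule coercive_weighted_gram) (use assms in auto)
  have th0: "\<theta> \<ge> 0" unfolding \<theta>_def by (rule K.inv_trace)
  have d: "real d = t * \<theta> + (\<Sum>i\<in>I. b i * a i / (1 + b i * a i))"
  proof -
    have "b i * (row_of d u i \<bullet> (minv (weighted_gram t d I b u) *\<^sub>v row_of d u i)) = b i * a i / (1 + b i * a i)"
      if "i \<in> I" for i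
      using weighted_gram_leave_one_out(1)[where b = b and d = d and u = u, OF I that t b] unfolding a_def by simp
    then show ?thesis
      using weighted_gram_trace_identity[where b = b and d = d and u = u, OF I t b] unfolding \<theta>_def by simp
  qed
  have est: "\<bar>b i * \<theta> / (1 + b i * \<theta>) - b i * a i / (1 + b i * a i)\<bar> \<le> C * (\<epsilon> i + 1 / t) + (if b i > C then 1 else 0)"
    if i: "i \<in> I" for i
  proof -
    interpret K': coercive_mat "weighted_gram t d (I - {i}) b u" d t
      by (rule coercive_weighted_gram) (use assms in auto)
    have a0: "a i \<ge> 0" unfolding a_def by (rule K'.inv_quadratic_nonneg) simp
    note bi = b[OF i]
    have "b i * \<theta> \<ge> 0" "b i * a i \<ge> 0" using bi th0 a0 by auto
    then have p': "0 < 1 + b i * \<theta>" "0 < 1 + b i * a i" by linarith+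
    have p: "1 + b i * \<theta> \<ge> 1" "1 + b i * a i \<ge> 1" using bi th0 a0 by auto
    \<comment> \<open>Two comparisons through the trace of the leave-one-out resolvent:
      \<open>\<epsilon> i\<close> for passing from the quadratic form to that trace, and
      \<open>1 / t\<close> for putting the removed row back.\<close>
    have close: "\<bar>\<theta> - a i\<bar> \<le> \<epsilon> i + 1 / t"
      using weighted_gram_leave_one_out(2,3)[where b = b and d = d and u = u, OF I i t b] unfolding \<epsilon>_def \<theta>_def a_def by linarith
    have e0: "\<epsilon> i + 1 / t \<ge> 0" using t by (simp add: \<epsilon>_def)
    show ?thesis
    proof (cases "b i > C")
      case True
      have "0 \<le> b i * \<theta> / (1 + b i * \<theta>)" "b i * \<theta> / (1 + b i * \<theta>) \<le> 1"
        "0 \<le> b i * a i / (1 + b i * a i)" "b i * a i / (1 + b i * a i) \<le> 1"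
        using bi th0 a0 p' by (simp_all add: divide_le_eq)
      then show ?thesis using True mult_nonneg_nonneg[OF C e0] by simp
    next
      case False
      have "b i * \<theta> / (1 + b i * \<theta>) - b i * a i / (1 + b i * a i) = b i * (\<theta> - a i) / ((1 + b i * \<theta>) * (1 + b i * a i))"
        using p by (simp add: field_simps)
      then have "\<bar>b i * \<theta> / (1 + b i * \<theta>) - b i * a i / (1 + b i * a i)\<bar> = b i * \<bar>\<theta> - a i\<bar> / ((1 + b i * \<theta>) * (1 + b i * a i))"
        using bi p by (simp add: abs_mult)
      also have "\<dots> \<le> b i * \<bar>\<theta> - a i\<bar> / 1"
        using bi p mult_mono[OF p] by (intro divide_left_mono) auto
      also have "\<dots> \<le> C * (\<epsilon> i + 1 / t)" using False bi close C by (simp add: mult_mono)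
      finally show ?thesis using False by simp
    qed
  qed
  have "\<bar>t * \<theta> + (\<Sum>i\<in>I. b i * \<theta> / (1 + b i * \<theta>)) - d\<bar> = \<bar>\<Sum>i\<in>I. b i * \<theta> / (1 + b i * \<theta>) - b i * a i / (1 + b i * a i)\<bar>"
    unfolding d by (simp add: sum_subtractf)
  also have "\<dots> \<le> (\<Sum>i\<in>I. C * (\<epsilon> i + 1 / t) + (if b i > C then 1 else 0))"
    by (rule order_trans[OF sum_abs sum_mono[OF est]])
  also have "\<dots> = (\<Sum>i\<in>I. C * (\<epsilon> i + 1 / t)) + (\<Sum>i\<in>I. if b i > C then 1 else 0)" by (rule sum.distrib)
  also have "(\<Sum>i\<in>I. C * (\<epsilon> i + 1 / t)) = C * (\<Sum>i\<in>I. \<epsilon> i + 1 / t)" by (simp only: sum_distrib_left)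
  also have "(\<Sum>i\<in>I. if b i > C then 1 else 0) = real (card {i\<in>I. b i > C})"
    using I by (simp add: sum.If_cases Int_def)
  finally show ?thesis .
qed

section \<open>Gaussian vectors\<close>

abbreviation lebesgue_prod :: "'i set \<Rightarrow> ('i \<Rightarrow> real) measure" where
  "lebesgue_prod I \<equiv> \<Pi>\<^sub>M i\<in>I. lborel"

definition std_gaussian :: "'i set \<Rightarrow> ('i \<Rightarrow> real) measure" where
  "std_gaussian I = (\<Pi>\<^sub>M i\<in>I. density lborel (\<lambda>x. ennreal (std_normal_density x)))"

lemma product_sigma_finite_lborel: "product_sigma_finite (\<lambda>_::'i. lborel :: real measure)"
  by standard

text \<open>Factors \<open>1\<close> and \<open>-1\<close> are the ones that occur: the comparison
  of measures below substitutes only translations and point reflections.\<close>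

lemma distr_lborel_affine_unit:
  assumes "\<bar>c\<bar> = (1::real)"
  shows "distr lborel borel (\<lambda>x. a + c * x) = lborel"
proof -
  have "lborel = density (distr lborel borel (\<lambda>x. a + c * x)) (\<lambda>_. ennreal \<bar>c\<bar>)"
    using lborel_real_affine[of c a] assms by auto
  also have "\<dots> = distr lborel borel (\<lambda>x. a + c * x)"
    using assms by (simp add: density_1)
  finally show ?thesis ..
qed

lemma distr_lebesgue_prod_affine_unit:
  assumes I: "finite I" and c: "\<bar>c\<bar> = (1::real)"
  shows "distr (lebesgue_prod I) (lebesgue_prod I) (\<lambda>y. \<lambda>i\<in>I. a i + c * y i) = lebesgue_prod I"
proof -
  interpret product_sigma_finite "\<lambda>_. lborel :: real measure" by (rule product_sigma_finite_lborel)
  have meas: "(\<lambda>y. \<lambda>i\<in>I. a i + c * y i) \<in> measurable (lebesgue_prod I) (lebesgue_prod I)"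
    by (intro measurable_restrict) measurable
  show ?thesis
  proof (rule PiM_eqI[OF I])
    fix E :: "'a \<Rightarrow> real set" assume E: "\<And>i. i \<in> I \<Longrightarrow> E i \<in> sets lborel"
    have "emeasure (distr (lebesgue_prod I) (lebesgue_prod I) (\<lambda>y. \<lambda>i\<in>I. a i + c * y i)) (Pi\<^sub>E I E)
        = emeasure (lebesgue_prod I) ((\<lambda>y. \<lambda>i\<in>I. a i + c * y i) -` Pi\<^sub>E I E \<inter> space (lebesgue_prod I))"
      using E I by (intro emeasure_distr[OF meas]) (auto intro!: sets_PiM_I_finite)
    also have "(\<lambda>y. \<lambda>i\<in>I. a i + c * y i) -` Pi\<^sub>E I E \<inter> space (lebesgue_prod I)
        = Pi\<^sub>E I (\<lambda>i. (\<lambda>x. a i + c * x) -` E i)"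
      by (auto simp: space_PiM PiE_iff)
    also have "emeasure (lebesgue_prod I) \<dots> = (\<Prod>i\<in>I. emeasure lborel ((\<lambda>x. a i + c * x) -` E i))"
    proof (rule emeasure_PiM[OF I])
      fix i assume "i \<in> I"
      then have "(\<lambda>x. a i + c * x) -` E i \<inter> space borel \<in> sets borel"
        using E by (intro measurable_sets[of _ borel borel]) auto
      then show "(\<lambda>x. a i + c * x) -` E i \<in> sets lborel" by simp
    qed
    also have "\<dots> = (\<Prod>i\<in>I. emeasure lborel (E i))"
    proof (rule prod.cong[OF refl])
      fix i assume "i \<in> I"
      then have "emeasure (distr lborel borel (\<lambda>x. a i + c * x)) (E i) = emeasure lborel ((\<lambda>x. a i + c * x) -` E i)"
        using E by (subst emeasure_distr) auto
      then show "emeasure lborel ((\<lambda>x. a i + c * x) -` E i) = emeasure lborel (E i)"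
        unfolding distr_lborel_affine_unit[OF c] by simp
    qed
    finally show "emeasure (distr (lebesgue_prod I) (lebesgue_prod I) (\<lambda>y. \<lambda>i\<in>I. a i + c * y i)) (Pi\<^sub>E I E) = (\<Prod>i\<in>I. emeasure lborel (E i))" .
  qed simp
qed

text \<open>Exhibits the density as a function of the Euclidean norm alone, which is what makes the
  Gaussian law rotation invariant.\<close>

lemma std_gaussian_eq_density:
  assumes I: "finite I"
  shows "std_gaussian I = density (lebesgue_prod I)
    (\<lambda>x. ennreal ((1 / sqrt (2 * pi)) ^ card I * exp (- (\<Sum>i\<in>I. (x i)\<^sup>2) / 2)))"
proof -
  have prod_eq: "ennreal ((1 / sqrt (2 * pi)) ^ card I * exp (- (\<Sum>i\<in>I. (x i)\<^sup>2) / 2))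
      = (\<Prod>i\<in>I. ennreal (std_normal_density (x i)))" for x :: "'a \<Rightarrow> real"
    using I by (simp add: prod_ennreal std_normal_density_def prod.distrib exp_sum[symmetric] sum_divide_distrib sum_negf
        prod_dividef power_divide)
  interpret S: product_sigma_finite "\<lambda>_. density lborel (\<lambda>x. ennreal (std_normal_density x))"
    by (intro product_sigma_finite.intro prob_space_imp_sigma_finite prob_space_normal_density) simp
  interpret L: product_sigma_finite "\<lambda>_. lborel :: real measure" by (rule product_sigma_finite_lborel)
  show ?thesis
    unfolding std_gaussian_def prod_eq
  proof (rule S.PiM_eqI[OF I, symmetric])
    show "sets (density (lebesgue_prod I) (\<lambda>x. \<Prod>i\<in>I. ennreal (std_normal_density (x i)))) =
      sets (\<Pi>\<^sub>M i\<in>I. density lborel (\<lambda>x. ennreal (std_normal_density x)))"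
      unfolding sets_density by (intro sets_PiM_cong) auto
    fix E :: "'a \<Rightarrow> real set"
    assume "\<And>i. i \<in> I \<Longrightarrow> E i \<in> sets (density lborel (\<lambda>x. ennreal (std_normal_density x)))"
    then have E: "\<And>i. i \<in> I \<Longrightarrow> E i \<in> sets lborel" by simp
    have box: "Pi\<^sub>E I E \<in> sets (lebesgue_prod I)" using E I by (auto intro!: sets_PiM_I_finite)
    have "emeasure (density (lebesgue_prod I) (\<lambda>x. \<Prod>i\<in>I. ennreal (std_normal_density (x i)))) (Pi\<^sub>E I E)
       = (\<integral>\<^sup>+x. (\<Prod>i\<in>I. ennreal (std_normal_density (x i))) * indicator (Pi\<^sub>E I E) x \<partial>lebesgue_prod I)"
      using box by (intro emeasure_density) auto
    also have "\<dots> = (\<integral>\<^sup>+x. (\<Prod>i\<in>I. ennreal (std_normal_density (x i)) * indicator (E i) (x i)) \<partial>lebesgue_prod I)"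
    proof (rule nn_integral_cong)
      fix x assume x: "x \<in> space (lebesgue_prod I)"
      have "indicator (Pi\<^sub>E I E) x = (\<Prod>i\<in>I. indicator (E i) (x i) :: ennreal)"
      proof (cases "\<forall>i\<in>I. x i \<in> E i")
        case True
        then have "x \<in> Pi\<^sub>E I E" using x by (auto simp: space_PiM PiE_def)
        moreover have "(\<Prod>i\<in>I. indicator (E i) (x i) :: ennreal) = 1"
          using True by (intro prod.neutral) simp
        ultimately show ?thesis by simp
      next
        case False
        then have "x \<notin> Pi\<^sub>E I E" by blast
        moreover have "(\<Prod>i\<in>I. indicator (E i) (x i) :: ennreal) = 0"
          using False I by (intro prod_zero) (auto simp: indicator_def)
        ultimately show ?thesis by simp
      qed
      then show "(\<Prod>i\<in>I. ennreal (std_normal_density (x i))) * indicator (Pi\<^sub>E I E) x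
        = (\<Prod>i\<in>I. ennreal (std_normal_density (x i)) * indicator (E i) (x i))"
        by (simp add: prod.distrib)
    qed
    also have "\<dots> = (\<Prod>i\<in>I. \<integral>\<^sup>+x. ennreal (std_normal_density x) * indicator (E i) x \<partial>lborel)"
      using E by (intro L.product_nn_integral_prod[OF I]) auto
    also have "\<dots> = (\<Prod>i\<in>I. emeasure (density lborel (\<lambda>x. ennreal (std_normal_density x))) (E i))"
      using E by (intro prod.cong refl emeasure_density[symmetric]) auto
    finally show "emeasure (density (lebesgue_prod I) (\<lambda>x. \<Prod>i\<in>I. ennreal (std_normal_density (x i)))) (Pi\<^sub>E I E) =
      (\<Prod>i\<in>I. emeasure (density lborel (\<lambda>x. ennreal (std_normal_density x))) (E i))" .
  qed
qed

lemma prob_space_std_gaussian: "prob_space (std_gaussian I)"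
  unfolding std_gaussian_def by (intro prob_space_PiM prob_space_normal_density) simp

lemma sets_std_gaussian [measurable_cong]: "sets (std_gaussian I) = sets (\<Pi>\<^sub>M i\<in>I. borel)"
  unfolding std_gaussian_def by (intro sets_PiM_cong) auto

text \<open>Uniqueness of Haar measure up to a factor: \<open>f \<mapsto> \<integral> f (A x) dx\<close> is translation invariant,
  so it is proportional to Lebesgue measure; the proportionality is compared against \<open>g\<close>.\<close>

lemma linear_image_lebesgue_prod:
  fixes A B :: "('i \<Rightarrow> real) \<Rightarrow> 'i \<Rightarrow> real"
  assumes I: "finite I"
    and A [measurable]: "A \<in> measurable (lebesgue_prod I) (lebesgue_prod I)"
    and B: "\<And>y. y \<in> space (lebesgue_prod I) \<Longrightarrow> B y \<in> space (lebesgue_prod I)"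
    and sub: "\<And>x y. x \<in> space (lebesgue_prod I) \<Longrightarrow> y \<in> space (lebesgue_prod I) \<Longrightarrow>
      A (\<lambda>i\<in>I. - B y i + 1 * x i) = (\<lambda>i\<in>I. A x i - y i)"
    and f [measurable]: "f \<in> borel_measurable (lebesgue_prod I)"
    and g [measurable]: "g \<in> borel_measurable (lebesgue_prod I)"
  shows "(\<integral>\<^sup>+x. f (A x) \<partial>lebesgue_prod I) * (\<integral>\<^sup>+x. g x \<partial>lebesgue_prod I) =
    (\<integral>\<^sup>+x. g (A x) \<partial>lebesgue_prod I) * (\<integral>\<^sup>+x. f x \<partial>(lebesgue_prod I :: ('i \<Rightarrow> real) measure))"
proof -
  interpret product_sigma_finite "\<lambda>_::'i. lborel :: real measure" by (rule product_sigma_finite_lborel)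
  let ?L = "lebesgue_prod I :: ('i \<Rightarrow> real) measure"
  interpret L: sigma_finite_measure ?L by (rule sigma_finite[OF I])
  interpret LL: pair_sigma_finite ?L ?L ..
  have trans: "(\<integral>\<^sup>+y. h (\<lambda>i\<in>I. a i + c * y i) \<partial>?L) = (\<integral>\<^sup>+y. h y \<partial>?L)"
    if "\<bar>c\<bar> = 1" and [measurable]: "h \<in> borel_measurable ?L" for h :: "('i \<Rightarrow> real) \<Rightarrow> ennreal" and a c
  proof -
    have m: "(\<lambda>y. \<lambda>i\<in>I. a i + c * y i) \<in> measurable ?L ?L" by (intro measurable_restrict) measurable
    have "(\<integral>\<^sup>+y. h y \<partial>?L) = (\<integral>\<^sup>+y. h y \<partial>distr ?L ?L (\<lambda>y. \<lambda>i\<in>I. a i + c * y i))"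
      using distr_lebesgue_prod_affine_unit[OF I that(1), of a] by simp
    also have "\<dots> = (\<integral>\<^sup>+y. h (\<lambda>i\<in>I. a i + c * y i) \<partial>?L)" by (rule nn_integral_distr[OF m]) simp
    finally show ?thesis ..
  qed
  have Ai: "(\<lambda>x. A x i) \<in> borel_measurable ?L" if "i \<in> I" for i
    using measurable_compose[OF A measurable_component_singleton[OF that]] by simp
  have Aspace: "A x \<in> space ?L" if "x \<in> space ?L" for x using measurable_space[OF A that] .
  have m1: "(\<lambda>(x, y). \<lambda>i\<in>I. A x i + 1 * y i) \<in> measurable (?L \<Otimes>\<^sub>M ?L) ?L"
    unfolding case_prod_beta
    by (intro measurable_restrict) (auto intro!: borel_measurable_add measurable_compose[OF measurable_fst Ai]
      simp: measurable_compose[OF measurable_snd] )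
  have m2: "(\<lambda>(x, y). \<lambda>i\<in>I. A x i + -1 * y i) \<in> measurable (?L \<Otimes>\<^sub>M ?L) ?L"
    unfolding case_prod_beta
    by (intro measurable_restrict) (auto intro!: borel_measurable_diff measurable_compose[OF measurable_fst Ai]
      simp: measurable_compose[OF measurable_snd] )
  note m1' = measurable_compose[OF m1 g, unfolded case_prod_beta]
  note m2' = measurable_compose[OF m2 f, unfolded case_prod_beta]
  have fA [measurable]: "(\<lambda>p. f (A (fst p))) \<in> borel_measurable (?L \<Otimes>\<^sub>M ?L)" by measurable
  have gA [measurable]: "(\<lambda>p. g (A (fst p))) \<in> borel_measurable (?L \<Otimes>\<^sub>M ?L)" by measurable
  have "(\<integral>\<^sup>+x. f (A x) \<partial>?L) * (\<integral>\<^sup>+x. g x \<partial>?L)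
      = (\<integral>\<^sup>+x. f (A x) * (\<integral>\<^sup>+y. g (\<lambda>i\<in>I. A x i + 1 * y i) \<partial>?L) \<partial>?L)"
    by (subst trans) (auto simp: nn_integral_multc)
  also have "\<dots> = (\<integral>\<^sup>+x. \<integral>\<^sup>+y. f (A x) * g (\<lambda>i\<in>I. A x i + 1 * y i) \<partial>?L \<partial>?L)"
  proof (rule nn_integral_cong)
    fix x assume "x \<in> space ?L"
    from measurable_compose[OF measurable_Pair1'[OF this] m1']
    show "f (A x) * (\<integral>\<^sup>+y. g (\<lambda>i\<in>I. A x i + 1 * y i) \<partial>?L) = (\<integral>\<^sup>+y. f (A x) * g (\<lambda>i\<in>I. A x i + 1 * y i) \<partial>?L)"
      by (intro nn_integral_cmult[symmetric]) simp
  qed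
  also have "\<dots> = (\<integral>\<^sup>+y. \<integral>\<^sup>+x. f (A x) * g (\<lambda>i\<in>I. A x i + 1 * y i) \<partial>?L \<partial>?L)"
    using LL.Fubini[of "\<lambda>p. f (A (fst p)) * g (\<lambda>i\<in>I. A (fst p) i + 1 * snd p i)"] fA m1'
    by (simp add: borel_measurable_times)
  \<comment> \<open>For fixed \<open>y\<close>, replace \<open>x\<close> by \<open>x - B y\<close>.
    By \<open>sub\<close> this changes \<open>A x\<close> into \<open>A x - y\<close>, so the shift
    moves from \<open>g\<close> to \<open>f\<close>.\<close>
  also have "\<dots> = (\<integral>\<^sup>+y. \<integral>\<^sup>+x. f (\<lambda>i\<in>I. A x i + -1 * y i) * g (A x) \<partial>?L \<partial>?L)"
  proof (rule nn_integral_cong)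
    fix y assume y: "y \<in> space ?L"
    from measurable_compose[OF measurable_Pair2'[OF y] m1']
    have [measurable]: "(\<lambda>x. g (\<lambda>i\<in>I. A x i + 1 * y i)) \<in> borel_measurable ?L" by simp
    then have m3: "(\<lambda>x. f (A x) * g (\<lambda>i\<in>I. A x i + 1 * y i)) \<in> borel_measurable ?L"
      using measurable_compose[OF A f] by (intro borel_measurable_times_ennreal)
    have "(\<integral>\<^sup>+x. f (A x) * g (\<lambda>i\<in>I. A x i + 1 * y i) \<partial>?L) =
      (\<integral>\<^sup>+x. f (A (\<lambda>i\<in>I. - B y i + 1 * x i)) * g (\<lambda>i\<in>I. A (\<lambda>i\<in>I. - B y i + 1 * x i) i + 1 * y i) \<partial>?L)"
      by (rule trans[OF _ m3, of 1 "\<lambda>i. - B y i", symmetric]) simp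
    also have "\<dots> = (\<integral>\<^sup>+x. f (\<lambda>i\<in>I. A x i + -1 * y i) * g (A x) \<partial>?L)"
    proof (rule nn_integral_cong)
      fix x assume x: "x \<in> space ?L"
      have "(\<lambda>i\<in>I. A x i) = A x" using Aspace[OF x] by (auto simp: space_PiM PiE_iff extensional_restrict)
      then have "(\<lambda>i\<in>I. A (\<lambda>i\<in>I. - B y i + 1 * x i) i + 1 * y i) = A x"
        unfolding sub[OF x y] by (simp cong: restrict_cong)
      then show "f (A (\<lambda>i\<in>I. - B y i + 1 * x i)) * g (\<lambda>i\<in>I. A (\<lambda>i\<in>I. - B y i + 1 * x i) i + 1 * y i)
        = f (\<lambda>i\<in>I. A x i + -1 * y i) * g (A x)"
        unfolding sub[OF x y] by simp
    qed
    finally show "(\<integral>\<^sup>+x. f (A x) * g (\<lambda>i\<in>I. A x i + 1 * y i) \<partial>?L) = (\<integral>\<^sup>+x. f (\<lambda>i\<in>I. A x i + -1 * y i) * g (A x) \<partial>?L)" .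
  qed
  also have "\<dots> = (\<integral>\<^sup>+x. \<integral>\<^sup>+y. f (\<lambda>i\<in>I. A x i + -1 * y i) * g (A x) \<partial>?L \<partial>?L)"
    using LL.Fubini[of "\<lambda>p. f (\<lambda>i\<in>I. A (fst p) i + -1 * snd p i) * g (A (fst p))"] gA m2'
    by (simp add: borel_measurable_times)
  also have "\<dots> = (\<integral>\<^sup>+x. (\<integral>\<^sup>+y. f (\<lambda>i\<in>I. A x i + -1 * y i) \<partial>?L) * g (A x) \<partial>?L)"
  proof (rule nn_integral_cong)
    fix x assume "x \<in> space ?L"
    from measurable_compose[OF measurable_Pair1'[OF this] m2']
    show "(\<integral>\<^sup>+y. f (\<lambda>i\<in>I. A x i + -1 * y i) * g (A x) \<partial>?L) = (\<integral>\<^sup>+y. f (\<lambda>i\<in>I. A x i + -1 * y i) \<partial>?L) * g (A x)"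
      by (intro nn_integral_multc) simp
  qed
  \<comment> \<open>The inner integral loses its dependence on \<open>x\<close> by the reflection
    that sends \<open>y\<close> to \<open>A x - y\<close>.\<close>
  also have "\<dots> = (\<integral>\<^sup>+x. (\<integral>\<^sup>+y. f y \<partial>?L) * g (A x) \<partial>?L)" by (subst trans) simp_all
  also have "\<dots> = (\<integral>\<^sup>+x. g (A x) \<partial>?L) * (\<integral>\<^sup>+x. f x \<partial>?L)"
    by (subst nn_integral_cmult) (auto simp: mult.commute)
  finally show ?thesis .
qed

text \<open>Take \<open>g\<close> to be the Gaussian density \<open>G\<close> itself. Since
  \<open>G\<close> is invariant under \<open>A\<close> and has integral one, the proportionality
  factor is \<open>1\<close>, and no Jacobian determinant has to be computed.\<close>

theorem std_gaussian_rotation_invariant: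
  fixes A B :: "('i \<Rightarrow> real) \<Rightarrow> 'i \<Rightarrow> real"
  assumes I: "finite I"
    and A: "A \<in> measurable (\<Pi>\<^sub>M i\<in>I. borel) (\<Pi>\<^sub>M i\<in>I. borel)"
    and B: "\<And>y. y \<in> extensional I \<Longrightarrow> B y \<in> extensional I"
    and sub: "\<And>x y. x \<in> extensional I \<Longrightarrow> y \<in> extensional I \<Longrightarrow>
      A (\<lambda>i\<in>I. - B y i + 1 * x i) = (\<lambda>i\<in>I. A x i - y i)"
    and norm: "\<And>x. x \<in> extensional I \<Longrightarrow> (\<Sum>i\<in>I. (A x i)\<^sup>2) = (\<Sum>i\<in>I. (x i)\<^sup>2)"
  shows "distr (std_gaussian I) (std_gaussian I) A = std_gaussian I"
proof (rule measure_eqI)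
  let ?L = "lebesgue_prod I :: ('i \<Rightarrow> real) measure"
  define G :: "('i \<Rightarrow> real) \<Rightarrow> ennreal"
    where "G x = ennreal ((1 / sqrt (2 * pi)) ^ card I * exp (- (\<Sum>i\<in>I. (x i)\<^sup>2) / 2))" for x
  have sg: "std_gaussian I = density ?L G" unfolding G_def by (rule std_gaussian_eq_density[OF I])
  have [measurable_cong]: "sets (\<Pi>\<^sub>M i\<in>I. borel) = sets ?L" by (intro sets_PiM_cong) auto
  have AL [measurable]: "A \<in> measurable ?L ?L" using A by measurable
  have sp: "space ?L = extensional I" by (auto simp: space_PiM PiE_def)
  have G [measurable]: "G \<in> borel_measurable ?L" unfolding G_def by measurable
  have GA: "G (A x) = G x" if "x \<in> space ?L" for x using that norm unfolding sp G_def by simp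
  have G1: "(\<integral>\<^sup>+x. G x \<partial>?L) = 1"
  proof -
    have "emeasure (density ?L G) (space ?L) = 1"
      using prob_space.emeasure_space_1[OF prob_space_std_gaussian[of I]] unfolding sg by simp
    then show ?thesis by (simp add: emeasure_density nn_integral_indicator cong: nn_integral_cong)
  qed
  show "sets (distr (std_gaussian I) (std_gaussian I) A) = sets (std_gaussian I)" by simp
  fix E assume "E \<in> sets (distr (std_gaussian I) (std_gaussian I) A)"
  then have E: "E \<in> sets ?L" unfolding sets_distr unfolding sg sets_density .
  have AE: "A -` E \<inter> space ?L \<in> sets ?L" by (rule measurable_sets[OF AL E])
  have GE: "(\<lambda>x. G x * indicator E x) \<in> borel_measurable ?L"
    using G E by (intro borel_measurable_times_ennreal borel_measurable_indicator)
  have Am: "A \<in> measurable (std_gaussian I) (std_gaussian I)"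
    using AL unfolding sg measurable_cong_sets[OF sets_density sets_density] .
  define H where "H x = G x * indicator E x" for x
  have Hm: "H \<in> borel_measurable ?L" unfolding H_def by (rule GE)
  have HA: "G x * indicator (A -` E \<inter> space ?L) x = H (A x)" if x: "x \<in> space ?L" for x
  proof -
    have "x \<in> A -` E \<inter> space ?L \<longleftrightarrow> A x \<in> E" using x by blast
    then have "indicator (A -` E \<inter> space ?L) x = (indicator E (A x) :: ennreal)"
      unfolding indicator_def by presburger
    then show ?thesis using GA[OF x] unfolding H_def by presburger
  qed
  have "emeasure (distr (std_gaussian I) (std_gaussian I) A) E = emeasure (density ?L G) (A -` E \<inter> space ?L)"
    using emeasure_distr[OF Am, of E] E unfolding sg sets_density space_density by blast
  then have e1: "emeasure (distr (std_gaussian I) (std_gaussian I) A) E = (\<integral>\<^sup>+x. H (A x) \<partial>?L)"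
    unfolding emeasure_density[OF G AE] by (rule HOL.trans[OF _ nn_integral_cong[OF HA]])
  have "(\<integral>\<^sup>+x. H (A x) \<partial>?L) * (\<integral>\<^sup>+x. G x \<partial>?L) = (\<integral>\<^sup>+x. G (A x) \<partial>?L) * (\<integral>\<^sup>+x. H x \<partial>?L)"
    by (rule linear_image_lebesgue_prod[OF I AL, of B, OF _ _ Hm G]) (use B sub sp in blast)+
  moreover have "(\<integral>\<^sup>+x. G (A x) \<partial>?L) = 1"
    using nn_integral_cong[of ?L "\<lambda>x. G (A x)" G, OF GA] unfolding G1 .
  ultimately have e2: "(\<integral>\<^sup>+x. H (A x) \<partial>?L) = (\<integral>\<^sup>+x. H x \<partial>?L)"
    unfolding G1 by simp
  have "(\<integral>\<^sup>+x. H x \<partial>?L) = emeasure (density ?L G) E"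
    unfolding H_def by (rule emeasure_density[OF G E, symmetric])
  then show "emeasure (distr (std_gaussian I) (std_gaussian I) A) E = emeasure (std_gaussian I) E"
    unfolding e1 e2 unfolding sg .
qed

text \<open>The transposed kernel serves as \<open>B\<close>: orthonormal rows make it a right
  inverse, orthonormal columns make the map an isometry. Working with a kernel on an arbitrary
  finite index set covers both a single row of a matrix and a whole matrix of entries.\<close>

theorem std_gaussian_orthogonal_kernel:
  fixes w :: "'i \<Rightarrow> 'i \<Rightarrow> real"
  assumes S: "finite S"
    and w1: "\<And>a b. a \<in> S \<Longrightarrow> b \<in> S \<Longrightarrow> (\<Sum>s\<in>S. w s a * w s b) = (if a = b then 1 else 0)"
    and w2: "\<And>a b. a \<in> S \<Longrightarrow> b \<in> S \<Longrightarrow> (\<Sum>s\<in>S. w a s * w b s) = (if a = b then 1 else 0)"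
  shows "distr (std_gaussian S) (std_gaussian S) (\<lambda>x. \<lambda>a\<in>S. \<Sum>b\<in>S. w a b * x b) = std_gaussian S"
proof (rule std_gaussian_rotation_invariant[OF S, where B = "\<lambda>y. \<lambda>b\<in>S. \<Sum>a\<in>S. w a b * y a"])
  show "(\<lambda>x. \<lambda>a\<in>S. \<Sum>b\<in>S. w a b * x b) \<in> measurable (\<Pi>\<^sub>M i\<in>S. borel) (\<Pi>\<^sub>M i\<in>S. borel)"
    by (intro measurable_restrict borel_measurable_sum borel_measurable_times borel_measurable_const
        measurable_component_singleton)
  fix x y :: "'i \<Rightarrow> real"
  show "(\<lambda>b\<in>S. \<Sum>a\<in>S. w a b * y a) \<in> extensional S" by simp
  show "(\<lambda>a\<in>S. \<Sum>b\<in>S. w a b * (\<lambda>i\<in>S. - (\<lambda>b\<in>S. \<Sum>a\<in>S. w a b * y a) i + 1 * x i) b) =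
           (\<lambda>i\<in>S. (\<lambda>a\<in>S. \<Sum>b\<in>S. w a b * x b) i - y i)"
  proof (rule restrict_ext)
    fix a assume a: "a \<in> S"
    have "(\<Sum>b\<in>S. w a b * (\<lambda>i\<in>S. - (\<lambda>b\<in>S. \<Sum>a\<in>S. w a b * y a) i + 1 * x i) b)
       = (\<Sum>b\<in>S. w a b * x b - (\<Sum>c\<in>S. w a b * w c b * y c))"
      by (intro sum.cong refl) (simp add: algebra_simps sum_distrib_left)
    also have "\<dots> = (\<Sum>b\<in>S. w a b * x b) - (\<Sum>c\<in>S. \<Sum>b\<in>S. w a b * w c b * y c)"
      unfolding sum_subtractf by (subst (2) sum.swap) rule
    also have "(\<Sum>c\<in>S. \<Sum>b\<in>S. w a b * w c b * y c) = (\<Sum>c\<in>S. (if a = c then 1 else 0) * y c)"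
      unfolding sum_distrib_right[symmetric] by (intro sum.cong refl) (simp add: w2[OF a])
    also have "\<dots> = y a" using S a by (simp add: if_distrib[of "\<lambda>z. z * _"] cong: if_cong)
    finally show "(\<Sum>b\<in>S. w a b * (\<lambda>i\<in>S. - (\<lambda>b\<in>S. \<Sum>a\<in>S. w a b * y a) i + 1 * x i) b)
      = (\<lambda>a\<in>S. \<Sum>b\<in>S. w a b * x b) a - y a" using a by simp
  qed
  have "(\<Sum>a\<in>S. ((\<lambda>a\<in>S. \<Sum>b\<in>S. w a b * x b) a)\<^sup>2) = (\<Sum>a\<in>S. \<Sum>b\<in>S. \<Sum>c\<in>S. (w a b * w a c) * (x b * x c))"
    by (intro sum.cong refl) (simp add: power2_eq_square sum_product algebra_simps)
  also have "\<dots> = (\<Sum>b\<in>S. \<Sum>a\<in>S. \<Sum>c\<in>S. (w a b * w a c) * (x b * x c))" by (rule sum.swap)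
  also have "\<dots> = (\<Sum>b\<in>S. \<Sum>c\<in>S. \<Sum>a\<in>S. (w a b * w a c) * (x b * x c))"
    by (rule sum.cong[OF refl]) (rule sum.swap)
  also have "\<dots> = (\<Sum>b\<in>S. \<Sum>c\<in>S. (if b = c then 1 else 0) * (x b * x c))"
    unfolding sum_distrib_right[symmetric] by (intro sum.cong refl) (simp add: w1)
  also have "\<dots> = (\<Sum>b\<in>S. (x b)\<^sup>2)"
    using S by (intro sum.cong refl) (simp add: if_distrib[of "\<lambda>z. z * _"] power2_eq_square cong: if_cong)
  finally show "(\<Sum>a\<in>S. ((\<lambda>a\<in>S. \<Sum>b\<in>S. w a b * x b) a)\<^sup>2) = (\<Sum>i\<in>S. (x i)\<^sup>2)" .
qed

section \<open>Fourth moments of independent sums and of centred Gaussian squares\<close>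

lemma (in prob_space) fourth_moment_indep_sum:
  fixes X :: "'i \<Rightarrow> 'a \<Rightarrow> real"
  assumes fin: "finite I" and ind: "indep_vars (\<lambda>_. borel) X I"
    and int: "\<And>i k. i \<in> I \<Longrightarrow> k \<le> 4 \<Longrightarrow> integrable M (\<lambda>\<omega>. X i \<omega> ^ k)"
    and m1: "\<And>i. i \<in> I \<Longrightarrow> expectation (X i) = 0"
    and m2: "\<And>i. i \<in> I \<Longrightarrow> expectation (\<lambda>\<omega>. X i \<omega> ^ 2) = v i"
    and m4: "\<And>i. i \<in> I \<Longrightarrow> expectation (\<lambda>\<omega>. X i \<omega> ^ 4) \<le> C * (v i)\<^sup>2" and C: "C \<ge> 3"
  shows "expectation (\<lambda>\<omega>. (\<Sum>i\<in>I. X i \<omega>) ^ 4) \<le> C * (\<Sum>i\<in>I. v i)\<^sup>2"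
    and "expectation (\<lambda>\<omega>. (\<Sum>i\<in>I. X i \<omega>) ^ 2) = (\<Sum>i\<in>I. v i)"
    and "expectation (\<lambda>\<omega>. \<Sum>i\<in>I. X i \<omega>) = 0"
    and "\<And>k. k \<le> 4 \<Longrightarrow> integrable M (\<lambda>\<omega>. (\<Sum>i\<in>I. X i \<omega>) ^ k)"
proof -
  have "(\<forall>k\<le>4. integrable M (\<lambda>\<omega>. (\<Sum>i\<in>F. X i \<omega>) ^ k)) \<and> expectation (\<lambda>\<omega>. \<Sum>i\<in>F. X i \<omega>) = 0 \<and>
    expectation (\<lambda>\<omega>. (\<Sum>i\<in>F. X i \<omega>) ^ 2) = (\<Sum>i\<in>F. v i) \<and>
    expectation (\<lambda>\<omega>. (\<Sum>i\<in>F. X i \<omega>) ^ 4) \<le> C * (\<Sum>i\<in>F. v i)\<^sup>2" if "F \<subseteq> I" for F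
    using finite_subset[OF that fin] that
  proof (induction F)
    case empty
    then show ?case by simp
  next
    case (insert j F)
    define S where "S \<omega> = (\<Sum>i\<in>F. X i \<omega>)" for \<omega>
    have j: "j \<in> I" and F: "F \<subseteq> I" using insert by auto
    have IH: "\<And>k. k \<le> 4 \<Longrightarrow> integrable M (\<lambda>\<omega>. S \<omega> ^ k)" "expectation S = 0"
      "expectation (\<lambda>\<omega>. S \<omega> ^ 2) = (\<Sum>i\<in>F. v i)" "expectation (\<lambda>\<omega>. S \<omega> ^ 4) \<le> C * (\<Sum>i\<in>F. v i)\<^sup>2"
      using insert.IH[OF F] unfolding S_def by auto
    have iv: "indep_var borel (X j) borel S"
      unfolding S_def using insert.hyps insert.prems by (intro indep_vars_sum indep_vars_subset[OF ind]) auto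
    have ivp: "indep_var borel (\<lambda>\<omega>. X j \<omega> ^ a) borel (\<lambda>\<omega>. S \<omega> ^ b)" for a b
      using indep_var_compose[OF iv, of "\<lambda>x. x ^ a" borel "\<lambda>x. x ^ b" borel] by (simp add: comp_def)
    have I: "integrable M (\<lambda>\<omega>. X j \<omega> ^ a * S \<omega> ^ b)"
      and E: "expectation (\<lambda>\<omega>. X j \<omega> ^ a * S \<omega> ^ b) = expectation (\<lambda>\<omega>. X j \<omega> ^ a) * expectation (\<lambda>\<omega>. S \<omega> ^ b)"
      if "a \<le> 4" "b \<le> 4" for a b
      using indep_var_integrable[OF ivp int[OF j that(1)] IH(1)[OF that(2)]]
        indep_var_lebesgue_integral[OF ivp int[OF j that(1)] IH(1)[OF that(2)]] by auto
    have sum: "(\<Sum>i\<in>insert j F. X i \<omega>) = X j \<omega> + S \<omega>" for \<omega> using insert.hyps by (simp add: S_def)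
    have bin: "(X j \<omega> + S \<omega>) ^ k = (\<Sum>a\<le>k. of_nat (k choose a) * (X j \<omega> ^ a * S \<omega> ^ (k - a)))" for k \<omega>
      by (subst binomial_ring) (simp add: mult.assoc)
    have Ik: "integrable M (\<lambda>\<omega>. (X j \<omega> + S \<omega>) ^ k)" if "k \<le> 4" for k
      unfolding bin using that by (intro Bochner_Integration.integrable_sum integrable_mult_right I) auto
    have Ek: "expectation (\<lambda>\<omega>. (X j \<omega> + S \<omega>) ^ k) = (\<Sum>a\<le>k. of_nat (k choose a) * (expectation (\<lambda>\<omega>. X j \<omega> ^ a) * expectation (\<lambda>\<omega>. S \<omega> ^ (k - a))))"
      if "k \<le> 4" for k
      unfolding bin using that by (subst Bochner_Integration.integral_sum) (auto intro!: sum.cong integrable_mult_right I simp: E)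
    have V: "v j \<ge> 0" "(\<Sum>i\<in>F. v i) \<ge> 0" unfolding m2[OF j, symmetric] IH(3)[symmetric] by simp_all
    have x0: "expectation (\<lambda>\<omega>. X j \<omega> ^ 1) = 0" and s0: "expectation (\<lambda>\<omega>. S \<omega> ^ 1) = 0" using m1[OF j] IH(2) by simp_all
    have e0: "expectation (\<lambda>\<omega>. X j \<omega> ^ 0) = 1" "expectation (\<lambda>\<omega>. S \<omega> ^ 0) = 1" by (simp_all add: prob_space)
    have E1: "expectation (\<lambda>\<omega>. X j \<omega> + S \<omega>) = 0"
      using Ek[of 1] x0 s0 e0 by simp
    have E2: "expectation (\<lambda>\<omega>. (X j \<omega> + S \<omega>) ^ 2) = v j + (\<Sum>i\<in>F. v i)"
      using Ek[of 2] x0 s0 e0 m2[OF j] IH(3) by (simp add: numeral_eq_Suc)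
    \<comment> \<open>The binomial terms with a first moment vanish by centring. The mixed term with
      factor \<open>6\<close> is then absorbed into \<open>2 * C\<close>, which is where
      \<open>C \<ge> 3\<close> enters, and the bound becomes a perfect square.\<close>
    have "expectation (\<lambda>\<omega>. (X j \<omega> + S \<omega>) ^ 4) = expectation (\<lambda>\<omega>. S \<omega> ^ 4) + 6 * (v j * (\<Sum>i\<in>F. v i)) + expectation (\<lambda>\<omega>. X j \<omega> ^ 4)"
    proof -
      have "expectation (\<lambda>\<omega>. (X j \<omega> + S \<omega>) ^ 4) = (\<Sum>a\<in>{0,1,2,3,4}. of_nat (4 choose a) * (expectation (\<lambda>\<omega>. X j \<omega> ^ a) * expectation (\<lambda>\<omega>. S \<omega> ^ (4 - a))))"
        unfolding Ek[OF order_refl] by (rule sum.cong) (auto simp: numeral_eq_Suc)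
      also have "\<dots> = expectation (\<lambda>\<omega>. S \<omega> ^ 4) + 6 * (v j * (\<Sum>i\<in>F. v i)) + expectation (\<lambda>\<omega>. X j \<omega> ^ 4)"
        using x0 s0 e0 m2[OF j] IH(3) by (simp add: binomial_fact fact_numeral) (simp add: eval_nat_numeral)?
      finally show ?thesis .
    qed
    also have "\<dots> \<le> C * (\<Sum>i\<in>F. v i)\<^sup>2 + 2 * C * (v j * (\<Sum>i\<in>F. v i)) + C * (v j)\<^sup>2"
      using IH(4) m4[OF j] mult_right_mono[OF C, of "v j * (\<Sum>i\<in>F. v i)"] V by (intro add_mono) auto
    also have "\<dots> = C * (v j + (\<Sum>i\<in>F. v i))\<^sup>2" by (simp add: power2_eq_square algebra_simps)
    finally show ?case unfolding sum using Ik E1 E2 insert.hyps by simp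
  qed
  from this[OF order_refl] show "expectation (\<lambda>\<omega>. (\<Sum>i\<in>I. X i \<omega>) ^ 4) \<le> C * (\<Sum>i\<in>I. v i)\<^sup>2"
    "expectation (\<lambda>\<omega>. (\<Sum>i\<in>I. X i \<omega>) ^ 2) = (\<Sum>i\<in>I. v i)"
    "expectation (\<lambda>\<omega>. \<Sum>i\<in>I. X i \<omega>) = 0"
    "\<And>k. k \<le> 4 \<Longrightarrow> integrable M (\<lambda>\<omega>. (\<Sum>i\<in>I. X i \<omega>) ^ k)" by auto
qed

lemma std_normal_even_moments:
  "integrable (density lborel (\<lambda>x. ennreal (std_normal_density x))) (\<lambda>x. x ^ (2 * k))"
  "(\<integral>x. x ^ (2 * k) \<partial>density lborel (\<lambda>x. ennreal (std_normal_density x))) = fact (2 * k) / (2 ^ k * fact k)"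
proof -
  note h = std_normal_moment_even[of k]
  show "integrable (density lborel (\<lambda>x. ennreal (std_normal_density x))) (\<lambda>x. x ^ (2 * k))"
    using h by (subst integrable_density) (auto simp: has_bochner_integral_iff)
  show "(\<integral>x. x ^ (2 * k) \<partial>density lborel (\<lambda>x. ennreal (std_normal_density x))) = fact (2 * k) / (2 ^ k * fact k)"
    using h by (subst integral_density) (auto simp: has_bochner_integral_iff)
qed

lemma std_normal_centered_square_moments:
  defines "N \<equiv> density lborel (\<lambda>x. ennreal (std_normal_density x))"
  shows "k \<le> 4 \<Longrightarrow> integrable N (\<lambda>x. (x\<^sup>2 - 1) ^ k)"
    and "(\<integral>x. x\<^sup>2 - 1 \<partial>N) = 0" and "(\<integral>x. (x\<^sup>2 - 1) ^ 2 \<partial>N) = 2" and "(\<integral>x. (x\<^sup>2 - 1) ^ 4 \<partial>N) = 60"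
proof -
  have bin: "(x\<^sup>2 - 1) ^ k = (\<Sum>a\<le>k. of_nat (k choose a) * (-1) ^ (k - a) * x ^ (2 * a))" for x :: real and k
  proof -
    have "(x\<^sup>2 + -1) ^ k = (\<Sum>a\<le>k. of_nat (k choose a) * (x\<^sup>2) ^ a * (-1) ^ (k - a))" by (rule binomial_ring)
    also have "\<dots> = (\<Sum>a\<le>k. of_nat (k choose a) * (-1) ^ (k - a) * x ^ (2 * a))"
      by (intro sum.cong refl) (simp add: power_mult)
    finally show ?thesis by simp
  qed
  have i: "integrable N (\<lambda>x. x ^ (2 * a))" and e: "(\<integral>x. x ^ (2 * a) \<partial>N) = fact (2 * a) / (2 ^ a * fact a)" for a
    unfolding N_def by (rule std_normal_even_moments)+
  show ik: "integrable N (\<lambda>x. (x\<^sup>2 - 1) ^ k)" for k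
    unfolding bin by (intro Bochner_Integration.integrable_sum integrable_mult_right i)
  have ek: "(\<integral>x. (x\<^sup>2 - 1) ^ k \<partial>N) = (\<Sum>a\<le>k. of_nat (k choose a) * (-1) ^ (k - a) * (fact (2 * a) / (2 ^ a * fact a)))" for k
    unfolding bin by (subst Bochner_Integration.integral_sum) (auto intro!: integrable_mult_right i simp: e)
  show "(\<integral>x. x\<^sup>2 - 1 \<partial>N) = 0" using ek[of 1] by simp
  show "(\<integral>x. (x\<^sup>2 - 1) ^ 2 \<partial>N) = 2" unfolding ek by (simp add: numeral_eq_Suc)
  have "(\<integral>x. (x\<^sup>2 - 1) ^ 4 \<partial>N) = (\<Sum>a\<in>{0,1,2,3,4}. of_nat (4 choose a) * (-1) ^ (4 - a) * (fact (2 * a) / (2 ^ a * fact a)))"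
    unfolding ek by (rule sum.cong) (auto simp: numeral_eq_Suc)
  also have "\<dots> = 60" by (simp add: binomial_fact fact_numeral)
  finally show "(\<integral>x. (x\<^sup>2 - 1) ^ 4 \<partial>N) = 60" .
qed

lemma std_gaussian_fourth_moment:
  fixes c :: "'i \<Rightarrow> real"
  assumes S: "finite S"
  shows "(\<integral>\<^sup>+x. ennreal ((\<Sum>s\<in>S. c s * ((x s)\<^sup>2 - 1)) ^ 4) \<partial>std_gaussian S) \<le> ennreal (60 * (\<Sum>s\<in>S. (c s)\<^sup>2)\<^sup>2)"
proof (cases "S = {}")
  case False
  let ?N = "density lborel (\<lambda>x. ennreal (std_normal_density x))"
  let ?G = "std_gaussian S"
  interpret prob_space ?G by (rule prob_space_std_gaussian)
  have N: "prob_space ?N" by (intro prob_space_normal_density) simp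
  have dist: "distr ?G ?N (\<lambda>x. x s) = ?N" if "s \<in> S" for s
    unfolding std_gaussian_def by (rule distr_PiM_component[OF _ that]) (rule N)
  have meas [measurable]: "(\<lambda>x. x s) \<in> measurable ?G ?N" if "s \<in> S" for s
    unfolding std_gaussian_def by (rule measurable_component_singleton[OF that])
  have indc: "indep_vars (\<lambda>_. ?N) (\<lambda>s x. x s) S"
  proof (subst indep_vars_iff_distr_eq_PiM')
    show "S \<noteq> {}" by fact
    have "distr ?G (\<Pi>\<^sub>M s\<in>S. ?N) (\<lambda>x. \<lambda>s\<in>S. x s) = distr ?G ?G (\<lambda>x. x)"
      by (rule distr_cong) (auto simp: std_gaussian_def space_PiM PiE_iff extensional_restrict)
    also have "\<dots> = (\<Pi>\<^sub>M s\<in>S. ?N)" by (simp add: std_gaussian_def)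
    also have "\<dots> = (\<Pi>\<^sub>M s\<in>S. distr ?G ?N (\<lambda>x. x s))" by (intro PiM_cong refl) (simp add: dist)
    finally show "distr ?G (\<Pi>\<^sub>M s\<in>S. ?N) (\<lambda>x. \<lambda>s\<in>S. x s) = (\<Pi>\<^sub>M s\<in>S. distr ?G ?N (\<lambda>x. x s))" .
  qed (rule meas)
  define X where "X s x = c s * ((x s)\<^sup>2 - 1)" for s and x :: "'i \<Rightarrow> real"
  have ind: "indep_vars (\<lambda>_. borel) X S"
    using indep_vars_compose2[OF indc, of "\<lambda>s z. c s * (z\<^sup>2 - 1)" "\<lambda>_. borel"] unfolding X_def by simp
  note mom = std_normal_centered_square_moments
  have pw: "X s x ^ k = c s ^ k * ((x s)\<^sup>2 - 1) ^ k" for s k x by (simp add: X_def power_mult_distrib)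
  have int: "integrable ?G (\<lambda>x. X s x ^ k)" if "s \<in> S" "k \<le> 4" for s k
  proof -
    have "integrable (distr ?G ?N (\<lambda>x. x s)) (\<lambda>z. (z\<^sup>2 - 1) ^ k)" unfolding dist[OF that(1)] using that mom(1) by simp
    then have "integrable ?G (\<lambda>x. ((x s)\<^sup>2 - 1) ^ k)" by (subst (asm) integrable_distr_eq[OF meas[OF that(1)]]) auto
    then show ?thesis unfolding pw by simp
  qed
  have ex: "expectation (\<lambda>x. X s x ^ k) = c s ^ k * (\<integral>z. (z\<^sup>2 - 1) ^ k \<partial>?N)" if "s \<in> S" for s k
  proof -
    have "(\<integral>z. (z\<^sup>2 - 1) ^ k \<partial>?N) = (\<integral>z. (z\<^sup>2 - 1) ^ k \<partial>distr ?G ?N (\<lambda>x. x s))" unfolding dist[OF that] ..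
    also have "\<dots> = expectation (\<lambda>x. ((x s)\<^sup>2 - 1) ^ k)" by (rule integral_distr[OF meas[OF that]]) simp
    finally show ?thesis unfolding pw by simp
  qed
  \<comment> \<open>Each summand has variance \<open>2 * (c s)\<^sup>2\<close> and fourth moment
    \<open>60 * (c s) ^ 4\<close>, which is \<open>15\<close> times the squared variance. The bound
    \<open>15 * (2 * V)\<^sup>2\<close>, with \<open>V\<close> the sum of the squared coefficients,
    is the stated \<open>60 * V\<^sup>2\<close>.\<close>
  note sums = fourth_moment_indep_sum[OF S ind int, of "\<lambda>s. 2 * (c s)\<^sup>2" 15]
  have cond: "expectation (X s) = 0" "expectation (\<lambda>x. X s x ^ 2) = 2 * (c s)\<^sup>2"
    "expectation (\<lambda>x. X s x ^ 4) \<le> 15 * (2 * (c s)\<^sup>2)\<^sup>2" if "s \<in> S" for s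
    using ex[OF that, of 1] ex[OF that, of 2] ex[OF that, of 4] mom
    by (simp_all add: power_mult_distrib flip: power_mult)
  have "expectation (\<lambda>x. (\<Sum>s\<in>S. X s x) ^ 4) \<le> 15 * (\<Sum>s\<in>S. 2 * (c s)\<^sup>2)\<^sup>2"
    and i4: "integrable ?G (\<lambda>x. (\<Sum>s\<in>S. X s x) ^ 4)"
    using sums(1,4) cond by auto
  then have le: "expectation (\<lambda>x. (\<Sum>s\<in>S. X s x) ^ 4) \<le> 60 * (\<Sum>s\<in>S. (c s)\<^sup>2)\<^sup>2"
    by (simp add: sum_distrib_left[symmetric] power_mult_distrib)
  have "(\<integral>\<^sup>+x. ennreal ((\<Sum>s\<in>S. X s x) ^ 4) \<partial>?G) = ennreal (expectation (\<lambda>x. (\<Sum>s\<in>S. X s x) ^ 4))"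
    by (rule nn_integral_eq_integral[OF i4]) simp
  also have "\<dots> \<le> ennreal (60 * (\<Sum>s\<in>S. (c s)\<^sup>2)\<^sup>2)" using le by (rule ennreal_leI)
  finally show ?thesis unfolding X_def .
qed simp

section \<open>The self-consistent equation in probability\<close>

text \<open>Matrices of all sizes share one type, so measurability is stated entrywise with the
  dimensions fixed. The dimensions are required at every point and not just on the space of
  \<open>M\<close>, so that they can be used as unconditional rewrite rules.\<close>

definition measurable_mat :: "'a measure \<Rightarrow> nat \<Rightarrow> nat \<Rightarrow> ('a \<Rightarrow> real mat) \<Rightarrow> bool" where
  "measurable_mat M n m A \<longleftrightarrow> (\<forall>\<omega>. A \<omega> \<in> carrier_mat n m) \<and>
     (\<forall>i<n. \<forall>j<m. (\<lambda>\<omega>. A \<omega> $$ (i, j)) \<in> borel_measurable M)"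

lemma measurable_matD:
  assumes "measurable_mat M n m A"
  shows "A \<omega> \<in> carrier_mat n m" "dim_row (A \<omega>) = n" "dim_col (A \<omega>) = m"
    "i < n \<Longrightarrow> j < m \<Longrightarrow> (\<lambda>\<omega>. A \<omega> $$ (i, j)) \<in> borel_measurable M"
  using assms unfolding measurable_mat_def by (auto dest: spec[of _ \<omega>])

lemma measurable_mat_mult:
  assumes A: "measurable_mat M n m A" and B: "measurable_mat M m k B"
  shows "measurable_mat M n k (\<lambda>\<omega>. A \<omega> * B \<omega>)"
  unfolding measurable_mat_def
proof (intro conjI allI impI)
  show "A \<omega> * B \<omega> \<in> carrier_mat n k" for \<omega> by (rule mult_carrier_mat[OF measurable_matD(1)[OF A] measurable_matD(1)[OF B]])
  fix i j assume ij: "i < n" "j < k"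
  have "(A \<omega> * B \<omega>) $$ (i, j) = (\<Sum>l<m. A \<omega> $$ (i, l) * B \<omega> $$ (l, j))" for \<omega>
    using ij measurable_matD(2,3)[OF A] measurable_matD(2,3)[OF B] by (simp add: scalar_prod_def atLeast0LessThan)
  then show "(\<lambda>\<omega>. (A \<omega> * B \<omega>) $$ (i, j)) \<in> borel_measurable M"
    using ij measurable_matD(4)[OF A] measurable_matD(4)[OF B] by (auto intro!: borel_measurable_sum borel_measurable_times)
qed

lemma measurable_mat_transpose:
  assumes A: "measurable_mat M n m A"
  shows "measurable_mat M m n (\<lambda>\<omega>. (A \<omega>)\<^sup>T)"
  unfolding measurable_mat_def
proof (intro conjI allI impI)
  show "(A \<omega>)\<^sup>T \<in> carrier_mat m n" for \<omega> using measurable_matD(1)[OF A, of \<omega>] by simp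
  fix i j assume ij: "i < m" "j < n"
  have "(A \<omega>)\<^sup>T $$ (i, j) = A \<omega> $$ (j, i)" for \<omega>
    using ij measurable_matD(2,3)[OF A, of \<omega>] by simp
  then show "(\<lambda>\<omega>. (A \<omega>)\<^sup>T $$ (i, j)) \<in> borel_measurable M"
    using measurable_matD(4)[OF A ij(2,1)] by simp
qed

lemma measurable_mat_add:
  assumes A: "measurable_mat M n m A" and B: "measurable_mat M n m B"
  shows "measurable_mat M n m (\<lambda>\<omega>. A \<omega> + B \<omega>)"
  unfolding measurable_mat_def
proof (intro conjI allI impI)
  show "A \<omega> + B \<omega> \<in> carrier_mat n m" for \<omega>
    by (rule add_carrier_mat[OF measurable_matD(1)[OF B]])
  fix i j assume ij: "i < n" "j < m"
  have "(A \<omega> + B \<omega>) $$ (i, j) = A \<omega> $$ (i, j) + B \<omega> $$ (i, j)" for \<omega>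
    using ij measurable_matD(2,3)[OF B, of \<omega>] by simp
  then show "(\<lambda>\<omega>. (A \<omega> + B \<omega>) $$ (i, j)) \<in> borel_measurable M"
    using borel_measurable_add[OF measurable_matD(4)[OF A ij] measurable_matD(4)[OF B ij]] by simp
qed

lemma measurable_mat_smult:
  assumes A: "measurable_mat M n m A" and c: "c \<in> borel_measurable M"
  shows "measurable_mat M n m (\<lambda>\<omega>. c \<omega> \<cdot>\<^sub>m A \<omega>)"
  unfolding measurable_mat_def
proof (intro conjI allI impI)
  show "c \<omega> \<cdot>\<^sub>m A \<omega> \<in> carrier_mat n m" for \<omega>
    by (rule smult_carrier_mat[OF measurable_matD(1)[OF A]])
  fix i j assume ij: "i < n" "j < m"
  have "(c \<omega> \<cdot>\<^sub>m A \<omega>) $$ (i, j) = c \<omega> * A \<omega> $$ (i, j)" for \<omega>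
    using ij measurable_matD(2,3)[OF A, of \<omega>] by simp
  then show "(\<lambda>\<omega>. (c \<omega> \<cdot>\<^sub>m A \<omega>) $$ (i, j)) \<in> borel_measurable M"
    using borel_measurable_times[OF c measurable_matD(4)[OF A ij]] by simp
qed

lemma measurable_mat_one: "measurable_mat M n n (\<lambda>\<omega>. 1\<^sub>m n)"
  unfolding measurable_mat_def by auto

lemma measurable_det:
  assumes A: "measurable_mat M n n A"
  shows "(\<lambda>\<omega>. det (A \<omega>)) \<in> borel_measurable M"
proof -
  have "det (A \<omega>) = (\<Sum>p | p permutes {0..<n}. of_int (sign p) * (\<Prod>i = 0..<n. A \<omega> $$ (i, p i)))" for \<omega>
    unfolding det_def measurable_matD(2,3)[OF A] by simp
  moreover have "(\<lambda>\<omega>. \<Sum>p | p permutes {0..<n}. of_int (sign p) * (\<Prod>i = 0..<n. A \<omega> $$ (i, p i))) \<in> borel_measurable M"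
  proof (intro borel_measurable_sum borel_measurable_times borel_measurable_const borel_measurable_prod)
    fix p i assume "p \<in> {p. p permutes {0..<n}}" "i \<in> {0..<n}"
    then show "(\<lambda>\<omega>. A \<omega> $$ (i, p i)) \<in> borel_measurable M"
      using permutes_in_image[of p "{0..<n}" i] by (intro measurable_matD(4)[OF A]) auto
  qed
  ultimately show ?thesis by simp
qed

lemma measurable_mat_minv:
  assumes A: "measurable_mat M n n A"
  shows "measurable_mat M n n (\<lambda>\<omega>. minv (A \<omega>))"
  unfolding measurable_mat_def
proof (intro conjI allI impI)
  note D = measurable_matD[OF A]
  show "minv (A \<omega>) \<in> carrier_mat n n" for \<omega> unfolding minv_def using D(1)[of \<omega>] by (simp add: adj_mat)
  fix i j assume ij: "i < n" "j < n"
  have "measurable_mat M (n - 1) (n - 1) (\<lambda>\<omega>. mat_delete (A \<omega>) j i)"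
    unfolding measurable_mat_def mat_delete_def using D(4) ij by (simp add: D(2,3))
  from measurable_det[OF this] have "(\<lambda>\<omega>. det (mat_delete (A \<omega>) j i)) \<in> borel_measurable M" .
  then have "(\<lambda>\<omega>. 1 / det (A \<omega>) * ((- 1) ^ (j + i) * det (mat_delete (A \<omega>) j i))) \<in> borel_measurable M"
    using measurable_det[OF A] by measurable
  then show "(\<lambda>\<omega>. minv (A \<omega>) $$ (i, j)) \<in> borel_measurable M"
    using ij D(2,3) by (simp add: minv_def adj_mat_def cofactor_def)
qed

lemma measurable_mtrace:
  assumes A: "measurable_mat M n n A"
  shows "(\<lambda>\<omega>. mtrace (A \<omega>)) \<in> borel_measurable M"
  unfolding mtrace_def measurable_matD(2)[OF A]
  by (intro borel_measurable_sum measurable_matD(4)[OF A]) auto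

section \<open>Concentration of quadratic forms and the self-consistent equation\<close>

lemma orthogonal_mat_columns:
  assumes Q: "(Q :: real mat) \<in> carrier_mat n n" "Q\<^sup>T * Q = 1\<^sub>m n" "Q * Q\<^sup>T = 1\<^sub>m n" and kl: "k < n" "l < n"
  shows "(\<Sum>m<n. Q $$ (m, k) * Q $$ (m, l)) = (if k = l then 1 else 0)"
    and "(\<Sum>m<n. Q $$ (k, m) * Q $$ (l, m)) = (if k = l then 1 else 0)"
proof -
  have "(Q\<^sup>T * Q) $$ (k, l) = (\<Sum>m<n. Q $$ (m, k) * Q $$ (m, l))"
    using Q(1) kl by (auto simp: scalar_prod_def atLeast0LessThan intro!: sum.cong)
  then show "(\<Sum>m<n. Q $$ (m, k) * Q $$ (m, l)) = (if k = l then 1 else 0)" using Q(2) kl by simp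
  have "(Q * Q\<^sup>T) $$ (k, l) = (\<Sum>m<n. Q $$ (k, m) * Q $$ (l, m))"
    using Q(1) kl by (auto simp: scalar_prod_def atLeast0LessThan intro!: sum.cong)
  then show "(\<Sum>m<n. Q $$ (k, m) * Q $$ (l, m)) = (if k = l then 1 else 0)" using Q(3) kl by simp
qed

lemma orthogonal_diag_entry:
  assumes Q: "(Q :: real mat) \<in> carrier_mat n n" and kl: "k < n" "l < n"
  shows "(Q * mat_diag n e * Q\<^sup>T) $$ (k, l) = (\<Sum>m<n. e m * (Q $$ (k, m) * Q $$ (l, m)))"
proof -
  have "Q * mat_diag n e = mat n n (\<lambda>(i, j). Q $$ (i, j) * e j)"
    using Q by (subst mat_diag_mult_right) auto
  then show ?thesis using Q kl by (auto simp: scalar_prod_def atLeast0LessThan mult_ac intro!: sum.cong)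
qed

text \<open>In an orthonormal eigenbasis of \<open>A\<close> the centred quadratic form is a
  weighted sum of centred squares, the weights being the eigenvalues. The rotated row is again
  standard Gaussian, and the sum of the squared eigenvalues is the squared Frobenius norm.\<close>

lemma quadratic_form_fourth_moment:
  fixes i :: 'i and A :: "real mat"
  assumes A: "A \<in> carrier_mat d d" "A\<^sup>T = A"
  shows "(\<integral>\<^sup>+x. ennreal ((row_of d x i \<bullet> (A *\<^sub>v row_of d x i) - mtrace A) ^ 4) \<partial>std_gaussian ({i} \<times> {..<d}))
    \<le> ennreal (60 * (\<Sum>k<d. \<Sum>l<d. (A $$ (k, l))\<^sup>2)\<^sup>2)"
proof -
  obtain Q e where Q: "Q \<in> carrier_mat d d" "Q\<^sup>T * Q = 1\<^sub>m d" "Q * Q\<^sup>T = 1\<^sub>m d" and AQ: "A = Q * mat_diag d e * Q\<^sup>T"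
    using real_symmetric_spectral[OF A] by blast
  note orth = orthogonal_mat_columns[OF Q]
  have ent: "A $$ (k, l) = (\<Sum>m<d. e m * (Q $$ (k, m) * Q $$ (l, m)))" if "k < d" "l < d" for k l
    unfolding AQ by (rule orthogonal_diag_entry[OF Q(1) that])
  let ?S = "{i} \<times> {..<d}" let ?G = "std_gaussian ({i} \<times> {..<d})"
  have S: "finite ?S" by simp
  have sumS: "(\<Sum>b\<in>?S. f b) = (\<Sum>l<d. f (i, l))" for f :: "'i \<times> nat \<Rightarrow> real"
    using sum.cartesian_product[of "\<lambda>x l. f (x, l)" "{..<d}" "{i}"] by simp
  define T where "T x = (\<lambda>a\<in>?S. \<Sum>b\<in>?S. Q $$ (snd b, snd a) * x b)" for x :: "'i \<times> nat \<Rightarrow> real"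
  have T: "distr ?G ?G T = ?G"
    unfolding T_def by (rule std_gaussian_orthogonal_kernel[OF S]) (auto simp: sumS orth split: if_splits)
  have Tm: "T \<in> measurable ?G ?G"
    unfolding T_def measurable_cong_sets[OF sets_std_gaussian sets_std_gaussian]
    by (intro measurable_restrict borel_measurable_sum borel_measurable_times borel_measurable_const
        measurable_component_singleton)
  have tr: "mtrace A = (\<Sum>m<d. e m)"
  proof -
    have "mtrace A = (\<Sum>k<d. \<Sum>m<d. e m * (Q $$ (k, m) * Q $$ (k, m)))"
      unfolding mtrace_def using A ent by simp
    also have "\<dots> = (\<Sum>m<d. \<Sum>k<d. e m * (Q $$ (k, m) * Q $$ (k, m)))" by (rule sum.swap)
    also have "\<dots> = (\<Sum>m<d. e m)" unfolding sum_distrib_left[symmetric] by (intro sum.cong refl) (simp add: orth)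
    finally show ?thesis .
  qed
  have quad: "row_of d x i \<bullet> (A *\<^sub>v row_of d x i) = (\<Sum>m<d. e m * (T x (i, m))\<^sup>2)" for x
  proof -
    have "row_of d x i \<bullet> (A *\<^sub>v row_of d x i) = (\<Sum>k<d. x (i, k) * (\<Sum>l<d. A $$ (k, l) * x (i, l)))"
      using A by (auto simp: scalar_prod_def row_of_def atLeast0LessThan intro!: sum.cong)
    also have "\<dots> = (\<Sum>k<d. \<Sum>l<d. \<Sum>m<d. e m * ((Q $$ (k, m) * x (i, k)) * (Q $$ (l, m) * x (i, l))))"
      by (intro sum.cong refl) (simp add: ent sum_distrib_left sum_distrib_right mult_ac)
    also have "\<dots> = (\<Sum>k<d. \<Sum>m<d. \<Sum>l<d. e m * ((Q $$ (k, m) * x (i, k)) * (Q $$ (l, m) * x (i, l))))"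
      by (rule sum.cong[OF refl]) (rule sum.swap)
    also have "\<dots> = (\<Sum>m<d. \<Sum>k<d. \<Sum>l<d. e m * ((Q $$ (k, m) * x (i, k)) * (Q $$ (l, m) * x (i, l))))"
      by (rule sum.swap)
    also have "\<dots> = (\<Sum>m<d. e m * (T x (i, m))\<^sup>2)"
    proof (rule sum.cong[OF refl])
      fix m assume "m \<in> {..<d}"
      then have TT: "T x (i, m) = (\<Sum>l<d. Q $$ (l, m) * x (i, l))" unfolding T_def by (simp add: sumS)
      show "(\<Sum>k<d. \<Sum>l<d. e m * ((Q $$ (k, m) * x (i, k)) * (Q $$ (l, m) * x (i, l)))) = e m * (T x (i, m))\<^sup>2"
        unfolding TT power2_eq_square unfolding sum_product unfolding sum_distrib_left ..
    qed
    finally show ?thesis .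
  qed
  have frob: "(\<Sum>k<d. \<Sum>l<d. (A $$ (k, l))\<^sup>2) = (\<Sum>m<d. (e m)\<^sup>2)"
  proof -
    have "(\<Sum>k<d. \<Sum>l<d. (A $$ (k, l))\<^sup>2)
      = (\<Sum>k<d. \<Sum>l<d. \<Sum>m<d. \<Sum>m'<d. e m * e m' * (Q $$ (k, m) * Q $$ (k, m')) * (Q $$ (l, m) * Q $$ (l, m')))"
      by (intro sum.cong refl) (simp add: ent power2_eq_square sum_product mult_ac)
    also have "\<dots> = (\<Sum>k<d. \<Sum>m<d. \<Sum>l<d. \<Sum>m'<d. e m * e m' * (Q $$ (k, m) * Q $$ (k, m')) * (Q $$ (l, m) * Q $$ (l, m')))"
      by (rule sum.cong[OF refl]) (rule sum.swap)
    also have "\<dots> = (\<Sum>k<d. \<Sum>m<d. \<Sum>m'<d. \<Sum>l<d. e m * e m' * (Q $$ (k, m) * Q $$ (k, m')) * (Q $$ (l, m) * Q $$ (l, m')))"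
      by (rule sum.cong[OF refl], rule sum.cong[OF refl]) (rule sum.swap)
    also have "\<dots> = (\<Sum>k<d. \<Sum>m<d. \<Sum>m'<d. e m * e m' * (Q $$ (k, m) * Q $$ (k, m')) * (if m = m' then 1 else 0))"
      unfolding sum_distrib_left[symmetric] by (intro sum.cong refl) (simp add: orth)
    also have "\<dots> = (\<Sum>k<d. \<Sum>m<d. (e m)\<^sup>2 * (Q $$ (k, m) * Q $$ (k, m)))"
      by (intro sum.cong refl) (simp add: if_distrib[of "\<lambda>z. _ * z"] power2_eq_square cong: if_cong)
    also have "\<dots> = (\<Sum>m<d. \<Sum>k<d. (e m)\<^sup>2 * (Q $$ (k, m) * Q $$ (k, m)))" by (rule sum.swap)
    also have "\<dots> = (\<Sum>m<d. (e m)\<^sup>2)" unfolding sum_distrib_left[symmetric] by (intro sum.cong refl) (simp add: orth)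
    finally show ?thesis .
  qed
  define F where "F y = ennreal ((\<Sum>s\<in>?S. e (snd s) * ((y s)\<^sup>2 - 1)) ^ 4)" for y :: "'i \<times> nat \<Rightarrow> real"
  have Fm: "F \<in> borel_measurable ?G"
    unfolding F_def measurable_cong_sets[OF sets_std_gaussian refl]
    by (intro measurable_compose[OF _ measurable_ennreal] borel_measurable_power borel_measurable_sum
        borel_measurable_times borel_measurable_diff borel_measurable_const measurable_component_singleton)
  have "(\<integral>\<^sup>+x. ennreal ((row_of d x i \<bullet> (A *\<^sub>v row_of d x i) - mtrace A) ^ 4) \<partial>?G) = (\<integral>\<^sup>+x. F (T x) \<partial>?G)"
    unfolding quad tr F_def sumS by (simp add: right_diff_distrib sum_subtractf)
  also have "\<dots> = (\<integral>\<^sup>+x. F x \<partial>distr ?G ?G T)" by (rule nn_integral_distr[OF Tm, symmetric]) (use Fm in simp)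
  also have "\<dots> = (\<integral>\<^sup>+x. F x \<partial>?G)" unfolding T ..
  also have "\<dots> \<le> ennreal (60 * (\<Sum>s\<in>?S. (e (snd s))\<^sup>2)\<^sup>2)"
    unfolding F_def by (rule std_gaussian_fourth_moment[OF S])
  also have "(\<Sum>s\<in>?S. (e (snd s))\<^sup>2) = (\<Sum>k<d. \<Sum>l<d. (A $$ (k, l))\<^sup>2)" unfolding sumS frob by simp
  finally show ?thesis .
qed

text \<open>The fluctuation of one quadratic form around its conditional mean: the matrix is built
  from the other rows, so under the Gaussian law it is independent of row \<open>i\<close>.\<close>

definition loo_error :: "real \<Rightarrow> nat \<Rightarrow> 'i set \<Rightarrow> ('i \<Rightarrow> real) \<Rightarrow> ('i \<times> nat \<Rightarrow> real) \<Rightarrow> 'i \<Rightarrow> real" where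
  "loo_error t d I b u i = \<bar>row_of d u i \<bullet> (minv (weighted_gram t d (I - {i}) b u) *\<^sub>v row_of d u i)
        - mtrace (minv (weighted_gram t d (I - {i}) b u))\<bar>"

lemma measurable_weighted_gram:
  assumes "J \<subseteq> I"
  shows "measurable_mat (std_gaussian (I \<times> {..<d})) d d (weighted_gram t d J b)"
  unfolding measurable_mat_def
proof (intro conjI allI impI)
  fix k l assume kl: "k < d" "l < d"
  have c: "(\<lambda>u. u (i, m)) \<in> borel_measurable (std_gaussian (I \<times> {..<d}))" if "i \<in> J" "m < d" for i m
    unfolding measurable_cong_sets[OF sets_std_gaussian refl] using that assms
    by (intro measurable_component_singleton) auto
  show "(\<lambda>u. weighted_gram t d J b u $$ (k, l)) \<in> borel_measurable (std_gaussian (I \<times> {..<d}))"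
  proof -
    have "weighted_gram t d J b u $$ (k, l) = (if k = l then t else 0) + (\<Sum>i\<in>J. b i * u (i, k) * u (i, l))" for u
      using kl by (simp add: weighted_gram_def)
    moreover have "(\<lambda>u. (if k = l then t else 0) + (\<Sum>i\<in>J. b i * u (i, k) * u (i, l))) \<in> borel_measurable (std_gaussian (I \<times> {..<d}))"
      by (intro borel_measurable_add borel_measurable_const borel_measurable_sum borel_measurable_times c kl)
    ultimately show ?thesis by (simp only:)
  qed
qed simp

lemma measurable_loo_error:
  assumes "i \<in> I"
  shows "(\<lambda>u. loo_error t d I b u i) \<in> borel_measurable (std_gaussian (I \<times> {..<d}))"
proof -
  let ?G = "std_gaussian (I \<times> {..<d})"
  have R: "measurable_mat ?G d d (\<lambda>u. minv (weighted_gram t d (I - {i}) b u))"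
    by (intro measurable_mat_minv measurable_weighted_gram) auto
  have c: "(\<lambda>u. u (i, m)) \<in> borel_measurable ?G" if "m < d" for m
    unfolding measurable_cong_sets[OF sets_std_gaussian refl] using that assms
    by (intro measurable_component_singleton) auto
  have "row_of d u i \<bullet> (minv (weighted_gram t d (I - {i}) b u) *\<^sub>v row_of d u i)
     = (\<Sum>k<d. u (i, k) * (\<Sum>l<d. minv (weighted_gram t d (I - {i}) b u) $$ (k, l) * u (i, l)))" for u
    using measurable_matD(2,3)[OF R, of u] by (auto simp: scalar_prod_def row_of_def atLeast0LessThan intro!: sum.cong)
  then show ?thesis unfolding loo_error_def
    using c measurable_matD(4)[OF R] measurable_mtrace[OF R]
    by (auto intro!: borel_measurable_abs borel_measurable_diff borel_measurable_sum borel_measurable_times)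
qed

lemma loo_error_fourth_moment:
  fixes b :: "'i \<Rightarrow> real"
  assumes I: "finite I" "i \<in> I" and t: "t > 0" and b: "\<And>i. i \<in> I \<Longrightarrow> b i \<ge> 0"
  shows "(\<integral>\<^sup>+u. ennreal (loo_error t d I b u i ^ 4) \<partial>std_gaussian (I \<times> {..<d})) \<le> ennreal (60 * (d / t\<^sup>2)\<^sup>2)"
proof -
  let ?N = "density lborel (\<lambda>x. ennreal (std_normal_density x))"
  interpret N: product_sigma_finite "\<lambda>_ :: 'i \<times> nat. ?N"
    by (intro product_sigma_finite.intro prob_space_imp_sigma_finite prob_space_normal_density) simp
  let ?A = "(I - {i}) \<times> {..<d}" and ?B = "{i} \<times> {..<d}"
  have un: "I \<times> {..<d} = ?A \<union> ?B" using I by auto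
  have m: "(\<lambda>u. ennreal (loo_error t d I b u i ^ 4)) \<in> borel_measurable (std_gaussian (?A \<union> ?B))"
    unfolding un[symmetric] by (intro measurable_compose[OF _ measurable_ennreal] borel_measurable_power measurable_loo_error I)
  have "(\<integral>\<^sup>+u. ennreal (loo_error t d I b u i ^ 4) \<partial>std_gaussian (I \<times> {..<d})) =
    (\<integral>\<^sup>+x. \<integral>\<^sup>+y. ennreal (loo_error t d I b (merge ?A ?B (x, y)) i ^ 4) \<partial>std_gaussian ?B \<partial>std_gaussian ?A)"
    using m unfolding un unfolding std_gaussian_def by (intro N.product_nn_integral_fold) (use I in auto)
  \<comment> \<open>Conditionally on the other rows \<open>x\<close> the matrix of the quadratic
    form is fixed, and the bound obtained from its Frobenius norm does not depend on
    \<open>x\<close>.\<close>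
  also have "\<dots> \<le> (\<integral>\<^sup>+x. ennreal (60 * (d / t\<^sup>2)\<^sup>2) \<partial>std_gaussian ?A)"
  proof (rule nn_integral_mono)
    fix x :: "'i \<times> nat \<Rightarrow> real"
    let ?K = "weighted_gram t d (I - {i}) b x"
    interpret K: coercive_mat ?K d t by (rule coercive_weighted_gram) (use I t b in auto)
    have "weighted_gram t d (I - {i}) b (merge ?A ?B (x, y)) = ?K" for y
      by (rule eq_matI) (auto simp: weighted_gram_def merge_def intro!: sum.cong)
    moreover have "row_of d (merge ?A ?B (x, y)) i = row_of d y i" for y
      by (auto simp: row_of_def merge_def)
    ultimately have "loo_error t d I b (merge ?A ?B (x, y)) i ^ 4
        = (row_of d y i \<bullet> (minv ?K *\<^sub>v row_of d y i) - mtrace (minv ?K)) ^ 4" for y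
      unfolding loo_error_def by simp
    then have "(\<integral>\<^sup>+y. ennreal (loo_error t d I b (merge ?A ?B (x, y)) i ^ 4) \<partial>std_gaussian ?B)
        \<le> ennreal (60 * (\<Sum>k<d. \<Sum>l<d. (minv ?K $$ (k, l))\<^sup>2)\<^sup>2)"
      using quadratic_form_fourth_moment[OF K.inv_carrier minv_symmetric[OF K.carrier K.det_nz K.sym], of i] by simp
    also have "\<dots> \<le> ennreal (60 * (d / t\<^sup>2)\<^sup>2)"
      by (intro ennreal_leI mult_left_mono power_mono K.inv_frobenius sum_nonneg) auto
    finally show "(\<integral>\<^sup>+y. ennreal (loo_error t d I b (merge ?A ?B (x, y)) i ^ 4) \<partial>std_gaussian ?B)
        \<le> ennreal (60 * (d / t\<^sup>2)\<^sup>2)" .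
  qed
  also have "\<dots> = ennreal (60 * (d / t\<^sup>2)\<^sup>2)"
    using prob_space.emeasure_space_1[OF prob_space_std_gaussian[of ?A]] by simp
  finally show ?thesis .
qed

text \<open>Cauchy--Schwarz applied twice. It trades the fourth moment of a sum of dependent errors
  for the sum of their fourth moments.\<close>

lemma sum_power4_le:
  fixes f :: "'i \<Rightarrow> real"
  shows "(\<Sum>i\<in>I. f i) ^ 4 \<le> real (card I) ^ 3 * (\<Sum>i\<in>I. f i ^ 4)"
proof -
  have cs: "(\<Sum>i\<in>I. g i)\<^sup>2 \<le> card I * (\<Sum>i\<in>I. (g i)\<^sup>2)" for g :: "'i \<Rightarrow> real"
    using Cauchy_Schwarz_ineq_sum[of "\<lambda>_. 1" g I] by simp
  have "(\<Sum>i\<in>I. f i) ^ 4 = ((\<Sum>i\<in>I. f i)\<^sup>2)\<^sup>2" by simp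
  also have "\<dots> \<le> (real (card I) * (\<Sum>i\<in>I. (f i)\<^sup>2))\<^sup>2" by (intro power_mono cs) simp
  also have "\<dots> \<le> (real (card I))\<^sup>2 * (real (card I) * (\<Sum>i\<in>I. ((f i)\<^sup>2)\<^sup>2))"
    unfolding power_mult_distrib using cs[of "\<lambda>i. (f i)\<^sup>2"] by (intro mult_left_mono) auto
  also have "\<dots> = real (card I) ^ 3 * (\<Sum>i\<in>I. f i ^ 4)"
    by (simp add: power2_eq_square power3_eq_cube power4_eq_xxxx mult.assoc)
  finally show ?thesis .
qed

definition self_consistency_defect :: "real \<Rightarrow> nat \<Rightarrow> 'i set \<Rightarrow> ('i \<Rightarrow> real) \<Rightarrow> real \<Rightarrow> real" where
  "self_consistency_defect t d I b \<theta> = \<bar>t * \<theta> + (\<Sum>i\<in>I. b i * \<theta> / (1 + b i * \<theta>)) - d\<bar>"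

text \<open>Markov's inequality for the fourth power of the summed leave-one-out errors, with
  threshold \<open>C = c / d\<close> for the weights. The hypothesis \<open>large\<close> says that
  the deterministic rank one contribution uses at most half of the tolerance. For fixed
  \<open>c\<close>, \<open>t\<close>, \<open>\<eta>\<close> and \<open>card I\<close> comparable to
  \<open>d\<close>, the bound is of order \<open>1 / d\<^sup>2\<close>, hence summable.\<close>

theorem self_consistent_prob:
  fixes b :: "'i \<Rightarrow> real" and c \<eta> :: real
  assumes I: "finite I" and t: "t > 0" and b: "\<And>i. i \<in> I \<Longrightarrow> b i \<ge> 0" and c: "c \<ge> 0" and \<eta>: "\<eta> > 0" and d: "d > 0"
    and large: "c * card I / (d * t) \<le> \<eta> * d / 2"
  shows "emeasure (std_gaussian (I \<times> {..<d})) {u \<in> space (std_gaussian (I \<times> {..<d})).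
      self_consistency_defect t d I b (mtrace (minv (weighted_gram t d I b u))) > \<eta> * d + card {i\<in>I. b i > c / d}}
    \<le> ennreal (960 * (c * real (card I)) ^ 4 / (\<eta> ^ 4 * t ^ 4 * real d ^ 6))" (is "emeasure ?G ?E \<le> _")
proof -
  define s where "s u = (\<Sum>i\<in>I. loo_error t d I b u i)" for u
  \<comment> \<open>Chosen so that on the exceptional event \<open>k * s u ^ 4 \<ge> 1\<close>:
    there the random part \<open>c / d * s u\<close> exceeds \<open>\<eta> * d / 2\<close>. The
    constant \<open>960\<close> below is this factor \<open>2 ^ 4\<close> times the
    \<open>60\<close> of the fourth moment.\<close>
  define k where "k = (2 * c / (\<eta> * d ^ 2)) ^ 4"
  have k0: "k \<ge> 0" using c \<eta> by (simp add: k_def)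
  have sub: "1 \<le> k * s u ^ 4" if "u \<in> ?E" for u
  proof -
    let ?\<theta> = "mtrace (minv (weighted_gram t d I b u))"
    have "self_consistency_defect t d I b ?\<theta> \<le> c / d * (\<Sum>i\<in>I. loo_error t d I b u i + 1 / t) + card {i\<in>I. b i > c / d}"
      unfolding self_consistency_defect_def loo_error_def
      by (rule weighted_gram_self_consistent[OF I t b]) (use c in auto)
    also have "c / d * (\<Sum>i\<in>I. loo_error t d I b u i + 1 / t) = c / d * s u + c * card I / (d * t)"
      by (simp add: s_def sum.distrib algebra_simps)
    finally have le: "self_consistency_defect t d I b ?\<theta>
      \<le> c / d * s u + c * card I / (d * t) + card {i\<in>I. b i > c / d}" .
    have gt: "self_consistency_defect t d I b ?\<theta> > \<eta> * d + card {i\<in>I. b i > c / d}"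
      using that by simp
    have "\<eta> * d / 2 < c / d * s u" using le gt large by linarith
    then have "1 < 2 * c / (\<eta> * d ^ 2) * s u"
      using \<eta> d by (simp add: field_simps power2_eq_square)
    then have "1 ^ 4 \<le> (2 * c / (\<eta> * d ^ 2) * s u) ^ 4" by (intro power_mono) auto
    then show ?thesis unfolding k_def power_mult_distrib by simp
  qed
  have lm: "(\<lambda>u. loo_error t d I b u i) \<in> borel_measurable ?G" if "i \<in> I" for i by (rule measurable_loo_error[OF that])
  have sm: "s \<in> borel_measurable ?G" unfolding s_def using lm by (intro borel_measurable_sum)
  have km: "(\<lambda>u. ennreal (k * s u ^ 4)) \<in> borel_measurable ?G" using sm by measurable
  have "emeasure ?G ?E \<le> emeasure ?G {u \<in> space ?G. 1 \<le> ennreal (k * s u ^ 4)}"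
    using sub km by (intro emeasure_mono) (auto simp flip: ennreal_1 intro!: ennreal_leI)
  also have "\<dots> \<le> (\<integral>\<^sup>+u. ennreal (k * s u ^ 4) \<partial>?G)"
  proof -
    have "emeasure ?G {u \<in> space ?G. 1 \<le> ennreal (k * s u ^ 4)} = (\<integral>\<^sup>+u. indicator {u \<in> space ?G. 1 \<le> ennreal (k * s u ^ 4)} u \<partial>?G)"
      using km by (intro nn_integral_indicator[symmetric] borel_measurable_le borel_measurable_const)
    also have "\<dots> \<le> (\<integral>\<^sup>+u. ennreal (k * s u ^ 4) \<partial>?G)"
      by (intro nn_integral_mono) (auto split: split_indicator)
    finally show ?thesis .
  qed
  also have "\<dots> \<le> (\<integral>\<^sup>+u. ennreal (k * real (card I) ^ 3) * (\<Sum>i\<in>I. ennreal (loo_error t d I b u i ^ 4)) \<partial>?G)"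
  proof (rule nn_integral_mono)
    fix u
    have "k * s u ^ 4 \<le> k * (real (card I) ^ 3 * (\<Sum>i\<in>I. loo_error t d I b u i ^ 4))"
      unfolding s_def by (intro mult_left_mono sum_power4_le k0)
    then have "ennreal (k * s u ^ 4) \<le> ennreal (k * real (card I) ^ 3 * (\<Sum>i\<in>I. loo_error t d I b u i ^ 4))"
      by (intro ennreal_leI) (simp add: mult.assoc)
    also have "\<dots> = ennreal (k * real (card I) ^ 3) * (\<Sum>i\<in>I. ennreal (loo_error t d I b u i ^ 4))"
      using k0 by (simp add: ennreal_mult' sum_nonneg)
    finally show "ennreal (k * s u ^ 4) \<le> ennreal (k * real (card I) ^ 3) * (\<Sum>i\<in>I. ennreal (loo_error t d I b u i ^ 4))" .
  qed
  also have "\<dots> = ennreal (k * real (card I) ^ 3) * (\<Sum>i\<in>I. \<integral>\<^sup>+u. ennreal (loo_error t d I b u i ^ 4) \<partial>?G)"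
  proof -
    have lm4: "(\<lambda>u. ennreal (loo_error t d I b u i ^ 4)) \<in> borel_measurable ?G" if "i \<in> I" for i
      using lm[OF that] by measurable
    show ?thesis
      by (subst nn_integral_cmult) (simp_all only: nn_integral_sum[OF lm4] borel_measurable_sum lm4)
  qed
  also have "\<dots> \<le> ennreal (k * real (card I) ^ 3) * (\<Sum>i\<in>I. ennreal (60 * (d / t\<^sup>2)\<^sup>2))"
    by (intro mult_left_mono sum_mono loo_error_fourth_moment I t b) auto
  also have "\<dots> = ennreal (k * real (card I) ^ 3 * (card I * (60 * (d / t\<^sup>2)\<^sup>2)))"
    using k0 by (simp add: ennreal_mult ennreal_of_nat_eq_real_of_nat)
  also have "k * real (card I) ^ 3 * (card I * (60 * (d / t\<^sup>2)\<^sup>2)) = 960 * (c * real (card I)) ^ 4 / (\<eta> ^ 4 * t ^ 4 * real d ^ 6)"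
    using \<eta> t d unfolding k_def by (simp add: field_simps numeral_eq_Suc)
  finally show ?thesis .
qed

section \<open>Reduction by rotation invariance\<close>

text \<open>The rank is the size of a maximal independent subset of the set of columns; a repeated
  column would leave fewer than \<open>p\<close> candidates. Distinctness is what allows passing
  between the column set and coefficient vectors.\<close>

lemma full_rank_distinct_cols:
  assumes X: "(X :: real mat) \<in> carrier_mat n p" and r: "vec_space.rank n X = p"
  shows "distinct (cols X)"
proof (rule ccontr)
  interpret vec_space "TYPE(real)" n .
  assume nd: "\<not> distinct (cols X)"
  obtain S where S: "maximal S (\<lambda>T. T \<subseteq> set (cols X) \<and> lin_indpt T)"
    using maximal_exists[of "(\<lambda>T. T \<subseteq> set (cols X) \<and> lin_indpt T)" "card (set (cols X))" "{}"]
    by (meson List.finite_set card_mono empty_iff empty_subsetI finite_lin_indpt2 rev_finite_subset)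
  then have "card S \<le> card (set (cols X))" by (simp add: card_mono maximal_def)
  also have "\<dots> < length (cols X)" using nd card_distinct card_length le_neq_implies_less by blast
  finally show False using rank_card_indpt[OF X S] r X by simp
qed

text \<open>A kernel vector \<open>v\<close> of the Gram matrix satisfies
  \<open>(X v) \<bullet> (X v) = 0\<close>, so it is a linear relation among the columns of
  \<open>X\<close>.\<close>

lemma full_rank_det_gram:
  assumes X: "(X :: real mat) \<in> carrier_mat n p" and r: "vec_space.rank n X = p"
  shows "det (X\<^sup>T * X) \<noteq> 0"
proof
  interpret vec_space "TYPE(real)" n .
  have S: "X\<^sup>T * X \<in> carrier_mat p p" using X by simp
  assume "det (X\<^sup>T * X) = 0"
  then obtain v where v: "v \<in> carrier_vec p" "v \<noteq> 0\<^sub>v p" "X\<^sup>T * X *\<^sub>v v = 0\<^sub>v p"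
    using det_0_iff_vec_prod_zero[OF S] by auto
  have Xv: "X *\<^sub>v v \<in> carrier_vec n" using X v by simp
  have "(X *\<^sub>v v) \<bullet> (X *\<^sub>v v) = (X\<^sup>T *\<^sub>v (X *\<^sub>v v)) \<bullet> v"
    using transpose_vec_mult_scalar[OF X v(1) Xv] by simp
  also have "X\<^sup>T *\<^sub>v (X *\<^sub>v v) = 0\<^sub>v p"
    using v(3) assoc_mult_mat_vec[of "X\<^sup>T" p n X p v] X v(1) by simp
  finally have "X *\<^sub>v v = 0\<^sub>v n" using scalar_prod_self_eq_0[OF Xv] v(1) by simp
  then have "lin_dep (set (cols X))"
    using lin_depI[OF X v(1,2) _ full_rank_distinct_cols[OF X r]] by simp
  then show False using full_rank_lin_indpt[OF X r full_rank_distinct_cols[OF X r]] by simp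
qed

section \<open>Traces and the spectrum of a Gram matrix\<close>

lemma mtrace_mult_commute:
  assumes A: "A \<in> carrier_mat n m" and B: "B \<in> carrier_mat m n"
  shows "mtrace (A * B) = mtrace (B * A)"
proof -
  have "mtrace (A * B) = (\<Sum>i<n. \<Sum>j<m. A $$ (i, j) * B $$ (j, i))"
    unfolding mtrace_def using A B by (auto simp: scalar_prod_def atLeast0LessThan intro!: sum.cong)
  also have "\<dots> = (\<Sum>j<m. \<Sum>i<n. A $$ (i, j) * B $$ (j, i))" by (rule sum.swap)
  also have "\<dots> = mtrace (B * A)"
    unfolding mtrace_def using A B by (auto simp: scalar_prod_def atLeast0LessThan mult_ac intro!: sum.cong)
  finally show ?thesis .
qed

lemma mtrace_add: "A \<in> carrier_mat n n \<Longrightarrow> B \<in> carrier_mat n n \<Longrightarrow> mtrace (A + B) = mtrace A + mtrace B"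
  unfolding mtrace_def by (simp add: sum.distrib)

lemma mtrace_smult: "A \<in> carrier_mat n n \<Longrightarrow> mtrace (c \<cdot>\<^sub>m A) = c * mtrace A"
  unfolding mtrace_def by (simp add: sum_distrib_left)

lemma mtrace_one: "mtrace (1\<^sub>m n) = n"
  unfolding mtrace_def by simp

lemma mtrace_orthogonal_diag:
  assumes Q: "(Q :: real mat) \<in> carrier_mat n n" "Q\<^sup>T * Q = 1\<^sub>m n" "Q * Q\<^sup>T = 1\<^sub>m n"
  shows "mtrace (Q * mat_diag n e * Q\<^sup>T) = (\<Sum>i<n. e i)"
proof -
  have "mtrace (Q * mat_diag n e * Q\<^sup>T) = (\<Sum>k<n. \<Sum>m<n. e m * (Q $$ (k, m) * Q $$ (k, m)))"
    unfolding mtrace_def using Q(1) orthogonal_diag_entry[OF Q(1), of _ _ e] by simp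
  also have "\<dots> = (\<Sum>m<n. \<Sum>k<n. e m * (Q $$ (k, m) * Q $$ (k, m)))" by (rule sum.swap)
  also have "\<dots> = (\<Sum>m<n. e m)"
    unfolding sum_distrib_left[symmetric] by (intro sum.cong refl) (simp add: orthogonal_mat_columns(1)[OF Q])
  finally show ?thesis .
qed

lemma eq_orthogonal_diagI:
  assumes Q: "(Q :: real mat) \<in> carrier_mat n n" "Q * Q\<^sup>T = 1\<^sub>m n" and A: "A \<in> carrier_mat n n"
    and ev: "\<And>i. i < n \<Longrightarrow> A *\<^sub>v col Q i = e i \<cdot>\<^sub>v col Q i"
  shows "A = Q * mat_diag n e * Q\<^sup>T"
proof -
  have "A * Q = Q * mat_diag n e"
  proof (rule eq_matI)
    fix i j assume "i < dim_row (Q * mat_diag n e)" "j < dim_col (Q * mat_diag n e)"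
    then have ij: "i < n" "j < n" using Q by (auto simp: mat_diag_def)
    have "(A * Q) $$ (i, j) = (A *\<^sub>v col Q j) $ i" using ij A Q by simp
    also have "\<dots> = e j * Q $$ (i, j)" unfolding ev[OF ij(2)] using ij Q by simp
    also have "\<dots> = (Q * mat_diag n e) $$ (i, j)" using ij Q by (subst mat_diag_mult_right[OF Q(1)]) simp
    finally show "(A * Q) $$ (i, j) = (Q * mat_diag n e) $$ (i, j)" .
  qed (use A Q in \<open>auto simp: mat_diag_def\<close>)
  then have "A * Q * Q\<^sup>T = Q * mat_diag n e * Q\<^sup>T" by simp
  then show ?thesis using A Q by (simp add: assoc_mult_mat[of A n n Q n "Q\<^sup>T" n])
qed

lemma gram_quadratic:
  assumes X: "(X :: real mat) \<in> carrier_mat n p" and v: "v \<in> carrier_vec p"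
  shows "v \<bullet> (X\<^sup>T * X *\<^sub>v v) = (X *\<^sub>v v) \<bullet> (X *\<^sub>v v)"
proof -
  have Xv: "X *\<^sub>v v \<in> carrier_vec n" using X v by simp
  have "v \<bullet> (X\<^sup>T * X *\<^sub>v v) = v \<bullet> (X\<^sup>T *\<^sub>v (X *\<^sub>v v))"
    using assoc_mult_mat_vec[of "X\<^sup>T" p n X p v] X v(1) by simp
  also have "\<dots> = (X\<^sup>T *\<^sub>v (X *\<^sub>v v)) \<bullet> v" by (rule comm_scalar_prod[OF v]) (use X Xv in simp)
  also have "\<dots> = (X *\<^sub>v v) \<bullet> (X *\<^sub>v v)" using transpose_vec_mult_scalar[OF X v Xv] by simp
  finally show ?thesis .
qed

lemma gram_symmetric: "(X\<^sup>T * (X :: real mat))\<^sup>T = X\<^sup>T * X"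
  by (subst transpose_mult[of _ "dim_col X" "dim_row X" _ "dim_col X"]) auto

lemma coercive_shift:
  assumes A: "A \<in> carrier_mat n n" "A\<^sup>T = A" and psd: "\<And>x. x \<in> carrier_vec n \<Longrightarrow> 0 \<le> x \<bullet> (A *\<^sub>v x)" and s: "s > 0"
  shows "coercive_mat (A + s \<cdot>\<^sub>m 1\<^sub>m n) n s"
proof
  show "A + s \<cdot>\<^sub>m 1\<^sub>m n \<in> carrier_mat n n" by simp
  have "(s \<cdot>\<^sub>m (1\<^sub>m n :: real mat))\<^sup>T = s \<cdot>\<^sub>m 1\<^sub>m n" by (rule eq_matI) auto
  then show "(A + s \<cdot>\<^sub>m 1\<^sub>m n)\<^sup>T = A + s \<cdot>\<^sub>m 1\<^sub>m n"
    using transpose_add[OF A(1), of "s \<cdot>\<^sub>m 1\<^sub>m n"] A(2) by simp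
  fix x :: "real vec" assume x: "x \<in> carrier_vec n"
  have "(A + s \<cdot>\<^sub>m 1\<^sub>m n) *\<^sub>v x = A *\<^sub>v x + s \<cdot>\<^sub>v x"
    using A x by (subst add_mult_distrib_mat_vec[of _ n n]) (auto intro!: eq_vecI)
  then have "x \<bullet> ((A + s \<cdot>\<^sub>m 1\<^sub>m n) *\<^sub>v x) = x \<bullet> (A *\<^sub>v x) + s * (x \<bullet> x)"
    using A x by (simp add: scalar_prod_add_distrib[of _ n])
  then show "s * (x \<bullet> x) \<le> x \<bullet> ((A + s \<cdot>\<^sub>m 1\<^sub>m n) *\<^sub>v x)" using psd[OF x] by simp
qed (fact s)

lemma coercive_gram:
  assumes X: "(X :: real mat) \<in> carrier_mat n p" and c: "c \<ge> 0" and s: "s > 0"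
  shows "coercive_mat (c \<cdot>\<^sub>m (X\<^sup>T * X) + s \<cdot>\<^sub>m 1\<^sub>m p) p s"
proof (rule coercive_shift[OF _ _ _ s])
  have S: "X\<^sup>T * X \<in> carrier_mat p p" using X by simp
  then show "c \<cdot>\<^sub>m (X\<^sup>T * X) \<in> carrier_mat p p" by simp
  show "(c \<cdot>\<^sub>m (X\<^sup>T * X))\<^sup>T = c \<cdot>\<^sub>m (X\<^sup>T * X)"
  proof (rule eq_matI)
    fix i j assume ij: "i < dim_row (c \<cdot>\<^sub>m (X\<^sup>T * X))" "j < dim_col (c \<cdot>\<^sub>m (X\<^sup>T * X))"
    have "(X\<^sup>T * X) $$ (j, i) = (X\<^sup>T * X)\<^sup>T $$ (i, j)" using ij S by simp
    then show "(c \<cdot>\<^sub>m (X\<^sup>T * X))\<^sup>T $$ (i, j) = (c \<cdot>\<^sub>m (X\<^sup>T * X)) $$ (i, j)"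
      unfolding gram_symmetric using ij by simp
  qed (use X in auto)
  fix x :: "real vec" assume x: "x \<in> carrier_vec p"
  have "c \<cdot>\<^sub>m (X\<^sup>T * X) *\<^sub>v x = c \<cdot>\<^sub>v (X\<^sup>T * X *\<^sub>v x)" using S x by (intro eq_vecI) auto
  then have "x \<bullet> (c \<cdot>\<^sub>m (X\<^sup>T * X) *\<^sub>v x) = c * (x \<bullet> (X\<^sup>T * X *\<^sub>v x))"
    using scalar_prod_smult_distrib[OF x mult_mat_vec_carrier[OF S x]] by simp
  also have "\<dots> = c * ((X *\<^sub>v x) \<bullet> (X *\<^sub>v x))" unfolding gram_quadratic[OF X x] ..
  finally show "0 \<le> x \<bullet> (c \<cdot>\<^sub>m (X\<^sup>T * X) *\<^sub>v x)" using c scalar_prod_self_nonneg[of "X *\<^sub>v x"] by simp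
qed

text \<open>All matrices built from the Gram matrix of \<open>X\<close> are diagonalised by the eigenvectors of \<open>X X\<^sup>T\<close>.
  The convention \<open>1 / 0 = 0\<close> gives the correct (pseudo-inverse) eigenvalues on the kernel of \<open>X\<^sup>T\<close>.\<close>

lemma sandwich_orthogonal_diag:
  assumes X: "(X :: real mat) \<in> carrier_mat n p"
    and Q: "Q \<in> carrier_mat n n" "Q\<^sup>T * Q = 1\<^sub>m n" "Q * Q\<^sup>T = 1\<^sub>m n"
    and XQ: "X * X\<^sup>T = Q * mat_diag n \<sigma> * Q\<^sup>T"
    and C: "C \<in> carrier_mat p p"
    and ev: "\<And>y i. i < n \<Longrightarrow> \<sigma> i \<noteq> 0 \<Longrightarrow> y \<in> carrier_vec p \<Longrightarrow> X\<^sup>T * X *\<^sub>v y = \<sigma> i \<cdot>\<^sub>v y \<Longrightarrow> C *\<^sub>v y = c i \<cdot>\<^sub>v y"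
  shows "X * C * X\<^sup>T = Q * mat_diag n (\<lambda>i. c i * \<sigma> i) * Q\<^sup>T"
proof (rule eq_orthogonal_diagI[OF Q(1,3)])
  show "X * C * X\<^sup>T \<in> carrier_mat n n" using X C by simp
  fix i assume i: "i < n"
  define q where "q = col Q i"
  define y where "y = X\<^sup>T *\<^sub>v q"
  have q: "q \<in> carrier_vec n" using Q i by (simp add: q_def)
  have y: "y \<in> carrier_vec p" using X q by (simp add: y_def)
  have D: "mat_diag n \<sigma> \<in> carrier_mat n n" by simp
  have "X * X\<^sup>T *\<^sub>v q = \<sigma> i \<cdot>\<^sub>v q"
  proof -
    have Qq: "Q\<^sup>T *\<^sub>v q = unit_vec n i"
    proof -
      have "Q\<^sup>T *\<^sub>v q = col (Q\<^sup>T * Q) i" unfolding q_def using Q(1) i by (subst col_mult2[of _ n n]) auto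
      then show ?thesis unfolding Q(2) using i by simp
    qed
    have "X * X\<^sup>T *\<^sub>v q = Q * mat_diag n \<sigma> *\<^sub>v (Q\<^sup>T *\<^sub>v q)"
      unfolding XQ using Q(1) q D by (intro assoc_mult_mat_vec[of _ n n _ n]) auto
    also have "\<dots> = col (Q * mat_diag n \<sigma>) i"
    proof -
      have QD: "Q * mat_diag n \<sigma> \<in> carrier_mat n n" by (rule mult_carrier_mat[OF Q(1) D])
      show ?thesis unfolding Qq using carrier_matD[OF QD] i by (intro eq_vecI) (auto simp: scalar_prod_right_unit[of _ n])
    qed
    also have "\<dots> = \<sigma> i \<cdot>\<^sub>v q" unfolding q_def using Q(1) i by (subst mat_diag_mult_right[OF Q(1)]) (auto intro!: eq_vecI)
    finally show ?thesis .
  qed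
  then have Xy: "X *\<^sub>v y = \<sigma> i \<cdot>\<^sub>v q"
    unfolding y_def using X q assoc_mult_mat_vec[of X n p "X\<^sup>T" n q] by simp
  have Sy: "X\<^sup>T * X *\<^sub>v y = \<sigma> i \<cdot>\<^sub>v y"
  proof -
    have "X\<^sup>T * X *\<^sub>v y = X\<^sup>T *\<^sub>v (X *\<^sub>v y)" using X y assoc_mult_mat_vec[of "X\<^sup>T" p n X p y] by simp
    also have "\<dots> = \<sigma> i \<cdot>\<^sub>v (X\<^sup>T *\<^sub>v q)" unfolding Xy using X q by (intro mult_mat_vec[of _ p n]) auto
    also have "\<dots> = \<sigma> i \<cdot>\<^sub>v y" unfolding y_def ..
    finally show ?thesis .
  qed
  have XC: "X * C * X\<^sup>T *\<^sub>v q = X *\<^sub>v (C *\<^sub>v y)"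
    unfolding y_def using X C q assoc_mult_mat_vec[of "X * C" n p "X\<^sup>T" n q] assoc_mult_mat_vec[of X n p C p "X\<^sup>T *\<^sub>v q"] by simp
  show "X * C * X\<^sup>T *\<^sub>v col Q i = (c i * \<sigma> i) \<cdot>\<^sub>v col Q i"
  proof (cases "\<sigma> i = 0")
    \<comment> \<open>On the kernel of \<open>X * X\<^sup>T\<close> the vector
      \<open>y = X\<^sup>T q\<close> is zero, because its squared length is
      \<open>\<sigma> i * (q \<bullet> q)\<close>. So the value of \<open>c i\<close> does not
      matter there, in agreement with the factor \<open>\<sigma> i\<close> in the claimed
      eigenvalue.\<close>
    case True
    have "y \<bullet> y = q \<bullet> (X *\<^sub>v y)"
      using transpose_vec_mult_scalar[OF X y q] unfolding y_def by simp
    also have "\<dots> = 0" unfolding Xy True using q by simp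
    finally have "y = 0\<^sub>v p" using scalar_prod_self_eq_0[OF y] by simp
    moreover have "C *\<^sub>v 0\<^sub>v p = 0\<^sub>v p" using C by (intro eq_vecI) (auto simp: scalar_prod_def)
    moreover have "X *\<^sub>v 0\<^sub>v p = 0\<^sub>v n" using X by (intro eq_vecI) (auto simp: scalar_prod_def)
    moreover have "(0 :: real) \<cdot>\<^sub>v q = 0\<^sub>v n" using q by (intro eq_vecI) auto
    ultimately show ?thesis using XC True unfolding q_def by simp
  next
    case False
    have "X * C * X\<^sup>T *\<^sub>v q = c i \<cdot>\<^sub>v (X *\<^sub>v y)"
      unfolding XC ev[OF i False y Sy] using X y by (intro mult_mat_vec[of _ n p])
    also have "\<dots> = (c i * \<sigma> i) \<cdot>\<^sub>v q" unfolding Xy by (simp add: smult_smult_assoc)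
    finally show ?thesis unfolding q_def .
  qed
qed

text \<open>One basis serves for both compressed matrices that occur,
  \<open>X S\<^sup>-\<^sup>1 X\<^sup>T\<close> and \<open>X S\<^sup>-\<^sup>2 X\<^sup>T\<close> with
  \<open>S = X\<^sup>T * X\<close>. The last clause expresses the resolvent trace of
  \<open>S\<close> by the same \<open>\<sigma>\<close>; it rests on cyclicity of the trace, so
  \<open>S\<close> is never diagonalised separately.\<close>

lemma gram_spectral:
  assumes X: "(X :: real mat) \<in> carrier_mat n p" and det: "det (X\<^sup>T * X) \<noteq> 0"
  obtains Q \<sigma> where "Q \<in> carrier_mat n n" "Q\<^sup>T * Q = 1\<^sub>m n" "Q * Q\<^sup>T = 1\<^sub>m n" "\<forall>i<n. \<sigma> i \<ge> 0"
    "card {i. i < n \<and> \<sigma> i \<noteq> 0} = p"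
    "X * minv (X\<^sup>T * X) * X\<^sup>T = Q * mat_diag n (\<lambda>i. if \<sigma> i = 0 then 0 else 1) * Q\<^sup>T"
    "X * (minv (X\<^sup>T * X) * minv (X\<^sup>T * X)) * X\<^sup>T = Q * mat_diag n (\<lambda>i. 1 / \<sigma> i) * Q\<^sup>T"
    "\<forall>a>0. \<forall>s>0. mtrace (minv (a \<cdot>\<^sub>m (X\<^sup>T * X) + s \<cdot>\<^sub>m 1\<^sub>m p)) = (\<Sum>i | i < n \<and> \<sigma> i \<noteq> 0. 1 / (a * \<sigma> i + s))"
proof -
  define S where "S = X\<^sup>T * X"
  have S: "S \<in> carrier_mat p p" using X by (simp add: S_def)
  have dS: "det S \<noteq> 0" using det by (simp add: S_def)
  note mS = minv[OF S dS]
  have "X * X\<^sup>T \<in> carrier_mat n n" using X by simp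
  moreover have "(X * X\<^sup>T)\<^sup>T = X * X\<^sup>T" using gram_symmetric[of "X\<^sup>T"] by simp
  ultimately obtain Q \<sigma> where Q: "Q \<in> carrier_mat n n" "Q\<^sup>T * Q = 1\<^sub>m n" "Q * Q\<^sup>T = 1\<^sub>m n"
    and XQ: "X * X\<^sup>T = Q * mat_diag n \<sigma> * Q\<^sup>T" using real_symmetric_spectral by blast
  note sandwich = sandwich_orthogonal_diag[OF X Q XQ]
  have inv_ev: "minv A *\<^sub>v y = (1 / e) \<cdot>\<^sub>v y"
    if "A \<in> carrier_mat p p" "det A \<noteq> 0" "A *\<^sub>v y = e \<cdot>\<^sub>v y" "y \<in> carrier_vec p" "e \<noteq> 0" for A y e
  proof -
    have "y = minv A *\<^sub>v (e \<cdot>\<^sub>v y)" using minv_mult_vec(2)[OF that(1,2,4)] that(3) by simp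
    also have "\<dots> = e \<cdot>\<^sub>v (minv A *\<^sub>v y)" using minv(1)[OF that(1,2)] that(4) by (rule mult_mat_vec)
    finally have "(1 / e) \<cdot>\<^sub>v y = (1 / e) \<cdot>\<^sub>v (e \<cdot>\<^sub>v (minv A *\<^sub>v y))" by simp
    then show ?thesis using that(5) by (simp add: smult_smult_assoc)
  qed
  have nonneg: "\<sigma> i \<ge> 0" if i: "i < n" for i
  proof -
    have q: "col Q i \<in> carrier_vec n" using Q i by simp
    have "X * X\<^sup>T *\<^sub>v col Q i = \<sigma> i \<cdot>\<^sub>v col Q i"
    proof -
      have "X * 1\<^sub>m p * X\<^sup>T = X * X\<^sup>T" using X by simp
      moreover have "(X * X\<^sup>T) * Q = Q * mat_diag n \<sigma>"
      proof -
        have QD: "Q * mat_diag n \<sigma> \<in> carrier_mat n n" by (rule mult_carrier_mat[OF Q(1) mat_diag_dim])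
        show ?thesis
          unfolding XQ using assoc_mult_mat[OF QD _ Q(1), of "Q\<^sup>T"] Q right_mult_one_mat[OF QD] by simp
      qed
      ultimately have "(X * X\<^sup>T) *\<^sub>v col Q i = col (Q * mat_diag n \<sigma>) i"
        using X Q(1) i by (metis col_mult2 mult_carrier_mat transpose_carrier_mat)
      also have "\<dots> = \<sigma> i \<cdot>\<^sub>v col Q i" using Q(1) i by (subst mat_diag_mult_right[OF Q(1)]) (auto intro!: eq_vecI)
      finally show ?thesis .
    qed
    moreover have "col Q i \<bullet> col Q i = 1"
      using orthogonal_mat_columns(1)[OF Q i i] Q(1) i by (simp add: scalar_prod_def atLeast0LessThan)
    ultimately have "\<sigma> i = col Q i \<bullet> (X * X\<^sup>T *\<^sub>v col Q i)" using q scalar_prod_smult_distrib[OF q q] by simp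
    also have "\<dots> = (X\<^sup>T *\<^sub>v col Q i) \<bullet> (X\<^sup>T *\<^sub>v col Q i)"
      using gram_quadratic[of "X\<^sup>T" p n "col Q i"] X q by simp
    finally show ?thesis using scalar_prod_self_nonneg[of "X\<^sup>T *\<^sub>v col Q i"] by simp
  qed
  have P: "X * minv S * X\<^sup>T = Q * mat_diag n (\<lambda>i. if \<sigma> i = 0 then 0 else 1) * Q\<^sup>T"
  proof -
    have "X * minv S * X\<^sup>T = Q * mat_diag n (\<lambda>i. 1 / \<sigma> i * \<sigma> i) * Q\<^sup>T"
      using inv_ev[OF S dS] by (intro sandwich mS) (auto simp: S_def)
    moreover have "(\<lambda>i. 1 / \<sigma> i * \<sigma> i) = (\<lambda>i. if \<sigma> i = 0 then 0 else 1)" by auto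
    ultimately show ?thesis by simp
  qed
  have B: "X * (minv S * minv S) * X\<^sup>T = Q * mat_diag n (\<lambda>i. 1 / \<sigma> i) * Q\<^sup>T"
  proof -
    have "X * (minv S * minv S) * X\<^sup>T = Q * mat_diag n (\<lambda>i. 1 / \<sigma> i * (1 / \<sigma> i) * \<sigma> i) * Q\<^sup>T"
    proof (rule sandwich)
      show "minv S * minv S \<in> carrier_mat p p" using mS by simp
      fix y i assume iy: "\<sigma> i \<noteq> 0" "y \<in> carrier_vec p" "X\<^sup>T * X *\<^sub>v y = \<sigma> i \<cdot>\<^sub>v y"
      have e: "minv S *\<^sub>v y = (1 / \<sigma> i) \<cdot>\<^sub>v y" using inv_ev[OF S dS _ iy(2,1)] iy(3) by (simp add: S_def)
      have "minv S * minv S *\<^sub>v y = minv S *\<^sub>v (minv S *\<^sub>v y)" using mS(1) iy(2) by (intro assoc_mult_mat_vec)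
      also have "\<dots> = minv S *\<^sub>v ((1 / \<sigma> i) \<cdot>\<^sub>v y)" unfolding e ..
      also have "\<dots> = (1 / \<sigma> i) \<cdot>\<^sub>v (minv S *\<^sub>v y)" using mS(1) iy(2) by (rule mult_mat_vec)
      finally show "minv S * minv S *\<^sub>v y = (1 / \<sigma> i * (1 / \<sigma> i)) \<cdot>\<^sub>v y" unfolding e by (simp add: smult_smult_assoc)
    qed
    moreover have "(\<lambda>i. 1 / \<sigma> i * (1 / \<sigma> i) * \<sigma> i) = (\<lambda>i. 1 / \<sigma> i)" by auto
    ultimately show ?thesis by simp
  qed
  \<comment> \<open>The first compressed matrix is a projection: the number of nonzero
    \<open>\<sigma> i\<close> is its trace, which by cyclicity equals the trace of the identity of
    size \<open>p\<close>.\<close>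
  have card: "real (card {i. i < n \<and> \<sigma> i \<noteq> 0}) = p"
  proof -
    have "mtrace (X * minv S * X\<^sup>T) = mtrace (minv S * X\<^sup>T * X)"
      using mtrace_mult_commute[of X n p "minv S * X\<^sup>T"] X mS(1) by (simp add: assoc_mult_mat[of X n p _ p _ n])
    also have "minv S * X\<^sup>T * X = minv S * S" unfolding S_def[symmetric]
      using X mS(1) by (simp add: assoc_mult_mat[of _ p p _ n _ p] S_def)
    also have "mtrace \<dots> = p" unfolding mS(3) by (rule mtrace_one)
    finally have "(\<Sum>i<n. (if \<sigma> i = 0 then 0 else 1 :: real)) = p"
      unfolding P mtrace_orthogonal_diag[OF Q] .
    moreover have "(\<Sum>i<n. (if \<sigma> i = 0 then 0 else 1 :: real)) = (\<Sum>i | i < n \<and> \<sigma> i \<noteq> 0. 1)"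
      by (rule sum.mono_neutral_cong_right) auto
    ultimately show ?thesis by simp
  qed
  have g: "mtrace (minv (a \<cdot>\<^sub>m S + s \<cdot>\<^sub>m 1\<^sub>m p)) = (\<Sum>i | i < n \<and> \<sigma> i \<noteq> 0. 1 / (a * \<sigma> i + s))" if a: "a > 0" and s: "s > 0" for a s
  proof -
    define L where "L = a \<cdot>\<^sub>m S + s \<cdot>\<^sub>m 1\<^sub>m p"
    interpret L: coercive_mat L p s
      unfolding L_def S_def by (rule coercive_gram[OF X]) (use a s in auto)
    have pos: "a * \<sigma> i + s > 0" if "i < n" for i using nonneg[OF that] a s by (simp add: add_nonneg_pos)
    note R = L.inv_carrier
    have XLX: "X * minv L * X\<^sup>T = Q * mat_diag n (\<lambda>i. 1 / (a * \<sigma> i + s) * \<sigma> i) * Q\<^sup>T"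
    proof (rule sandwich[OF R])
      fix y i assume iy: "i < n" "y \<in> carrier_vec p" "X\<^sup>T * X *\<^sub>v y = \<sigma> i \<cdot>\<^sub>v y"
      have "L *\<^sub>v y = a \<cdot>\<^sub>m S *\<^sub>v y + s \<cdot>\<^sub>m 1\<^sub>m p *\<^sub>v y"
        unfolding L_def using S iy(2) by (intro add_mult_distrib_mat_vec[of _ p p]) auto
      also have "a \<cdot>\<^sub>m S *\<^sub>v y = a \<cdot>\<^sub>v (S *\<^sub>v y)" using S iy(2) by (intro eq_vecI) auto
      also have "S *\<^sub>v y = \<sigma> i \<cdot>\<^sub>v y" using iy(3) by (simp add: S_def)
      also have "s \<cdot>\<^sub>m 1\<^sub>m p *\<^sub>v y = s \<cdot>\<^sub>v y" using iy(2) by (intro eq_vecI) auto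
      also have "a \<cdot>\<^sub>v (\<sigma> i \<cdot>\<^sub>v y) + s \<cdot>\<^sub>v y = (a * \<sigma> i + s) \<cdot>\<^sub>v y" using iy(2) by (auto simp: algebra_simps intro!: eq_vecI)
      finally show "minv L *\<^sub>v y = (1 / (a * \<sigma> i + s)) \<cdot>\<^sub>v y"
        using pos[OF iy(1)] by (intro inv_ev L.det_nz iy(2)) auto
    qed
    have "mtrace (X * minv L * X\<^sup>T) = mtrace (minv L * S)"
      using mtrace_mult_commute[of X n p "minv L * X\<^sup>T"] X R
      by (simp add: assoc_mult_mat[of X n p _ p _ n] assoc_mult_mat[of _ p p _ n _ p] S_def)
    then have t1: "mtrace (minv L * S) = (\<Sum>i<n. 1 / (a * \<sigma> i + s) * \<sigma> i)"
      unfolding XLX mtrace_orthogonal_diag[OF Q] by simp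
    \<comment> \<open>Tracing \<open>1 = a * L\<^sup>-\<^sup>1 S + s * L\<^sup>-\<^sup>1\<close>
      recovers the trace of the inverse of \<open>L\<close> from the trace of
      \<open>L\<^sup>-\<^sup>1 S\<close>, which is known on the side of
      \<open>X * X\<^sup>T\<close>. The terms with \<open>\<sigma> i = 0\<close> drop out, and
      exactly \<open>p\<close> terms remain.\<close>
    have "1\<^sub>m p = minv L * L" using minv(3)[OF L.carrier L.det_nz] by simp
    also have "\<dots> = minv L * (a \<cdot>\<^sub>m S) + minv L * (s \<cdot>\<^sub>m 1\<^sub>m p)"
      unfolding L_def[of] using mult_add_distrib_mat[OF R, of "a \<cdot>\<^sub>m S" p "s \<cdot>\<^sub>m 1\<^sub>m p"] S unfolding L_def by simp
    also have "\<dots> = a \<cdot>\<^sub>m (minv L * S) + s \<cdot>\<^sub>m minv L"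
      using mult_smult_distrib[OF R S, of a] mult_smult_distrib[OF R one_carrier_mat, of s] R by simp
    finally have "mtrace (1\<^sub>m p) = a * mtrace (minv L * S) + s * mtrace (minv L)"
      using mult_carrier_mat[OF R S] R by (simp add: mtrace_add[of _ p] mtrace_smult[of _ p])
    then have e: "s * mtrace (minv L) = p - a * (\<Sum>i<n. 1 / (a * \<sigma> i + s) * \<sigma> i)"
      unfolding t1 mtrace_one by simp
    have "(\<Sum>i<n. 1 / (a * \<sigma> i + s) * \<sigma> i) = (\<Sum>i | i < n \<and> \<sigma> i \<noteq> 0. 1 / (a * \<sigma> i + s) * \<sigma> i)"
      by (rule sum.mono_neutral_right) auto
    then have "s * mtrace (minv L) = (\<Sum>i | i < n \<and> \<sigma> i \<noteq> 0. 1) - a * (\<Sum>i | i < n \<and> \<sigma> i \<noteq> 0. 1 / (a * \<sigma> i + s) * \<sigma> i)"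
      using e card by simp
    also have "\<dots> = (\<Sum>i | i < n \<and> \<sigma> i \<noteq> 0. s * (1 / (a * \<sigma> i + s)))"
      unfolding sum_distrib_left sum_subtractf[symmetric]
    proof (intro sum.cong refl)
      fix i assume "i \<in> {i. i < n \<and> \<sigma> i \<noteq> 0}"
      then have "a * \<sigma> i + s > 0" using pos by simp
      then show "1 - a * (1 / (a * \<sigma> i + s) * \<sigma> i) = s * (1 / (a * \<sigma> i + s))" by (simp add: field_simps)
    qed
    finally have "s * mtrace (minv L) = s * (\<Sum>i | i < n \<and> \<sigma> i \<noteq> 0. 1 / (a * \<sigma> i + s))" by (simp only: sum_distrib_left)
    then show ?thesis using s unfolding L_def by simp
  qed
  show ?thesis
    by (rule that[OF Q]) (use nonneg P B card g in \<open>auto simp: S_def\<close>)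
qed

text \<open>The map that sends \<open>U\<close> to \<open>Q\<^sup>T * U\<close>, written on families
  of entries. As a kernel on index pairs it is \<open>Q\<^sup>T\<close> tensored with the identity
  on columns, the form needed by \<open>std_gaussian_orthogonal_kernel\<close>.\<close>

definition rotate_rows :: "nat \<Rightarrow> nat \<Rightarrow> real mat \<Rightarrow> (nat \<times> nat \<Rightarrow> real) \<Rightarrow> nat \<times> nat \<Rightarrow> real" where
  "rotate_rows n d Q u = (\<lambda>a\<in>{..<n} \<times> {..<d}. \<Sum>b\<in>{..<n} \<times> {..<d}. (if snd a = snd b then Q $$ (fst b, fst a) else 0) * u b)"

lemma rotate_rows_entry:
  assumes "i < n" "k < d"
  shows "rotate_rows n d Q u (i, k) = (\<Sum>j<n. Q $$ (j, i) * u (j, k))"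
proof -
  have "rotate_rows n d Q u (i, k) = (\<Sum>b\<in>{..<n} \<times> {..<d}. (if k = snd b then Q $$ (fst b, i) else 0) * u b)"
    using assms by (simp add: rotate_rows_def cong: if_cong)
  also have "\<dots> = (\<Sum>j<n. \<Sum>l<d. (if k = l then Q $$ (j, i) else 0) * u (j, l))"
    unfolding sum.cartesian_product by (intro sum.cong refl) auto
  also have "\<dots> = (\<Sum>j<n. Q $$ (j, i) * u (j, k))"
    using assms by (simp add: if_distrib[of "\<lambda>z. z * _"] cong: if_cong)
  finally show ?thesis .
qed

lemma distr_rotate_rows:
  assumes Q: "Q \<in> carrier_mat n n" "Q\<^sup>T * Q = 1\<^sub>m n" "Q * Q\<^sup>T = 1\<^sub>m n"
  shows "distr (std_gaussian ({..<n} \<times> {..<d})) (std_gaussian ({..<n} \<times> {..<d})) (rotate_rows n d Q) = std_gaussian ({..<n} \<times> {..<d})"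
  unfolding rotate_rows_def
proof (rule std_gaussian_orthogonal_kernel)
  note orth = orthogonal_mat_columns[OF Q]
  let ?S = "{..<n} \<times> {..<d}"
  show "finite ?S" by simp
  have sumS: "(\<Sum>s\<in>?S. f s) = (\<Sum>j<n. \<Sum>l<d. f (j, l))" for f :: "nat \<times> nat \<Rightarrow> real"
    by (simp add: sum.cartesian_product)
  fix a b assume "a \<in> ?S" "b \<in> ?S"
  then obtain i k j l where ab: "a = (i, k)" "b = (j, l)" "i < n" "k < d" "j < n" "l < d" by auto
  have "(\<Sum>s\<in>?S. (if snd s = snd a then Q $$ (fst a, fst s) else 0) * (if snd s = snd b then Q $$ (fst b, fst s) else 0))
     = (\<Sum>m<n. \<Sum>h<d. (if h = k then (if k = l then Q $$ (i, m) * Q $$ (j, m) else 0) else 0))"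
    unfolding sumS ab by (intro sum.cong refl) auto
  also have "\<dots> = (if a = b then 1 else 0)" using ab orth(2)[of i j] by (cases "k = l") auto
  finally show "(\<Sum>s\<in>?S. (if snd s = snd a then Q $$ (fst a, fst s) else 0) * (if snd s = snd b then Q $$ (fst b, fst s) else 0))
      = (if a = b then 1 else 0)" .
  have "(\<Sum>s\<in>?S. (if snd a = snd s then Q $$ (fst s, fst a) else 0) * (if snd b = snd s then Q $$ (fst s, fst b) else 0))
     = (\<Sum>m<n. \<Sum>h<d. (if h = k then (if k = l then Q $$ (m, i) * Q $$ (m, j) else 0) else 0))"
    unfolding sumS ab by (intro sum.cong refl) auto
  also have "\<dots> = (if a = b then 1 else 0)" using ab orth(1)[of i j] by (cases "k = l") auto
  finally show "(\<Sum>s\<in>?S. (if snd a = snd s then Q $$ (fst s, fst a) else 0) * (if snd b = snd s then Q $$ (fst s, fst b) else 0))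
      = (if a = b then 1 else 0)" .
qed

lemma gram_eq_weighted_gram:
  assumes Q: "Q \<in> carrier_mat n n"
  shows "(mat n d u)\<^sup>T * (Q * mat_diag n b * Q\<^sup>T) * mat n d u + t \<cdot>\<^sub>m 1\<^sub>m d
    = weighted_gram t d {..<n} b (rotate_rows n d Q u)"
proof (rule eq_matI)
  let ?B = "Q * mat_diag n b * Q\<^sup>T"
  have "Q\<^sup>T \<in> carrier_mat n n" using Q by simp
  then have B: "?B \<in> carrier_mat n n" by (rule mult_carrier_mat[OF mult_carrier_mat[OF Q mat_diag_dim]])
  fix k l assume "k < dim_row (weighted_gram t d {..<n} b (rotate_rows n d Q u))"
    "l < dim_col (weighted_gram t d {..<n} b (rotate_rows n d Q u))"
  then have kl: "k < d" "l < d" by (auto simp: weighted_gram_def)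
  have "((mat n d u)\<^sup>T * ?B * mat n d u) $$ (k, l) = (\<Sum>c<n. (\<Sum>a<n. u (a, k) * ?B $$ (a, c)) * u (c, l))"
    using kl B by (auto simp: scalar_prod_def atLeast0LessThan intro!: sum.cong)
  also have "\<dots> = (\<Sum>c<n. \<Sum>a<n. \<Sum>m<n. b m * ((Q $$ (a, m) * u (a, k)) * (Q $$ (c, m) * u (c, l))))"
    by (intro sum.cong refl) (simp add: orthogonal_diag_entry[OF Q] sum_distrib_left sum_distrib_right mult_ac)
  also have "\<dots> = (\<Sum>c<n. \<Sum>m<n. \<Sum>a<n. b m * ((Q $$ (a, m) * u (a, k)) * (Q $$ (c, m) * u (c, l))))"
    by (rule sum.cong[OF refl]) (rule sum.swap)
  also have "\<dots> = (\<Sum>m<n. \<Sum>c<n. \<Sum>a<n. b m * ((Q $$ (a, m) * u (a, k)) * (Q $$ (c, m) * u (c, l))))" by (rule sum.swap)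
  also have "\<dots> = (\<Sum>m<n. \<Sum>a<n. \<Sum>c<n. b m * ((Q $$ (a, m) * u (a, k)) * (Q $$ (c, m) * u (c, l))))"
    by (rule sum.cong[OF refl]) (rule sum.swap)
  also have "\<dots> = (\<Sum>m<n. b m * rotate_rows n d Q u (m, k) * rotate_rows n d Q u (m, l))"
  proof (rule sum.cong[OF refl])
    fix m assume "m \<in> {..<n}"
    then have m: "m < n" by simp
    have "(\<Sum>a<n. \<Sum>c<n. b m * ((Q $$ (a, m) * u (a, k)) * (Q $$ (c, m) * u (c, l))))
      = b m * ((\<Sum>a<n. Q $$ (a, m) * u (a, k)) * (\<Sum>c<n. Q $$ (c, m) * u (c, l)))"
      unfolding sum_product unfolding sum_distrib_left ..
    then show "(\<Sum>a<n. \<Sum>c<n. b m * ((Q $$ (a, m) * u (a, k)) * (Q $$ (c, m) * u (c, l))))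
      = b m * rotate_rows n d Q u (m, k) * rotate_rows n d Q u (m, l)"
      unfolding rotate_rows_entry[OF m kl(1)] rotate_rows_entry[OF m kl(2)] by simp
  qed
  finally show "((mat n d u)\<^sup>T * ?B * mat n d u + t \<cdot>\<^sub>m 1\<^sub>m d) $$ (k, l) = weighted_gram t d {..<n} b (rotate_rows n d Q u) $$ (k, l)"
    using kl by (simp add: weighted_gram_def)
qed (simp_all add: weighted_gram_def)

text \<open>Replacing \<open>U\<close> by \<open>Q\<^sup>T * U\<close> diagonalises the inner matrix
  and leaves the Gaussian law unchanged, so the estimate for diagonal weights carries over with the
  same bound.\<close>

theorem rotated_self_consistent_prob:
  fixes b :: "nat \<Rightarrow> real" and c \<eta> :: real
  assumes Q: "Q \<in> carrier_mat n n" "Q\<^sup>T * Q = 1\<^sub>m n" "Q * Q\<^sup>T = 1\<^sub>m n"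
    and t: "t > 0" and b: "\<And>i. i < n \<Longrightarrow> b i \<ge> 0" and c: "c \<ge> 0" and \<eta>: "\<eta> > 0" and d: "d > 0"
    and large: "c * n / (d * t) \<le> \<eta> * d / 2"
  shows "emeasure (std_gaussian ({..<n} \<times> {..<d})) {u \<in> space (std_gaussian ({..<n} \<times> {..<d})).
      self_consistency_defect t d {..<n} b (mtrace (minv ((mat n d u)\<^sup>T * (Q * mat_diag n b * Q\<^sup>T) * mat n d u + t \<cdot>\<^sub>m 1\<^sub>m d)))
        > \<eta> * d + card {i\<in>{..<n}. b i > c / d}}
    \<le> ennreal (960 * (c * real n) ^ 4 / (\<eta> ^ 4 * t ^ 4 * real d ^ 6))"
proof -
  let ?G = "std_gaussian ({..<n} \<times> {..<d})"
  define E where "E = {u \<in> space ?G. self_consistency_defect t d {..<n} b (mtrace (minv (weighted_gram t d {..<n} b u)))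
        > \<eta> * d + card {i\<in>{..<n}. b i > c / d}}"
  have rm: "rotate_rows n d Q \<in> measurable ?G ?G"
    unfolding rotate_rows_def measurable_cong_sets[OF sets_std_gaussian sets_std_gaussian]
    by (intro measurable_restrict borel_measurable_sum borel_measurable_times borel_measurable_const
        measurable_component_singleton)
  have "(\<lambda>u. mtrace (minv (weighted_gram t d {..<n} b u))) \<in> borel_measurable ?G"
    by (rule measurable_mtrace[OF measurable_mat_minv[OF measurable_weighted_gram[OF order_refl]]])
  then have dm: "(\<lambda>u. self_consistency_defect t d {..<n} b (mtrace (minv (weighted_gram t d {..<n} b u)))) \<in> borel_measurable ?G"
    unfolding self_consistency_defect_def
    by (intro borel_measurable_abs borel_measurable_diff borel_measurable_add borel_measurable_sum
        borel_measurable_divide borel_measurable_times borel_measurable_const)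
  have Em: "E \<in> sets ?G" unfolding E_def by (rule borel_measurable_less[OF borel_measurable_const dm])
  have "{u \<in> space ?G. self_consistency_defect t d {..<n} b (mtrace (minv ((mat n d u)\<^sup>T * (Q * mat_diag n b * Q\<^sup>T) * mat n d u + t \<cdot>\<^sub>m 1\<^sub>m d)))
        > \<eta> * d + card {i\<in>{..<n}. b i > c / d}} = rotate_rows n d Q -` E \<inter> space ?G"
    unfolding E_def gram_eq_weighted_gram[OF Q(1)] using measurable_space[OF rm] by blast
  also have "emeasure ?G \<dots> = emeasure (distr ?G ?G (rotate_rows n d Q)) E" by (rule emeasure_distr[OF rm Em, symmetric])
  also have "\<dots> = emeasure ?G E" unfolding distr_rotate_rows[OF Q] ..
  also have "\<dots> \<le> ennreal (960 * (c * real (card {..<n})) ^ 4 / (\<eta> ^ 4 * t ^ 4 * real d ^ 6))"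
    unfolding E_def by (rule self_consistent_prob) (use assms in auto)
  finally show ?thesis by simp
qed

section \<open>Stieltjes transforms of the limit laws\<close>

text \<open>An explicit antiderivative: the square root itself, an arccosine of an affine function
  of \<open>x\<close>, and an arccosine of a Moebius transform of \<open>x\<close> that accounts for
  the pole at \<open>-c\<close>. Allowing \<open>a + c = 0\<close> covers the case where the support
  touches the pole.\<close>

lemma has_integral_semicircle_resolvent:
  fixes a b c :: real
  assumes ab: "a < b" and c: "a + c \<ge> 0"
  shows "((\<lambda>x. sqrt ((b - x) * (x - a)) / (x + c)) has_integral
    (pi * ((a + b) / 2 + c - sqrt ((a + c) * (b + c))))) {a..b}"
proof -
  define A B where "A = a + c" and "B = b + c"
  have AB: "0 \<le> A" "A < B" using assms by (auto simp: A_def B_def)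
  define S where "S = sqrt (A * B)"
  have S2: "S * S = A * B" using AB by (simp add: S_def)
  \<comment> \<open>Both \<open>u\<close> and \<open>w\<close> are normalised to run from
    \<open>1\<close> at \<open>a\<close> to \<open>-1\<close> at \<open>b\<close>, so each arccosine
    contributes exactly \<open>pi\<close>. If \<open>A = 0\<close> then \<open>w\<close> has no such
    normalisation, but its coefficient \<open>S\<close> vanishes.\<close>
  define u where "u x = (A + B - 2 * (x + c)) / (B - A)" for x
  define w where "w x = (2 * A * B / (x + c) - (A + B)) / (B - A)" for x
  define F where "F x = sqrt ((b - x) * (x - a)) + (A + B) / 2 * arccos (u x) - S * arccos (w x)" for x
  have pos: "0 < x + c" if "a < x" for x using that c by simp
  have u1: "-1 \<le> u x \<and> u x \<le> 1" if "x \<in> {a..b}" for x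
    using that AB by (auto simp: u_def field_simps A_def B_def)
  have w1: "-1 \<le> w x \<and> w x \<le> 1" if "x \<in> {a..b}" "A > 0" for x
  proof -
    have X: "A \<le> x + c" "x + c \<le> B" "0 < x + c" using that by (auto simp: A_def B_def)
    then have "2 * A * B / (x + c) \<le> 2 * B" "2 * A \<le> 2 * A * B / (x + c)"
      using mult_left_mono[OF X(1), of "2 * B"] mult_left_mono[OF X(2), of "2 * A"] X(3) AB
      by (auto simp: pos_divide_le_eq pos_le_divide_eq mult_ac)
    then show ?thesis using AB by (auto simp: w_def field_simps)
  qed
  have "(F has_vector_derivative sqrt ((b - x) * (x - a)) / (x + c)) (at x)" if x: "x \<in> {a<..<b}" for x
  proof -
    define s where "s = sqrt ((b - x) * (x - a))"
    have s0: "s > 0" using x by (simp add: s_def)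
    have s2: "s * s = (b - x) * (x - a)" using x by (simp add: s_def)
    define X where "X = x + c"
    have X: "0 < X" "A < X" "X < B" using x pos[of x] by (auto simp: X_def A_def B_def)
    have sX: "s * s = (B - X) * (X - A)" using s2 by (simp add: X_def A_def B_def)
    have d1: "((\<lambda>x. sqrt ((b - x) * (x - a))) has_real_derivative (A + B - 2 * X) / (2 * s)) (at x)"
      using x s0 unfolding s_def X_def A_def B_def
      by (auto intro!: derivative_eq_intros simp: field_simps)
    have uu: "1 - (u x)\<^sup>2 = (2 * s / (B - A))\<^sup>2"
    proof -
      have "(B - A)\<^sup>2 - (A + B - 2 * X)\<^sup>2 = 4 * (s * s)" unfolding sX by (simp add: power2_eq_square algebra_simps)
      moreover have "1 - (u x)\<^sup>2 = ((B - A)\<^sup>2 - (A + B - 2 * X)\<^sup>2) / (B - A)\<^sup>2"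
        unfolding u_def X_def[symmetric] power_divide using AB by (simp add: diff_divide_distrib)
      ultimately have "1 - (u x)\<^sup>2 = 4 * (s * s) / (B - A)\<^sup>2" by simp
      then show ?thesis by (simp add: power2_eq_square)
    qed
    then have su: "sqrt (1 - (u x)\<^sup>2) = 2 * s / (B - A)" using s0 AB by simp
    have "(u x)\<^sup>2 < 1" using uu s0 AB by (smt (verit) divide_pos_pos zero_less_power)
    then have ux: "-1 < u x" "u x < 1" by (auto simp: abs_square_less_1 abs_less_iff)
    have du: "(u has_real_derivative - 2 / (B - A)) (at x)"
      unfolding u_def by (intro DERIV_cdivide) (auto intro!: derivative_eq_intros)
    have d2: "((\<lambda>x. arccos (u x)) has_real_derivative 1 / s) (at x)"
    proof -
      have "((\<lambda>x. arccos (u x)) has_real_derivative inverse (- sqrt (1 - (u x)\<^sup>2)) * (- 2 / (B - A))) (at x)"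
        by (rule DERIV_chain2[OF DERIV_arccos[OF ux] du])
      also have "inverse (- sqrt (1 - (u x)\<^sup>2)) * (- 2 / (B - A)) = 1 / s"
        unfolding su using s0 AB by (simp add: field_simps)
      finally show ?thesis .
    qed
    have d3: "((\<lambda>x. S * arccos (w x)) has_real_derivative A * B / (X * s)) (at x)"
    proof (cases "A = 0")
      case True
      then show ?thesis by (simp add: S_def)
    next
      case False
      then have A0: "A > 0" and S0: "S > 0" using AB by (auto simp: S_def)
      have ww: "1 - (w x)\<^sup>2 = (2 * S * s / (X * (B - A)))\<^sup>2"
      proof -
        have "(2 * A * B / X - (A + B))\<^sup>2 * X\<^sup>2 = (2 * A * B - (A + B) * X)\<^sup>2"
          using X unfolding power_mult_distrib[symmetric] by (simp add: left_diff_distrib)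
        then have "((B - A)\<^sup>2 - (2 * A * B / X - (A + B))\<^sup>2) * X\<^sup>2 = 4 * (A * B) * ((B - X) * (X - A))"
          by (simp add: power2_eq_square algebra_simps)
        also have "\<dots> = (2 * S * s)\<^sup>2" unfolding sX[symmetric] S2[symmetric] by (simp add: power2_eq_square)
        finally have "(B - A)\<^sup>2 - (2 * A * B / X - (A + B))\<^sup>2 = (2 * S * s)\<^sup>2 / X\<^sup>2"
          using X by (simp add: nonzero_eq_divide_eq)
        moreover have "1 - (w x)\<^sup>2 = ((B - A)\<^sup>2 - (2 * A * B / X - (A + B))\<^sup>2) / (B - A)\<^sup>2"
          unfolding w_def X_def[symmetric] power_divide using AB by (simp add: diff_divide_distrib)
        ultimately show ?thesis by (simp add: power_divide power_mult_distrib)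
      qed
      then have sw: "sqrt (1 - (w x)\<^sup>2) = 2 * S * s / (X * (B - A))" using s0 S0 X AB by simp
      have "(w x)\<^sup>2 < 1" using ww s0 S0 X AB
        by (smt (verit) divide_pos_pos zero_less_power mult_pos_pos)
      then have wx: "-1 < w x" "w x < 1" by (auto simp: abs_square_less_1 abs_less_iff)
      have dw: "(w has_real_derivative - (2 * A * B) / (X * X * (B - A))) (at x)"
      proof -
        have "((\<lambda>x. 2 * A * B / (x + c) - (A + B)) has_real_derivative - (2 * A * B) / (X * X)) (at x)"
          using X(1) unfolding X_def by (auto intro!: derivative_eq_intros)
        from DERIV_cdivide[OF this, of "B - A"] show ?thesis unfolding w_def by simp
      qed
      have "((\<lambda>x. S * arccos (w x)) has_real_derivative S * (inverse (- sqrt (1 - (w x)\<^sup>2)) * (- (2 * A * B) / (X * X * (B - A))))) (at x)"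
        by (intro DERIV_cmult DERIV_chain2[OF DERIV_arccos[OF wx] dw])
      also have "S * (inverse (- sqrt (1 - (w x)\<^sup>2)) * (- (2 * A * B) / (X * X * (B - A)))) = A * B / (X * s)"
        unfolding sw using s0 S0 X AB by (simp add: field_simps)
      finally show ?thesis .
    qed
    have "(F has_real_derivative (A + B - 2 * X) / (2 * s) + (A + B) / 2 * (1 / s) - A * B / (X * s)) (at x)"
      unfolding F_def by (intro DERIV_add DERIV_diff d1 d3 DERIV_cmult d2)
    \<comment> \<open>Over the common denominator \<open>X * s\<close> the numerator is
      \<open>(A + B) * X - X * X - A * B\<close>, which factors as
      \<open>(B - X) * (X - A)\<close>.\<close>
    also have "(A + B - 2 * X) / (2 * s) + (A + B) / 2 * (1 / s) - A * B / (X * s) = (s * s) / (X * s)"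
      unfolding sX using s0 X by (simp add: field_simps)
    also have "\<dots> = s / X" using s0 by simp
    finally show ?thesis unfolding s_def X_def by (simp add: has_real_derivative_iff_has_vector_derivative)
  qed
  moreover have "continuous_on {a..b} F"
  proof -
    have C1: "continuous_on {a..b} (\<lambda>x. S * arccos (w x))"
    proof (cases "A = 0")
      case True then show ?thesis by (simp add: S_def)
    next
      case False
      then have "A > 0" using AB by simp
      then show ?thesis using w1 AB unfolding w_def A_def
        by (intro continuous_intros) auto
    qed
    have C2: "continuous_on {a..b} (\<lambda>x. arccos (u x))"
      using u1 AB unfolding u_def by (intro continuous_intros) auto
    have C3: "continuous_on {a..b} (\<lambda>x. sqrt ((b - x) * (x - a)))" by (intro continuous_intros)
    show ?thesis unfolding F_def
      by (rule continuous_on_diff[OF continuous_on_add[OF C3 continuous_on_mult[OF continuous_on_const C2]] C1])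
  qed
  ultimately have "((\<lambda>x. sqrt ((b - x) * (x - a)) / (x + c)) has_integral (F b - F a)) {a..b}"
    using ab by (intro fundamental_theorem_of_calculus_interior) auto
  moreover have "F a = 0"
  proof -
    have "u a = 1" using AB by (simp add: u_def A_def B_def)
    moreover have "S = 0 \<or> w a = 1" using AB by (auto simp: w_def S_def A_def[symmetric])
    ultimately show ?thesis by (auto simp: F_def)
  qed
  moreover have "F b = pi * ((a + b) / 2 + c - sqrt ((a + c) * (b + c)))"
  proof -
    have "u b = -1" using AB by (simp add: u_def A_def B_def field_simps)
    moreover have "w b = -1" using AB by (simp add: w_def B_def[symmetric] field_simps)
    ultimately show ?thesis unfolding F_def by (simp add: S_def A_def B_def algebra_simps add_divide_distrib)
  qed
  ultimately show ?thesis by simp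
qed

text \<open>The analogue for a half-line. An antiderivative of \<open>sqrt (x - a) / (x + c)\<close>
  is \<open>2 * s - 2 * q * arctan (s / q)\<close> with \<open>s = sqrt (x - a)\<close> and
  \<open>q = sqrt (a + c)\<close>. The growing terms \<open>2 * s\<close> cancel because the
  coefficients sum to zero, the same condition that makes the integral converge.\<close>

lemma nn_integral_sqrt_partial_fractions:
  fixes a :: real and \<alpha> c :: "'k \<Rightarrow> real"
  assumes K: "finite K" and c: "\<And>k. k \<in> K \<Longrightarrow> a + c k \<ge> 0" and \<alpha>: "(\<Sum>k\<in>K. \<alpha> k) = 0"
    and f: "\<And>x. a < x \<Longrightarrow> f x = sqrt (x - a) * (\<Sum>k\<in>K. \<alpha> k / (x + c k))"
    and f0: "\<And>x. a < x \<Longrightarrow> f x \<ge> 0"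
  shows "(\<integral>\<^sup>+x. ennreal (indicator {a..} x * f x) \<partial>lborel) = ennreal (- pi * (\<Sum>k\<in>K. \<alpha> k * sqrt (a + c k)))"
proof -
  define q where "q k = sqrt (a + c k)" for k
  define F where "F x = (\<Sum>k\<in>K. \<alpha> k * (- 2 * q k * arctan (sqrt (x - a) / q k)))" for x
  have q0: "q k \<ge> 0" "q k * q k = a + c k" if "k \<in> K" for k using c[OF that] by (auto simp: q_def)
  have D: "DERIV F x :> f x" if x: "a < x" for x
  proof -
    define s where "s = sqrt (x - a)"
    have s: "s > 0" "s * s = x - a" using x by (auto simp: s_def)
    have Dk: "((\<lambda>x. - 2 * q k * arctan (sqrt (x - a) / q k)) has_real_derivative - (a + c k) / ((x + c k) * s)) (at x)"
      if k: "k \<in> K" for k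
    \<comment> \<open>For \<open>q k = 0\<close> the pole sits at the end point of the support; both
      the arctangent term and its claimed derivative are then zero.\<close>
    proof (cases "q k = 0")
      case True
      then have "a + c k = 0" using q0[OF k] by auto
      then show ?thesis using True by simp
    next
      case False
      then have q: "q k > 0" using q0[OF k] by auto
      have ds: "((\<lambda>x. sqrt (x - a) / q k) has_real_derivative 1 / (2 * s) / q k) (at x)"
        using s x q unfolding s_def by (auto intro!: derivative_eq_intros simp: field_simps)
      have "((\<lambda>x. - 2 * q k * arctan (sqrt (x - a) / q k)) has_real_derivative
         - 2 * q k * (inverse (1 + (sqrt (x - a) / q k)\<^sup>2) * (1 / (2 * s) / q k))) (at x)"
        by (intro DERIV_cmult DERIV_chain2[OF DERIV_arctan ds])
      also have "1 + (sqrt (x - a) / q k)\<^sup>2 = (x + c k) / (q k * q k)"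
      proof -
        have "(sqrt (x - a) / q k)\<^sup>2 = (x - a) / (q k * q k)"
          using x by (simp add: power_divide power2_eq_square)
        then have "1 + (sqrt (x - a) / q k)\<^sup>2 = (q k * q k + (x - a)) / (q k * q k)"
          using q by (simp add: add_divide_distrib)
        then show ?thesis unfolding q0(2)[OF k] by simp
      qed
      also have "- 2 * q k * (inverse ((x + c k) / (q k * q k)) * (1 / (2 * s) / q k)) = - (q k * q k) / ((x + c k) * s)"
      proof -
        have "- 2 * q k * (inverse (Y / (q k * q k)) * (1 / (2 * s) / q k)) = - (q k * q k) / (Y * s)" if "Y > 0" for Y
          using q s(1) that by (simp add: field_simps)
        then show ?thesis using c[OF k] x by simp
      qed
      finally show ?thesis unfolding q0(2)[OF k] .
    qed
    have "(F has_real_derivative (\<Sum>k\<in>K. \<alpha> k * (- (a + c k) / ((x + c k) * s)))) (at x)"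
      unfolding F_def by (intro DERIV_sum DERIV_cmult Dk)
    also have "(\<Sum>k\<in>K. \<alpha> k * (- (a + c k) / ((x + c k) * s))) = (\<Sum>k\<in>K. s * (\<alpha> k / (x + c k)) - \<alpha> k / s)"
    proof (rule sum.cong[OF refl])
      fix k assume "k \<in> K"
      then have p: "x + c k > 0" using c[of k] x by auto
      have "- (a + c k) / ((x + c k) * s) = (s * s - (x + c k)) / ((x + c k) * s)"
        unfolding s(2) by simp
      also have "\<dots> = s / (x + c k) - 1 / s" using p s(1) by (simp add: diff_divide_distrib)
      finally show "\<alpha> k * (- (a + c k) / ((x + c k) * s)) = s * (\<alpha> k / (x + c k)) - \<alpha> k / s"
        by (simp add: right_diff_distrib)
    qed
    also have "\<dots> = f x" unfolding f[OF x] s_def[symmetric]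
      by (simp add: sum_subtractf sum_distrib_left sum_divide_distrib[symmetric] \<alpha>)
    finally show ?thesis .
  qed
  have cont: "isCont f x" if x: "a < x" for x
  proof -
    have "isCont (\<lambda>x. sqrt (x - a) * (\<Sum>k\<in>K. \<alpha> k / (x + c k))) x"
      using x c by (intro continuous_intros) (fastforce)+
    moreover have "eventually (\<lambda>y. f y = sqrt (y - a) * (\<Sum>k\<in>K. \<alpha> k / (y + c k))) (nhds x)"
      using eventually_nhds_in_open[of "{a<..}" x] x by (auto elim!: eventually_mono simp: f)
    ultimately show ?thesis
      using isCont_cong[of f "\<lambda>x. sqrt (x - a) * (\<Sum>k\<in>K. \<alpha> k / (x + c k))" x] by simp
  qed
  have lim_a: "((F \<circ> real_of_ereal) \<longlongrightarrow> 0) (at_right (ereal a))"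
  proof -
    have "isCont (\<lambda>x. arctan (sqrt (x - a) / q k)) a" for k
      by (cases "q k = 0") (auto intro!: continuous_intros)
    then have "isCont F a"
      unfolding F_def by (intro continuous_sum continuous_mult continuous_const)
    then have "(F \<longlongrightarrow> F a) (at_right a)"
      by (simp add: continuous_at_imp_continuous_at_within continuous_within filterlim_at_split isContD)
    moreover have "F a = 0" by (simp add: F_def)
    ultimately show ?thesis by (simp add: ereal_tendsto_simps)
  qed
  have lim_inf: "((F \<circ> real_of_ereal) \<longlongrightarrow> - pi * (\<Sum>k\<in>K. \<alpha> k * sqrt (a + c k))) (at_left \<infinity>)"
  proof -
    have lim: "((\<lambda>x. - 2 * q k * arctan (sqrt (x - a) / q k)) \<longlongrightarrow> - 2 * q k * (pi / 2)) at_top" if k: "k \<in> K" for k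
    proof (cases "q k = 0")
      case True then show ?thesis by simp
    next
      case False
      then have q: "q k > 0" using q0[OF k] by auto
      have "filterlim (\<lambda>x. sqrt (x - a) / q k) at_top at_top"
        using q by real_asymp
      then have "((\<lambda>x. arctan (sqrt (x - a) / q k)) \<longlongrightarrow> pi / 2) at_top"
        by (rule filterlim_compose[OF tendsto_arctan_at_top])
      then show ?thesis by (rule tendsto_mult_left)
    qed
    have "(F \<longlongrightarrow> (\<Sum>k\<in>K. \<alpha> k * (- 2 * q k * (pi / 2)))) at_top"
      unfolding F_def by (intro tendsto_sum tendsto_mult[OF tendsto_const lim])
    also have "(\<Sum>k\<in>K. \<alpha> k * (- 2 * q k * (pi / 2))) = - pi * (\<Sum>k\<in>K. \<alpha> k * sqrt (a + c k))"
      by (simp add: q_def sum_distrib_left sum_negf mult.commute mult.left_commute)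
    finally show ?thesis by (simp add: ereal_tendsto_simps)
  qed
  note FTC = interval_integral_FTC_nonneg[of "ereal a" "\<infinity>" F f 0 "- pi * (\<Sum>k\<in>K. \<alpha> k * sqrt (a + c k))"]
  have int: "set_integrable lborel {a<..} f" "(LBINT x=ereal a..\<infinity>. f x) = - pi * (\<Sum>k\<in>K. \<alpha> k * sqrt (a + c k)) - 0"
    using FTC D cont f0 lim_a lim_inf by (auto simp: einterval_def greaterThan_def)
  have ae: "(\<integral>\<^sup>+x. ennreal (indicator {a..} x * f x) \<partial>lborel) = (\<integral>\<^sup>+x. ennreal (indicator {a<..} x * f x) \<partial>lborel)"
  proof (rule nn_integral_cong_AE)
    show "AE x in lborel. ennreal (indicator {a..} x * f x) = ennreal (indicator {a<..} x * f x)"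
      using AE_lborel_singleton[of a] by eventually_elim (auto split: split_indicator)
  qed
  also have "\<dots> = ennreal (LINT x|lborel. indicator {a<..} x * f x)"
    using int(1) f0 by (intro nn_integral_eq_integral) (auto simp: set_integrable_def split: split_indicator)
  also have "(LINT x|lborel. indicator {a<..} x * f x) = (LBINT x=ereal a..\<infinity>. f x)"
    by (simp add: interval_lebesgue_integral_def einterval_def set_lebesgue_integral_def greaterThan_def)
  finally show ?thesis unfolding int by simp
qed

section \<open>Laws with a density and an atom at zero\<close>

lemma nn_integral_add_measure:
  assumes "sets \<nu> = sets borel" "sets \<rho> = sets borel" and h: "h \<in> borel_measurable borel"
  shows "(\<integral>\<^sup>+x. h x \<partial>add_measure \<nu> \<rho>) = (\<integral>\<^sup>+x. h x \<partial>\<nu>) + (\<integral>\<^sup>+x. h x \<partial>\<rho>)"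
  using h
proof (induction rule: borel_measurable_induct)
  have m: "f \<in> borel_measurable N" if "f \<in> borel_measurable borel" "sets N = sets borel" for f :: "real \<Rightarrow> ennreal" and N
    using that by (simp cong: measurable_cong_sets)
  note sets = assms(1,2) sets_add_measure[of \<nu> \<rho>]
  {
    case (cong f g)
    then show ?case by (simp add: fun_eq_iff[THEN iffD2])
  next
    case (set A)
    then show ?case using sets by (simp add: emeasure_add_measure)
  next
    case (mult u c)
    then show ?case using sets by (simp add: nn_integral_cmult m distrib_left)
  next
    case (add u v)
    then show ?case using sets by (simp add: nn_integral_add m ac_simps)
  next
    case (seq U)
    have U: "U i \<in> borel_measurable N" if "sets N = sets borel" for N i using seq(1) m that by blast
    have eq: "(\<integral>\<^sup>+x. (SUP i. U i x) \<partial>N) = (SUP i. \<integral>\<^sup>+x. U i x \<partial>N)" if "sets N = sets borel" for N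
      by (rule nn_integral_monotone_convergence_SUP[OF seq(3)]) (rule U[OF that])
    have mono: "incseq (\<lambda>i. \<integral>\<^sup>+x. U i x \<partial>N)" for N
      using seq(3) by (intro incseq_SucI nn_integral_mono) (auto simp: incseq_Suc_iff le_fun_def)
    show ?case
      unfolding SUP_apply[abs_def] eq[OF sets(1)] eq[OF sets(2)] eq[OF sets(3)]
      by (simp add: seq.IH ennreal_SUP_add[OF mono mono])
  }
qed

text \<open>The common shape of both limit laws. The mass \<open>min 1 \<beta>\<close> complements
  the atom of mass \<open>max 0 (1 - \<beta>)\<close>, so one computation of the total mass covers
  \<open>\<beta> < 1\<close> and \<open>\<beta> \<ge> 1\<close>.\<close>

locale density_with_atom =
  fixes f :: "real \<Rightarrow> real" and \<beta> :: real
  assumes f [measurable]: "f \<in> borel_measurable borel"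
    and f_neg: "\<And>x. x < 0 \<Longrightarrow> f x = 0" and \<beta>: "\<beta> > 0"
    and mass: "(\<integral>\<^sup>+x. ennreal (f x) \<partial>lborel) = ennreal (min 1 \<beta>)"
begin

definition law :: "real measure" where
  "law = add_measure (density lborel (\<lambda>x. ennreal (f x))) (atom_at_zero \<beta>)"

lemma nn_integral_law:
  assumes h: "h \<in> borel_measurable borel"
  shows "(\<integral>\<^sup>+x. h x \<partial>law) = (\<integral>\<^sup>+x. ennreal (f x) * h x \<partial>lborel) + ennreal (max 0 (1 - \<beta>)) * h 0"
proof -
  have "(\<integral>\<^sup>+x. h x \<partial>law) = (\<integral>\<^sup>+x. h x \<partial>density lborel (\<lambda>x. ennreal (f x))) + (\<integral>\<^sup>+x. h x \<partial>atom_at_zero \<beta>)"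
    unfolding law_def by (rule nn_integral_add_measure) (use h in \<open>auto simp: atom_at_zero_def\<close>)
  also have "(\<integral>\<^sup>+x. h x \<partial>density lborel (\<lambda>x. ennreal (f x))) = (\<integral>\<^sup>+x. ennreal (f x) * h x \<partial>lborel)"
    using h by (intro nn_integral_density) auto
  also have "(\<integral>\<^sup>+x. h x \<partial>atom_at_zero \<beta>) = ennreal (max 0 (1 - \<beta>)) * h 0"
    unfolding atom_at_zero_def using h by (simp add: nn_integral_scale_measure nn_integral_return max_def)
  finally show ?thesis .
qed

lemma sets_law [simp]: "sets law = sets borel"
  by (simp add: law_def)

lemma real_distribution_law: "real_distribution law"
proof -
  have "emeasure law UNIV = (\<integral>\<^sup>+x. 1 \<partial>law)" using sets_eq_imp_space_eq[OF sets_law] by simp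
  also have "\<dots> = ennreal (min 1 \<beta>) + ennreal (max 0 (1 - \<beta>))" by (subst nn_integral_law) (auto simp: mass)
  also have "\<dots> = ennreal (min 1 \<beta> + max 0 (1 - \<beta>))" using \<beta> by (intro ennreal_plus[symmetric]) auto
  also have "min 1 \<beta> + max 0 (1 - \<beta>) = 1" by auto
  finally have "prob_space law"
    using sets_eq_imp_space_eq[OF sets_law] by (intro prob_spaceI) simp
  then show ?thesis
    using sets_eq_imp_space_eq[OF sets_law] by (simp add: real_distribution_def real_distribution_axioms_def)
qed

lemma AE_law_nonneg: "AE x in law. x \<ge> 0"
proof -
  have "(\<integral>\<^sup>+x. indicator {..<0} x \<partial>law) = 0"
  proof (subst nn_integral_law)
    have "(\<integral>\<^sup>+x. ennreal (f x) * indicator {..<0} x \<partial>lborel) = (\<integral>\<^sup>+(x::real). 0 \<partial>lborel)"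
      by (rule nn_integral_cong) (auto simp: f_neg split: split_indicator)
    then show "(\<integral>\<^sup>+x. ennreal (f x) * indicator {..<0} x \<partial>lborel) + ennreal (max 0 (1 - \<beta>)) * indicator {..<0} (0::real) = 0"
      by simp
  qed auto
  then have "emeasure law {..<0} = 0" by simp
  then show ?thesis
    by (intro AE_I[of _ _ "{..<0}"]) auto
qed

text \<open>\<open>ennreal\<close> sends negative numbers to \<open>0\<close>, so the integral
  formula alone does not give the sign of \<open>V\<close>. A negative \<open>V\<close> would force
  the density to be nonpositive almost everywhere, against its positive mass. This avoids checking
  the sign of the closed formulas by hand.\<close>

lemma resolvent_value_nonneg:
  assumes t: "t > 0" and V: "(\<integral>\<^sup>+x. ennreal (f x * (1 / (x + t))) \<partial>lborel) = ennreal V"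
  shows "V \<ge> 0"
proof (rule ccontr)
  assume "\<not> V \<ge> 0"
  then have "(\<integral>\<^sup>+x. ennreal (f x * (1 / (x + t))) \<partial>lborel) = 0" unfolding V by (simp add: ennreal_neg)
  then have "AE x in lborel. ennreal (f x * (1 / (x + t))) = 0"
    by (subst (asm) nn_integral_0_iff_AE) auto
  then have "AE x in lborel. ennreal (f x) = 0"
  proof eventually_elim
    case (elim x)
    show ?case
    proof (cases "x < 0")
      case False
      then have "1 / (x + t) > 0" using t by simp
      moreover have "f x * (1 / (x + t)) \<le> 0" using elim by (simp add: ennreal_eq_0_iff)
      ultimately have "f x \<le> 0" by (simp only: mult_le_0_iff) auto
      then show ?thesis by (simp add: ennreal_neg)
    qed (simp add: f_neg)
  qed
  then have "(\<integral>\<^sup>+x. ennreal (f x) \<partial>lborel) = 0" by (subst nn_integral_0_iff_AE) auto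
  then show False using mass \<beta> by (auto simp: min_def ennreal_eq_0_iff split: if_splits)
qed

lemma resolvent_law:
  assumes t: "t > 0" and V: "(\<integral>\<^sup>+x. ennreal (f x * (1 / (x + t))) \<partial>lborel) = ennreal V" "V \<ge> 0"
  shows "(LINT x|law. 1 / (x + t)) = V + max 0 (1 - \<beta>) / t"
    and "t * (V + max 0 (1 - \<beta>) / t) \<le> 1"
proof -
  interpret real_distribution law by (rule real_distribution_law)
  have pos: "AE x in law. 0 \<le> 1 / (x + t)" using AE_law_nonneg by eventually_elim (use t in auto)
  have "(\<integral>\<^sup>+x. ennreal (1 / (x + t)) \<partial>law) = (\<integral>\<^sup>+x. ennreal (f x) * ennreal (1 / (x + t)) \<partial>lborel) + ennreal (max 0 (1 - \<beta>)) * ennreal (1 / t)"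
    by (subst nn_integral_law) auto
  also have "(\<integral>\<^sup>+x. ennreal (f x) * ennreal (1 / (x + t)) \<partial>lborel) = (\<integral>\<^sup>+x. ennreal (f x * (1 / (x + t))) \<partial>lborel)"
  proof (rule nn_integral_cong)
    fix x :: real
    show "ennreal (f x) * ennreal (1 / (x + t)) = ennreal (f x * (1 / (x + t)))"
    proof (cases "x < 0")
      case False
      then have "0 \<le> 1 / (x + t)" using t by simp
      then show ?thesis by (simp only: ennreal_mult'')
    qed (simp add: f_neg)
  qed
  also have "\<dots> + ennreal (max 0 (1 - \<beta>)) * ennreal (1 / t) = ennreal (V + max 0 (1 - \<beta>) / t)"
  proof -
    have "ennreal (max 0 (1 - \<beta>)) * ennreal (1 / t) = ennreal (max 0 (1 - \<beta>) / t)"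
      using t by (subst ennreal_mult[symmetric]) auto
    then show ?thesis unfolding V(1) using V(2) t by (subst ennreal_plus) auto
  qed
  finally have nn: "(\<integral>\<^sup>+x. ennreal (1 / (x + t)) \<partial>law) = ennreal (V + max 0 (1 - \<beta>) / t)" .
  have m0: "0 \<le> V + max 0 (1 - \<beta>) / t" using V(2) t by auto
  show i: "(LINT x|law. 1 / (x + t)) = V + max 0 (1 - \<beta>) / t"
    using pos m0 by (subst integral_eq_nn_integral) (auto simp: nn)
  have "(LINT x|law. 1 / (x + t)) \<le> (LINT x|law. 1 / t)"
  proof (rule integral_mono_AE)
    show "AE x in law. 1 / (x + t) \<le> 1 / t" using AE_law_nonneg by eventually_elim (use t in \<open>auto simp: field_simps\<close>)
    show "integrable law (\<lambda>x. 1 / (x + t))" using pos by (intro integrableI_nonneg) (auto simp: nn)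
  qed simp
  then show "t * (V + max 0 (1 - \<beta>) / t) \<le> 1" unfolding i using t prob_space by (simp add: field_simps)
qed

end

section \<open>The two limit laws and the equations for their transforms\<close>

lemma nn_integral_indicator_has_integral:
  fixes f :: "real \<Rightarrow> real"
  assumes "f \<in> borel_measurable borel" "(f has_integral I) {a..b}" "\<And>x. x \<in> {a..b} \<Longrightarrow> 0 \<le> f x"
  shows "(\<integral>\<^sup>+x. ennreal (indicator {a..b} x * f x) \<partial>lborel) = ennreal I"
proof (rule nn_integral_has_integral_lborel)
  show "(\<lambda>x. indicator {a..b} x * f x) \<in> borel_measurable borel"
    by (intro borel_measurable_times borel_measurable_indicator assms(1)) simp
  show "0 \<le> indicator {a..b} x * f x" for x using assms(3) by (auto split: split_indicator)
  have "((\<lambda>x. if x \<in> {a..b} then f x else 0) has_integral I) UNIV"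
    using assms(2) by (simp only: has_integral_restrict_UNIV)
  moreover have "(\<lambda>x. if x \<in> {a..b} then f x else 0) = (\<lambda>x. indicator {a..b} x * f x)"
    by (auto split: split_indicator)
  ultimately show "((\<lambda>x. indicator {a..b} x * f x) has_integral I) UNIV" by simp
qed

text \<open>Here \<open>s\<close> is the value of the square root at \<open>x\<close>. The support
  can reach \<open>x = 0\<close> only where the root vanishes, and then both sides are
  \<open>0\<close> by the convention for division by zero. In the third identity
  \<open>t \<noteq> 1\<close> keeps the poles at \<open>-1\<close> and \<open>-t\<close>
  apart.\<close>

lemma sqrt_partial_fractions:
  fixes x t s :: real
  assumes t: "t > 0" and x: "x \<ge> 0" and s: "x = 0 \<Longrightarrow> s = 0"
  shows "s / (x + 0) - s / (x + 1) = s * (1 / (x * (x + 1)))"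
    and "1 / t * (s / (x + 0)) - 1 / t * (s / (x + t)) = s * (1 / x * (1 / (x + t)))"
    and "t \<noteq> 1 \<Longrightarrow> 1 / t * (s / (x + 0)) + - 1 / (t - 1) * (s / (x + 1)) + 1 / (t * (t - 1)) * (s / (x + t))
      = s * (1 / (x * (x + 1)) * (1 / (x + t)))"
proof -
  show "s / (x + 0) - s / (x + 1) = s * (1 / (x * (x + 1)))"
    using x s by (cases "x = 0") (auto simp: field_simps)
  show "1 / t * (s / (x + 0)) - 1 / t * (s / (x + t)) = s * (1 / x * (1 / (x + t)))"
  proof (cases "x = 0")
    case False
    then show ?thesis using x t by (simp add: divide_simps) (simp add: algebra_simps)
  qed (use s in simp)
  assume "t \<noteq> 1"
  show "1 / t * (s / (x + 0)) + - 1 / (t - 1) * (s / (x + 1)) + 1 / (t * (t - 1)) * (s / (x + t))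
      = s * (1 / (x * (x + 1)) * (1 / (x + t)))"
  proof (cases "x = 0")
    case False
    then have nz: "x \<noteq> 0" "x + 1 \<noteq> 0" "x + t \<noteq> 0" "t \<noteq> 0" "t - 1 \<noteq> 0" using x t \<open>t \<noteq> 1\<close> by auto
    have "(1 / t * (s / (x + 0)) + - 1 / (t - 1) * (s / (x + 1)) + 1 / (t * (t - 1)) * (s / (x + t))) * (t * (t - 1) * x * (x + 1) * (x + t))
       = s * (t - 1) * (x + 1) * (x + t) - s * t * x * (x + t) + s * x * (x + 1)"
    proof -
      have "1 / t * (s / (x + 0)) * (t * (t - 1) * x * (x + 1) * (x + t)) = s * (t - 1) * (x + 1) * (x + t)"
        "- 1 / (t - 1) * (s / (x + 1)) * (t * (t - 1) * x * (x + 1) * (x + t)) = - s * t * x * (x + t)"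
        "1 / (t * (t - 1)) * (s / (x + t)) * (t * (t - 1) * x * (x + 1) * (x + t)) = s * x * (x + 1)"
        using nz by (simp_all add: divide_simps)
      then show ?thesis by (simp only: distrib_right)
    qed
    also have "\<dots> = s * t * (t - 1)" by (simp add: algebra_simps)
    also have "\<dots> = s * (1 / (x * (x + 1)) * (1 / (x + t))) * (t * (t - 1) * x * (x + 1) * (x + t))"
      using nz by (simp add: divide_simps)
    finally show ?thesis using nz by (subst (asm) mult_cancel_right) auto
  qed (use s in simp)
qed

lemma min_one_eq: "(1 + \<beta> - \<bar>1 - \<beta>\<bar>) / 2 = min 1 (\<beta>::real)"
  by (auto simp: min_def)

text \<open>Partial fractions reduce mass and transform to the semicircle integral with
  \<open>c = 0\<close> and \<open>c = t\<close>. The resulting closed form is a root of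
  \<open>t * m\<^sup>2 + (t + \<beta> - 1) * m - 1 = 0\<close>, which is the limiting equation
  cleared of its denominator.\<close>

lemma marchenko_pastur_law:
  assumes \<beta>: "\<beta> > 0"
  shows "real_distribution (marchenko_pastur \<beta>)" and "AE x in marchenko_pastur \<beta>. x \<ge> 0"
    and "\<And>t. t > 0 \<Longrightarrow> \<exists>m>0. (LINT x|marchenko_pastur \<beta>. 1 / (x + t)) = m \<and> t * m + \<beta> * m / (1 + m) = 1"
proof -
  define a b where "a = (sqrt \<beta> - 1)\<^sup>2" and "b = (sqrt \<beta> + 1)\<^sup>2"
  have sb: "sqrt \<beta> * sqrt \<beta> = \<beta>" "sqrt \<beta> > 0" using \<beta> by auto
  have "b - a = 4 * sqrt \<beta>" by (simp add: a_def b_def power2_eq_square algebra_simps)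
  then have "a < b" using sb(2) by linarith
  moreover have "a \<ge> 0" by (simp add: a_def)
  ultimately have ab: "a < b" "a \<ge> 0" by auto
  have sum: "a + b = 2 * (1 + \<beta>)" using sb by (simp add: a_def b_def power2_eq_square algebra_simps)
  have "a * b = (\<beta> - 1)\<^sup>2"
  proof -
    have "a * b = ((sqrt \<beta> - 1) * (sqrt \<beta> + 1))\<^sup>2" by (simp add: a_def b_def power_mult_distrib)
    also have "(sqrt \<beta> - 1) * (sqrt \<beta> + 1) = \<beta> - 1" using sb by (simp add: algebra_simps)
    finally show ?thesis .
  qed
  then have prod: "a * b = (1 - \<beta>)\<^sup>2" by (simp add: power2_commute)
  define q where "q x = sqrt ((b - x) * (x - a))" for x
  define w where "w x = 1 / (2 * pi * x) * sqrt (4 * \<beta> - (\<beta> + 1 - x)\<^sup>2)" for x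
  define f where "f x = indicator {a..b} x * w x" for x
  have poly: "4 * \<beta> - (\<beta> + 1 - x)\<^sup>2 = (b - x) * (x - a)" for x
  proof -
    have "(b - x) * (x - a) = (a + b) * x - a * b - x * x" by (simp add: algebra_simps)
    then show ?thesis unfolding sum prod by (simp add: power2_eq_square algebra_simps)
  qed
  have fw: "w x = 1 / (2 * pi) * (q x * (1 / x))" for x
    unfolding w_def poly q_def by simp
  have q0: "q x \<ge> 0" "x = 0 \<Longrightarrow> q x = 0" if "x \<in> {a..b}" for x
    using that ab by (auto simp: q_def)
  have qm [measurable]: "q \<in> borel_measurable borel" unfolding q_def by measurable
  have wm [measurable]: "w \<in> borel_measurable borel" unfolding w_def by measurable
  have fm: "f \<in> borel_measurable borel" unfolding f_def by measurable
  note J = has_integral_semicircle_resolvent[OF ab(1), folded q_def]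
  have S0: "sqrt ((a + 0) * (b + 0)) = \<bar>1 - \<beta>\<bar>" using prod by simp
  have mass: "(\<integral>\<^sup>+x. ennreal (f x) \<partial>lborel) = ennreal (min 1 \<beta>)"
    unfolding f_def
  proof (rule nn_integral_indicator_has_integral[OF wm])
    have "((\<lambda>x. 1 / (2 * pi) * (q x / (x + 0))) has_integral 1 / (2 * pi) * (pi * ((a + b) / 2 + 0 - sqrt ((a + 0) * (b + 0))))) {a..b}"
      using J[of 0] ab(2) by (intro has_integral_mult_right) simp
    also have "(\<lambda>x. 1 / (2 * pi) * (q x / (x + 0))) = w" unfolding fw by auto
    also have "1 / (2 * pi) * (pi * ((a + b) / 2 + 0 - sqrt ((a + 0) * (b + 0)))) = min 1 \<beta>"
      unfolding S0 sum min_one_eq[symmetric] by simp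
    finally show "(w has_integral min 1 \<beta>) {a..b}" .
    show "0 \<le> w x" if "x \<in> {a..b}" for x using q0[OF that] ab that unfolding fw by auto
  qed
  interpret D: density_with_atom f \<beta>
    by standard (use fm \<beta> mass ab in \<open>auto simp: f_def\<close>)
  have law: "D.law = marchenko_pastur \<beta>"
    unfolding D.law_def marchenko_pastur_def f_def w_def a_def b_def ..
  show "real_distribution (marchenko_pastur \<beta>)" "AE x in marchenko_pastur \<beta>. x \<ge> 0"
    using D.real_distribution_law D.AE_law_nonneg unfolding law by auto
  fix t :: real assume t: "t > 0"
  define R where "R = sqrt ((a + t) * (b + t))"
  define V where "V = 1 / (2 * pi) * (1 / t * (pi * ((a + b) / 2 + 0 - sqrt ((a + 0) * (b + 0)))) - 1 / t * (pi * ((a + b) / 2 + t - R)))"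
  have V: "(\<integral>\<^sup>+x. ennreal (f x * (1 / (x + t))) \<partial>lborel) = ennreal V"
    unfolding f_def mult.assoc
  proof (rule nn_integral_indicator_has_integral)
    show "(\<lambda>x. w x * (1 / (x + t))) \<in> borel_measurable borel" by measurable
    have "((\<lambda>x. 1 / (2 * pi) * (1 / t * (q x / (x + 0)) - 1 / t * (q x / (x + t)))) has_integral V) {a..b}"
      unfolding V_def R_def using J[of 0] J[of t] ab(2) t by (intro has_integral_mult_right has_integral_diff) auto
    then show "((\<lambda>x. w x * (1 / (x + t))) has_integral V) {a..b}"
    proof (rule has_integral_eq[rotated])
      fix x assume x: "x \<in> {a..b}"
      then show "1 / (2 * pi) * (1 / t * (q x / (x + 0)) - 1 / t * (q x / (x + t))) = w x * (1 / (x + t))"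
        using sqrt_partial_fractions(2)[of t x "q x"] t ab q0[OF x] unfolding fw by simp
    qed
    show "0 \<le> w x * (1 / (x + t))" if "x \<in> {a..b}" for x using q0[OF that] ab that t unfolding fw by auto
  qed
  have "V \<ge> 0" by (rule D.resolvent_value_nonneg[OF t V])
  note res = D.resolvent_law[OF t V this]
  define m where "m = V + max 0 (1 - \<beta>) / t"
  have R2: "R * R = (t + \<beta> - 1)\<^sup>2 + 4 * t"
  proof -
    have "R * R = (a + t) * (b + t)" using ab t by (simp add: R_def)
    also have "\<dots> = a * b + (a + b) * t + t * t" by (simp add: algebra_simps)
    also have "\<dots> = (t + \<beta> - 1)\<^sup>2 + 4 * t" unfolding sum prod by (simp add: power2_eq_square algebra_simps)
    finally show ?thesis .
  qed
  \<comment> \<open>The atom removes the absolute value, since \<open>2 * max 0 (1 - \<beta>) -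
    \<bar>1 - \<beta>\<bar> = 1 - \<beta>\<close>; hence a single quadratic equation holds for every
    \<open>\<beta>\<close>.\<close>
  have "2 * t * V = R - t - \<bar>1 - \<beta>\<bar>" unfolding V_def S0 using t by (simp add: field_simps)
  moreover have "2 * t * m = 2 * t * V + 2 * max 0 (1 - \<beta>)" using t by (simp add: m_def field_simps)
  ultimately have m: "2 * t * m = R - (t + \<beta> - 1)" by (auto simp: max_def abs_if split: if_splits)
  have "(2 * t * m + (t + \<beta> - 1))\<^sup>2 = (t + \<beta> - 1)\<^sup>2 + 4 * t" using R2 m by (simp add: power2_eq_square)
  then have "4 * t * (t * m * m + (t + \<beta> - 1) * m - 1) = 0" by (simp add: power2_eq_square algebra_simps)
  then have quad: "t * m * m + (t + \<beta> - 1) * m - 1 = 0" using t by simp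
  have "m \<ge> 0" unfolding m_def using \<open>V \<ge> 0\<close> t by simp
  moreover have "m \<noteq> 0" using quad by auto
  ultimately have m0: "m > 0" by simp
  have "t * m * (1 + m) + \<beta> * m = 1 + m" using quad by (simp add: algebra_simps)
  then have "t * m + \<beta> * m / (1 + m) = 1" using m0 by (simp add: field_simps)
  then show "\<exists>m>0. (LINT x|marchenko_pastur \<beta>. 1 / (x + t)) = m \<and> t * m + \<beta> * m / (1 + m) = 1"
    using res(1) m0 unfolding law m_def by blast
qed

text \<open>The final equation is the system \<open>t * m + m * g = 1\<close>,
  \<open>m * g + \<beta> * (1 + l) * g / (1 + g) = \<beta>\<close> with \<open>g\<close> eliminated;
  \<open>g\<close> is the limit of the resolvent trace of the Gram matrix of \<open>X\<close> at the
  point \<open>r * m\<close>. The bound \<open>t * m \<le> 1\<close> makes the recovered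
  \<open>g\<close> nonnegative.\<close>

lemma coeff_law_law:
  assumes \<beta>: "\<beta> > 0" and l: "l \<ge> 0"
  shows "real_distribution (coeff_law l \<beta>)" and "AE x in coeff_law l \<beta>. x \<ge> 0"
    and "\<And>t. t > 1 \<Longrightarrow> \<exists>m>0. (LINT x|coeff_law l \<beta>. 1 / (x + t)) = m \<and> t * m \<le> 1 \<and>
      (1 - t * m) * (1 + m * (1 - t) + \<beta> * (1 + l)) = \<beta> * (1 + m * (1 - t))"
proof -
  define Q where "Q x = - (\<beta> - 1)\<^sup>2 + 2 * \<beta> * ((1 + \<beta>) * l + 2) * x - \<beta>\<^sup>2 * l\<^sup>2 * x\<^sup>2" for x
  \<comment> \<open>The polynomial \<open>Q\<close> is negative to the left of its smallest zero,
    hence \<open>R\<close> gives the root at the poles \<open>0\<close>, \<open>-1\<close> and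
    \<open>-t\<close>. Expressing both cases of \<open>l\<close> through \<open>R\<close> yields one
    formula \<open>V\<close>; at the pole \<open>-1\<close> the radicand is a perfect
    square.\<close>
  define R where "R c = sqrt (- Q (- c))" for c
  define w where "w x = 1 / (2 * pi) * (1 / (x * (x + 1))) * sqrt (Q x)" for x
  define f where "f x = indicator (coeff_law_support l \<beta>) x * w x" for x
  define V where "V t = (- (1 / t) * R 0 + 1 / (t - 1) * R 1 - 1 / (t * (t - 1)) * R t) / 2" for t
  have R0: "R 0 = \<bar>1 - \<beta>\<bar>" by (simp add: R_def Q_def power2_commute[of \<beta>])
  have R1: "R 1 = \<beta> * l + 1 + \<beta>"
  proof -
    have "- Q (- 1) = (\<beta> * l + 1 + \<beta>)\<^sup>2" by (simp add: Q_def power2_eq_square algebra_simps)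
    then show ?thesis using \<beta> l by (simp add: R_def)
  qed
  have wm [measurable]: "w \<in> borel_measurable borel" unfolding w_def Q_def by measurable
  have fm: "f \<in> borel_measurable borel" unfolding f_def coeff_law_support_def
    by (cases "l = 0") (auto intro!: borel_measurable_times borel_measurable_indicator wm)
  have "(\<forall>x<0. f x = 0) \<and> (\<integral>\<^sup>+x. ennreal (f x) \<partial>lborel) = ennreal (min 1 \<beta>) \<and>
    (\<forall>t>1. (\<integral>\<^sup>+x. ennreal (f x * (1 / (x + t))) \<partial>lborel) = ennreal (V t))"
  proof (cases "l = 0")
    case True
    define a where "a = (\<beta> - 1)\<^sup>2 / (4 * \<beta>)"
    have a0: "a \<ge> 0" using \<beta> by (simp add: a_def)
    have supp: "coeff_law_support l \<beta> = {a..}" using True by (simp add: coeff_law_support_def a_def)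
    have Qa: "Q x = 4 * \<beta> * (x - a)" for x using True \<beta> by (simp add: Q_def a_def field_simps)
    have Qs: "sqrt (Q x) = 2 * sqrt \<beta> * sqrt (x - a)" for x unfolding Qa by (simp add: real_sqrt_mult)
    have Ra: "sqrt \<beta> * sqrt (a + c) = R c / 2" if "c \<ge> 0" for c
    proof -
      have "- Q (- c) = 4 * (\<beta> * (a + c))" unfolding Qa by (simp add: algebra_simps)
      then show ?thesis by (simp add: R_def real_sqrt_mult)
    qed
    have ws: "w x = sqrt \<beta> / pi * (sqrt (x - a) * (1 / (x * (x + 1))))" for x
      unfolding w_def Qs by simp
    have wnn: "w x \<ge> 0" if "a < x" for x using that a0 \<beta> unfolding ws by simp
    have "(\<integral>\<^sup>+x. ennreal (indicator {a..} x * w x) \<partial>lborel) = ennreal (- pi * (\<Sum>k\<in>{0,1::nat}. (if k = 0 then sqrt \<beta> / pi else - (sqrt \<beta> / pi)) * sqrt (a + real k)))"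
    proof (rule nn_integral_sqrt_partial_fractions)
      fix x assume x: "a < x"
      show "w x = sqrt (x - a) * (\<Sum>k\<in>{0,1::nat}. (if k = 0 then sqrt \<beta> / pi else - (sqrt \<beta> / pi)) / (x + real k))"
        using sqrt_partial_fractions(1)[of 1 x "sqrt \<beta> / pi * sqrt (x - a)"] x a0 unfolding ws by (simp add: algebra_simps)
    qed (use a0 wnn in auto)
    also have "- pi * (\<Sum>k\<in>{0,1::nat}. (if k = 0 then sqrt \<beta> / pi else - (sqrt \<beta> / pi)) * sqrt (a + real k)) = sqrt \<beta> * sqrt (a + 1) - sqrt \<beta> * sqrt (a + 0)"
      by (simp add: algebra_simps)
    also have "\<dots> = min 1 \<beta>" unfolding Ra[OF zero_le_one] Ra[OF order_refl] R0 R1 using True min_one_eq[of \<beta>] by (simp add: diff_divide_distrib add_divide_distrib)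
    finally have mass: "(\<integral>\<^sup>+x. ennreal (f x) \<partial>lborel) = ennreal (min 1 \<beta>)" unfolding f_def supp .
    have res: "(\<integral>\<^sup>+x. ennreal (f x * (1 / (x + t))) \<partial>lborel) = ennreal (V t)" if t: "t > 1" for t
    proof -
      have tt: "t \<ge> 0" using t by simp
      define A where "A k = sqrt \<beta> / pi * (if k = 0 then 1 / t else if k = 1 then - 1 / (t - 1) else 1 / (t * (t - 1)))" for k :: nat
      define c where "c k = (if k = 0 then 0 else if k = 1 then 1 else t)" for k :: nat
      have "(\<integral>\<^sup>+x. ennreal (indicator {a..} x * (w x * (1 / (x + t)))) \<partial>lborel) = ennreal (- pi * (\<Sum>k\<in>{0,1,2::nat}. A k * sqrt (a + c k)))"
      proof (rule nn_integral_sqrt_partial_fractions)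
        have "(\<Sum>k\<in>{0,1,2::nat}. A k) = sqrt \<beta> / pi * (1 / t + - 1 / (t - 1) + 1 / (t * (t - 1)))"
          by (simp add: A_def algebra_simps)
        also have "1 / t + - 1 / (t - 1) + 1 / (t * (t - 1)) = 0" using t by (simp add: divide_simps)
        finally show "(\<Sum>k\<in>{0,1,2::nat}. A k) = 0" by simp
        fix x assume x: "a < x"
        show "w x * (1 / (x + t)) = sqrt (x - a) * (\<Sum>k\<in>{0,1,2::nat}. A k / (x + c k))"
        proof -
          let ?s = "sqrt \<beta> / pi * sqrt (x - a)"
          have "w x * (1 / (x + t)) = ?s * (1 / (x * (x + 1)) * (1 / (x + t)))" unfolding ws by simp
          also have "\<dots> = 1 / t * (?s / (x + 0)) + - 1 / (t - 1) * (?s / (x + 1)) + 1 / (t * (t - 1)) * (?s / (x + t))"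
            using sqrt_partial_fractions(3)[of t x ?s] t x a0 by simp
          also have "\<dots> = sqrt (x - a) * (\<Sum>k\<in>{0,1,2::nat}. A k / (x + c k))"
            by (simp add: A_def c_def algebra_simps)
          finally show ?thesis .
        qed
        show "0 \<le> w x * (1 / (x + t))" using wnn[OF x] x a0 t by simp
      qed (use a0 t in \<open>auto simp: c_def\<close>)
      also have "- pi * (\<Sum>k\<in>{0,1,2::nat}. A k * sqrt (a + c k))
        = - (1 / t) * (sqrt \<beta> * sqrt (a + 0)) + 1 / (t - 1) * (sqrt \<beta> * sqrt (a + 1)) - 1 / (t * (t - 1)) * (sqrt \<beta> * sqrt (a + t))"
      proof -
        have "(\<Sum>k\<in>{0,1,2::nat}. A k * sqrt (a + c k))
          = sqrt \<beta> / pi * (1 / t * sqrt (a + 0) + - 1 / (t - 1) * sqrt (a + 1) + 1 / (t * (t - 1)) * sqrt (a + t))"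
          unfolding distrib_left by (simp add: A_def c_def mult_ac)
        moreover have "- pi * (sqrt \<beta> / pi * y) = - sqrt \<beta> * y" for y by simp
        ultimately show ?thesis by (simp only:) (simp add: algebra_simps)
      qed
      also have "\<dots> = V t" unfolding Ra[OF zero_le_one] Ra[OF order_refl] Ra[OF tt]
        by (simp add: V_def add_divide_distrib diff_divide_distrib)
      finally show ?thesis unfolding f_def supp by (simp only: mult.assoc)
    qed
    show ?thesis using mass res a0 by (auto simp: f_def supp)
  next
    case False
    then have l0: "l > 0" using l by simp
    define s where "s = sqrt (l\<^sup>2 * \<beta> + l * (\<beta> + 1) + 1)"
    define k where "k = 1 / (l\<^sup>2 * \<beta>)"
    define a b where "a = k * ((1 + \<beta>) * l + 2 - 2 * s)" and "b = k * ((1 + \<beta>) * l + 2 + 2 * s)"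
    have supp: "coeff_law_support l \<beta> = {a..b}" using False by (simp add: coeff_law_support_def a_def b_def k_def s_def)
    have pos: "l\<^sup>2 * \<beta> + l * (\<beta> + 1) + 1 > 0" using l0 \<beta> by (intro add_nonneg_pos) auto
    then have s0: "s > 0" and s2: "s * s = l\<^sup>2 * \<beta> + l * (\<beta> + 1) + 1" by (auto simp: s_def)
    have k0: "k > 0" using l0 \<beta> by (simp add: k_def)
    have kl: "\<beta>\<^sup>2 * l\<^sup>2 * k = \<beta>" using l0 \<beta> by (simp add: k_def power2_eq_square)
    have "b - a = 4 * (k * s)" by (simp add: a_def b_def algebra_simps)
    then have ab: "a < b" using k0 s0 by (simp add: algebra_simps)
    have sum: "\<beta>\<^sup>2 * l\<^sup>2 * (a + b) = 2 * \<beta> * ((1 + \<beta>) * l + 2)"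
    proof -
      have "a + b = k * (2 * ((1 + \<beta>) * l + 2))" by (simp add: a_def b_def algebra_simps)
      then have "\<beta>\<^sup>2 * l\<^sup>2 * (a + b) = \<beta>\<^sup>2 * l\<^sup>2 * k * (2 * ((1 + \<beta>) * l + 2))" by simp
      then show ?thesis unfolding kl by simp
    qed
    have prod: "\<beta>\<^sup>2 * l\<^sup>2 * (a * b) = (\<beta> - 1)\<^sup>2"
    proof -
      have "a * b = k * k * (((1 + \<beta>) * l + 2)\<^sup>2 - 4 * (s * s))" by (simp add: a_def b_def power2_eq_square algebra_simps)
      also have "((1 + \<beta>) * l + 2)\<^sup>2 - 4 * (s * s) = l\<^sup>2 * (\<beta> - 1)\<^sup>2" unfolding s2 by (simp add: power2_eq_square algebra_simps)
      finally have "\<beta>\<^sup>2 * l\<^sup>2 * (a * b) = (\<beta>\<^sup>2 * l\<^sup>2 * k) * (k * l\<^sup>2) * (\<beta> - 1)\<^sup>2" by simp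
      also have "\<dots> = \<beta> * (k * l\<^sup>2) * (\<beta> - 1)\<^sup>2" unfolding kl ..
      also have "\<beta> * (k * l\<^sup>2) = 1" using l0 \<beta> by (simp add: k_def)
      finally show ?thesis by simp
    qed
    have b0: "b > 0" unfolding b_def using k0 s0 l0 \<beta> by (intro mult_pos_pos) (auto intro!: add_pos_pos)
    have a0: "a \<ge> 0"
    proof (rule ccontr)
      assume "\<not> a \<ge> 0"
      then have "a * b < 0" using b0 by (simp add: mult_less_0_iff)
      then have "\<beta>\<^sup>2 * l\<^sup>2 * (a * b) < 0" using l0 \<beta> by (simp add: mult_less_0_iff)
      then show False unfolding prod by (simp add: not_less)
    qed
    define q where "q x = sqrt ((b - x) * (x - a))" for x
    have Qf: "Q x = (\<beta> * l)\<^sup>2 * ((b - x) * (x - a))" for x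
    proof -
      have "(\<beta> * l)\<^sup>2 * ((b - x) * (x - a)) = \<beta>\<^sup>2 * l\<^sup>2 * (a + b) * x - \<beta>\<^sup>2 * l\<^sup>2 * (a * b) - \<beta>\<^sup>2 * l\<^sup>2 * x\<^sup>2"
        by (simp add: power2_eq_square algebra_simps)
      then show ?thesis unfolding sum prod Q_def by simp
    qed
    have Qs: "sqrt (Q x) = \<beta> * l * q x" for x
      unfolding Qf q_def using \<beta> l0 by (simp only: real_sqrt_mult real_sqrt_abs) simp
    have Rs: "R c = \<beta> * l * sqrt ((a + c) * (b + c))" for c
    proof -
      have "- Q (- c) = (\<beta> * l)\<^sup>2 * ((a + c) * (b + c))" unfolding Qf by (simp add: algebra_simps)
      then show ?thesis unfolding R_def using \<beta> l0 by (simp only: real_sqrt_mult real_sqrt_abs) simp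
    qed
    have ws: "w x = \<beta> * l / (2 * pi) * (q x * (1 / (x * (x + 1))))" for x unfolding w_def Qs by simp
    have q0: "q x \<ge> 0" "x = 0 \<Longrightarrow> q x = 0" if "x \<in> {a..b}" for x
      using that a0 by (auto simp: q_def)
    have wnn: "w x \<ge> 0" if "x \<in> {a..b}" for x using q0[OF that] that a0 \<beta> l0 unfolding ws by simp
    have J: "((\<lambda>x. q x / (x + c)) has_integral pi * ((a + b) / 2 + c) - pi / (\<beta> * l) * R c) {a..b}" if "c \<ge> 0" for c
    proof -
      have "((\<lambda>x. q x / (x + c)) has_integral pi * ((a + b) / 2 + c - sqrt ((a + c) * (b + c)))) {a..b}"
        unfolding q_def using a0 that by (intro has_integral_semicircle_resolvent[OF ab]) simp
      then show ?thesis unfolding Rs using \<beta> l0 by (simp add: right_diff_distrib)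
    qed
    have mass: "(\<integral>\<^sup>+x. ennreal (f x) \<partial>lborel) = ennreal (min 1 \<beta>)"
      unfolding f_def supp
    proof (rule nn_integral_indicator_has_integral[OF wm])
      have "((\<lambda>x. \<beta> * l / (2 * pi) * (q x / (x + 0) - q x / (x + 1))) has_integral
         \<beta> * l / (2 * pi) * ((pi * ((a + b) / 2 + 0) - pi / (\<beta> * l) * R 0) - (pi * ((a + b) / 2 + 1) - pi / (\<beta> * l) * R 1))) {a..b}"
        by (intro has_integral_mult_right has_integral_diff J) auto
      also have "\<beta> * l / (2 * pi) * ((pi * ((a + b) / 2 + 0) - pi / (\<beta> * l) * R 0) - (pi * ((a + b) / 2 + 1) - pi / (\<beta> * l) * R 1))
         = (R 1 - R 0 - \<beta> * l) / 2" using \<beta> l0 by (simp add: field_simps)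
      also have "\<dots> = min 1 \<beta>" unfolding R0 R1 min_one_eq[symmetric] by simp
      finally show "(w has_integral min 1 \<beta>) {a..b}"
      proof (rule has_integral_eq[rotated])
        fix x assume x: "x \<in> {a..b}"
        show "\<beta> * l / (2 * pi) * (q x / (x + 0) - q x / (x + 1)) = w x"
          using sqrt_partial_fractions(1)[of 1 x "q x"] x a0 q0[OF x] unfolding ws by simp
      qed
    qed (rule wnn)
    have res: "(\<integral>\<^sup>+x. ennreal (f x * (1 / (x + t))) \<partial>lborel) = ennreal (V t)" if t: "t > 1" for t
      unfolding f_def supp mult.assoc
    proof (rule nn_integral_indicator_has_integral)
      show "(\<lambda>x. w x * (1 / (x + t))) \<in> borel_measurable borel" by measurable
      let ?J = "\<lambda>c. pi * ((a + b) / 2 + c) - pi / (\<beta> * l) * R c"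
      have "((\<lambda>x. \<beta> * l / (2 * pi) * (1 / t * (q x / (x + 0)) + - 1 / (t - 1) * (q x / (x + 1)) + 1 / (t * (t - 1)) * (q x / (x + t)))) has_integral
         \<beta> * l / (2 * pi) * (1 / t * ?J 0 + - 1 / (t - 1) * ?J 1 + 1 / (t * (t - 1)) * ?J t)) {a..b}"
        using t by (intro has_integral_mult_right has_integral_add J) auto
      also have "1 / t * ?J 0 + - 1 / (t - 1) * ?J 1 + 1 / (t * (t - 1)) * ?J t
        = pi * ((a + b) / 2 * (1 / t + - 1 / (t - 1) + 1 / (t * (t - 1))) + (- 1 / (t - 1) + t * (1 / (t * (t - 1)))))
          + pi / (\<beta> * l) * (- (1 / t * R 0) - - 1 / (t - 1) * R 1 - 1 / (t * (t - 1)) * R t)"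
      proof -
        have "A0 * (p * (h + 0) - P * R 0) + A1 * (p * (h + 1) - P * R 1) + A2 * (p * (h + t) - P * R t)
          = p * (h * (A0 + A1 + A2) + (A1 + t * A2)) + P * (- (A0 * R 0) - A1 * R 1 - A2 * R t)" for A0 A1 A2 p h P :: real
          by (simp add: algebra_simps)
        then show ?thesis .
      qed
      \<comment> \<open>The function \<open>1 / (x * (x + 1) * (x + t))\<close> decays like the
        inverse cube, so its residues sum to zero, also when weighted with the poles. The polynomial
        parts of \<open>?J\<close> therefore cancel and only the \<open>R\<close> terms
        survive.\<close>
      also have "1 / t + - 1 / (t - 1) + 1 / (t * (t - 1)) = 0" using t by (simp add: divide_simps)
      also have "- 1 / (t - 1) + t * (1 / (t * (t - 1))) = 0" using t by (simp add: divide_simps)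
      also have "- (1 / t * R 0) - - 1 / (t - 1) * R 1 - 1 / (t * (t - 1)) * R t = 2 * V t" by (simp add: V_def mult.commute)
      also have "\<beta> * l / (2 * pi) * (pi * ((a + b) / 2 * 0 + 0) + pi / (\<beta> * l) * (2 * V t)) = V t"
        using \<beta> l0 by simp
      finally show "((\<lambda>x. w x * (1 / (x + t))) has_integral V t) {a..b}"
      proof (rule has_integral_eq[rotated])
        fix x assume x: "x \<in> {a..b}"
        show "\<beta> * l / (2 * pi) * (1 / t * (q x / (x + 0)) + - 1 / (t - 1) * (q x / (x + 1)) + 1 / (t * (t - 1)) * (q x / (x + t))) = w x * (1 / (x + t))"
          using sqrt_partial_fractions(3)[of t x "q x"] x a0 q0[OF x] t unfolding ws by simp
      qed
      show "0 \<le> w x * (1 / (x + t))" if "x \<in> {a..b}" for x using wnn[OF that] that a0 t by simp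
    qed
    show ?thesis using mass res a0 by (auto simp: f_def supp)
  qed
  then have fneg: "\<And>x. x < 0 \<Longrightarrow> f x = 0" and mass: "(\<integral>\<^sup>+x. ennreal (f x) \<partial>lborel) = ennreal (min 1 \<beta>)"
    and res: "\<And>t. t > 1 \<Longrightarrow> (\<integral>\<^sup>+x. ennreal (f x * (1 / (x + t))) \<partial>lborel) = ennreal (V t)" by auto
  interpret D: density_with_atom f \<beta> by standard (use fm \<beta> mass fneg in auto)
  have law: "D.law = coeff_law l \<beta>"
    unfolding D.law_def coeff_law_def f_def w_def Q_def ..
  show "real_distribution (coeff_law l \<beta>)" "AE x in coeff_law l \<beta>. x \<ge> 0"
    using D.real_distribution_law D.AE_law_nonneg unfolding law by auto
  fix t :: real assume t: "t > 1"
  then have t0: "t > 0" by simp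
  have Vnn: "V t \<ge> 0" by (rule D.resolvent_value_nonneg[OF t0 res[OF t]])
  note r = D.resolvent_law[OF t0 res[OF t] Vnn]
  define m where "m = V t + max 0 (1 - \<beta>) / t"
  have RR: "R t * R t = - Q (- t)"
  proof -
    have "0 \<le> (\<beta> - 1)\<^sup>2 + 2 * \<beta> * ((1 + \<beta>) * l + 2) * t + \<beta>\<^sup>2 * l\<^sup>2 * t\<^sup>2"
      using t \<beta> l by (intro add_nonneg_nonneg mult_nonneg_nonneg) auto
    also have "\<dots> = - Q (- t)" by (simp add: Q_def)
    finally have "- Q (- t) \<ge> 0" .
    then show ?thesis by (simp add: R_def)
  qed
  have "2 * t * (t - 1) * V t = - (t - 1) * R 0 + t * R 1 - R t"
  proof -
    have "t * (t - 1) * (1 / t) = t - 1" "t * (t - 1) * (1 / (t - 1)) = t" "t * (t - 1) * (1 / (t * (t - 1))) = 1"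
      using t by auto
    moreover have "2 * t * (t - 1) * V t = - (t * (t - 1) * (1 / t)) * R 0 + (t * (t - 1) * (1 / (t - 1))) * R 1 - (t * (t - 1) * (1 / (t * (t - 1)))) * R t"
    proof -
      have "2 * t * (t - 1) * ((- A0 * r0 + A1 * r1 - A2 * r2) / 2) = - (t * (t - 1) * A0) * r0 + (t * (t - 1) * A1) * r1 - (t * (t - 1) * A2) * r2"
        for A0 A1 A2 r0 r1 r2 :: real
      proof -
        have half: "2 * t * (t - 1) * (y / 2) = t * (t - 1) * y" for y :: real by simp
        show ?thesis unfolding half by (simp add: algebra_simps)
      qed
      then show ?thesis unfolding V_def .
    qed
    ultimately show ?thesis by (simp only:)
  qed
  moreover have "2 * t * (t - 1) * m = 2 * t * (t - 1) * V t + 2 * (t - 1) * max 0 (1 - \<beta>)"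
    using t by (simp add: m_def field_simps)
  moreover have "2 * (t - 1) * max 0 (1 - \<beta>) = (t - 1) * \<bar>1 - \<beta>\<bar> + (t - 1) * (1 - \<beta>)"
    by (auto simp: max_def abs_if algebra_simps)
  ultimately have m: "2 * t * (t - 1) * m = (t - 1) * (1 - \<beta>) + t * (\<beta> * l + 1 + \<beta>) - R t"
    unfolding R0 R1 by (simp add: algebra_simps)
  \<comment> \<open>By \<open>m\<close> this is \<open>R t + 2 * t * (t - 1) * m\<close>. Squaring
    \<open>R t\<close> and using
    \<open>- Q (- t) = B * B - 4 * t * (t - 1) * (1 + \<beta> * l)\<close> leaves a quadratic
    equation for \<open>m\<close> after division by \<open>4 * t * (t - 1)\<close>.\<close>
  define B where "B = (t - 1) * (1 - \<beta>) + t * (\<beta> * l + 1 + \<beta>)"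
  have "(B - 2 * t * (t - 1) * m) * (B - 2 * t * (t - 1) * m) = - Q (- t)"
  proof -
    have "B - 2 * t * (t - 1) * m = R t" unfolding m B_def by simp
    then show ?thesis using RR by simp
  qed
  also have "- Q (- t) = B * B - 4 * t * (t - 1) * (1 + \<beta> * l)"
    unfolding B_def Q_def by (simp add: power2_eq_square algebra_simps)
  finally have "4 * t * (t - 1) * (t * (t - 1) * m * m - B * m + (1 + \<beta> * l)) = 0"
    by (simp add: algebra_simps)
  then have quad: "t * (t - 1) * m * m - B * m + (1 + \<beta> * l) = 0" using t by simp
  have "m \<noteq> 0"
  proof
    assume "m = 0"
    then have "1 + \<beta> * l = 0" using quad by simp
    moreover have "\<beta> * l \<ge> 0" using \<beta> l by simp
    ultimately show False by linarith
  qed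
  moreover have "m \<ge> 0" unfolding m_def using Vnn t by simp
  ultimately have "m > 0" by simp
  moreover have "(1 - t * m) * (1 + m * (1 - t) + \<beta> * (1 + l)) = \<beta> * (1 + m * (1 - t))"
    using quad unfolding B_def by (simp add: algebra_simps)
  ultimately show "\<exists>m>0. (LINT x|coeff_law l \<beta>. 1 / (x + t)) = m \<and> t * m \<le> 1 \<and>
      (1 - t * m) * (1 + m * (1 - t) + \<beta> * (1 + l)) = \<beta> * (1 + m * (1 - t))"
    using r unfolding law m_def by blast
qed

section \<open>Weak convergence from resolvents\<close>

lemma real_distribution_integrable_bounded:
  assumes "real_distribution M" "f \<in> borel_measurable borel" "\<And>x. \<bar>f x\<bar> \<le> (B::real)"
  shows "integrable M f"
proof -
  interpret real_distribution M by fact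
  show ?thesis using assms(2,3) by (intro integrable_const_bound[of _ B]) auto
qed

lemma tendsto_integral_uniform_approx:
  fixes f :: "real \<Rightarrow> real"
  assumes M: "\<And>n. real_distribution (M n)" "real_distribution L"
    and f: "f \<in> borel_measurable borel" "\<And>x. \<bar>f x\<bar> \<le> B"
    and approx: "\<And>e. e > 0 \<Longrightarrow> \<exists>g C. g \<in> borel_measurable borel \<and> (\<forall>x. \<bar>g x\<bar> \<le> C) \<and>
      (\<forall>x. \<bar>f x - g x\<bar> \<le> e) \<and> (\<lambda>n. integral\<^sup>L (M n) g) \<longlonglongrightarrow> integral\<^sup>L L g"
  shows "(\<lambda>n. integral\<^sup>L (M n) f) \<longlonglongrightarrow> integral\<^sup>L L f"
proof (rule LIMSEQ_I)
  fix e :: real assume "e > 0"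
  then have e4: "e / 4 > 0" by simp
  from approx[OF this] obtain g C where g: "g \<in> borel_measurable borel" "\<And>x. \<bar>g x\<bar> \<le> C"
    "\<And>x. \<bar>f x - g x\<bar> \<le> e / 4" "(\<lambda>n. integral\<^sup>L (M n) g) \<longlonglongrightarrow> integral\<^sup>L L g" by blast
  have close: "\<bar>integral\<^sup>L N f - integral\<^sup>L N g\<bar> \<le> e / 4" if N: "real_distribution N" for N
  proof -
    interpret real_distribution N by fact
    have i: "integrable N f" "integrable N g"
      using real_distribution_integrable_bounded[OF N] f g(1,2) by blast+
    have "\<bar>integral\<^sup>L N f - integral\<^sup>L N g\<bar> = \<bar>integral\<^sup>L N (\<lambda>x. f x - g x)\<bar>" using i by simp
    also have "\<dots> \<le> integral\<^sup>L N (\<lambda>x. \<bar>f x - g x\<bar>)" by (rule integral_abs_bound)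
    also have "\<dots> \<le> integral\<^sup>L N (\<lambda>x. e / 4)" using i g(3) by (intro integral_mono) auto
    finally show ?thesis using prob_space by simp
  qed
  from LIMSEQ_D[OF g(4) e4] obtain n0 where n0: "\<And>n. n \<ge> n0 \<Longrightarrow> \<bar>integral\<^sup>L (M n) g - integral\<^sup>L L g\<bar> < e / 4" by auto
  have "norm (integral\<^sup>L (M n) f - integral\<^sup>L L f) < e" if "n \<ge> n0" for n
    using close[OF M(1)[of n]] close[OF M(2)] n0[OF that] \<open>e > 0\<close> unfolding real_norm_def by linarith
  then show "\<exists>no. \<forall>n\<ge>no. norm (integral\<^sup>L (M n) f - integral\<^sup>L L f) < e" by blast
qed

context
  fixes M :: "nat \<Rightarrow> real measure" and L :: "real measure" and t :: "nat \<Rightarrow> real"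
  assumes M: "\<And>n. real_distribution (M n)" "real_distribution L"
    and nonneg: "\<And>n. AE x in M n. x \<ge> 0" "AE x in L. x \<ge> 0"
    and t: "\<And>k. t k > 1" "t \<longlonglongrightarrow> 1" "inj t"
    and lim: "\<And>k. (\<lambda>n. LINT x|M n. 1 / (x + t k)) \<longlonglongrightarrow> (LINT x|L. 1 / (x + t k))"
begin

text \<open>Truncating at \<open>0\<close> changes nothing almost everywhere for laws on the
  half-line, but makes the bounds hold at every point.\<close>

definition resolvent :: "real \<Rightarrow> real \<Rightarrow> real" where "resolvent s x = 1 / (max x 0 + s)"

lemma resolvent_measurable [measurable]: "resolvent s \<in> borel_measurable borel"
  unfolding resolvent_def by measurable

lemma resolvent_bound: "s \<ge> 1 \<Longrightarrow> \<bar>resolvent s x\<bar> \<le> 1" and resolvent_nonneg: "s \<ge> 1 \<Longrightarrow> 0 \<le> resolvent s x"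
  unfolding resolvent_def by (auto simp: field_simps)

lemma prod_resolvent_bound: "(\<And>k. k \<in> F \<Longrightarrow> s k \<ge> 1) \<Longrightarrow> \<bar>\<Prod>k\<in>F. resolvent (s k) x\<bar> \<le> 1"
  unfolding abs_prod by (intro prod_le_1) (auto simp: resolvent_bound)

text \<open>The resolvent identity writes the product of two resolvents at distinct points as a
  difference quotient. Each use lowers the number of factors by one, and injectivity of
  \<open>t\<close> keeps the denominators nonzero.\<close>

lemma tendsto_prod_resolvent:
  assumes "finite F" "F \<noteq> {}"
  shows "(\<lambda>n. LINT x|M n. (\<Prod>k\<in>F. resolvent (t k) x)) \<longlonglongrightarrow> (LINT x|L. (\<Prod>k\<in>F. resolvent (t k) x))"
  using assms
proof (induction "card F" arbitrary: F rule: less_induct)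
  case (less F)
  have t1: "t k \<ge> 1" for k using t(1)[of k] by simp
  show ?case
  proof (cases "card F \<le> 1")
    case True
    with less.prems have "card F = 1" by (metis One_nat_def Suc_leI card_gt_0_iff le_antisym)
    then obtain k where F: "F = {k}" by (auto simp: card_1_singleton_iff)
    have "(LINT x|N. resolvent (t k) x) = (LINT x|N. 1 / (x + t k))"
      if "real_distribution N" "AE x in N. x \<ge> 0" for N
    proof -
      interpret real_distribution N by fact
      show ?thesis using that(2) by (intro integral_cong_AE) (auto simp: resolvent_def)
    qed
    then show ?thesis using lim[of k] M nonneg unfolding F by simp
  next
    case False
    then obtain k where k: "k \<in> F" using less.prems by blast
    with False obtain j where j: "j \<in> F" "j \<noteq> k"
      by (metis One_nat_def card_le_Suc0_iff_eq less.prems(1))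
    define G where "G = F - {j, k}"
    have F: "F = insert j (insert k G)" and nG: "j \<notin> G" "k \<notin> G" "finite G"
      using j k less.prems by (auto simp: G_def)
    have ne: "t j \<noteq> t k" using t(3) j(2) by (auto simp: inj_eq)
    have eq: "(\<Prod>i\<in>F. resolvent (t i) x) = ((\<Prod>i\<in>insert k G. resolvent (t i) x) - (\<Prod>i\<in>insert j G. resolvent (t i) x)) / (t j - t k)" for x
    proof -
      have "resolvent (t j) x * resolvent (t k) x = (resolvent (t k) x - resolvent (t j) x) / (t j - t k)"
      proof -
        define P Q where "P = max x 0 + t j" and "Q = max x 0 + t k"
        have "P > 0" "Q > 0" using t(1)[of j] t(1)[of k] by (auto simp: P_def Q_def)
        then have "1 / Q - 1 / P = (P - Q) / (P * Q)" by (simp add: field_simps)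
        moreover have "P - Q = t j - t k" by (simp add: P_def Q_def)
        ultimately show ?thesis using ne unfolding resolvent_def P_def[symmetric] Q_def[symmetric] by simp
      qed
      moreover have "(\<Prod>i\<in>F. resolvent (t i) x) = resolvent (t j) x * resolvent (t k) x * (\<Prod>i\<in>G. resolvent (t i) x)"
        unfolding F using nG j(2) by (simp add: mult.assoc)
      ultimately have "(\<Prod>i\<in>F. resolvent (t i) x) = (resolvent (t k) x - resolvent (t j) x) / (t j - t k) * (\<Prod>i\<in>G. resolvent (t i) x)"
        by simp
      then show ?thesis using nG by (simp add: left_diff_distrib diff_divide_distrib)
    qed
    have int: "(LINT x|N. (\<Prod>i\<in>F. resolvent (t i) x)) = ((LINT x|N. (\<Prod>i\<in>insert k G. resolvent (t i) x)) - (LINT x|N. (\<Prod>i\<in>insert j G. resolvent (t i) x))) / (t j - t k)"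
      if N: "real_distribution N" for N
    proof -
      have i: "integrable N (\<lambda>x. \<Prod>i\<in>H. resolvent (t i) x)" for H
        by (rule real_distribution_integrable_bounded[OF N, of _ 1]) (auto intro!: prod_resolvent_bound simp: t1)
      show ?thesis unfolding eq using i by simp
    qed
    have "card (insert k G) < card F" "card (insert j G) < card F"
      unfolding F using nG j(2) by auto
    from less.hyps[OF this(1)] less.hyps[OF this(2)] show ?thesis
      unfolding int[OF M(1)] int[OF M(2)] using nG ne by (intro tendsto_intros) auto
  qed
qed

lemma tendsto_power_resolvent:
  "(\<lambda>n. LINT x|M n. resolvent 1 x ^ k) \<longlonglongrightarrow> (LINT x|L. resolvent 1 x ^ k)"
proof (cases "k = 0")
  case True
  have "(LINT x|N. (1::real)) = 1" if "real_distribution N" for N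
  proof -
    interpret real_distribution N by fact
    show ?thesis using prob_space by simp
  qed
  then show ?thesis using True M by simp
next
  case False
  show ?thesis
  proof (rule tendsto_integral_uniform_approx[OF M, of _ 1])
    show "\<bar>resolvent 1 x ^ k\<bar> \<le> 1" for x
      using resolvent_bound[of 1 x] by (simp add: power_abs power_le_one)
    fix e :: real assume e: "e > 0"
    have "\<exists>n0. \<forall>n\<ge>n0. \<bar>t n - 1\<bar> < e / k"
      using LIMSEQ_D[OF t(2), of "e / k"] e False by auto
    then obtain n0 where n0: "\<And>n. n \<ge> n0 \<Longrightarrow> \<bar>t n - 1\<bar> < e / k" by blast
    \<comment> \<open>The \<open>k\<close> equal factors at the point \<open>1\<close> are replaced
      by \<open>k\<close> distinct ones close to it. All factors are bounded by \<open>1\<close>, so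
      the error of the product is at most the sum of \<open>k\<close> errors of size
      \<open>e / k\<close>.\<close>
    define F where "F = {n0..<n0 + k}"
    have "\<bar>resolvent 1 x ^ k - (\<Prod>i\<in>F. resolvent (t i) x)\<bar> \<le> e" for x
    proof -
      have "norm ((\<Prod>i\<in>F. resolvent 1 x) - (\<Prod>i\<in>F. resolvent (t i) x)) \<le> (\<Sum>i\<in>F. norm (resolvent 1 x - resolvent (t i) x))"
        by (rule norm_prod_diff) (use resolvent_bound t(1) in \<open>auto simp: less_imp_le\<close>)
      also have "\<dots> \<le> (\<Sum>i\<in>F. e / k)"
      proof (rule sum_mono)
        fix i assume "i \<in> F"
        then have ti: "t i - 1 < e / k" using n0[of i] by (auto simp: F_def)
        have "resolvent 1 x - resolvent (t i) x = (t i - 1) * (resolvent 1 x * resolvent (t i) x)"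
        proof -
          have "max x 0 + t i > 0" "max x 0 + 1 > 0" using t(1)[of i] by auto
          then show ?thesis unfolding resolvent_def by (simp add: field_simps)
        qed
        moreover have "resolvent 1 x * resolvent (t i) x \<le> 1" "0 \<le> resolvent 1 x * resolvent (t i) x"
          using resolvent_bound[of 1 x] resolvent_bound[of "t i" x] resolvent_nonneg[of 1 x] resolvent_nonneg[of "t i" x] t(1)[of i]
          by (auto intro: mult_le_one)
        ultimately have "\<bar>resolvent 1 x - resolvent (t i) x\<bar> \<le> t i - 1"
          using t(1)[of i] by (auto simp: abs_mult intro: mult_left_le)
        then show "norm (resolvent 1 x - resolvent (t i) x) \<le> e / k" using ti by simp
      qed
      also have "\<dots> = e" using False by (simp add: F_def)
      finally show ?thesis by (simp add: F_def)
    qed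
    moreover have "\<bar>\<Prod>i\<in>F. resolvent (t i) x\<bar> \<le> 1" for x
      using prod_resolvent_bound[of F t x] t(1) by (auto simp: less_imp_le)
    moreover have "(\<lambda>x. \<Prod>i\<in>F. resolvent (t i) x) \<in> borel_measurable borel" by measurable
    moreover have "(\<lambda>n. LINT x|M n. (\<Prod>k\<in>F. resolvent (t k) x)) \<longlonglongrightarrow> (LINT x|L. (\<Prod>k\<in>F. resolvent (t k) x))"
      using False by (intro tendsto_prod_resolvent) (auto simp: F_def)
    ultimately show "\<exists>g C. g \<in> borel_measurable borel \<and> (\<forall>x. \<bar>g x\<bar> \<le> C) \<and>
      (\<forall>x. \<bar>resolvent 1 x ^ k - g x\<bar> \<le> e) \<and> (\<lambda>n. integral\<^sup>L (M n) g) \<longlonglongrightarrow> integral\<^sup>L L g" by blast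
  qed measurable
qed

text \<open>The half-line corresponds to the bounded variable \<open>y = 1 / (x + 1)\<close>, so
  Weierstrass approximation on \<open>{0..1}\<close> reduces continuous functions of
  \<open>y\<close> to the powers already treated.\<close>

lemma tendsto_continuous_resolvent:
  fixes h :: "real \<Rightarrow> real" and B :: real
  assumes h: "continuous_on {0..1} h" and hb: "\<And>y. \<bar>h y\<bar> \<le> B" and hm: "(\<lambda>x. h (resolvent 1 x)) \<in> borel_measurable borel"
  shows "(\<lambda>n. LINT x|M n. h (resolvent 1 x)) \<longlonglongrightarrow> (LINT x|L. h (resolvent 1 x))"
proof (rule tendsto_integral_uniform_approx[OF M hm, of B])
  show "\<bar>h (resolvent 1 x)\<bar> \<le> B" for x by (rule hb)
  fix e :: real assume "e > 0"
  from Stone_Weierstrass_real_polynomial_function[OF compact_Icc h this]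
  obtain g where g: "real_polynomial_function g" "\<And>y. y \<in> {0..1} \<Longrightarrow> \<bar>h y - g y\<bar> < e" by blast
  then obtain a m where gs: "g = (\<lambda>y. \<Sum>i\<le>m. a i * y ^ i)" by (auto simp: real_polynomial_function_iff_sum)
  have r01: "resolvent 1 x \<in> {0..1}" for x
    using resolvent_bound[of 1 x] resolvent_nonneg[of 1 x] by auto
  have "\<bar>h (resolvent 1 x) - g (resolvent 1 x)\<bar> \<le> e" for x using g(2)[OF r01[of x]] by simp
  moreover have "\<bar>g (resolvent 1 x)\<bar> \<le> B + e" for x using g(2)[OF r01[of x]] hb[of "resolvent 1 x"] by linarith
  moreover have "(\<lambda>x. g (resolvent 1 x)) \<in> borel_measurable borel" unfolding gs by measurable
  moreover have "(LINT x|N. g (resolvent 1 x)) = (\<Sum>i\<le>m. a i * (LINT x|N. resolvent 1 x ^ i))" if "real_distribution N" for N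
  proof -
    have "integrable N (\<lambda>x. resolvent 1 x ^ i)" for i
      by (rule real_distribution_integrable_bounded[OF that, of _ 1])
        (auto simp: power_abs intro!: power_le_one resolvent_bound)
    then show ?thesis unfolding gs by (simp add: Bochner_Integration.integral_sum)
  qed
  then have "(\<lambda>n. LINT x|M n. g (resolvent 1 x)) \<longlonglongrightarrow> (LINT x|L. g (resolvent 1 x))"
    using M by (auto intro!: tendsto_intros tendsto_power_resolvent)
  ultimately show "\<exists>g C. g \<in> borel_measurable borel \<and> (\<forall>x. \<bar>g x\<bar> \<le> C) \<and>
      (\<forall>x. \<bar>h (resolvent 1 x) - g x\<bar> \<le> e) \<and> (\<lambda>n. integral\<^sup>L (M n) g) \<longlonglongrightarrow> integral\<^sup>L L g" by blast
qed

lemma resolvent_conv_imp_weak_conv: "weak_conv_m M L"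
proof (rule integral_cts_step_conv_imp_weak_conv[OF M])
  fix a b :: real assume ab: "a < b"
  \<comment> \<open>The step function in the variable \<open>y\<close>, using
    \<open>x = 1 / y - 1\<close>. It vanishes to the right of \<open>b\<close>, so \<open>h\<close>
    is zero near \<open>y = 0\<close>, and the point at infinity creates no discontinuity.\<close>
  define h where "h y = (if y \<le> 0 then 0 else cts_step a b (1 / y - 1))" for y :: real
  have eq: "h (resolvent 1 x) = cts_step a b (max x 0)" for x
    unfolding h_def resolvent_def by (auto simp: field_simps)
  have step: "0 \<le> cts_step a b x" "cts_step a b x \<le> 1" for x using ab by (auto simp: cts_step_def)
  have cs: "isCont (cts_step a b) x" for x
    using cts_step_uniformly_continuous[OF ab] isUCont_isCont by blast
  have [measurable]: "cts_step a b \<in> borel_measurable borel"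
    using cs by (intro borel_measurable_continuous_onI) (auto simp: continuous_on_eq_continuous_at)
  have cont: "continuous_on {0..1} h"
    unfolding continuous_on_eq_continuous_within
  proof
    fix y :: real assume y: "y \<in> {0..1}"
    have "isCont h y"
    proof (cases "y = 0")
      case True
      define d where "d = 1 / (\<bar>b\<bar> + 1)"
      have d: "d > 0" by (simp add: d_def)
      have "h z = 0" if "z \<in> {-d<..<d}" for z
      proof (cases "z \<le> 0")
        case False
        then have "z * (\<bar>b\<bar> + 1) < 1" using that by (simp add: d_def field_simps)
        then have "\<bar>b\<bar> + 1 < 1 / z" using False by (simp add: field_simps)
        then have "b < 1 / z - 1" by linarith
        then show ?thesis using ab False by (simp add: h_def cts_step_def)
      qed (simp add: h_def)
      then have "eventually (\<lambda>z. h z = 0) (nhds 0)"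
        using eventually_nhds_in_open[of "{-d<..<d}" 0] d by (auto elim!: eventually_mono)
      then show ?thesis using True isCont_cong[of h "\<lambda>_. 0" 0] by simp
    next
      case False
      then have y0: "y > 0" using y by simp
      have "isCont (\<lambda>y. cts_step a b (1 / y - 1)) y"
        using y0 by (intro isCont_o2[OF _ cs] continuous_intros) auto
      moreover have "eventually (\<lambda>z. h z = cts_step a b (1 / z - 1)) (nhds y)"
        using eventually_nhds_in_open[of "{0<..}" y] y0 by (auto elim!: eventually_mono simp: h_def)
      ultimately show ?thesis using isCont_cong[of h "\<lambda>y. cts_step a b (1 / y - 1)" y] by simp
    qed
    then show "continuous (at y within {0..1}) h" by (rule continuous_at_imp_continuous_at_within)
  qed
  have "\<bar>h y\<bar> \<le> 1" for y using step by (auto simp: h_def abs_le_iff intro: order_trans[of _ 0])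
  moreover have "(\<lambda>x. h (resolvent 1 x)) \<in> borel_measurable borel" unfolding eq by measurable
  ultimately have "(\<lambda>n. LINT x|M n. h (resolvent 1 x)) \<longlonglongrightarrow> (LINT x|L. h (resolvent 1 x))"
    using cont by (intro tendsto_continuous_resolvent)
  moreover have "(LINT x|N. h (resolvent 1 x)) = integral\<^sup>L N (cts_step a b)"
    if "real_distribution N" "AE x in N. x \<ge> 0" for N
  proof -
    interpret real_distribution N by fact
    show ?thesis unfolding eq using that(2) by (intro integral_cong_AE) auto
  qed
  ultimately show "(\<lambda>n. integral\<^sup>L (M n) (cts_step a b)) \<longlonglongrightarrow> integral\<^sup>L L (cts_step a b)"
    using M nonneg by simp
qed

end

section \<open>Empirical eigenvalue distributions\<close>

lemma orthogonal_diag_mult_col: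
  assumes Q: "(Q :: real mat) \<in> carrier_mat n n" "Q\<^sup>T * Q = 1\<^sub>m n" and i: "i < n"
  shows "Q * mat_diag n e * Q\<^sup>T *\<^sub>v col Q i = e i \<cdot>\<^sub>v col Q i"
proof -
  have QD: "Q * mat_diag n e \<in> carrier_mat n n" by (rule mult_carrier_mat[OF Q(1) mat_diag_dim])
  have q: "col Q i \<in> carrier_vec n" using Q i by simp
  have "Q\<^sup>T *\<^sub>v col Q i = col (Q\<^sup>T * Q) i" using Q(1) i by (subst col_mult2[of _ n n]) auto
  then have Qq: "Q\<^sup>T *\<^sub>v col Q i = unit_vec n i" unfolding Q(2) using i by simp
  have "Q * mat_diag n e * Q\<^sup>T *\<^sub>v col Q i = Q * mat_diag n e *\<^sub>v (Q\<^sup>T *\<^sub>v col Q i)"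
    using Q(1) q QD by (intro assoc_mult_mat_vec[of _ n n _ n]) auto
  also have "\<dots> = col (Q * mat_diag n e) i"
    unfolding Qq using carrier_matD[OF QD] i by (intro eq_vecI) (auto simp: scalar_prod_right_unit[of _ n])
  also have "\<dots> = e i \<cdot>\<^sub>v col Q i" using Q(1) i by (subst mat_diag_mult_right[OF Q(1)]) (auto intro!: eq_vecI)
  finally show ?thesis .
qed

lemma orthogonal_diag_nonneg:
  assumes Q: "(Q :: real mat) \<in> carrier_mat n n" "Q\<^sup>T * Q = 1\<^sub>m n" "Q * Q\<^sup>T = 1\<^sub>m n" and i: "i < n"
    and psd: "\<And>x. x \<in> carrier_vec n \<Longrightarrow> 0 \<le> x \<bullet> (Q * mat_diag n e * Q\<^sup>T *\<^sub>v x)"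
  shows "e i \<ge> 0"
proof -
  have q: "col Q i \<in> carrier_vec n" using Q i by simp
  have one: "col Q i \<bullet> col Q i = 1"
    using orthogonal_mat_columns(1)[OF Q i i] Q(1) i by (simp add: scalar_prod_def atLeast0LessThan)
  show ?thesis using psd[OF q] unfolding orthogonal_diag_mult_col[OF Q(1,2) i] scalar_prod_smult_distrib[OF q q] one by simp
qed

lemma minv_orthogonal_diag_shift:
  assumes Q: "(Q :: real mat) \<in> carrier_mat n n" "Q\<^sup>T * Q = 1\<^sub>m n" "Q * Q\<^sup>T = 1\<^sub>m n"
    and e: "\<And>i. i < n \<Longrightarrow> e i + t \<noteq> 0"
  shows "minv (Q * mat_diag n e * Q\<^sup>T + t \<cdot>\<^sub>m 1\<^sub>m n) = Q * mat_diag n (\<lambda>i. 1 / (e i + t)) * Q\<^sup>T"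
proof (rule minv_unique(1))
  let ?D = "mat_diag n (\<lambda>i. e i + t)" and ?E = "mat_diag n (\<lambda>i. 1 / (e i + t))"
  have QT: "Q\<^sup>T \<in> carrier_mat n n" using Q by simp
  have c: "Q * mat_diag n f * Q\<^sup>T \<in> carrier_mat n n" for f
    by (rule mult_carrier_mat[OF mult_carrier_mat[OF Q(1) mat_diag_dim] QT])
  have QD: "Q * mat_diag n f \<in> carrier_mat n n" for f by (rule mult_carrier_mat[OF Q(1) mat_diag_dim])
  show "Q * mat_diag n e * Q\<^sup>T + t \<cdot>\<^sub>m 1\<^sub>m n \<in> carrier_mat n n" by simp
  show "Q * ?E * Q\<^sup>T \<in> carrier_mat n n" by (rule c)
  have shift: "Q * mat_diag n e * Q\<^sup>T + t \<cdot>\<^sub>m 1\<^sub>m n = Q * ?D * Q\<^sup>T"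
  proof (rule eq_matI)
    fix k l assume "k < dim_row (Q * ?D * Q\<^sup>T)" "l < dim_col (Q * ?D * Q\<^sup>T)"
    then have kl: "k < n" "l < n" using Q by auto
    have "t * (if k = l then 1 else 0) = (\<Sum>m<n. t * (Q $$ (k, m) * Q $$ (l, m)))"
      unfolding sum_distrib_left[symmetric] orthogonal_mat_columns(2)[OF Q kl] ..
    then show "(Q * mat_diag n e * Q\<^sup>T + t \<cdot>\<^sub>m 1\<^sub>m n) $$ (k, l) = (Q * ?D * Q\<^sup>T) $$ (k, l)"
      unfolding orthogonal_diag_entry[OF Q(1) kl] using kl carrier_matD[OF c[of e]] orthogonal_diag_entry[OF Q(1) kl, of e]
      by (simp add: distrib_right sum.distrib)
  qed (use Q in auto)
  have "Q * ?D * Q\<^sup>T * (Q * ?E * Q\<^sup>T) = Q * ?D * (Q\<^sup>T * (Q * ?E * Q\<^sup>T))"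
    by (rule assoc_mult_mat[OF QD QT c])
  also have "Q\<^sup>T * (Q * ?E * Q\<^sup>T) = Q\<^sup>T * (Q * ?E) * Q\<^sup>T" by (rule assoc_mult_mat[OF QT QD QT, symmetric])
  also have "Q\<^sup>T * (Q * ?E) = ?E"
    using assoc_mult_mat[OF QT Q(1) mat_diag_dim, of "\<lambda>i. 1 / (e i + t)"] unfolding Q(2) by (simp add: left_mult_one_mat[OF mat_diag_dim])
  also have "Q * ?D * (?E * Q\<^sup>T) = Q * ?D * ?E * Q\<^sup>T"
    by (rule assoc_mult_mat[OF QD mat_diag_dim QT, symmetric])
  also have "Q * ?D * ?E = Q * (?D * ?E)" by (rule assoc_mult_mat[OF Q(1) mat_diag_dim mat_diag_dim])
  also have "?D * ?E = mat_diag n (\<lambda>i. (e i + t) * (1 / (e i + t)))" by (rule mat_diag_diag)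
  also have "\<dots> = 1\<^sub>m n" using e by (intro eq_matI) (auto simp: mat_diag_def)
  also have "Q * 1\<^sub>m n * Q\<^sup>T = 1\<^sub>m n" using Q by simp
  finally show "(Q * mat_diag n e * Q\<^sup>T + t \<cdot>\<^sub>m 1\<^sub>m n) * (Q * ?E * Q\<^sup>T) = 1\<^sub>m n" unfolding shift .
qed

lemma nn_integral_dirac_sum:
  assumes h: "h \<in> borel_measurable borel"
  shows "(\<integral>\<^sup>+x. h x \<partial>dirac_sum S) = (\<Sum>x\<in>#S. h x)"
proof (induction S)
  case empty
  have "dirac_sum {#} = null_measure borel" by (rule measure_eqI) (auto simp: emeasure_dirac_sum)
  then show ?case by simp
next
  case (add x S)
  have "dirac_sum (add_mset x S) = add_measure (return borel x) (dirac_sum S)"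
    by (rule measure_eqI) (auto simp: emeasure_dirac_sum emeasure_add_measure)
  then show ?case using add h by (simp add: nn_integral_add_measure nn_integral_return)
qed

text \<open>In an eigenbasis the law is the average of point masses at the \<open>e i\<close>, and
  the trace of the resolvent is the sum of \<open>1 / (e i + t)\<close>; positivity keeps all
  denominators away from zero.\<close>

lemma empirical_eigenvalue_distribution_psd:
  assumes A: "A \<in> carrier_mat n n" "A\<^sup>T = A" and psd: "\<And>x. x \<in> carrier_vec n \<Longrightarrow> 0 \<le> x \<bullet> (A *\<^sub>v x)" and n: "n > 0"
  shows "real_distribution (empirical_eigenvalue_distribution A)"
    and "AE x in empirical_eigenvalue_distribution A. x \<ge> 0"
    and "\<And>t. t > 0 \<Longrightarrow> (LINT x|empirical_eigenvalue_distribution A. 1 / (x + t)) = mtrace (minv (A + t \<cdot>\<^sub>m 1\<^sub>m n)) / n"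
proof -
  obtain Q e where Q: "Q \<in> carrier_mat n n" "Q\<^sup>T * Q = 1\<^sub>m n" "Q * Q\<^sup>T = 1\<^sub>m n" and AQ: "A = Q * mat_diag n e * Q\<^sup>T"
    using real_symmetric_spectral[OF A] by blast
  let ?E = "empirical_eigenvalue_distribution A"
  have e0: "e i \<ge> 0" if "i < n" for i
    by (rule orthogonal_diag_nonneg[OF Q that]) (use psd AQ in simp)
  have E: "?E = scale_measure (1 / of_nat n) (dirac_sum (mset (map e [0..<n])))"
    unfolding empirical_eigenvalue_distribution_def char_poly_orthogonal_diag(2)[OF Q, of e, folded AQ]
      carrier_matD(1)[OF A(1)] ..
  have sets [simp]: "sets ?E = sets borel" unfolding E by simp
  have space [simp]: "space ?E = UNIV" using sets_eq_imp_space_eq[OF sets] by simp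
  have nn: "(\<integral>\<^sup>+x. h x \<partial>?E) = 1 / of_nat n * (\<Sum>i<n. h (e i))" if h: "h \<in> borel_measurable borel" for h
  proof -
    have "h \<in> borel_measurable (dirac_sum S)" for S using h by (simp cong: measurable_cong_sets)
    then have "(\<integral>\<^sup>+x. h x \<partial>?E) = 1 / of_nat n * (\<Sum>x\<in>#mset (map e [0..<n]). h x)"
      unfolding E by (subst nn_integral_scale_measure) (simp_all add: nn_integral_dirac_sum[OF h])
    also have "(\<Sum>x\<in>#mset (map e [0..<n]). h x) = (\<Sum>i<n. h (e i))"
      by (simp add: sum_unfold_sum_mset image_mset.compositionality comp_def atLeast0LessThan)
    finally show ?thesis .
  qed
  have inv: "1 / (of_nat n :: ennreal) = ennreal (1 / n)"
    using n by (simp add: divide_ennreal[symmetric] ennreal_of_nat_eq_real_of_nat)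
  have "emeasure ?E UNIV = (\<integral>\<^sup>+x. 1 \<partial>?E)" by simp
  also have "\<dots> = 1 / of_nat n * of_nat n" by (subst nn) auto
  also have "\<dots> = ennreal (1 / n) * ennreal n" unfolding inv by (simp add: ennreal_of_nat_eq_real_of_nat)
  also have "\<dots> = 1" using n by (simp add: ennreal_mult[symmetric])
  finally have "prob_space ?E" by (intro prob_spaceI) simp
  then show rd: "real_distribution ?E" by (simp add: real_distribution_def real_distribution_axioms_def)
  have "(\<Sum>i<n. indicator {..<0} (e i) :: ennreal) = 0"
    using e0 by (intro sum.neutral) (auto simp: indicator_def not_less)
  then have "(\<integral>\<^sup>+x. indicator {..<0} x \<partial>?E) = 0" by (subst nn) auto
  then have "emeasure ?E {..<0} = 0" by simp
  then show ae: "AE x in ?E. x \<ge> 0" by (intro AE_I[of _ _ "{..<0}"]) auto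
  fix t :: real assume t: "t > 0"
  have pos: "AE x in ?E. 0 \<le> 1 / (x + t)" using ae by eventually_elim (use t in auto)
  have ep: "0 \<le> 1 / (e i + t)" if "i < n" for i using e0[OF that] t by simp
  have "(\<integral>\<^sup>+x. ennreal (1 / (x + t)) \<partial>?E) = ennreal (1 / n) * (\<Sum>i<n. ennreal (1 / (e i + t)))"
    by (subst nn) (auto simp: inv)
  also have "\<dots> = ennreal (1 / n) * ennreal (\<Sum>i<n. 1 / (e i + t))" using ep by (subst sum_ennreal) auto
  also have "\<dots> = ennreal (1 / n * (\<Sum>i<n. 1 / (e i + t)))" using ep by (intro ennreal_mult[symmetric] sum_nonneg) auto
  finally have nnt: "(\<integral>\<^sup>+x. ennreal (1 / (x + t)) \<partial>?E) = ennreal (1 / n * (\<Sum>i<n. 1 / (e i + t)))" .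
  have m: "(\<lambda>x. 1 / (x + t)) \<in> borel_measurable ?E" by (simp cong: measurable_cong_sets)
  have "(LINT x|?E. 1 / (x + t)) = 1 / n * (\<Sum>i<n. 1 / (e i + t))"
  proof -
    have "0 \<le> 1 / real n * (\<Sum>i<n. 1 / (e i + t))" using ep by (intro mult_nonneg_nonneg sum_nonneg) auto
    then show ?thesis unfolding integral_eq_nn_integral[OF m pos] nnt by (rule enn2real_ennreal)
  qed
  also have "(\<Sum>i<n. 1 / (e i + t)) = mtrace (minv (A + t \<cdot>\<^sub>m 1\<^sub>m n))"
    unfolding AQ
  proof (subst minv_orthogonal_diag_shift[OF Q])
    show "e i + t \<noteq> 0" if "i < n" for i using e0[OF that] t by simp
  qed (simp add: mtrace_orthogonal_diag[OF Q])
  finally show "(LINT x|?E. 1 / (x + t)) = mtrace (minv (A + t \<cdot>\<^sub>m 1\<^sub>m n)) / n" by simp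
qed

section \<open>Empirical laws of the fitted values and the coefficients\<close>

lemma minv_smult:
  assumes A: "A \<in> carrier_mat n n" "det A \<noteq> 0" and c: "c \<noteq> 0"
  shows "minv (c \<cdot>\<^sub>m A) = (1 / c) \<cdot>\<^sub>m minv A"
proof (rule minv_unique(1))
  note m = minv[OF A]
  show "c \<cdot>\<^sub>m A * ((1 / c) \<cdot>\<^sub>m minv A) = 1\<^sub>m n"
    using mult_smult_assoc_mat[OF A(1) smult_carrier_mat[OF m(1)], of c "1 / c"] mult_smult_distrib[OF A(1) m(1), of "1 / c"] m(2) c
    by (auto intro!: eq_matI)
qed (use A minv[OF A] in auto)

lemma mat_inverse_eq_minv:
  assumes A: "A \<in> carrier_mat n n" "det A \<noteq> 0"
  shows "mat_inverse A = Some (minv A)"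
proof (cases "mat_inverse A")
  case None
  then show ?thesis using mat_inverse(1)[OF A(1), where b = "()"] det_non_zero_imp_unit[OF A, where b = "()"] by simp
next
  case (Some B)
  from mat_inverse(2)[OF A(1) this] have "A * B = 1\<^sub>m n" "B \<in> carrier_mat n n" by auto
  then show ?thesis using minv_unique(1)[OF A(1)] Some by simp
qed

text \<open>Brings both matrices to the form \<open>U\<^sup>T * B * U\<close>. For the fitted values
  one factor \<open>S\<close> cancels, leaving the projection onto the column space; for the
  coefficients \<open>S\<^sup>-\<^sup>2\<close> remains in the middle.\<close>

lemma hat_gram:
  assumes X: "X \<in> carrier_mat n p" and U: "U \<in> carrier_mat n r" and det: "det (X\<^sup>T * X) \<noteq> 0"
  defines "S \<equiv> X\<^sup>T * X"
  shows "A_hat X U \<in> carrier_mat p r" "Y_hat X U \<in> carrier_mat n r"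
    "(Y_hat X U)\<^sup>T * Y_hat X U = U\<^sup>T * (X * minv S * X\<^sup>T) * U"
    "(A_hat X U)\<^sup>T * A_hat X U = U\<^sup>T * (X * (minv S * minv S) * X\<^sup>T) * U"
proof -
  have S: "S \<in> carrier_mat p p" "det S \<noteq> 0" "S\<^sup>T = S" using X det gram_symmetric[of X] by (auto simp: S_def)
  note m = minv[OF S(1,2)]
  have mT: "(minv S)\<^sup>T = minv S" by (rule minv_symmetric[OF S])
  have XT: "X\<^sup>T \<in> carrier_mat p n" and UT: "U\<^sup>T \<in> carrier_mat r n" using X U by auto
  have A: "A_hat X U = minv S * X\<^sup>T * U"
    unfolding A_hat_def S_def[symmetric] mat_inverse_eq_minv[OF S(1,2)] by simp
  have mX: "minv S * X\<^sup>T \<in> carrier_mat p n" by (rule mult_carrier_mat[OF m(1) XT])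
  have mXU: "minv S * X\<^sup>T * U \<in> carrier_mat p r" by (rule mult_carrier_mat[OF mX U])
  show Ac: "A_hat X U \<in> carrier_mat p r" unfolding A by (rule mXU)
  show "Y_hat X U \<in> carrier_mat n r" unfolding Y_hat_def by (rule mult_carrier_mat[OF X Ac])
  have Xm: "X * minv S \<in> carrier_mat n p" by (rule mult_carrier_mat[OF X m(1)])
  have AT: "(minv S * X\<^sup>T * U)\<^sup>T = U\<^sup>T * (X * minv S)"
    unfolding transpose_mult[OF mX U] transpose_mult[OF m(1) XT] mT by simp
  have UXm: "U\<^sup>T * (X * minv S) \<in> carrier_mat r p" by (rule mult_carrier_mat[OF UT Xm])
  have mm: "minv S * minv S \<in> carrier_mat p p" by (rule mult_carrier_mat[OF m(1) m(1)])
  have "(A_hat X U)\<^sup>T * A_hat X U = U\<^sup>T * (X * minv S) * (minv S * X\<^sup>T * U)" unfolding A AT ..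
  also have "\<dots> = U\<^sup>T * (X * minv S) * (minv S * X\<^sup>T) * U" by (rule assoc_mult_mat[OF UXm mX U, symmetric])
  also have "U\<^sup>T * (X * minv S) * (minv S * X\<^sup>T) = U\<^sup>T * (X * minv S * (minv S * X\<^sup>T))" by (rule assoc_mult_mat[OF UT Xm mX])
  also have "X * minv S * (minv S * X\<^sup>T) = X * minv S * minv S * X\<^sup>T" by (rule assoc_mult_mat[OF Xm m(1) XT, symmetric])
  also have "X * minv S * minv S = X * (minv S * minv S)" by (rule assoc_mult_mat[OF X m(1) m(1)])
  finally show "(A_hat X U)\<^sup>T * A_hat X U = U\<^sup>T * (X * (minv S * minv S) * X\<^sup>T) * U" .
  have YT: "(X * (minv S * X\<^sup>T * U))\<^sup>T = U\<^sup>T * (X * minv S) * X\<^sup>T"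
    unfolding transpose_mult[OF X mXU] AT ..
  have "(Y_hat X U)\<^sup>T * Y_hat X U = U\<^sup>T * (X * minv S) * X\<^sup>T * (X * (minv S * X\<^sup>T * U))" unfolding Y_hat_def A YT ..
  also have "\<dots> = U\<^sup>T * (X * minv S) * (X\<^sup>T * (X * (minv S * X\<^sup>T * U)))"
    by (rule assoc_mult_mat[OF UXm XT mult_carrier_mat[OF X mXU]])
  also have "X\<^sup>T * (X * (minv S * X\<^sup>T * U)) = S * (minv S * X\<^sup>T * U)" unfolding S_def by (rule assoc_mult_mat[OF XT X mXU[unfolded S_def], symmetric])
  also have "\<dots> = S * (minv S * (X\<^sup>T * U))" unfolding assoc_mult_mat[OF m(1) XT U] ..
  also have "\<dots> = S * minv S * (X\<^sup>T * U)" by (rule assoc_mult_mat[OF S(1) m(1) mult_carrier_mat[OF XT U], symmetric])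
  also have "\<dots> = X\<^sup>T * U" unfolding m(2) by (rule left_mult_one_mat[OF mult_carrier_mat[OF XT U]])
  also have "U\<^sup>T * (X * minv S) * (X\<^sup>T * U) = U\<^sup>T * (X * minv S) * X\<^sup>T * U" by (rule assoc_mult_mat[OF UXm XT U, symmetric])
  also have "U\<^sup>T * (X * minv S) * X\<^sup>T = U\<^sup>T * (X * minv S * X\<^sup>T)" by (rule assoc_mult_mat[OF UT Xm XT])
  finally show "(Y_hat X U)\<^sup>T * Y_hat X U = U\<^sup>T * (X * minv S * X\<^sup>T) * U" .
qed

lemma empirical_smult_gram:
  assumes Y: "Y \<in> carrier_mat n r" and c: "c \<ge> 0" and r: "r > 0"
  shows "real_distribution (empirical_eigenvalue_distribution (c \<cdot>\<^sub>m (Y\<^sup>T * Y)))"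
    and "AE x in empirical_eigenvalue_distribution (c \<cdot>\<^sub>m (Y\<^sup>T * Y)). x \<ge> 0"
    and "t > 0 \<Longrightarrow> (LINT x|empirical_eigenvalue_distribution (c \<cdot>\<^sub>m (Y\<^sup>T * Y)). 1 / (x + t)) = mtrace (minv (c \<cdot>\<^sub>m (Y\<^sup>T * Y) + t \<cdot>\<^sub>m 1\<^sub>m r)) / r"
proof -
  have S: "Y\<^sup>T * Y \<in> carrier_mat r r" using Y by simp
  have C: "c \<cdot>\<^sub>m (Y\<^sup>T * Y) \<in> carrier_mat r r" using S by simp
  have sym: "(c \<cdot>\<^sub>m (Y\<^sup>T * Y))\<^sup>T = c \<cdot>\<^sub>m (Y\<^sup>T * Y)"
  proof (rule eq_matI)
    fix i j assume ij: "i < dim_row (c \<cdot>\<^sub>m (Y\<^sup>T * Y))" "j < dim_col (c \<cdot>\<^sub>m (Y\<^sup>T * Y))"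
    have "(Y\<^sup>T * Y) $$ (j, i) = (Y\<^sup>T * Y)\<^sup>T $$ (i, j)" using ij S by simp
    then show "(c \<cdot>\<^sub>m (Y\<^sup>T * Y))\<^sup>T $$ (i, j) = (c \<cdot>\<^sub>m (Y\<^sup>T * Y)) $$ (i, j)"
      unfolding gram_symmetric using ij by simp
  qed (use Y in auto)
  have psd: "0 \<le> x \<bullet> (c \<cdot>\<^sub>m (Y\<^sup>T * Y) *\<^sub>v x)" if x: "x \<in> carrier_vec r" for x
  proof -
    have "c \<cdot>\<^sub>m (Y\<^sup>T * Y) *\<^sub>v x = c \<cdot>\<^sub>v (Y\<^sup>T * Y *\<^sub>v x)" using S x by (intro eq_vecI) auto
    then have "x \<bullet> (c \<cdot>\<^sub>m (Y\<^sup>T * Y) *\<^sub>v x) = c * ((Y *\<^sub>v x) \<bullet> (Y *\<^sub>v x))"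
      using scalar_prod_smult_distrib[OF x mult_mat_vec_carrier[OF S x]] gram_quadratic[OF Y x] by simp
    then show ?thesis using c scalar_prod_self_nonneg[of "Y *\<^sub>v x"] by simp
  qed
  note emp = empirical_eigenvalue_distribution_psd[OF C sym psd r]
  show "real_distribution (empirical_eigenvalue_distribution (c \<cdot>\<^sub>m (Y\<^sup>T * Y)))"
    "AE x in empirical_eigenvalue_distribution (c \<cdot>\<^sub>m (Y\<^sup>T * Y)). x \<ge> 0"
    using emp(1,2) by blast+
  show "t > 0 \<Longrightarrow> (LINT x|empirical_eigenvalue_distribution (c \<cdot>\<^sub>m (Y\<^sup>T * Y)). 1 / (x + t)) = mtrace (minv (c \<cdot>\<^sub>m (Y\<^sup>T * Y) + t \<cdot>\<^sub>m 1\<^sub>m r)) / r"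
    by (rule emp)
qed

text \<open>The factor \<open>1 / r\<close> is moved into the spectral parameter, which becomes
  \<open>r * t\<close>. It cancels against the normalisation of the empirical law, so the transform
  is an unnormalised trace.\<close>

lemma empirical_scaled_resolvent:
  assumes Y: "Y \<in> carrier_mat n r" and r: "r > 0" and t: "t > 0"
  shows "(LINT x|empirical_eigenvalue_distribution (1 / real r \<cdot>\<^sub>m (Y\<^sup>T * Y)). 1 / (x + t)) = mtrace (minv (Y\<^sup>T * Y + (r * t) \<cdot>\<^sub>m 1\<^sub>m r))"
proof -
  define K where "K = 1 \<cdot>\<^sub>m (Y\<^sup>T * Y) + (r * t) \<cdot>\<^sub>m 1\<^sub>m r"
  have S: "Y\<^sup>T * Y \<in> carrier_mat r r" using Y by simp
  interpret K: coercive_mat K r "r * t"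
    unfolding K_def by (rule coercive_gram[OF Y]) (use r t in auto)
  have K: "K = Y\<^sup>T * Y + (r * t) \<cdot>\<^sub>m 1\<^sub>m r" unfolding K_def using S by (intro eq_matI) auto
  have "1 / real r \<cdot>\<^sub>m (Y\<^sup>T * Y) + t \<cdot>\<^sub>m 1\<^sub>m r = (1 / real r) \<cdot>\<^sub>m K"
    unfolding K using S r by (intro eq_matI) (auto simp: distrib_left)
  then have "(LINT x|empirical_eigenvalue_distribution (1 / real r \<cdot>\<^sub>m (Y\<^sup>T * Y)). 1 / (x + t)) = mtrace (minv ((1 / real r) \<cdot>\<^sub>m K)) / r"
    using empirical_smult_gram(3)[OF Y _ r t, of "1 / real r"] r by simp
  also have "minv ((1 / real r) \<cdot>\<^sub>m K) = real r \<cdot>\<^sub>m minv K"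
    using minv_smult[OF K.carrier K.det_nz, of "1 / real r"] r by simp
  also have "mtrace (real r \<cdot>\<^sub>m minv K) / r = mtrace (minv K)" using mtrace_smult[OF K.inv_carrier] r by simp
  finally show ?thesis unfolding K .
qed

section \<open>Exceptional events\<close>

lemma measurable_mat_compose:
  assumes A: "measurable_mat M' n m A" and f: "f \<in> measurable M M'"
  shows "measurable_mat M n m (\<lambda>\<omega>. A (f \<omega>))"
  using measurable_matD(1)[OF A] measurable_compose[OF f measurable_matD(4)[OF A]]
  unfolding measurable_mat_def by blast

lemma measurable_mat_of_entries: "measurable_mat (entry_space n m) n m (\<lambda>x. mat n m x)"
  unfolding measurable_mat_def
proof (intro conjI allI impI)
  fix i j assume ij: "i < n" "j < m"
  have "(\<lambda>x. x (i, j)) \<in> borel_measurable (entry_space n m)"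
    unfolding entry_space_def using ij by (intro measurable_component_singleton) auto
  then show "(\<lambda>x. mat n m x $$ (i, j)) \<in> borel_measurable (entry_space n m)" using ij by (simp only: index_mat)
qed simp

lemma mat_mat_entries: "A \<in> carrier_mat n m \<Longrightarrow> mat n m (mat_entries n m A) = A"
  by (rule eq_matI) (auto simp: mat_entries_def)

lemma distr_gaussian_entries:
  assumes M: "prob_space M" and iid: "iid_std_gaussian_entries M n m A" and nm: "n > 0" "m > 0"
  shows "distr M (entry_space n m) (\<lambda>\<omega>. mat_entries n m (A \<omega>)) = std_gaussian ({..<n} \<times> {..<m})"
proof -
  interpret prob_space M by fact
  let ?S = "{..<n} \<times> {..<m}"
  let ?N = "density lborel (\<lambda>x. ennreal (std_normal_density x))"
  have D: "distributed M lborel (\<lambda>\<omega>. A \<omega> $$ ij) (\<lambda>x. ennreal (std_normal_density x))" if "ij \<in> ?S" for ij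
    using iid that unfolding iid_std_gaussian_entries_def by blast
  have rv: "random_variable borel (\<lambda>\<omega>. A \<omega> $$ ij)" if "ij \<in> ?S" for ij
    using distributed_measurable[OF D[OF that]] by (simp only: measurable_lborel1)
  have comp: "distr M borel (\<lambda>\<omega>. A \<omega> $$ ij) = ?N" if "ij \<in> ?S" for ij
  proof -
    have "distr M borel (\<lambda>\<omega>. A \<omega> $$ ij) = distr M lborel (\<lambda>\<omega>. A \<omega> $$ ij)" by (rule distr_cong) simp_all
    also have "\<dots> = ?N" by (rule distributed_distr_eq_density[OF D[OF that]])
    finally show ?thesis .
  qed
  have ne: "?S \<noteq> {}" using nm by auto
  have "indep_vars (\<lambda>_. borel) (\<lambda>ij \<omega>. A \<omega> $$ ij) ?S" using iid unfolding iid_std_gaussian_entries_def by blast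
  then have "distr M (\<Pi>\<^sub>M ij\<in>?S. borel) (\<lambda>\<omega>. \<lambda>ij\<in>?S. A \<omega> $$ ij) = (\<Pi>\<^sub>M ij\<in>?S. distr M borel (\<lambda>\<omega>. A \<omega> $$ ij))"
    using indep_vars_iff_distr_eq_PiM'[OF ne, of "\<lambda>ij \<omega>. A \<omega> $$ ij" "\<lambda>_. borel"] rv by blast
  also have "\<dots> = std_gaussian ?S" unfolding std_gaussian_def by (intro PiM_cong refl comp)
  finally show ?thesis unfolding entry_space_def mat_entries_def .
qed

lemma space_entry_space: "space (entry_space n m) = space (std_gaussian ({..<n} \<times> {..<m}))"
  unfolding entry_space_def by (rule sets_eq_imp_space_eq[OF sets_std_gaussian[symmetric]])

text \<open>Independence makes the joint law of the entries a product, so Fubini integrates a bound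
  that holds for each fixed design \<open>A\<close>. Full rank holds only almost surely, so the
  bound is demanded only for \<open>A\<close> with invertible Gram matrix.\<close>

lemma joint_event_bound:
  fixes \<Phi> :: "real mat \<Rightarrow> real mat \<Rightarrow> bool"
  assumes M: "prob_space M" and dims: "n > 0" "r > 0"
    and X: "random_matrix M n p X" and U: "random_matrix M n r U" and iid: "iid_std_gaussian_entries M n r U"
    and ind: "indep_random_matrices M n p X n r U"
    and rank: "AE \<omega> in M. vec_space.rank n (X \<omega>) = p"
    and meas: "{z \<in> space (entry_space n p \<Otimes>\<^sub>M entry_space n r). \<Phi> (mat n p (fst z)) (mat n r (snd z))} \<in> sets (entry_space n p \<Otimes>\<^sub>M entry_space n r)"
    and bound: "\<And>A. A \<in> carrier_mat n p \<Longrightarrow> det (A\<^sup>T * A) \<noteq> 0 \<Longrightarrow>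
      emeasure (std_gaussian ({..<n} \<times> {..<r})) {u \<in> space (std_gaussian ({..<n} \<times> {..<r})). \<Phi> A (mat n r u)} \<le> K"
  shows "{\<omega> \<in> space M. \<Phi> (X \<omega>) (U \<omega>)} \<in> sets M" "emeasure M {\<omega> \<in> space M. \<Phi> (X \<omega>) (U \<omega>)} \<le> K"
proof -
  interpret prob_space M by fact
  let ?EX = "entry_space n p" and ?EU = "entry_space n r"
  let ?x = "\<lambda>\<omega>. mat_entries n p (X \<omega>)" and ?u = "\<lambda>\<omega>. mat_entries n r (U \<omega>)"
  let ?G = "std_gaussian ({..<n} \<times> {..<r})"
  define \<Psi> where "\<Psi> = {z \<in> space (?EX \<Otimes>\<^sub>M ?EU). \<Phi> (mat n p (fst z)) (mat n r (snd z))}"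
  have \<Psi>: "\<Psi> \<in> sets (?EX \<Otimes>\<^sub>M ?EU)" unfolding \<Psi>_def by (rule meas)
  have car: "X \<omega> \<in> carrier_mat n p" "U \<omega> \<in> carrier_mat n r" if "\<omega> \<in> space M" for \<omega>
    using X U that unfolding random_matrix_def by auto
  have xm: "?x \<in> measurable M ?EX" and um: "?u \<in> measurable M ?EU"
    using X U unfolding random_matrix_def by auto
  have pm: "(\<lambda>\<omega>. (?x \<omega>, ?u \<omega>)) \<in> measurable M (?EX \<Otimes>\<^sub>M ?EU)" by (rule measurable_Pair[OF xm um])
  have ev: "{\<omega> \<in> space M. \<Phi> (X \<omega>) (U \<omega>)} = (\<lambda>\<omega>. (?x \<omega>, ?u \<omega>)) -` \<Psi> \<inter> space M"
  proof -
    have "\<omega> \<in> (\<lambda>\<omega>. (?x \<omega>, ?u \<omega>)) -` \<Psi> \<longleftrightarrow> \<Phi> (X \<omega>) (U \<omega>)" if \<omega>: "\<omega> \<in> space M" for \<omega>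
      using measurable_space[OF pm \<omega>] mat_mat_entries[OF car(1)[OF \<omega>]] mat_mat_entries[OF car(2)[OF \<omega>]]
      unfolding \<Psi>_def by simp
    then show ?thesis by blast
  qed
  show "{\<omega> \<in> space M. \<Phi> (X \<omega>) (U \<omega>)} \<in> sets M" unfolding ev by (rule measurable_sets[OF pm \<Psi>])
  have DU: "distr M ?EU ?u = ?G" by (rule distr_gaussian_entries[OF M iid dims])
  have joint: "distr M ?EX ?x \<Otimes>\<^sub>M ?G = distr M (?EX \<Otimes>\<^sub>M ?EU) (\<lambda>\<omega>. (?x \<omega>, ?u \<omega>))"
    using ind unfolding indep_random_matrices_def indep_var_distribution_eq DU by blast
  interpret G: prob_space ?G by (rule prob_space_std_gaussian)
  interpret DX: prob_space "distr M ?EX ?x" by (rule prob_space_distr[OF xm])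
  have "emeasure M {\<omega> \<in> space M. \<Phi> (X \<omega>) (U \<omega>)} = emeasure (distr M (?EX \<Otimes>\<^sub>M ?EU) (\<lambda>\<omega>. (?x \<omega>, ?u \<omega>))) \<Psi>"
    unfolding ev by (rule emeasure_distr[OF pm \<Psi>, symmetric])
  also have "\<dots> = emeasure (distr M ?EX ?x \<Otimes>\<^sub>M ?G) \<Psi>" unfolding joint ..
  also have "\<dots> = (\<integral>\<^sup>+x. emeasure ?G (Pair x -` \<Psi>) \<partial>distr M ?EX ?x)"
  proof (rule G.emeasure_pair_measure_alt)
    have "sets (distr M ?EX ?x \<Otimes>\<^sub>M ?G) = sets (?EX \<Otimes>\<^sub>M ?EU)" unfolding joint by (rule sets_distr)
    then show "\<Psi> \<in> sets (distr M ?EX ?x \<Otimes>\<^sub>M ?G)" using \<Psi> by simp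
  qed
  also have "\<dots> \<le> (\<integral>\<^sup>+x. K \<partial>distr M ?EX ?x)"
  proof (rule nn_integral_mono_AE)
    let ?P = "\<lambda>x. det ((mat n p x)\<^sup>T * mat n p x) \<noteq> 0"
    have dm: "(\<lambda>x. det ((mat n p x)\<^sup>T * mat n p x)) \<in> borel_measurable ?EX"
      by (rule measurable_det[OF measurable_mat_mult[OF measurable_mat_transpose[OF measurable_mat_of_entries] measurable_mat_of_entries]])
    have Pm: "{x \<in> space ?EX. ?P x} \<in> sets ?EX"
      by (rule borel_measurable_neq[OF dm borel_measurable_const])
    have "AE \<omega> in M. ?P (?x \<omega>)"
      using rank AE_space
    proof eventually_elim
      case (elim \<omega>)
      then show ?case using full_rank_det_gram[OF car(1)] mat_mat_entries[OF car(1)] by simp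
    qed
    then have "AE x in distr M ?EX ?x. ?P x" unfolding AE_distr_iff[OF xm Pm] .
    then show "AE x in distr M ?EX ?x. emeasure ?G (Pair x -` \<Psi>) \<le> K"
      using AE_space
    proof eventually_elim
      case (elim x)
      then have x: "x \<in> space ?EX" by simp
      have "Pair x -` \<Psi> = {u \<in> space ?G. \<Phi> (mat n p x) (mat n r u)}"
        unfolding \<Psi>_def space_pair_measure using x by (auto simp: space_entry_space)
      then show ?case using bound[of "mat n p x"] elim(1) by simp
    qed
  qed
  also have "\<dots> = K" using DX.emeasure_space_1 by simp
  finally show "emeasure M {\<omega> \<in> space M. \<Phi> (X \<omega>) (U \<omega>)} \<le> K" .
qed

section \<open>The three exceptional events\<close>

definition gram_resolvent :: "real mat \<Rightarrow> real \<Rightarrow> real" where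
  "gram_resolvent X s = mtrace (minv (X\<^sup>T * X + s \<cdot>\<^sub>m 1\<^sub>m (dim_col X)))"

definition compressed_resolvent :: "real mat \<Rightarrow> real mat \<Rightarrow> real mat \<Rightarrow> real \<Rightarrow> real" where
  "compressed_resolvent X C U t = mtrace (minv (U\<^sup>T * (X * C * X\<^sup>T) * U + t \<cdot>\<^sub>m 1\<^sub>m (dim_col U)))"

text \<open>The defect of the self-consistent equation for \<open>X\<^sup>T * X\<close>, with
  \<open>n\<close> rows of weight one in dimension \<open>p\<close>. The spectral parameter is
  \<open>r * s\<close> because the trace \<open>\<theta>\<close> at which it is evaluated later is
  \<open>r\<close> times a transform value.\<close>

definition gram_event :: "nat \<Rightarrow> nat \<Rightarrow> nat \<Rightarrow> real \<Rightarrow> real \<Rightarrow> real mat \<Rightarrow> bool" where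
  "gram_event n p r s \<eta> X \<longleftrightarrow> \<eta> * p < \<bar>r * s * gram_resolvent X (r * s)
     + n * (gram_resolvent X (r * s) / (1 + gram_resolvent X (r * s))) - p\<bar>"

definition fitted_event :: "nat \<Rightarrow> nat \<Rightarrow> real \<Rightarrow> real \<Rightarrow> real mat \<Rightarrow> real mat \<Rightarrow> bool" where
  "fitted_event p r t \<eta> X U \<longleftrightarrow> \<eta> * r < \<bar>r * t * compressed_resolvent X (minv (X\<^sup>T * X)) U (r * t)
     + p * (compressed_resolvent X (minv (X\<^sup>T * X)) U (r * t) / (1 + compressed_resolvent X (minv (X\<^sup>T * X)) U (r * t))) - r\<bar>"

text \<open>With weights \<open>1 / \<sigma> i\<close> the sum in the defect equals
  \<open>\<theta>\<close> times the resolvent trace of \<open>X\<^sup>T * X\<close> at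
  \<open>\<theta>\<close>, so the event is expressed without eigenvalues and is visibly measurable.
  The second term on the left is an upper bound for the number of weights above
  \<open>c / r\<close>.\<close>

definition coeff_event :: "nat \<Rightarrow> real \<Rightarrow> real \<Rightarrow> real \<Rightarrow> real mat \<Rightarrow> real mat \<Rightarrow> bool" where
  "coeff_event r t c \<eta> X U \<longleftrightarrow> \<eta> * r + 2 * (r / c) * gram_resolvent X (r / c) <
     \<bar>t * compressed_resolvent X (minv (X\<^sup>T * X) * minv (X\<^sup>T * X)) U t
     + compressed_resolvent X (minv (X\<^sup>T * X) * minv (X\<^sup>T * X)) U t
       * gram_resolvent X (compressed_resolvent X (minv (X\<^sup>T * X) * minv (X\<^sup>T * X)) U t) - r\<bar>"

lemma one_smult_mat: "(1 :: real) \<cdot>\<^sub>m A = A"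
  by (rule eq_matI) auto

lemma fitted_event_bound:
  assumes A: "A \<in> carrier_mat n p" and det: "det (A\<^sup>T * A) \<noteq> 0" and t: "t > 0" and \<eta>: "\<eta> > 0" and r: "r > 0"
    and large: "n / (r * t) \<le> \<eta> * r / 2"
  shows "emeasure (std_gaussian ({..<n} \<times> {..<r})) {u \<in> space (std_gaussian ({..<n} \<times> {..<r})). fitted_event p r t \<eta> A (mat n r u)}
    \<le> ennreal (960 * real n ^ 4 / (\<eta> ^ 4 * t ^ 4 * real r ^ 6))"
proof -
  obtain Q \<sigma> where Q: "Q \<in> carrier_mat n n" "Q\<^sup>T * Q = 1\<^sub>m n" "Q * Q\<^sup>T = 1\<^sub>m n"
    and \<sigma>': "\<forall>i<n. \<sigma> i \<ge> 0"
    and card: "card {i. i < n \<and> \<sigma> i \<noteq> 0} = p"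
    and P: "A * minv (A\<^sup>T * A) * A\<^sup>T = Q * mat_diag n (\<lambda>i. if \<sigma> i = 0 then 0 else 1) * Q\<^sup>T"
    and B: "A * (minv (A\<^sup>T * A) * minv (A\<^sup>T * A)) * A\<^sup>T = Q * mat_diag n (\<lambda>i. 1 / \<sigma> i) * Q\<^sup>T"
    and g': "\<forall>a>0. \<forall>s>0. mtrace (minv (a \<cdot>\<^sub>m (A\<^sup>T * A) + s \<cdot>\<^sub>m 1\<^sub>m p)) = (\<Sum>i | i < n \<and> \<sigma> i \<noteq> 0. 1 / (a * \<sigma> i + s))"
    by (rule gram_spectral[OF A det])
  define b where "b i = (if \<sigma> i = 0 then 0 else 1 :: real)" for i
  have rt: "real r * t > 0" using r t by simp
  have sum: "(\<Sum>i<n. b i * \<theta> / (1 + b i * \<theta>)) = p * (\<theta> / (1 + \<theta>))" for \<theta>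
  proof -
    have "(\<Sum>i<n. b i * \<theta> / (1 + b i * \<theta>)) = (\<Sum>i | i < n \<and> \<sigma> i \<noteq> 0. \<theta> / (1 + \<theta>))"
      by (rule sum.mono_neutral_cong_right) (auto simp: b_def)
    then show ?thesis using card by simp
  qed
  \<comment> \<open>The threshold constant is taken to be \<open>r\<close>, that is,
    \<open>C = 1\<close>. The weights are \<open>0\<close> or \<open>1\<close>, so none is
    discarded; the factor \<open>r\<close> is compensated by the spectral parameter
    \<open>r * t\<close>.\<close>
  have none: "{i \<in> {..<n}. b i > real r / real r} = {}" using r by (auto simp: b_def)
  have "emeasure (std_gaussian ({..<n} \<times> {..<r})) {u \<in> space (std_gaussian ({..<n} \<times> {..<r})). fitted_event p r t \<eta> A (mat n r u)}
     = emeasure (std_gaussian ({..<n} \<times> {..<r})) {u \<in> space (std_gaussian ({..<n} \<times> {..<r})).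
      self_consistency_defect (r * t) r {..<n} b (mtrace (minv ((mat n r u)\<^sup>T * (Q * mat_diag n b * Q\<^sup>T) * mat n r u + (r * t) \<cdot>\<^sub>m 1\<^sub>m r)))
        > \<eta> * r + card {i\<in>{..<n}. b i > real r / real r}}"
    unfolding none fitted_event_def compressed_resolvent_def P b_def[abs_def, symmetric] self_consistency_defect_def sum by simp
  also have "\<dots> \<le> ennreal (960 * (real r * real n) ^ 4 / (\<eta> ^ 4 * (r * t) ^ 4 * real r ^ 6))"
    by (rule rotated_self_consistent_prob[OF Q rt _ _ \<eta> r]) (use large r in \<open>auto simp: b_def\<close>)
  also have "960 * (real r * real n) ^ 4 / (\<eta> ^ 4 * (r * t) ^ 4 * real r ^ 6) = 960 * real n ^ 4 / (\<eta> ^ 4 * t ^ 4 * real r ^ 6)"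
    using r by (simp add: power_mult_distrib)
  finally show ?thesis .
qed

text \<open>There is no factor \<open>1 / r\<close> here: the weights are inverse eigenvalues,
  naturally of order \<open>1 / n\<close>, so a threshold \<open>c / r\<close> with fixed
  \<open>c\<close> is the right scale and the spectral parameter stays \<open>t\<close>.\<close>

lemma coeff_event_bound:
  assumes A: "A \<in> carrier_mat n p" and det: "det (A\<^sup>T * A) \<noteq> 0" and t: "t > 0" and \<eta>: "\<eta> > 0" and r: "r > 0" and c: "c > 0"
    and large: "c * n / (r * t) \<le> \<eta> * r / 2"
  shows "emeasure (std_gaussian ({..<n} \<times> {..<r})) {u \<in> space (std_gaussian ({..<n} \<times> {..<r})). coeff_event r t c \<eta> A (mat n r u)}
    \<le> ennreal (960 * (c * real n) ^ 4 / (\<eta> ^ 4 * t ^ 4 * real r ^ 6))"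
proof -
  let ?G = "std_gaussian ({..<n} \<times> {..<r})"
  obtain Q \<sigma> where Q: "Q \<in> carrier_mat n n" "Q\<^sup>T * Q = 1\<^sub>m n" "Q * Q\<^sup>T = 1\<^sub>m n"
    and \<sigma>': "\<forall>i<n. \<sigma> i \<ge> 0"
    and card: "card {i. i < n \<and> \<sigma> i \<noteq> 0} = p"
    and P: "A * minv (A\<^sup>T * A) * A\<^sup>T = Q * mat_diag n (\<lambda>i. if \<sigma> i = 0 then 0 else 1) * Q\<^sup>T"
    and B: "A * (minv (A\<^sup>T * A) * minv (A\<^sup>T * A)) * A\<^sup>T = Q * mat_diag n (\<lambda>i. 1 / \<sigma> i) * Q\<^sup>T"
    and g': "\<forall>a>0. \<forall>s>0. mtrace (minv (a \<cdot>\<^sub>m (A\<^sup>T * A) + s \<cdot>\<^sub>m 1\<^sub>m p)) = (\<Sum>i | i < n \<and> \<sigma> i \<noteq> 0. 1 / (a * \<sigma> i + s))"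
    by (rule gram_spectral[OF A det])
  have \<sigma>: "\<sigma> i \<ge> 0" if "i < n" for i using \<sigma>' that by blast
  have g: "mtrace (minv (a \<cdot>\<^sub>m (A\<^sup>T * A) + s \<cdot>\<^sub>m 1\<^sub>m p)) = (\<Sum>i | i < n \<and> \<sigma> i \<noteq> 0. 1 / (a * \<sigma> i + s))"
    if "a > 0" "s > 0" for a s using g' that by blast
  define b where "b i = 1 / \<sigma> i" for i
  have b0: "b i \<ge> 0" if "i < n" for i using \<sigma>[OF that] by (simp add: b_def)
  have gr: "gram_resolvent A s = (\<Sum>i | i < n \<and> \<sigma> i \<noteq> 0. 1 / (\<sigma> i + s))" if "s > 0" for s
    using g[of 1 s] that A unfolding gram_resolvent_def one_smult_mat by simp
  have sum: "(\<Sum>i<n. b i * \<theta> / (1 + b i * \<theta>)) = \<theta> * gram_resolvent A \<theta>" if th: "\<theta> > 0" for \<theta>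
  proof -
    have "(\<Sum>i<n. b i * \<theta> / (1 + b i * \<theta>)) = (\<Sum>i | i < n \<and> \<sigma> i \<noteq> 0. \<theta> * (1 / (\<sigma> i + \<theta>)))"
    proof (rule sum.mono_neutral_cong_right)
      fix i assume "i \<in> {i. i < n \<and> \<sigma> i \<noteq> 0}"
      then have "\<sigma> i > 0" using \<sigma>[of i] by auto
      then show "b i * \<theta> / (1 + b i * \<theta>) = \<theta> * (1 / (\<sigma> i + \<theta>))" using th by (simp add: b_def field_simps)
    qed (auto simp: b_def)
    then show ?thesis unfolding gr[OF th] sum_distrib_left .
  qed
  \<comment> \<open>A weight above \<open>c / r\<close> means \<open>\<sigma> i < w\<close> with
    \<open>w = r / c\<close>, and then \<open>2 * w / (\<sigma> i + w) \<ge> 1\<close>. Summing over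
    all nonzero \<open>\<sigma> i\<close> replaces the count by a resolvent trace.\<close>
  have count: "card {i\<in>{..<n}. b i > c / r} \<le> 2 * (r / c) * gram_resolvent A (r / c)"
  proof -
    have s0: "r / c > 0" and cr: "\<not> c / real r < 0" using r c by (simp_all add: divide_less_0_iff)
    have "real (card {i\<in>{..<n}. b i > c / r}) = (\<Sum>i\<in>{i\<in>{..<n}. b i > c / r}. 1)" by simp
    also have "\<dots> \<le> (\<Sum>i\<in>{i\<in>{..<n}. b i > c / r}. 2 * (r / c) * (1 / (\<sigma> i + r / c)))"
    proof (rule sum_mono)
      fix i assume i: "i \<in> {i\<in>{..<n}. b i > c / r}"
      then have "\<sigma> i \<noteq> 0" using cr by (auto simp: b_def)
      then have "\<sigma> i > 0" using \<sigma>[of i] i by auto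
      then have "\<sigma> i \<le> r / c" using i r c by (auto simp: b_def field_simps)
      moreover have "1 \<le> 2 * w * (1 / (x + w))" if "0 < x" "x \<le> w" for x w :: real using that by simp
      ultimately show "1 \<le> 2 * (r / c) * (1 / (\<sigma> i + r / c))" using \<open>\<sigma> i > 0\<close> by blast
    qed
    also have "\<dots> \<le> (\<Sum>i | i < n \<and> \<sigma> i \<noteq> 0. 2 * (r / c) * (1 / (\<sigma> i + r / c)))"
    proof (rule sum_mono2)
      show "{i\<in>{..<n}. b i > c / r} \<subseteq> {i. i < n \<and> \<sigma> i \<noteq> 0}" using cr by (auto simp: b_def)
      fix i assume "i \<in> {i. i < n \<and> \<sigma> i \<noteq> 0} - {i\<in>{..<n}. b i > c / r}"
      then have "0 \<le> \<sigma> i" using \<sigma> by blast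
      moreover have "0 \<le> 2 * w * (1 / (x + w))" if "0 \<le> x" "0 < w" for x w :: real using that by simp
      ultimately show "0 \<le> 2 * (r / c) * (1 / (\<sigma> i + r / c))" using s0 by blast
    qed simp
    also have "\<dots> = 2 * (r / c) * gram_resolvent A (r / c)" unfolding gr[OF s0] sum_distrib_left ..
    finally show ?thesis .
  qed
  let ?\<theta> = "\<lambda>u. mtrace (minv ((mat n r u)\<^sup>T * (Q * mat_diag n b * Q\<^sup>T) * mat n r u + t \<cdot>\<^sub>m 1\<^sub>m r))"
  \<comment> \<open>Strict positivity is needed because the sum formula above is stated for
    \<open>\<theta> > 0\<close>, where the denominators \<open>\<sigma> i + \<theta>\<close> cannot
    vanish.\<close>
  have th: "?\<theta> u > 0" for u
  proof -
    interpret K: coercive_mat "weighted_gram t r {..<n} b (rotate_rows n r Q u)" r t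
      by (rule coercive_weighted_gram) (use t b0 in auto)
    show ?thesis unfolding gram_eq_weighted_gram[OF Q(1)] by (rule K.inv_trace_pos[OF r])
  qed
  define E where "E = {u \<in> space ?G. self_consistency_defect t r {..<n} b (?\<theta> u) > \<eta> * r + card {i\<in>{..<n}. b i > c / r}}"
  have "{u \<in> space ?G. coeff_event r t c \<eta> A (mat n r u)} \<subseteq> E"
  proof
    fix u assume u: "u \<in> {u \<in> space ?G. coeff_event r t c \<eta> A (mat n r u)}"
    have e: "compressed_resolvent A (minv (A\<^sup>T * A) * minv (A\<^sup>T * A)) (mat n r u) t = ?\<theta> u"
      unfolding compressed_resolvent_def B b_def by simp
    have "self_consistency_defect t r {..<n} b (?\<theta> u) = \<bar>t * ?\<theta> u + ?\<theta> u * gram_resolvent A (?\<theta> u) - r\<bar>"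
      unfolding self_consistency_defect_def sum[OF th] ..
    moreover have "\<eta> * r + 2 * (r / c) * gram_resolvent A (r / c) < \<bar>t * ?\<theta> u + ?\<theta> u * gram_resolvent A (?\<theta> u) - r\<bar>"
      using u unfolding mem_Collect_eq coeff_event_def e by blast
    ultimately show "u \<in> E" using u count unfolding E_def mem_Collect_eq by linarith
  qed
  moreover have "E \<in> sets ?G"
  proof -
    have "measurable_mat ?G r r (\<lambda>u. (mat n r u)\<^sup>T * (Q * mat_diag n b * Q\<^sup>T) * mat n r u + t \<cdot>\<^sub>m 1\<^sub>m r)"
    proof -
      have m: "measurable_mat ?G n r (\<lambda>u. mat n r u)"
        using measurable_mat_of_entries[of n r]
        unfolding measurable_mat_def entry_space_def measurable_cong_sets[OF sets_std_gaussian refl] .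
      have QT: "Q\<^sup>T \<in> carrier_mat n n" using Q by simp
      have c: "measurable_mat ?G n n (\<lambda>u. Q * mat_diag n b * Q\<^sup>T)"
        unfolding measurable_mat_def by (intro conjI allI impI borel_measurable_const mult_carrier_mat[OF mult_carrier_mat[OF Q(1) mat_diag_dim] QT])
      show ?thesis
        by (rule measurable_mat_add[OF measurable_mat_mult[OF measurable_mat_mult[OF measurable_mat_transpose[OF m] c] m]
            measurable_mat_smult[OF measurable_mat_one borel_measurable_const]])
    qed
    from measurable_mtrace[OF measurable_mat_minv[OF this]]
    have "(\<lambda>u. self_consistency_defect t r {..<n} b (?\<theta> u)) \<in> borel_measurable ?G"
      unfolding self_consistency_defect_def
      by (intro borel_measurable_abs borel_measurable_diff borel_measurable_add borel_measurable_sum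
          borel_measurable_divide borel_measurable_times borel_measurable_const)
    then show ?thesis unfolding E_def by (rule borel_measurable_less[OF borel_measurable_const])
  qed
  ultimately have "emeasure ?G {u \<in> space ?G. coeff_event r t c \<eta> A (mat n r u)} \<le> emeasure ?G E" by (rule emeasure_mono)
  also have "\<dots> \<le> ennreal (960 * (c * real n) ^ 4 / (\<eta> ^ 4 * t ^ 4 * real r ^ 6))"
    unfolding E_def by (rule rotated_self_consistent_prob[OF Q t b0 _ \<eta> r large]) (use c in auto)
  finally show ?thesis .
qed

lemma measurable_gram_resolvent:
  assumes X: "measurable_mat M n p X" and s: "s \<in> borel_measurable M"
  shows "(\<lambda>\<omega>. gram_resolvent (X \<omega>) (s \<omega>)) \<in> borel_measurable M"
  unfolding gram_resolvent_def measurable_matD(3)[OF X]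
  by (rule measurable_mtrace[OF measurable_mat_minv[OF measurable_mat_add[OF
        measurable_mat_mult[OF measurable_mat_transpose[OF X] X] measurable_mat_smult[OF measurable_mat_one s]]]])

lemma measurable_compressed_resolvent:
  assumes X: "measurable_mat M n p X" and C: "measurable_mat M p p C" and U: "measurable_mat M n r U"
  shows "(\<lambda>\<omega>. compressed_resolvent (X \<omega>) (C \<omega>) (U \<omega>) t) \<in> borel_measurable M"
  unfolding compressed_resolvent_def measurable_matD(3)[OF U]
  by (rule measurable_mtrace[OF measurable_mat_minv[OF measurable_mat_add[OF
      measurable_mat_mult[OF measurable_mat_mult[OF measurable_mat_transpose[OF U]
        measurable_mat_mult[OF measurable_mat_mult[OF X C] measurable_mat_transpose[OF X]]] U]
      measurable_mat_smult[OF measurable_mat_one borel_measurable_const]]]])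

context
  fixes n p r :: nat and E X U
  defines "E \<equiv> entry_space n p \<Otimes>\<^sub>M entry_space n r"
    and "X \<equiv> \<lambda>z :: (nat \<times> nat \<Rightarrow> real) \<times> (nat \<times> nat \<Rightarrow> real). mat n p (fst z)"
    and "U \<equiv> \<lambda>z :: (nat \<times> nat \<Rightarrow> real) \<times> (nat \<times> nat \<Rightarrow> real). mat n r (snd z)"
begin

lemma measurable_joint_mats: "measurable_mat E n p X" "measurable_mat E n r U"
  unfolding X_def U_def E_def
  by (rule measurable_mat_compose[OF measurable_mat_of_entries measurable_fst]
      measurable_mat_compose[OF measurable_mat_of_entries measurable_snd])+

lemma measurable_gram_inverse: "measurable_mat E p p (\<lambda>z. minv ((X z)\<^sup>T * X z))"
  by (intro measurable_mat_minv measurable_mat_mult[OF measurable_mat_transpose[OF measurable_joint_mats(1)] measurable_joint_mats(1)])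

lemma fitted_event_measurable: "{z \<in> space E. fitted_event p r t \<eta> (X z) (U z)} \<in> sets E"
proof -
  have "(\<lambda>z. compressed_resolvent (X z) (minv ((X z)\<^sup>T * X z)) (U z) (r * t)) \<in> borel_measurable E"
    by (rule measurable_compressed_resolvent[OF measurable_joint_mats(1) measurable_gram_inverse measurable_joint_mats(2)])
  then show ?thesis unfolding fitted_event_def
    by (intro borel_measurable_less borel_measurable_abs borel_measurable_diff borel_measurable_add borel_measurable_times
        borel_measurable_divide borel_measurable_const)
qed

lemma coeff_event_measurable: "{z \<in> space E. coeff_event r t c \<eta> (X z) (U z)} \<in> sets E"
proof -
  have "(\<lambda>z. compressed_resolvent (X z) (minv ((X z)\<^sup>T * X z) * minv ((X z)\<^sup>T * X z)) (U z) t) \<in> borel_measurable E" (is "?\<theta> \<in> _")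
    by (rule measurable_compressed_resolvent[OF measurable_joint_mats(1) measurable_mat_mult[OF measurable_gram_inverse measurable_gram_inverse] measurable_joint_mats(2)])
  moreover from this have "(\<lambda>z. gram_resolvent (X z) (?\<theta> z)) \<in> borel_measurable E"
    by (rule measurable_gram_resolvent[OF measurable_joint_mats(1)])
  moreover have "(\<lambda>z. gram_resolvent (X z) (r / c)) \<in> borel_measurable E"
    by (rule measurable_gram_resolvent[OF measurable_joint_mats(1) borel_measurable_const])
  ultimately show ?thesis unfolding coeff_event_def
    by (intro borel_measurable_less borel_measurable_abs borel_measurable_diff borel_measurable_add borel_measurable_times
        borel_measurable_const)
qed

end

text \<open>The Gram matrix of \<open>X\<close> is already a weighted Gram matrix with unit weights,
  so no rotation is required. Choosing the threshold constant equal to the dimension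
  \<open>p\<close> discards no weight.\<close>

lemma gram_event_bound:
  assumes M: "prob_space M" and X: "random_matrix M n p X" and iid: "iid_std_gaussian_entries M n p X"
    and dims: "n > 0" "p > 0" "r > 0" and s: "s > 0" and \<eta>: "\<eta> > 0" and large: "n / (r * s) \<le> \<eta> * p / 2"
  shows "{\<omega> \<in> space M. gram_event n p r s \<eta> (X \<omega>)} \<in> sets M"
    and "emeasure M {\<omega> \<in> space M. gram_event n p r s \<eta> (X \<omega>)} \<le> ennreal (960 * real n ^ 4 / (\<eta> ^ 4 * (r * s) ^ 4 * real p ^ 2))"
proof -
  let ?E = "entry_space n p" and ?x = "\<lambda>\<omega>. mat_entries n p (X \<omega>)" and ?G = "std_gaussian ({..<n} \<times> {..<p})"
  define \<Psi> where "\<Psi> = {x \<in> space ?E. gram_event n p r s \<eta> (mat n p x)}"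
  have "(\<lambda>x. gram_resolvent (mat n p x) (r * s)) \<in> borel_measurable ?E"
    by (rule measurable_gram_resolvent[OF measurable_mat_of_entries borel_measurable_const])
  then have \<Psi>: "\<Psi> \<in> sets ?E" unfolding \<Psi>_def gram_event_def
    by (intro borel_measurable_less borel_measurable_abs borel_measurable_diff borel_measurable_add borel_measurable_times
        borel_measurable_divide borel_measurable_const)
  have car: "X \<omega> \<in> carrier_mat n p" if "\<omega> \<in> space M" for \<omega> using X that unfolding random_matrix_def by auto
  have xm: "?x \<in> measurable M ?E" using X unfolding random_matrix_def by auto
  have ev: "{\<omega> \<in> space M. gram_event n p r s \<eta> (X \<omega>)} = ?x -` \<Psi> \<inter> space M"
  proof -
    have "\<omega> \<in> ?x -` \<Psi> \<longleftrightarrow> gram_event n p r s \<eta> (X \<omega>)" if \<omega>: "\<omega> \<in> space M" for \<omega>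
      using measurable_space[OF xm \<omega>] mat_mat_entries[OF car[OF \<omega>]] unfolding \<Psi>_def by simp
    then show ?thesis by blast
  qed
  show "{\<omega> \<in> space M. gram_event n p r s \<eta> (X \<omega>)} \<in> sets M" unfolding ev by (rule measurable_sets[OF xm \<Psi>])
  have rs: "r * s > 0" using dims s by simp
  have K: "(mat n p x)\<^sup>T * mat n p x + (r * s) \<cdot>\<^sub>m 1\<^sub>m p = weighted_gram (r * s) p {..<n} (\<lambda>_. 1) x" for x
    by (rule eq_matI) (auto simp: weighted_gram_def scalar_prod_def atLeast0LessThan intro!: sum.cong)
  have none: "{i \<in> {..<n}. real p / real p < 1} = {}" using dims by auto
  have eq: "\<Psi> = {x \<in> space ?G. \<eta> * p + card {i\<in>{..<n}. 1 > real p / real p}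
      < self_consistency_defect (r * s) p {..<n} (\<lambda>_. 1) (mtrace (minv (weighted_gram (r * s) p {..<n} (\<lambda>_. 1) x)))}"
    unfolding \<Psi>_def space_entry_space gram_event_def gram_resolvent_def self_consistency_defect_def none K[symmetric] by simp
  have "emeasure M {\<omega> \<in> space M. gram_event n p r s \<eta> (X \<omega>)} = emeasure (distr M ?E ?x) \<Psi>"
    unfolding ev by (rule emeasure_distr[OF xm \<Psi>, symmetric])
  also have "\<dots> = emeasure ?G \<Psi>" unfolding distr_gaussian_entries[OF M iid dims(1,2)] ..
  also have "\<dots> \<le> ennreal (960 * (real p * real (card {..<n})) ^ 4 / (\<eta> ^ 4 * (r * s) ^ 4 * real p ^ 6))"
    unfolding eq by (rule self_consistent_prob[OF _ rs _ _ \<eta> dims(2)]) (use large dims in auto)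
  also have "960 * (real p * real (card {..<n})) ^ 4 / (\<eta> ^ 4 * (r * s) ^ 4 * real p ^ 6) = 960 * real n ^ 4 / (\<eta> ^ 4 * (r * s) ^ 4 * real p ^ 2)"
  proof -
    define P where "P = real p ^ 4"
    have "real p ^ 6 = P * real p ^ 2" "P > 0" using dims by (simp_all add: P_def flip: power_add)
    then show ?thesis unfolding power_mult_distrib[of "real p"] P_def[symmetric] by simp
  qed
  finally show "emeasure M {\<omega> \<in> space M. gram_event n p r s \<eta> (X \<omega>)} \<le> ennreal (960 * real n ^ 4 / (\<eta> ^ 4 * (r * s) ^ 4 * real p ^ 2))" .
qed

section \<open>Almost sure convergence\<close>

text \<open>The model is constrained only for \<open>N \<ge> 1\<close>, where the empirical laws are
  known to be distributions on the half-line. Substituting the limit law at index \<open>0\<close>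
  supplies the missing hypothesis without affecting convergence.\<close>

lemma weak_conv_m_of_resolvents:
  assumes E: "\<And>N. N \<ge> 1 \<Longrightarrow> real_distribution (E N)" "\<And>N. N \<ge> 1 \<Longrightarrow> AE x in E N. x \<ge> 0"
    and L: "real_distribution L" "AE x in L. x \<ge> 0"
    and t: "\<And>k. t k > 1" "t \<longlonglongrightarrow> 1" "inj t"
    and lim: "\<And>k. (\<lambda>N. LINT x|E N. 1 / (x + t k)) \<longlonglongrightarrow> (LINT x|L. 1 / (x + t k))"
  shows "weak_conv_m E L"
proof -
  define E' where "E' N = (if N \<ge> 1 then E N else L)" for N
  have ev: "eventually (\<lambda>N. E' N = E N) sequentially"
    using eventually_ge_at_top[of 1] by eventually_elim (simp add: E'_def)
  have "weak_conv_m E' L"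
  proof (rule resolvent_conv_imp_weak_conv[where t = t])
    show "real_distribution (E' N)" for N
      by (cases "N \<ge> 1") (use E(1) L(1) in \<open>auto simp: E'_def\<close>)
    show "AE x in E' N. x \<ge> 0" for N
    proof (cases "N \<ge> 1")
      case True
      then have "E' N = E N" by (simp add: E'_def)
      then show ?thesis using E(2)[OF True] by (simp only:)
    next
      case False
      then have "E' N = L" by (simp add: E'_def)
      then show ?thesis using L(2) by (simp only:)
    qed
    fix k
    have "eventually (\<lambda>N. (LINT x|E' N. 1 / (x + t k)) = (LINT x|E N. 1 / (x + t k))) sequentially"
      using ev by eventually_elim simp
    then show "(\<lambda>N. LINT x|E' N. 1 / (x + t k)) \<longlonglongrightarrow> (LINT x|L. 1 / (x + t k))"
      using lim[of k] by (subst tendsto_cong)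
  qed (use L t in auto)
  moreover have "((\<lambda>N. cdf (E' N) x) \<longlonglongrightarrow> cdf L x) \<longleftrightarrow> ((\<lambda>N. cdf (E N) x) \<longlonglongrightarrow> cdf L x)" for x
    by (rule tendsto_cong) (use ev in eventually_elim, simp)
  ultimately show ?thesis unfolding weak_conv_m_def weak_conv_def by simp
qed

text \<open>A slope of at least \<open>t\<close> gives \<open>\<bar>x N - y\<bar> \<le> \<bar>\<phi>
  N (x N) - \<phi> N y\<bar> / t\<close>. Hence approximate roots converge to the limiting root
  although \<open>\<phi>\<close> changes with \<open>N\<close>.\<close>

lemma tendsto_of_slope:
  fixes \<phi> :: "nat \<Rightarrow> real \<Rightarrow> real"
  assumes t: "t > 0"
    and slope: "eventually (\<lambda>N. \<forall>u v. 0 < u \<longrightarrow> u \<le> v \<longrightarrow> t * (v - u) \<le> \<phi> N v - \<phi> N u) sequentially"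
    and x: "eventually (\<lambda>N. x N > 0) sequentially" and y: "y > 0"
    and lim: "(\<lambda>N. \<phi> N (x N)) \<longlonglongrightarrow> b" "(\<lambda>N. \<phi> N y) \<longlonglongrightarrow> b"
  shows "x \<longlonglongrightarrow> y"
proof -
  have z: "(\<lambda>N. \<bar>\<phi> N (x N) - \<phi> N y\<bar> / t) \<longlonglongrightarrow> 0"
    using tendsto_divide[OF tendsto_rabs[OF tendsto_diff[OF lim]] tendsto_const[of t]] t by simp
  have "eventually (\<lambda>N. norm (x N - y) \<le> \<bar>\<phi> N (x N) - \<phi> N y\<bar> / t) sequentially"
    using slope x
  proof eventually_elim
    case (elim N)
    have "t * \<bar>x N - y\<bar> \<le> \<bar>\<phi> N (x N) - \<phi> N y\<bar>"
    proof (cases "x N \<le> y")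
      case True
      then have "t * (y - x N) \<le> \<phi> N y - \<phi> N (x N)" using elim by blast
      then show ?thesis using True by (simp add: abs_if)
    next
      case False
      then have "t * (x N - y) \<le> \<phi> N (x N) - \<phi> N y" using elim y by simp
      then show ?thesis using False by (simp add: abs_if)
    qed
    then show ?case using t by (simp add: pos_le_divide_eq mult.commute)
  qed
  from Lim_null_comparison[OF this z] have "(\<lambda>N. x N - y) \<longlonglongrightarrow> 0" .
  then show ?thesis by (simp add: LIM_zero_iff)
qed

lemma AE_eventually_not:
  assumes M: "prob_space M" and meas: "\<And>N. N \<ge> 1 \<Longrightarrow> {\<omega> \<in> space M. bad N \<omega>} \<in> sets M"
    and bound: "eventually (\<lambda>N. emeasure M {\<omega> \<in> space M. bad N \<omega>} \<le> ennreal (K / real N ^ 2)) sequentially"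
  shows "AE \<omega> in M. eventually (\<lambda>N. \<not> bad N \<omega>) sequentially"
proof -
  interpret prob_space M by fact
  obtain N0 where N0: "\<And>N. N \<ge> N0 \<Longrightarrow> emeasure M {\<omega> \<in> space M. bad N \<omega>} \<le> ennreal (K / real N ^ 2)"
    using bound unfolding eventually_sequentially by blast
  \<comment> \<open>Borel--Cantelli asks for a summable sequence of measurable events, while the
    bound holds only for large \<open>N\<close>; the finitely many other events are emptied.\<close>
  define A where "A N = (if N \<ge> N0 \<and> N \<ge> 1 then {\<omega> \<in> space M. bad N \<omega>} else {})" for N
  have A: "A N \<in> sets M" for N using meas by (simp add: A_def)
  have le: "measure M (A N) \<le> \<bar>K\<bar> * (1 / real N ^ 2)" for N
  proof (cases "N \<ge> N0 \<and> N \<ge> 1")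
    case True
    then have "emeasure M (A N) \<le> ennreal (K / real N ^ 2)" using N0 by (simp add: A_def)
    also have "\<dots> \<le> ennreal (\<bar>K\<bar> * (1 / real N ^ 2))" by (intro ennreal_leI) (simp add: divide_right_mono)
    finally show ?thesis unfolding emeasure_eq_measure by (subst (asm) ennreal_le_iff) auto
  qed (auto simp: A_def)
  have "summable (\<lambda>N. measure M (A N))"
  proof (rule summable_comparison_test')
    show "summable (\<lambda>N. \<bar>K\<bar> * (1 / real N ^ 2))"
      using inverse_power_summable[of 2, where 'a = real] by (intro summable_mult) (simp add: inverse_eq_divide power_one_over[symmetric])
    show "norm (measure M (A N)) \<le> \<bar>K\<bar> * (1 / real N ^ 2)" if "N \<ge> 0" for N using le by simp
  qed
  then have "AE \<omega> in M. eventually (\<lambda>N. \<omega> \<in> space M - A N) sequentially"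
    using A by (intro borel_cantelli_AE1) (auto simp: emeasure_eq_measure)
  then show ?thesis
  proof eventually_elim
    case (elim \<omega>)
    then show ?case using eventually_ge_at_top[of N0] eventually_ge_at_top[of 1]
      by eventually_elim (auto simp: A_def split: if_splits)
  qed
qed

lemma gram_resolvent_pos:
  assumes X: "X \<in> carrier_mat n p" and "s > 0" "p > 0"
  shows "gram_resolvent X s > 0"
proof -
  interpret coercive_mat "1 \<cdot>\<^sub>m (X\<^sup>T * X) + s \<cdot>\<^sub>m 1\<^sub>m p" p s by (rule coercive_gram) (use assms in auto)
  show ?thesis using inv_trace_pos[OF assms(3)] X unfolding gram_resolvent_def one_smult_mat by simp
qed

text \<open>Each summand \<open>x / (\<sigma> i + r * x)\<close> increases with \<open>x\<close>.
  This supplies the slope bound for the coefficient equation, in which the function of the unknown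
  is random.\<close>

lemma scaled_gram_resolvent_mono:
  assumes X: "X \<in> carrier_mat n p" and det: "det (X\<^sup>T * X) \<noteq> 0" and r: "r > 0" and xy: "0 < x" "x \<le> y"
  shows "x * gram_resolvent X (r * x) \<le> y * gram_resolvent X (r * y)"
proof -
  obtain Q \<sigma> where "Q \<in> carrier_mat n n" "Q\<^sup>T * Q = 1\<^sub>m n" "Q * Q\<^sup>T = 1\<^sub>m n"
    and \<sigma>: "\<forall>i<n. \<sigma> i \<ge> 0"
    and "card {i. i < n \<and> \<sigma> i \<noteq> 0} = p"
    and "X * minv (X\<^sup>T * X) * X\<^sup>T = Q * mat_diag n (\<lambda>i. if \<sigma> i = 0 then 0 else 1) * Q\<^sup>T"
    and "X * (minv (X\<^sup>T * X) * minv (X\<^sup>T * X)) * X\<^sup>T = Q * mat_diag n (\<lambda>i. 1 / \<sigma> i) * Q\<^sup>T"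
    and g: "\<forall>a>0. \<forall>s>0. mtrace (minv (a \<cdot>\<^sub>m (X\<^sup>T * X) + s \<cdot>\<^sub>m 1\<^sub>m p)) = (\<Sum>i | i < n \<and> \<sigma> i \<noteq> 0. 1 / (a * \<sigma> i + s))"
    by (rule gram_spectral[OF X det])
  have gr: "gram_resolvent X s = (\<Sum>i | i < n \<and> \<sigma> i \<noteq> 0. 1 / (\<sigma> i + s))" if "s > 0" for s
    using g[rule_format, of 1 s] that X unfolding gram_resolvent_def one_smult_mat by simp
  have rp: "r * x > 0" "r * y > 0" using r xy by auto
  show ?thesis
    unfolding gr[OF rp(1)] gr[OF rp(2)] sum_distrib_left
  proof (rule sum_mono)
    fix i assume "i \<in> {i. i < n \<and> \<sigma> i \<noteq> 0}"
    then have s: "\<sigma> i > 0" using \<sigma> by (simp add: less_le)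
    have "x * (\<sigma> i + r * y) \<le> y * (\<sigma> i + r * x)" using xy s by (simp add: algebra_simps)
    moreover have "\<sigma> i + r * x > 0" "\<sigma> i + r * y > 0" using s rp by auto
    ultimately show "x * (1 / (\<sigma> i + r * x)) \<le> y * (1 / (\<sigma> i + r * y))" by (simp add: divide_simps mult.commute)
  qed
qed

lemma tendsto_zero_of_eventually_le:
  fixes f :: "nat \<Rightarrow> real"
  assumes "\<And>j :: nat. eventually (\<lambda>N. \<bar>f N\<bar> \<le> 1 / real (Suc j) * B) sequentially" and B: "B > 0"
  shows "f \<longlonglongrightarrow> 0"
proof (rule tendstoI)
  fix e :: real assume e: "e > 0"
  obtain j where "inverse (real (Suc j)) < e / B" using reals_Archimedean[of "e / B"] e B by auto
  then have j: "1 / real (Suc j) * B < e" using B by (simp add: field_simps)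
  show "eventually (\<lambda>N. dist (f N) 0 < e) sequentially"
    using assms(1)[of j] by eventually_elim (use j in simp)
qed

lemma mono_saturation:
  assumes "0 < x" "x \<le> (y::real)"
  shows "x / (1 + x) \<le> y / (1 + y)"
  using assms by (simp add: divide_simps algebra_simps)

section \<open>Almost sure statements for the regression model\<close>

locale regression_model =
  fixes M :: "'a measure"
    and U X :: "nat \<Rightarrow> 'a \<Rightarrow> real mat"
    and p r :: "nat \<Rightarrow> nat"
    and l \<mu> \<beta> :: real
  assumes M: "prob_space M"
    and dims: "\<And>N. N \<ge> 1 \<Longrightarrow> 0 < p N \<and> p N \<le> N \<and> 0 < r N"
    and l: "l \<ge> 0" and Np: "(\<lambda>N. real N / real (p N)) \<longlonglongrightarrow> 1 + l"
    and \<mu>: "\<mu> > 0" and Nr: "(\<lambda>N. real N / real (r N)) \<longlonglongrightarrow> \<mu>"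
    and \<beta>: "\<beta> = \<mu> / (1 + l)"
    and U: "\<And>N. N \<ge> 1 \<Longrightarrow> random_matrix M N (r N) (U N)"
    and U_iid: "\<And>N. N \<ge> 1 \<Longrightarrow> iid_std_gaussian_entries M N (r N) (U N)"
    and X: "\<And>N. N \<ge> 1 \<Longrightarrow> random_matrix M N (p N) (X N)"
    and rank: "\<And>N. N \<ge> 1 \<Longrightarrow> AE \<omega> in M. vec_space.rank N (X N \<omega>) = p N"
    and indep: "\<And>N. N \<ge> 1 \<Longrightarrow> indep_random_matrices M N (p N) (X N) N (r N) (U N)"
begin

lemma \<beta>_pos: "\<beta> > 0"
  using \<mu> l by (simp add: \<beta>)

lemma \<mu>_eq: "\<mu> = \<beta> * (1 + l)"
  using l by (simp add: \<beta>)

lemma p_over_r_tendsto: "(\<lambda>N. real (p N) / real (r N)) \<longlonglongrightarrow> \<beta>"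
proof -
  have "(\<lambda>N. (real N / real (r N)) / (real N / real (p N))) \<longlonglongrightarrow> \<mu> / (1 + l)"
    using l by (intro tendsto_divide Nr Np) simp
  then have lim: "(\<lambda>N. (real N / real (r N)) / (real N / real (p N))) \<longlonglongrightarrow> \<beta>" by (simp add: \<beta>)
  have "eventually (\<lambda>N. (real N / real (r N)) / (real N / real (p N)) = real (p N) / real (r N)) sequentially"
    using eventually_ge_at_top[of 1] by eventually_elim simp
  from tendsto_cong[OF this] lim show ?thesis by simp
qed

text \<open>A constant exceeding both limits \<open>\<mu>\<close> and \<open>1 + l\<close>, so that
  \<open>N \<le> \<kappa> * r N\<close> and \<open>N \<le> \<kappa> * p N\<close> hold
  eventually.\<close>

definition \<kappa> :: real where "\<kappa> = \<mu> + l + 3"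

lemma \<kappa>_pos: "\<kappa> > 0"
  using \<mu> l by (simp add: \<kappa>_def)

lemma eventually_dims:
  "eventually (\<lambda>N. N \<ge> 1 \<and> real N \<le> \<kappa> * r N \<and> real N \<le> \<kappa> * p N) sequentially"
proof -
  have "eventually (\<lambda>N. real N / real (r N) < \<kappa>) sequentially" "eventually (\<lambda>N. real N / real (p N) < \<kappa>) sequentially"
    using Nr Np \<mu> l by (auto intro!: order_tendstoD simp: \<kappa>_def)
  then show ?thesis using eventually_ge_at_top[of 1]
  proof eventually_elim
    case (elim N)
    then show ?case using dims[of N] by (simp add: pos_divide_less_eq less_imp_le)
  qed
qed

lemma eventually_bounds:
  fixes a :: real
  shows "eventually (\<lambda>N. N \<ge> 1 \<and> a \<le> r N \<and> a \<le> p N \<and> real N \<le> \<kappa> * r N \<and> real N \<le> \<kappa> * p N) sequentially"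
  using eventually_dims eventually_ge_at_top[of "nat \<lceil>\<kappa> * a\<rceil>"]
proof eventually_elim
  case (elim N)
  then have "\<kappa> * a \<le> real N" by linarith
  then have "\<kappa> * a \<le> \<kappa> * r N" "\<kappa> * a \<le> \<kappa> * p N" using elim by linarith+
  then show ?case using elim \<kappa>_pos by simp
qed

text \<open>Turns the quotient from the probability estimates into a multiple of
  \<open>1 / N\<^sup>2\<close>, the summable rate required by Borel--Cantelli.\<close>

lemma six_power_bound:
  assumes "N \<ge> 1" "real N \<le> \<kappa> * real a" "real N \<le> \<kappa> * real b" "a > 0" "b > 0"
  shows "real N ^ 4 / (real a ^ 4 * real b ^ 2) \<le> \<kappa> ^ 6 / real N ^ 2"
proof -
  have "real N ^ 4 * real N ^ 2 \<le> (\<kappa> * real a) ^ 4 * (\<kappa> * real b) ^ 2"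
    using assms by (intro mult_mono power_mono) auto
  also have "\<dots> = \<kappa> ^ 6 * (real a ^ 4 * real b ^ 2)" by (simp add: power_mult_distrib)
  finally show ?thesis using assms by (simp add: frac_le_eq divide_simps)
qed

lemma fitted_eventually:
  assumes t: "t > 0" and \<eta>: "\<eta> > 0"
  shows "AE \<omega> in M. eventually (\<lambda>N. \<not> fitted_event (p N) (r N) t \<eta> (X N \<omega>) (U N \<omega>)) sequentially"
proof (rule AE_eventually_not[OF M, where K = "960 * \<kappa> ^ 6 / (\<eta> ^ 4 * t ^ 4)"])
  \<comment> \<open>Only the measurability part of \<open>joint_event_bound\<close> is wanted here,
    and with \<open>K = \<infinity>\<close> its probability bound is trivial.\<close>
  show "{\<omega> \<in> space M. fitted_event (p N) (r N) t \<eta> (X N \<omega>) (U N \<omega>)} \<in> sets M" if N: "N \<ge> 1" for N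
    using dims[OF N] N
    by (intro joint_event_bound(1)[OF M _ _ X[OF N] U[OF N] U_iid[OF N] indep[OF N] rank[OF N] fitted_event_measurable, where K = \<infinity>]) auto
  \<comment> \<open>For \<open>r N \<ge> a\<close> the rank one contribution is at most half of the
    tolerance, as required by the premise \<open>large\<close>.\<close>
  define a where "a = 2 * \<kappa> / (t * \<eta>)"
  have a: "a > 0" using t \<eta> \<kappa>_pos by (simp add: a_def)
  show "eventually (\<lambda>N. emeasure M {\<omega> \<in> space M. fitted_event (p N) (r N) t \<eta> (X N \<omega>) (U N \<omega>)}
      \<le> ennreal (960 * \<kappa> ^ 6 / (\<eta> ^ 4 * t ^ 4) / real N ^ 2)) sequentially"
    using eventually_bounds[of a]
  proof eventually_elim
    case (elim N)
    then have N: "N \<ge> 1" and d: "0 < p N" "0 < r N" using dims[of N] by auto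
    have "real N / (r N * t) \<le> \<kappa> / t" using elim d t by (simp add: field_simps)
    also have "\<dots> = \<eta> * a / 2" using t \<eta> by (simp add: a_def)
    also have "\<dots> \<le> \<eta> * r N / 2" using elim \<eta> by simp
    finally have large: "real N / (r N * t) \<le> \<eta> * r N / 2" .
    have "emeasure M {\<omega> \<in> space M. fitted_event (p N) (r N) t \<eta> (X N \<omega>) (U N \<omega>)}
      \<le> ennreal (960 * real N ^ 4 / (\<eta> ^ 4 * t ^ 4 * real (r N) ^ 6))"
      using N d by (intro joint_event_bound(2)[OF M _ _ X[OF N] U[OF N] U_iid[OF N] indep[OF N] rank[OF N] fitted_event_measurable]
          fitted_event_bound t \<eta> large) auto
    also have "\<dots> \<le> ennreal (960 * \<kappa> ^ 6 / (\<eta> ^ 4 * t ^ 4) / real N ^ 2)"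
    proof (rule ennreal_leI)
      have "960 * real N ^ 4 / (\<eta> ^ 4 * t ^ 4 * real (r N) ^ 6) = 960 / (\<eta> ^ 4 * t ^ 4) * (real N ^ 4 / (real (r N) ^ 4 * real (r N) ^ 2))"
        by simp
      also have "\<dots> \<le> 960 / (\<eta> ^ 4 * t ^ 4) * (\<kappa> ^ 6 / real N ^ 2)"
        using elim d t \<eta> by (intro mult_left_mono six_power_bound) auto
      finally show "960 * real N ^ 4 / (\<eta> ^ 4 * t ^ 4 * real (r N) ^ 6) \<le> 960 * \<kappa> ^ 6 / (\<eta> ^ 4 * t ^ 4) / real N ^ 2" by simp
    qed
    finally show ?case .
  qed
qed

lemma coeff_eventually:
  assumes t: "t > 0" and c: "c > 0" and \<eta>: "\<eta> > 0"
  shows "AE \<omega> in M. eventually (\<lambda>N. \<not> coeff_event (r N) t c \<eta> (X N \<omega>) (U N \<omega>)) sequentially"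
proof (rule AE_eventually_not[OF M, where K = "960 * c ^ 4 * \<kappa> ^ 6 / (\<eta> ^ 4 * t ^ 4)"])
  show "{\<omega> \<in> space M. coeff_event (r N) t c \<eta> (X N \<omega>) (U N \<omega>)} \<in> sets M" if N: "N \<ge> 1" for N
    using dims[OF N] N
    by (intro joint_event_bound(1)[OF M _ _ X[OF N] U[OF N] U_iid[OF N] indep[OF N] rank[OF N] coeff_event_measurable, where K = \<infinity>]) auto
  define a where "a = 2 * c * \<kappa> / (t * \<eta>)"
  have a: "a > 0" using t \<eta> \<kappa>_pos c by (simp add: a_def)
  show "eventually (\<lambda>N. emeasure M {\<omega> \<in> space M. coeff_event (r N) t c \<eta> (X N \<omega>) (U N \<omega>)}
      \<le> ennreal (960 * c ^ 4 * \<kappa> ^ 6 / (\<eta> ^ 4 * t ^ 4) / real N ^ 2)) sequentially"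
    using eventually_bounds[of a]
  proof eventually_elim
    case (elim N)
    then have N: "N \<ge> 1" and d: "0 < p N" "0 < r N" using dims[of N] by auto
    have "real N / (r N * t) \<le> \<kappa> / t" using elim d t by (simp add: field_simps)
    then have "c * (real N / (r N * t)) \<le> c * (\<kappa> / t)" using c by (intro mult_left_mono) auto
    also have "\<dots> = \<eta> * a / 2" using t \<eta> by (simp add: a_def)
    also have "\<dots> \<le> \<eta> * r N / 2" using elim \<eta> by simp
    finally have large: "c * real N / (r N * t) \<le> \<eta> * r N / 2" by simp
    have "emeasure M {\<omega> \<in> space M. coeff_event (r N) t c \<eta> (X N \<omega>) (U N \<omega>)}
      \<le> ennreal (960 * (c * real N) ^ 4 / (\<eta> ^ 4 * t ^ 4 * real (r N) ^ 6))"
      using N d by (intro joint_event_bound(2)[OF M _ _ X[OF N] U[OF N] U_iid[OF N] indep[OF N] rank[OF N] coeff_event_measurable]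
          coeff_event_bound t \<eta> c large) auto
    also have "\<dots> \<le> ennreal (960 * c ^ 4 * \<kappa> ^ 6 / (\<eta> ^ 4 * t ^ 4) / real N ^ 2)"
    proof (rule ennreal_leI)
      have "960 * (c * real N) ^ 4 / (\<eta> ^ 4 * t ^ 4 * real (r N) ^ 6) = 960 * c ^ 4 / (\<eta> ^ 4 * t ^ 4) * (real N ^ 4 / (real (r N) ^ 4 * real (r N) ^ 2))"
        by (simp add: power_mult_distrib)
      also have "\<dots> \<le> 960 * c ^ 4 / (\<eta> ^ 4 * t ^ 4) * (\<kappa> ^ 6 / real N ^ 2)"
        using elim d t \<eta> c by (intro mult_left_mono six_power_bound) auto
      finally show "960 * (c * real N) ^ 4 / (\<eta> ^ 4 * t ^ 4 * real (r N) ^ 6) \<le> 960 * c ^ 4 * \<kappa> ^ 6 / (\<eta> ^ 4 * t ^ 4) / real N ^ 2" by simp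
    qed
    finally show ?case .
  qed
qed

lemma gram_eventually:
  assumes iid: "\<forall>N\<ge>1. iid_std_gaussian_entries M N (p N) (X N)" and s: "s > 0" and \<eta>: "\<eta> > 0"
  shows "AE \<omega> in M. eventually (\<lambda>N. \<not> gram_event N (p N) (r N) s \<eta> (X N \<omega>)) sequentially"
proof -
  define a where "a = 2 * \<kappa> / (s * \<eta>)"
  have a: "a > 0" using s \<eta> \<kappa>_pos by (simp add: a_def)
  have large: "real N / (r N * s) \<le> \<eta> * p N / 2" if "N \<ge> 1" "a \<le> p N" "real N \<le> \<kappa> * r N" for N
  proof -
    have "real N / (r N * s) \<le> \<kappa> / s" using that dims[of N] s by (simp add: field_simps)
    also have "\<dots> = \<eta> * a / 2" using s \<eta> by (simp add: a_def)
    also have "\<dots> \<le> \<eta> * p N / 2" using that \<eta> by simp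
    finally show ?thesis .
  qed
  \<comment> \<open>The measurability statement for \<open>gram_event\<close> assumes
    \<open>large\<close>, but Borel--Cantelli needs measurability for every
    \<open>N \<ge> 1\<close>. Adding the deterministic size conditions makes the event empty where
    they fail; they hold eventually, so nothing is lost.\<close>
  define bad where "bad N \<omega> \<longleftrightarrow> gram_event N (p N) (r N) s \<eta> (X N \<omega>) \<and> a \<le> p N \<and> real N \<le> \<kappa> * r N" for N \<omega>
  have "AE \<omega> in M. eventually (\<lambda>N. \<not> bad N \<omega>) sequentially"
  proof (rule AE_eventually_not[OF M, where K = "960 * \<kappa> ^ 6 / (\<eta> ^ 4 * s ^ 4)"])
    show "{\<omega> \<in> space M. bad N \<omega>} \<in> sets M" if N: "N \<ge> 1" for N
    proof (cases "a \<le> p N \<and> real N \<le> \<kappa> * r N")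
      case True
      then show ?thesis unfolding bad_def using dims[OF N] N iid s \<eta> large[OF N]
        gram_event_bound(1)[OF M X[OF N], of "r N" s \<eta>] by simp
    next
      case False
      then have "{\<omega> \<in> space M. bad N \<omega>} = {}" unfolding bad_def by blast
      then show ?thesis by (simp only: sets.empty_sets)
    qed
    show "eventually (\<lambda>N. emeasure M {\<omega> \<in> space M. bad N \<omega>} \<le> ennreal (960 * \<kappa> ^ 6 / (\<eta> ^ 4 * s ^ 4) / real N ^ 2)) sequentially"
      using eventually_bounds[of a]
    proof eventually_elim
      case (elim N)
      then have N: "N \<ge> 1" and d: "0 < p N" "0 < r N" using dims[of N] by auto
      have "emeasure M {\<omega> \<in> space M. bad N \<omega>} = emeasure M {\<omega> \<in> space M. gram_event N (p N) (r N) s \<eta> (X N \<omega>)}"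
        unfolding bad_def using elim by simp
      also have "\<dots> \<le> ennreal (960 * real N ^ 4 / (\<eta> ^ 4 * (r N * s) ^ 4 * real (p N) ^ 2))"
        using N d iid elim by (intro gram_event_bound(2)[OF M X[OF N]] s \<eta> large) auto
      also have "\<dots> \<le> ennreal (960 * \<kappa> ^ 6 / (\<eta> ^ 4 * s ^ 4) / real N ^ 2)"
      proof (rule ennreal_leI)
        have "960 * real N ^ 4 / (\<eta> ^ 4 * (r N * s) ^ 4 * real (p N) ^ 2) = 960 / (\<eta> ^ 4 * s ^ 4) * (real N ^ 4 / (real (r N) ^ 4 * real (p N) ^ 2))"
          by (simp add: power_mult_distrib)
        also have "\<dots> \<le> 960 / (\<eta> ^ 4 * s ^ 4) * (\<kappa> ^ 6 / real N ^ 2)"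
          using elim d s \<eta> by (intro mult_left_mono six_power_bound) auto
        finally show "960 * real N ^ 4 / (\<eta> ^ 4 * (r N * s) ^ 4 * real (p N) ^ 2) \<le> 960 * \<kappa> ^ 6 / (\<eta> ^ 4 * s ^ 4) / real N ^ 2" by simp
      qed
      finally show ?case .
    qed
  qed
  then show ?thesis
  proof eventually_elim
    case (elim \<omega>)
    then show ?case using eventually_bounds[of a] by eventually_elim (auto simp: bad_def)
  qed
qed

definition shift :: "nat \<Rightarrow> real" where "shift k = 1 + 1 / real (Suc k)"

lemma shift: "shift k > 1" "shift \<longlonglongrightarrow> 1" "inj shift"
proof -
  show "shift k > 1" for k by (simp add: shift_def)
  have "(\<lambda>k. 1 + 1 / real (Suc k)) \<longlonglongrightarrow> 1 + 0" by (intro tendsto_add tendsto_const LIMSEQ_Suc[OF lim_1_over_n])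
  then show "shift \<longlonglongrightarrow> 1" by (simp add: shift_def[abs_def])
  show "inj shift" by (rule injI) (simp add: shift_def)
qed

lemma shift_pos: "shift k > 0"
  by (simp add: shift_def add_pos_pos)

lemma AE_regular:
  "AE \<omega> in M. \<forall>N\<ge>1. X N \<omega> \<in> carrier_mat N (p N) \<and> U N \<omega> \<in> carrier_mat N (r N) \<and> det ((X N \<omega>)\<^sup>T * X N \<omega>) \<noteq> 0"
proof -
  have "AE \<omega> in M. \<forall>N. N \<ge> 1 \<longrightarrow> vec_space.rank N (X N \<omega>) = p N"
    unfolding AE_all_countable using rank by auto
  then show ?thesis using AE_space
  proof eventually_elim
    case (elim \<omega>)
    have "X N \<omega> \<in> carrier_mat N (p N)" "U N \<omega> \<in> carrier_mat N (r N)" if "N \<ge> 1" for N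
      using X[OF that] U[OF that] elim(2) unfolding random_matrix_def by auto
    moreover from this have "det ((X N \<omega>)\<^sup>T * X N \<omega>) \<noteq> 0" if "N \<ge> 1" for N
      using elim(1) that by (intro full_rank_det_gram[of _ N "p N"]) auto
    ultimately show ?case by blast
  qed
qed

theorem fitted_weak_conv:
  "AE \<omega> in M. weak_conv_m (\<lambda>N. empirical_eigenvalue_distribution
     (1 / real (r N) \<cdot>\<^sub>m ((Y_hat (X N \<omega>) (U N \<omega>))\<^sup>T * Y_hat (X N \<omega>) (U N \<omega>)))) (marchenko_pastur \<beta>)"
proof -
  \<comment> \<open>Countably many points \<open>shift k\<close> and tolerances
    \<open>1 / Suc j\<close> are handled on one almost sure event; afterwards the argument is
    deterministic for fixed \<open>\<omega>\<close>.\<close>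
  have "AE \<omega> in M. \<forall>k j. eventually (\<lambda>N. \<not> fitted_event (p N) (r N) (shift k) (1 / real (Suc j)) (X N \<omega>) (U N \<omega>)) sequentially"
    unfolding AE_all_countable using shift(1) by (intro allI fitted_eventually shift_pos) auto
  then show ?thesis using AE_regular
  proof eventually_elim
    case (elim \<omega>)
    define x u y where "x N = X N \<omega>" and "u N = U N \<omega>" and "y N = Y_hat (X N \<omega>) (U N \<omega>)" for N
    have reg: "x N \<in> carrier_mat N (p N)" "u N \<in> carrier_mat N (r N)" "det ((x N)\<^sup>T * x N) \<noteq> 0"
      "y N \<in> carrier_mat N (r N)" "(y N)\<^sup>T * y N = (u N)\<^sup>T * (x N * minv ((x N)\<^sup>T * x N) * (x N)\<^sup>T) * u N" "0 < r N" "0 < p N"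
      if "N \<ge> 1" for N
      using elim(2) that hat_gram[of "X N \<omega>" N "p N" "U N \<omega>" "r N"] dims[OF that] by (auto simp: x_def u_def y_def)
    let ?E = "\<lambda>N. empirical_eigenvalue_distribution (1 / real (r N) \<cdot>\<^sub>m ((y N)\<^sup>T * y N))"
    have "weak_conv_m ?E (marchenko_pastur \<beta>)"
    proof (rule weak_conv_m_of_resolvents[OF _ _ marchenko_pastur_law(1,2)[OF \<beta>_pos] shift])
      show "real_distribution (?E N)" "AE x in ?E N. x \<ge> 0" if "N \<ge> 1" for N
        using empirical_smult_gram(1,2)[OF reg(4)[OF that] _ reg(6)[OF that], of "1 / real (r N)"] by auto
      fix k
      define t where "t = shift k"
      have t: "t > 0" using shift(1)[of k] by (simp add: t_def)
      obtain m where m: "m > 0" "(LINT x|marchenko_pastur \<beta>. 1 / (x + t)) = m" "t * m + \<beta> * m / (1 + m) = 1"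
        using marchenko_pastur_law(3)[OF \<beta>_pos t] by blast
      define mN where "mN N = (LINT x|?E N. 1 / (x + t))" for N
      have mN: "mN N = compressed_resolvent (x N) (minv ((x N)\<^sup>T * x N)) (u N) (r N * t)" "mN N > 0" if N: "N \<ge> 1" for N
      proof -
        have "mN N = mtrace (minv ((y N)\<^sup>T * y N + (r N * t) \<cdot>\<^sub>m 1\<^sub>m (r N)))"
          unfolding mN_def by (rule empirical_scaled_resolvent[OF reg(4)[OF N] reg(6)[OF N] t])
        moreover have "\<dots> = gram_resolvent (y N) (r N * t)" unfolding gram_resolvent_def using reg(4)[OF N] by simp
        ultimately show "mN N > 0" using gram_resolvent_pos[OF reg(4)[OF N]] reg(6)[OF N] t by simp
        show "mN N = compressed_resolvent (x N) (minv ((x N)\<^sup>T * x N)) (u N) (r N * t)"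
          using \<open>mN N = mtrace _\<close> unfolding compressed_resolvent_def reg(5)[OF N] using reg(2)[OF N] by simp
      qed
      define \<phi> where "\<phi> N v = t * v + real (p N) / real (r N) * (v / (1 + v))" for N v
      have "mN \<longlonglongrightarrow> m"
      proof (rule tendsto_of_slope[OF t, of \<phi>])
        show "eventually (\<lambda>N. \<forall>u v. 0 < u \<longrightarrow> u \<le> v \<longrightarrow> t * (v - u) \<le> \<phi> N v - \<phi> N u) sequentially"
        proof (intro always_eventually allI impI)
          fix N and a b :: real assume "0 < a" "a \<le> b"
          from mult_left_mono[OF mono_saturation[OF this], of "real (p N) / real (r N)"]
          show "t * (b - a) \<le> \<phi> N b - \<phi> N a" unfolding \<phi>_def by (simp add: algebra_simps)
        qed
        show "eventually (\<lambda>N. mN N > 0) sequentially"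
          using eventually_ge_at_top[of 1] by eventually_elim (rule mN(2))
        show "m > 0" by fact
        have "(\<lambda>N. \<phi> N m) \<longlonglongrightarrow> t * m + \<beta> * (m / (1 + m))" unfolding \<phi>_def by (intro tendsto_intros p_over_r_tendsto)
        then show "(\<lambda>N. \<phi> N m) \<longlonglongrightarrow> 1" using m(3) by simp
        have "(\<lambda>N. \<phi> N (mN N) - 1) \<longlonglongrightarrow> 0"
        proof (rule tendsto_zero_of_eventually_le[where B = 1])
          fix j
          show "eventually (\<lambda>N. \<bar>\<phi> N (mN N) - 1\<bar> \<le> 1 / real (Suc j) * 1) sequentially"
            using elim(1)[rule_format, of k j] eventually_ge_at_top[of 1]
          proof eventually_elim
            case (elim N)
            note N = elim(2)
            have "\<bar>r N * t * mN N + p N * (mN N / (1 + mN N)) - r N\<bar> \<le> 1 / real (Suc j) * r N"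
              using elim(1) unfolding fitted_event_def x_def[symmetric] u_def[symmetric] t_def[symmetric] mN(1)[OF N, symmetric] by simp
            moreover have "r N * t * mN N + p N * (mN N / (1 + mN N)) - r N = r N * (\<phi> N (mN N) - 1)"
            proof -
              have "r N * (\<phi> N (mN N) - 1) = r N * t * mN N + (r N * (real (p N) / real (r N))) * (mN N / (1 + mN N)) - r N"
                unfolding \<phi>_def by (simp only: distrib_left right_diff_distrib mult.assoc mult_1_right)
              then show ?thesis using reg(6)[OF N] by simp
            qed
            ultimately have "r N * \<bar>\<phi> N (mN N) - 1\<bar> \<le> r N * (1 / real (Suc j))" by (simp add: abs_mult mult.commute)
            then show ?case using reg(6)[OF N] by (simp only: mult_le_cancel_left_pos of_nat_0_less_iff mult_1_right)
          qed
        qed simp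
        then show "(\<lambda>N. \<phi> N (mN N)) \<longlonglongrightarrow> 1" by (simp add: LIM_zero_iff)
      qed
      then show "(\<lambda>N. LINT x|?E N. 1 / (x + shift k)) \<longlonglongrightarrow> (LINT x|marchenko_pastur \<beta>. 1 / (x + shift k))"
        using m(2) unfolding mN_def t_def by simp
    qed
    then show ?case by (simp add: y_def)
  qed
qed

text \<open>Two limits are nested. The self-consistent equation of \<open>X\<^sup>T * X\<close> is
  used at \<open>m k\<close>, to find the coefficient of the outer equation at its expected root,
  and at the small points \<open>1 / Suc c\<close>, to show that few weights exceed the
  threshold.\<close>

theorem coeff_weak_conv:
  assumes iid: "\<forall>N\<ge>1. iid_std_gaussian_entries M N (p N) (X N)"
  shows "AE \<omega> in M. weak_conv_m (\<lambda>N. empirical_eigenvalue_distribution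
     ((A_hat (X N \<omega>) (U N \<omega>))\<^sup>T * A_hat (X N \<omega>) (U N \<omega>))) (coeff_law l \<beta>)"
proof -
  define m where "m k = (LINT x|coeff_law l \<beta>. 1 / (x + shift k))" for k
  have m: "m k > 0" "shift k * m k \<le> 1"
    "(1 - shift k * m k) * (1 + m k * (1 - shift k) + \<beta> * (1 + l)) = \<beta> * (1 + m k * (1 - shift k))" for k
    using coeff_law_law(3)[OF \<beta>_pos l shift(1)[of k]] unfolding m_def by auto
  have "AE \<omega> in M. \<forall>k c j. eventually (\<lambda>N. \<not> coeff_event (r N) (shift k) (real (Suc c)) (1 / real (Suc j)) (X N \<omega>) (U N \<omega>)) sequentially"
    unfolding AE_all_countable using shift(1) by (intro allI coeff_eventually shift_pos) auto
  moreover have "AE \<omega> in M. \<forall>c j. eventually (\<lambda>N. \<not> gram_event N (p N) (r N) (1 / real (Suc c)) (1 / real (Suc j)) (X N \<omega>)) sequentially"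
    unfolding AE_all_countable by (intro allI gram_eventually[OF iid]) auto
  moreover have "AE \<omega> in M. \<forall>k j. eventually (\<lambda>N. \<not> gram_event N (p N) (r N) (m k) (1 / real (Suc j)) (X N \<omega>)) sequentially"
    unfolding AE_all_countable using m(1) by (intro allI gram_eventually[OF iid]) auto
  ultimately show ?thesis using AE_regular
  proof eventually_elim
    case (elim \<omega>)
    note coeff_ev = elim(1)[rule_format] and gram_ev = elim(2)[rule_format] and gram_m_ev = elim(3)[rule_format]
    define x u y where "x N = X N \<omega>" and "u N = U N \<omega>" and "y N = A_hat (X N \<omega>) (U N \<omega>)" for N
    have reg: "x N \<in> carrier_mat N (p N)" "u N \<in> carrier_mat N (r N)" "det ((x N)\<^sup>T * x N) \<noteq> 0"
      "y N \<in> carrier_mat (p N) (r N)"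
      "(y N)\<^sup>T * y N = (u N)\<^sup>T * (x N * (minv ((x N)\<^sup>T * x N) * minv ((x N)\<^sup>T * x N)) * (x N)\<^sup>T) * u N" "0 < r N" "0 < p N" "p N \<le> N"
      if "N \<ge> 1" for N
      using elim(4) that hat_gram[of "X N \<omega>" N "p N" "U N \<omega>" "r N"] dims[OF that] by (auto simp: x_def u_def y_def)
    define g where "g N s = gram_resolvent (x N) (r N * s)" for N and s :: real
    have gpos: "g N s > 0" if "N \<ge> 1" "s > 0" for N s
      unfolding g_def using gram_resolvent_pos[OF reg(1)[OF that(1)]] reg(6,7)[OF that(1)] that(2) by simp
    have gram_eq: "\<bar>s * g N s + real N / real (r N) * (g N s / (1 + g N s)) - real (p N) / real (r N)\<bar> \<le> \<eta> * (real (p N) / real (r N))"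
      if N: "N \<ge> 1" and e: "\<not> gram_event N (p N) (r N) s \<eta> (X N \<omega>)" for N and s \<eta> :: real
    proof -
      have R: "real (r N) > 0" using reg(6)[OF N] by simp
      have "\<bar>r N * s * g N s + N * (g N s / (1 + g N s)) - p N\<bar> \<le> \<eta> * p N"
        using e unfolding gram_event_def x_def[symmetric] g_def by simp
      then have "\<bar>r N * s * g N s + N * (g N s / (1 + g N s)) - p N\<bar> / r N \<le> \<eta> * p N / r N"
        using R by (simp add: divide_right_mono)
      moreover have "\<bar>r N * s * g N s + N * (g N s / (1 + g N s)) - p N\<bar> / r N
        = \<bar>s * g N s + real N / real (r N) * (g N s / (1 + g N s)) - real (p N) / real (r N)\<bar>"
      proof -
        have "\<bar>z\<bar> / r N = \<bar>z / r N\<bar>" for z :: real using R by simp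
        moreover have "(r N * s * g N s + N * (g N s / (1 + g N s)) - p N) / r N
          = s * g N s + real N / real (r N) * (g N s / (1 + g N s)) - real (p N) / real (r N)"
          using R by (simp add: add_divide_distrib diff_divide_distrib)
        ultimately show ?thesis by (simp only:)
      qed
      ultimately show ?thesis by simp
    qed
    have pr_bound: "eventually (\<lambda>N. real (p N) / real (r N) < \<beta> + 1) sequentially"
      by (rule order_tendstoD(2)[OF p_over_r_tendsto]) simp
    \<comment> \<open>Let \<open>a = N / r\<close>, \<open>q = p / r\<close> and let
      \<open>G\<close> be the resolvent trace at \<open>r * s\<close>. From
      \<open>s * G + a * G / (1 + G) \<le> q + s\<close> and \<open>a \<ge> q\<close>, which is
      \<open>p \<le> N\<close>, it follows that \<open>s * G\<^sup>2 \<le> q + s\<close>. Hence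
      \<open>s * G\<close> is of order \<open>sqrt s\<close>, also in the square case
      \<open>l = 0\<close>, and the fraction of large weights tends to zero with
      \<open>s\<close>.\<close>
    have small: "eventually (\<lambda>N. (1 / real (Suc c) * g N (1 / real (Suc c)))\<^sup>2 \<le> (\<beta> + 2) / real (Suc c)) sequentially" for c
    proof -
      define s where "s = 1 / real (Suc c)"
      have s: "0 < s" "s \<le> 1" by (auto simp: s_def)
      obtain j where "inverse (real (Suc j)) < s / (\<beta> + 1)" using reals_Archimedean[of "s / (\<beta> + 1)"] s \<beta>_pos by auto
      then have j: "1 / real (Suc j) * (\<beta> + 1) < s" using \<beta>_pos by (simp add: field_simps)
      show ?thesis
        using gram_ev[of c j] pr_bound eventually_ge_at_top[of 1]
      proof eventually_elim
        case (elim N)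
        note N = elim(3)
        define G where "G = g N s"
        define q a where "q = real (p N) / real (r N)" and "a = real N / real (r N)"
        have G: "G > 0" unfolding G_def by (rule gpos[OF N s(1)])
        have qa: "q \<le> a" "q \<ge> 0" "q < \<beta> + 1" unfolding q_def a_def using reg(8)[OF N] elim(2) by (auto intro: divide_right_mono)
        have "\<bar>s * G + a * (G / (1 + G)) - q\<bar> \<le> 1 / real (Suc j) * q"
          using gram_eq[OF N elim(1)] unfolding s_def[symmetric] G_def q_def a_def .
        also have "\<dots> \<le> 1 / real (Suc j) * (\<beta> + 1)" using qa by (intro mult_left_mono) auto
        also have "\<dots> \<le> s" using j by simp
        finally have "s * G + a * (G / (1 + G)) \<le> q + s" by linarith
        then have "(s * G + a * (G / (1 + G))) * (1 + G) \<le> (q + s) * (1 + G)" using G by (intro mult_right_mono) auto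
        then have "s * G * (1 + G) + a * G \<le> (q + s) * (1 + G)" using G by (simp add: distrib_right)
        moreover have "q * G \<le> a * G" using qa G by (intro mult_right_mono) auto
        ultimately have "s * (G * G) \<le> q + s" by (simp add: algebra_simps)
        then have "s * (G * G) \<le> \<beta> + 2" using qa s by linarith
        then have "s * (s * (G * G)) \<le> s * (\<beta> + 2)" using s by (intro mult_left_mono) auto
        then have "(s * G)\<^sup>2 \<le> (\<beta> + 2) * s" by (simp add: power2_eq_square mult_ac)
        then show ?case unfolding G_def s_def by simp
      qed
    qed
    let ?E = "\<lambda>N. empirical_eigenvalue_distribution (1 \<cdot>\<^sub>m ((y N)\<^sup>T * y N))"
    have "weak_conv_m ?E (coeff_law l \<beta>)"
    proof (rule weak_conv_m_of_resolvents[OF _ _ coeff_law_law(1,2)[OF \<beta>_pos l] shift])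
      show "real_distribution (?E N)" "AE x in ?E N. x \<ge> 0" if "N \<ge> 1" for N
        using empirical_smult_gram(1,2)[OF reg(4)[OF that] _ reg(6)[OF that], of 1] by auto
      fix k
      define t where "t = shift k"
      have t: "t > 0" using shift(1)[of k] by (simp add: t_def)
      note mk = m[of k, folded t_def]
      \<comment> \<open>The value that makes \<open>m k\<close> a root of the outer equation
        \<open>t * m + m * g = 1\<close>. The relation for the coefficient law then says exactly
        that \<open>gs\<close> solves the limiting equation for \<open>X\<^sup>T * X\<close> at
        \<open>m k\<close>.\<close>
      define gs where "gs = (1 - t * m k) / m k"
      have "t * m k \<noteq> 1"
      proof
        assume "t * m k = 1"
        then have "0 = \<beta> * (1 + (m k - t * m k))" using mk(3) by (simp add: algebra_simps)
        then have "\<beta> * m k = 0" using \<open>t * m k = 1\<close> by simp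
        then show False using \<beta>_pos mk(1) by simp
      qed
      then have gs: "gs > 0" using mk(1,2) by (simp add: gs_def)
      have mgs: "m k * gs = 1 - t * m k" using mk(1) by (simp add: gs_def)
      have gs_eq: "m k * gs + \<mu> * (gs / (1 + gs)) = \<beta>"
      proof -
        define z where "z = 1 + m k * (1 - t)"
        have mz: "m k * (1 + gs) = z" using mgs by (simp add: z_def algebra_simps)
        have z0: "z > 0" unfolding mz[symmetric] using mk(1) gs by simp
        have e: "a + \<mu> * (a / z) = a * (z + \<mu>) / z" for a using z0 by (simp add: add_divide_distrib distrib_left)
        have "gs / (1 + gs) = (m k * gs) / (m k * (1 + gs))" using mk(1) by simp
        also have "\<dots> = (1 - t * m k) / z" unfolding mgs mz ..
        finally have "m k * gs + \<mu> * (gs / (1 + gs)) = (1 - t * m k) * (z + \<mu>) / z"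
          unfolding mgs by (simp only: e)
        also have "(1 - t * m k) * (z + \<mu>) = \<beta> * z" using mk(3) unfolding z_def \<mu>_eq by simp
        finally show ?thesis using z0 by simp
      qed
      \<comment> \<open>The function \<open>g N\<close> is needed only at the deterministic point
        \<open>m k\<close>. Monotonicity of \<open>v * g N v\<close> replaces any control of
        \<open>g N\<close> at the random point \<open>mN N\<close>.\<close>
      have glim: "(\<lambda>N. g N (m k)) \<longlonglongrightarrow> gs"
      proof (rule tendsto_of_slope[OF mk(1), of "\<lambda>N v. m k * v + real N / real (r N) * (v / (1 + v))"])
        show "eventually (\<lambda>N. \<forall>u v. 0 < u \<longrightarrow> u \<le> v \<longrightarrow> m k * (v - u) \<le> m k * v + real N / real (r N) * (v / (1 + v))
            - (m k * u + real N / real (r N) * (u / (1 + u)))) sequentially"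
        proof (intro always_eventually allI impI)
          fix N and a b :: real assume "0 < a" "a \<le> b"
          from mult_left_mono[OF mono_saturation[OF this], of "real N / real (r N)"]
          show "m k * (b - a) \<le> m k * b + real N / real (r N) * (b / (1 + b)) - (m k * a + real N / real (r N) * (a / (1 + a)))"
            by (simp add: algebra_simps)
        qed
        show "eventually (\<lambda>N. g N (m k) > 0) sequentially"
          using eventually_ge_at_top[of 1] by eventually_elim (rule gpos[OF _ mk(1)])
        have "(\<lambda>N. m k * gs + real N / real (r N) * (gs / (1 + gs))) \<longlonglongrightarrow> m k * gs + \<mu> * (gs / (1 + gs))"
          by (intro tendsto_intros Nr)
        then show "(\<lambda>N. m k * gs + real N / real (r N) * (gs / (1 + gs))) \<longlonglongrightarrow> \<beta>" unfolding gs_eq .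
        have "(\<lambda>N. m k * g N (m k) + real N / real (r N) * (g N (m k) / (1 + g N (m k))) - real (p N) / real (r N)) \<longlonglongrightarrow> 0"
        proof (rule tendsto_zero_of_eventually_le[where B = "\<beta> + 1"])
          fix j
          show "eventually (\<lambda>N. \<bar>m k * g N (m k) + real N / real (r N) * (g N (m k) / (1 + g N (m k))) - real (p N) / real (r N)\<bar>
             \<le> 1 / real (Suc j) * (\<beta> + 1)) sequentially"
            using gram_m_ev[of k j] pr_bound eventually_ge_at_top[of 1]
          proof eventually_elim
            case (elim N)
            have "1 / real (Suc j) * (real (p N) / real (r N)) \<le> 1 / real (Suc j) * (\<beta> + 1)"
              using elim(2) by (intro mult_left_mono) auto
            with gram_eq[OF elim(3,1)] show ?case by (rule order_trans)
          qed
        qed (use \<beta>_pos in simp)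
        from tendsto_add[OF this p_over_r_tendsto]
        show "(\<lambda>N. m k * g N (m k) + real N / real (r N) * (g N (m k) / (1 + g N (m k)))) \<longlonglongrightarrow> \<beta>" by simp
      qed (rule gs)
      define mN where "mN N = (LINT x|?E N. 1 / (x + t))" for N
      have mN: "r N * mN N = compressed_resolvent (x N) (minv ((x N)\<^sup>T * x N) * minv ((x N)\<^sup>T * x N)) (u N) t" "mN N > 0" if N: "N \<ge> 1" for N
      proof -
        have a: "mN N = mtrace (minv (1 \<cdot>\<^sub>m ((y N)\<^sup>T * y N) + t \<cdot>\<^sub>m 1\<^sub>m (r N))) / r N"
          unfolding mN_def by (rule empirical_smult_gram(3)[OF reg(4)[OF N] _ reg(6)[OF N] t]) simp
        then have "mN N = gram_resolvent (y N) t / r N" unfolding one_smult_mat gram_resolvent_def using reg(4)[OF N] by simp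
        then show "mN N > 0" using gram_resolvent_pos[OF reg(4)[OF N] t] reg(6)[OF N] by simp
        show "r N * mN N = compressed_resolvent (x N) (minv ((x N)\<^sup>T * x N) * minv ((x N)\<^sup>T * x N)) (u N) t"
          unfolding compressed_resolvent_def a one_smult_mat reg(5)[OF N] using reg(2,6)[OF N] by simp
      qed
      define \<phi> where "\<phi> N v = t * v + v * g N v" for N v
      \<comment> \<open>Division by \<open>r N\<close> leaves two errors: the tolerance
        \<open>\<eta>\<close>, and the counted weights as \<open>2 * s * g N s\<close> with
        \<open>s = 1 / Suc c\<close>, which \<open>small\<close> makes as small as desired.\<close>
      have est: "\<bar>\<phi> N (mN N) - 1\<bar> \<le> \<eta> + 2 * (1 / real (Suc c) * g N (1 / real (Suc c)))"
        if N: "N \<ge> 1" and e: "\<not> coeff_event (r N) t (real (Suc c)) \<eta> (X N \<omega>) (U N \<omega>)" for N c \<eta>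
      proof -
        have R: "real (r N) > 0" using reg(6)[OF N] by simp
        have "\<bar>t * (r N * mN N) + r N * mN N * g N (mN N) - r N\<bar> \<le> \<eta> * r N + 2 * (r N / real (Suc c)) * gram_resolvent (x N) (r N / real (Suc c))"
          using e unfolding coeff_event_def x_def[symmetric] u_def[symmetric] mN(1)[OF N, symmetric] g_def by simp
        moreover have "t * (r N * mN N) + r N * mN N * g N (mN N) - r N = r N * (\<phi> N (mN N) - 1)"
          unfolding \<phi>_def by (simp add: algebra_simps)
        moreover have "\<eta> * r N + 2 * (r N / real (Suc c)) * gram_resolvent (x N) (r N / real (Suc c))
          = r N * (\<eta> + 2 * (1 / real (Suc c) * g N (1 / real (Suc c))))"
          unfolding g_def by (simp add: algebra_simps)
        ultimately have "r N * \<bar>\<phi> N (mN N) - 1\<bar> \<le> r N * (\<eta> + 2 * (1 / real (Suc c) * g N (1 / real (Suc c))))"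
          using R by (simp only: abs_mult abs_of_pos)
        then show ?thesis using R by (simp only: mult_le_cancel_left_pos)
      qed
      have "mN \<longlonglongrightarrow> m k"
      proof (rule tendsto_of_slope[OF t, of \<phi>])
        show "eventually (\<lambda>N. \<forall>u v. 0 < u \<longrightarrow> u \<le> v \<longrightarrow> t * (v - u) \<le> \<phi> N v - \<phi> N u) sequentially"
          using eventually_ge_at_top[of 1]
        proof (eventually_elim, intro allI impI)
          fix N :: nat and a b :: real assume N: "1 \<le> N" and ab: "0 < a" "a \<le> b"
          have "a * g N a \<le> b * g N b"
            unfolding g_def using reg(6)[OF N] by (intro scaled_gram_resolvent_mono[OF reg(1,3)[OF N] _ ab]) simp
          then show "t * (b - a) \<le> \<phi> N b - \<phi> N a" unfolding \<phi>_def by (simp add: algebra_simps)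
        qed
        show "eventually (\<lambda>N. mN N > 0) sequentially"
          using eventually_ge_at_top[of 1] by eventually_elim (rule mN(2))
        show "m k > 0" by (rule mk(1))
        have "(\<lambda>N. \<phi> N (m k)) \<longlonglongrightarrow> t * m k + m k * gs" unfolding \<phi>_def by (intro tendsto_intros glim)
        then show "(\<lambda>N. \<phi> N (m k)) \<longlonglongrightarrow> 1" unfolding mgs by simp
        have "(\<lambda>N. \<phi> N (mN N) - 1) \<longlonglongrightarrow> 0"
        proof (rule tendstoI)
          fix e :: real assume e: "e > 0"
          \<comment> \<open>Half of \<open>e\<close> is allotted to the tolerance. The other half
            goes to twice the counting term, which is why that term is made at most
            \<open>e / 4\<close>.\<close>
          obtain j where j: "1 / real (Suc j) < e / 2" using reals_Archimedean[of "e / 2"] e by (auto simp: inverse_eq_divide)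
          obtain c where "inverse (real (Suc c)) < (e / 4)\<^sup>2 / (\<beta> + 2)"
            using reals_Archimedean[of "(e / 4)\<^sup>2 / (\<beta> + 2)"] e \<beta>_pos by auto
          then have c: "(\<beta> + 2) / real (Suc c) < (e / 4)\<^sup>2" using \<beta>_pos by (simp add: field_simps)
          show "eventually (\<lambda>N. dist (\<phi> N (mN N) - 1) 0 < e) sequentially"
            using coeff_ev[of k c j] small[of c] eventually_ge_at_top[of 1]
          proof eventually_elim
            case (elim N)
            have "(1 / real (Suc c) * g N (1 / real (Suc c)))\<^sup>2 \<le> (e / 4)\<^sup>2" using elim(2) c by linarith
            then have "1 / real (Suc c) * g N (1 / real (Suc c)) \<le> e / 4" by (rule power2_le_imp_le) (use e in simp)
            with est[OF elim(3) elim(1)[folded t_def]] j have "\<bar>\<phi> N (mN N) - 1\<bar> < e" by linarith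
            then show ?case by (simp add: dist_real_def)
          qed
        qed
        then show "(\<lambda>N. \<phi> N (mN N)) \<longlonglongrightarrow> 1" by (simp add: LIM_zero_iff)
      qed
      then show "(\<lambda>N. LINT x|?E N. 1 / (x + shift k)) \<longlonglongrightarrow> (LINT x|coeff_law l \<beta>. 1 / (x + shift k))"
        unfolding mN_def t_def m_def .
    qed
    then show ?case unfolding one_smult_mat by (simp add: y_def)
  qed
qed

end

theorem theorem2p3:
  fixes M :: "'a measure"
    and U X :: "nat \<Rightarrow> 'a \<Rightarrow> real mat"
    and p r :: "nat \<Rightarrow> nat"
    and l \<mu> \<beta> :: real
  assumes "prob_space M"
    and "\<And>N. N \<ge> 1 \<Longrightarrow> 0 < p N \<and> p N \<le> N \<and> 0 < r N"
    and "l \<ge> 0" and "(\<lambda>N. real N / real (p N)) \<longlonglongrightarrow> 1 + l"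
    and "\<mu> > 0" and "(\<lambda>N. real N / real (r N)) \<longlonglongrightarrow> \<mu>"
    and "\<beta> = \<mu> / (1 + l)"
    and "\<And>N. N \<ge> 1 \<Longrightarrow> random_matrix M N (r N) (U N)"
    and "\<And>N. N \<ge> 1 \<Longrightarrow> iid_std_gaussian_entries M N (r N) (U N)"
    and "\<And>N. N \<ge> 1 \<Longrightarrow> random_matrix M N (p N) (X N)"
    and "\<And>N. N \<ge> 1 \<Longrightarrow> AE \<omega> in M. vec_space.rank N (X N \<omega>) = p N"
    and "\<And>N. N \<ge> 1 \<Longrightarrow> indep_random_matrices M N (p N) (X N) N (r N) (U N)"
  shows "(real_distribution (marchenko_pastur \<beta>) \<and>
          (AE \<omega> in M. weak_conv_m
             (\<lambda>N. empirical_eigenvalue_distribution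
                (1 / real (r N) \<cdot>\<^sub>m ((Y_hat (X N \<omega>) (U N \<omega>))\<^sup>T * Y_hat (X N \<omega>) (U N \<omega>))))
             (marchenko_pastur \<beta>))) \<and>
         ((\<forall>N\<ge>1. iid_std_gaussian_entries M N (p N) (X N)) \<longrightarrow>
          real_distribution (coeff_law l \<beta>) \<and>
          (AE \<omega> in M. weak_conv_m
             (\<lambda>N. empirical_eigenvalue_distribution
                ((A_hat (X N \<omega>) (U N \<omega>))\<^sup>T * A_hat (X N \<omega>) (U N \<omega>)))
             (coeff_law l \<beta>)))"
proof -
  interpret regression_model M U X p r l \<mu> \<beta>
    by (rule regression_model.intro) (fact assms)+
  show ?thesis
    using marchenko_pastur_law(1)[OF \<beta>_pos] fitted_weak_conv coeff_law_law(1)[OF \<beta>_pos l] coeff_weak_conv by blast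
qed

end
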